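(* Let $s>\frac12$ and $M,N\in\mathbb{N}_+$. Suppose $U\in C^{\infty}(\mathbb{R};H^s_+(\mathbb{R};\mathbb{C}^{M\times N}))$ solves the matrix Szegő equation $i\partial_t U=\Pi_{\geq 0}(UU^*U)$ with $U(0)=U_0\in H^s_+(\mathbb{R};\mathbb{C}^{M\times N})$. Then for every $(t,z)\in\mathbb{R}\times\mathbb{C}_+$ the Poisson integral of $U(t)$ is given by $$\underline{U}(t,z)=\tfrac{1}{2\pi i}\,\mathscr{I}\Big(\big(\mathbf{G}+\mathscr{L}^{(\mathbf{rl})}_{U_0}(t)-z\big)^{-1}e^{-it\mathbf{H}^{(\mathbf{r})}_{U_0}\mathbf{H}^{(\mathbf{l})}_{U_0}}(U_0)\Big)=\tfrac{1}{2\pi i}\,\mathscr{I}\Big(\big(\mathbf{G}+\mathscr{L}^{(\mathbf{lr})}_{U_0}(t)-z\big)^{-1}e^{-it\mathbf{H}^{(\mathbf{l})}_{U_0}\mathbf{H}^{(\mathbf{r})}_{U_0}}(U_0)\Big)\in\mathbb{C}^{M\times N}.$$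
   Context: Notation. $\mathbb{C}_+=\{z\in\mathbb{C}:\mathrm{Im}\,z>0\}$; $A^*$ is the conjugate transpose of a matrix $A$. Fourier transform: $\hat U(\xi)=\int_{\mathbb{R}}U(x)e^{-ix\xi}\,dx$ (extended to $L^2$). $L^2(\mathbb{R};\mathbb{C}^{M\times N})$ has inner product $\langle U,V\rangle=\int_{\mathbb{R}}\mathrm{tr}(U(x)V(x)^* )\,dx$. The Szegő projector $\Pi_{\geq0}$ is the Fourier multiplier $\widehat{\Pi_{\geq0}U}(\xi)=\mathbf{1}_{\xi\geq0}\hat U(\xi)$, and it is applied in this Fourier sense whenever the Fourier transform makes sense. $H^s_+(\mathbb{R};\mathbb{C}^{M\times N})=\Pi_{\geq0}(H^s(\mathbb{R};\mathbb{C}^{M\times N}))$ for $s\ge 0$, and $L^2_+=H^0_+$. Poisson integral: for $U\in L^2_+(\mathbb{R};\mathbb{C}^{M\times N})$ and $z\in\mathbb{C}_+$, $\underline{U}(z)=\frac{1}{2\pi}\int_0^{+\infty}e^{iz\xi}\hat U(\xi)\,d\xi$; for time-dependent $U$, $\underline{U}(t,z)$ is the Poisson integral of $U(t)$ at $z$. Operator $\mathbf{G}$: its domain is $\mathrm{Dom}(\mathbf{G})^{M\times N}=\{F\in L^2_+(\mathbb{R};\mathbb{C}^{M\times N}):\hat F|_{(0,+\infty)}\in H^1((0,+\infty);\mathbb{C}^{M\times N})\}$, and $\mathbf{G}(F)=i\frac{d}{d\eta}\big|_{\eta=0^+}\mathtt{S}(\eta)^*F$, where $\mathtt{S}(\eta)^*F=\Pi_{\geq0}(e^{-i\eta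 x}F)$ for $\eta\ge0$; equivalently $\mathbf{G}(F)(x)=xF(x)-\frac{i}{2\pi}\hat F(0^+)$. For $F\in L^2_+$ with $\hat F$ having a right limit at $0$ (in particular for $F\in\mathrm{Dom}(\mathbf{G})^{M\times N}$), $\mathscr{I}(F)=\hat F(0^+)\in\mathbb{C}^{M\times N}$. Hankel operators: for $U\in H^{1/2}_+(\mathbb{R};\mathbb{C}^{M\times N})$ and $d\in\mathbb{N}_+$, $\mathbf{H}^{(\mathbf{r})}_U:L^2_+(\mathbb{R};\mathbb{C}^{d\times N})\to L^2_+(\mathbb{R};\mathbb{C}^{M\times d})$, $\mathbf{H}^{(\mathbf{r})}_U(F)=\Pi_{\geq0}(UF^* )$, and $\mathbf{H}^{(\mathbf{l})}_U:L^2_+(\mathbb{R};\mathbb{C}^{M\times d})\to L^2_+(\mathbb{R};\mathbb{C}^{d\times N})$, $\mathbf{H}^{(\mathbf{l})}_U(G)=\Pi_{\geq0}(G^*U)$. These are bounded antilinear operators, and $\mathbf{H}^{(\mathbf{r})}_U\mathbf{H}^{(\mathbf{l})}_U$, $\mathbf{H}^{(\mathbf{l})}_U\mathbf{H}^{(\mathbf{r})}_U$ are $\mathbb{C}$-linear bounded positive self-adjoint operators on $L^2_+(\mathbb{R};\mathbb{C}^{M\times d})$ and $L^2_+(\mathbb{R};\mathbb{C}^{d\times N})$ respectively. Finite-rank operators: $\mathfrak{m}^{(\mathbf{rl})}_U(G)=U\,\widehat{U^*G}(0)=U\int_{\mathbb{R}}U(x)^*G(x)\,dx$ for $G\in L^2(\mathbb{R};\mathbb{C}^{M\times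 d})$, and $\mathfrak{m}^{(\mathbf{lr})}_U(F)=\widehat{FU^*}(0)\,U=\big(\int_{\mathbb{R}}F(x)U(x)^*\,dx\big)U$ for $F\in L^2(\mathbb{R};\mathbb{C}^{d\times N})$. For $t\in\mathbb{R}$ define the bounded operators $$\mathscr{L}^{(\mathbf{rl})}_U(t)=\frac1{2\pi}\int_0^t e^{-i\tau\mathbf{H}^{(\mathbf{r})}_U\mathbf{H}^{(\mathbf{l})}_U}\,\mathfrak{m}^{(\mathbf{rl})}_U\,e^{i\tau\mathbf{H}^{(\mathbf{r})}_U\mathbf{H}^{(\mathbf{l})}_U}\,d\tau\ \text{ on } L^2_+(\mathbb{R};\mathbb{C}^{M\times d}),\qquad \mathscr{L}^{(\mathbf{lr})}_U(t)=\frac1{2\pi}\int_0^t e^{-i\tau\mathbf{H}^{(\mathbf{l})}_U\mathbf{H}^{(\mathbf{r})}_U}\,\mathfrak{m}^{(\mathbf{lr})}_U\,e^{i\tau\mathbf{H}^{(\mathbf{l})}_U\mathbf{H}^{(\mathbf{r})}_U}\,d\tau\ \text{ on } L^2_+(\mathbb{R};\mathbb{C}^{d\times N}).$$ In the first formula of the claim the operators $\mathbf{H}^{(\mathbf{r})}_{U_0}\mathbf{H}^{(\mathbf{l})}_{U_0}$ and $\mathscr{L}^{(\mathbf{rl})}_{U_0}(t)$ are taken with $d=N$; in the second, $\mathbf{H}^{(\mathbf{l})}_{U_0}\mathbf{H}^{(\mathbf{r})}_{U_0}$ and $\mathscr{L}^{(\mathbf{lr})}_{U_0}(t)$ are taken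 with $d=M$; so all operators act on $L^2_+(\mathbb{R};\mathbb{C}^{M\times N})$. For $z\in\mathbb{C}_+$ the operators $\mathbf{G}+\mathscr{L}^{(\mathbf{rl})}_{U_0}(t)-z$ and $\mathbf{G}+\mathscr{L}^{(\mathbf{lr})}_{U_0}(t)-z$ are invertible from $\mathrm{Dom}(\mathbf{G})^{M\times N}$ onto $L^2_+(\mathbb{R};\mathbb{C}^{M\times N})$, so the formulas are meaningful. *)

theory Defs
  imports "HOL-Analysis.Analysis"
begin

section \<open>The space \<open>L\<^sup>2(\<real>; 'a)\<close>\<close>

text \<open>
  The type \<open>'a L2\<close> consists of the classes, modulo almost everywhere equality, of Borel functions
  with square-integrable norm. The matrix space of size \<open>M \<times> N\<close> is \<open>complex^'n^'m\<close>
  (\<open>CARD('m) = M\<close> rows, \<open>CARD('n) = N\<close> columns); its norm is the Frobenius norm, so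
  the real inner product below is the real part of \<open>\<integral> tr (U V\<^sup>*)\<close>.
\<close>

definition square_integrable :: "(real \<Rightarrow> 'a::euclidean_space) \<Rightarrow> bool" where
  "square_integrable f \<longleftrightarrow>
     f \<in> borel_measurable lborel \<and> integrable lborel (\<lambda>x. (norm (f x))\<^sup>2)"

definition L2_rel :: "(real \<Rightarrow> 'a::euclidean_space) \<Rightarrow> (real \<Rightarrow> 'a) \<Rightarrow> bool" where
  "L2_rel f g \<longleftrightarrow> square_integrable f \<and> square_integrable g \<and> (AE x in lborel. f x = g x)"

lemma square_integrable_zero: "square_integrable (\<lambda>x. 0)"
  by (simp add: square_integrable_def)

lemma square_integrable_bound:
  assumes f: "square_integrable f" and g: "g \<in> borel_measurable lborel"
    and le: "\<And>x. norm (g x) \<le> c * norm (f x)"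
  shows "square_integrable g"
proof -
  have "integrable lborel (\<lambda>x. c\<^sup>2 * (norm (f x))\<^sup>2)"
    using f by (simp add: square_integrable_def)
  then have "integrable lborel (\<lambda>x. (norm (g x))\<^sup>2)"
  proof (rule Bochner_Integration.integrable_bound)
    show "(\<lambda>x. (norm (g x))\<^sup>2) \<in> borel_measurable lborel" using g by measurable
    have "(norm (g x))\<^sup>2 \<le> c\<^sup>2 * (norm (f x))\<^sup>2" for x
      using power_mono[OF le[of x], of 2] by (simp add: power_mult_distrib)
    then show "AE x in lborel. norm ((norm (g x))\<^sup>2) \<le> norm (c\<^sup>2 * (norm (f x))\<^sup>2)"
      by simp
  qed
  then show ?thesis using g by (simp add: square_integrable_def)
qed

lemma square_integrable_scaleR:
  "square_integrable f \<Longrightarrow> square_integrable (\<lambda>x. r *\<^sub>R f x)"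
  by (rule square_integrable_bound[where c = "\<bar>r\<bar>"]) (auto simp: square_integrable_def)

lemma square_integrable_add:
  assumes f: "square_integrable f" and g: "square_integrable g"
  shows "square_integrable (\<lambda>x. f x + g x)"
proof -
  have [measurable]: "f \<in> borel_measurable lborel" "g \<in> borel_measurable lborel"
    using f g by (auto simp: square_integrable_def)
  have "integrable lborel (\<lambda>x. 2 * (norm (f x))\<^sup>2 + 2 * (norm (g x))\<^sup>2)"
    using f g by (simp add: square_integrable_def)
  then have "integrable lborel (\<lambda>x. (norm (f x + g x))\<^sup>2)"
  proof (rule Bochner_Integration.integrable_bound)
    have "(norm (f x + g x))\<^sup>2 \<le> 2 * (norm (f x))\<^sup>2 + 2 * (norm (g x))\<^sup>2" for x
    proof -
      have "(norm (f x + g x))\<^sup>2 \<le> (norm (f x) + norm (g x))\<^sup>2"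
        by (intro power_mono norm_triangle_ineq norm_ge_zero)
      also have "\<dots> \<le> 2 * (norm (f x))\<^sup>2 + 2 * (norm (g x))\<^sup>2"
        using zero_le_power2[of "norm (f x) - norm (g x)"]
        by (simp add: power2_sum power2_diff)
      finally show ?thesis .
    qed
    then show "AE x in lborel. norm ((norm (f x + g x))\<^sup>2)
        \<le> norm (2 * (norm (f x))\<^sup>2 + 2 * (norm (g x))\<^sup>2)"
      by simp
  qed simp
  then show ?thesis by (simp add: square_integrable_def)
qed

lemma square_integrable_minus: "square_integrable f \<Longrightarrow> square_integrable (\<lambda>x. - f x)"
  using square_integrable_scaleR[of f "-1"] by simp

lemma square_integrable_diff:
  "square_integrable f \<Longrightarrow> square_integrable g \<Longrightarrow> square_integrable (\<lambda>x. f x - g x)"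
  using square_integrable_add[OF _ square_integrable_minus, of f g] by simp

lemma square_integrable_inner:
  assumes f: "square_integrable f" and g: "square_integrable g"
  shows "integrable lborel (\<lambda>x. f x \<bullet> g x)"
proof -
  have [measurable]: "f \<in> borel_measurable lborel" "g \<in> borel_measurable lborel"
    using f g by (auto simp: square_integrable_def)
  have "integrable lborel (\<lambda>x. (norm (f x))\<^sup>2 + (norm (g x))\<^sup>2)"
    using f g by (simp add: square_integrable_def)
  then show ?thesis
  proof (rule Bochner_Integration.integrable_bound)
    have "\<bar>f x \<bullet> g x\<bar> \<le> (norm (f x))\<^sup>2 + (norm (g x))\<^sup>2" for x
    proof -
      have "\<bar>f x \<bullet> g x\<bar> \<le> norm (f x) * norm (g x)" by (rule Cauchy_Schwarz_ineq2)
      moreover have "0 \<le> norm (f x) * norm (g x)" by simp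
      ultimately show ?thesis
        using zero_le_power2[of "norm (f x) - norm (g x)"] by (simp add: power2_diff)
    qed
    then show "AE x in lborel. norm (f x \<bullet> g x) \<le> norm ((norm (f x))\<^sup>2 + (norm (g x))\<^sup>2)"
      by simp
  qed simp
qed

lemma part_equivp_L2_rel: "part_equivp L2_rel"
proof (rule part_equivpI)
  show "\<exists>f. L2_rel f f"
    by (rule exI[of _ "\<lambda>x. 0"]) (simp add: L2_rel_def square_integrable_zero)
  show "symp L2_rel" by (rule sympI) (auto simp: L2_rel_def eq_commute)
  show "transp L2_rel" by (rule transpI) (auto simp: L2_rel_def elim: AE_mp)
qed

quotient_type (overloaded) 'a L2 = "real \<Rightarrow> 'a::euclidean_space" / partial: L2_rel
  by (rule part_equivp_L2_rel)

instantiation L2 :: (euclidean_space) real_inner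
begin

lift_definition zero_L2 :: "'a L2" is "\<lambda>x. 0"
  by (simp add: L2_rel_def square_integrable_zero)

lift_definition plus_L2 :: "'a L2 \<Rightarrow> 'a L2 \<Rightarrow> 'a L2" is "\<lambda>f g x. f x + g x"
  by (auto simp: L2_rel_def intro: square_integrable_add)

lift_definition minus_L2 :: "'a L2 \<Rightarrow> 'a L2 \<Rightarrow> 'a L2" is "\<lambda>f g x. f x - g x"
  by (auto simp: L2_rel_def intro: square_integrable_diff)

lift_definition uminus_L2 :: "'a L2 \<Rightarrow> 'a L2" is "\<lambda>f x. - f x"
  by (auto simp: L2_rel_def intro: square_integrable_minus)

lift_definition scaleR_L2 :: "real \<Rightarrow> 'a L2 \<Rightarrow> 'a L2" is "\<lambda>r f x. r *\<^sub>R f x"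
  by (auto simp: L2_rel_def intro: square_integrable_scaleR)

lift_definition inner_L2 :: "'a L2 \<Rightarrow> 'a L2 \<Rightarrow> real" is "\<lambda>f g. LINT x|lborel. f x \<bullet> g x"
  by (rule integral_cong_AE) (auto simp: L2_rel_def square_integrable_def)

definition norm_L2 :: "'a L2 \<Rightarrow> real" where "norm_L2 F = sqrt (F \<bullet> F)"

definition sgn_L2 :: "'a L2 \<Rightarrow> 'a L2" where "sgn_L2 F = inverse (norm F) *\<^sub>R F"

definition dist_L2 :: "'a L2 \<Rightarrow> 'a L2 \<Rightarrow> real" where "dist_L2 F G = norm (F - G)"

definition uniformity_L2 :: "('a L2 \<times> 'a L2) filter" where
  "uniformity_L2 = (INF e\<in>{0<..}. principal {(F, G). dist F G < e})"

definition open_L2 :: "'a L2 set \<Rightarrow> bool" where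
  "open_L2 S \<longleftrightarrow> (\<forall>F\<in>S. \<forall>\<^sub>F (F', G) in uniformity. F' = F \<longrightarrow> G \<in> S)"

instance
proof
  fix a b :: real and F G K :: "'a L2"
  show "F + G + K = F + (G + K)"
    by transfer (auto simp: L2_rel_def add.assoc intro!: square_integrable_add)
  show "F + G = G + F"
    by transfer (auto simp: L2_rel_def add.commute intro!: square_integrable_add)
  show "0 + F = F" by transfer (auto simp: L2_rel_def)
  show "- F + F = 0" by transfer (auto simp: L2_rel_def square_integrable_zero)
  show "F - G = F + - G"
    by transfer (auto simp: L2_rel_def
        intro!: square_integrable_diff square_integrable_add square_integrable_minus)
  show "a *\<^sub>R (F + G) = a *\<^sub>R F + a *\<^sub>R G"
    by transfer (auto simp: L2_rel_def scaleR_add_right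
        intro!: square_integrable_scaleR square_integrable_add)
  show "(a + b) *\<^sub>R F = a *\<^sub>R F + b *\<^sub>R F"
    by transfer (auto simp: L2_rel_def scaleR_add_left
        intro!: square_integrable_scaleR square_integrable_add)
  show "a *\<^sub>R b *\<^sub>R F = (a * b) *\<^sub>R F"
    by transfer (auto simp: L2_rel_def intro!: square_integrable_scaleR)
  show "1 *\<^sub>R F = F" by transfer (auto simp: L2_rel_def)
  show "sgn F = inverse (norm F) *\<^sub>R F" by (rule sgn_L2_def)
  show "dist F G = norm (F - G)" by (rule dist_L2_def)
  show "(uniformity :: ('a L2 \<times> 'a L2) filter)
      = (INF e\<in>{0<..}. principal {(F, G). dist F G < e})"
    by (rule uniformity_L2_def)
  show "open S \<longleftrightarrow> (\<forall>F\<in>S. \<forall>\<^sub>F (F', G) in uniformity. F' = F \<longrightarrow> G \<in> S)" for S :: "'a L2 set"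
    by (rule open_L2_def)
  show "F \<bullet> G = G \<bullet> F" by transfer (simp add: inner_commute)
  show "(F + G) \<bullet> K = F \<bullet> K + G \<bullet> K"
    by transfer (auto simp: L2_rel_def inner_add_left
        intro!: Bochner_Integration.integral_add square_integrable_inner)
  show "(a *\<^sub>R F) \<bullet> G = a * (F \<bullet> G)" by transfer simp
  show "0 \<le> F \<bullet> F" by transfer simp
  show "F \<bullet> F = 0 \<longleftrightarrow> F = 0"
  proof transfer
    fix f :: "real \<Rightarrow> 'a"
    assume "L2_rel f f"
    then have f: "square_integrable f" by (simp add: L2_rel_def)
    have "(LINT x|lborel. f x \<bullet> f x) = 0 \<longleftrightarrow> (AE x in lborel. f x \<bullet> f x = 0)"
      by (rule integral_nonneg_eq_0_iff_AE) (auto intro: square_integrable_inner f)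
    then show "(LINT x|lborel. f x \<bullet> f x) = 0 \<longleftrightarrow> L2_rel f (\<lambda>x. 0)"
      using f by (simp add: L2_rel_def square_integrable_zero)
  qed
  show "norm F = sqrt (F \<bullet> F)" by (rule norm_L2_def)
qed

end


section \<open>Complex matrices\<close>

definition mscale :: "complex \<Rightarrow> complex^'n^'m \<Rightarrow> complex^'n^'m"  (infixr "*\<^sub>M" 75) where
  "c *\<^sub>M A = map_matrix ((*) c) A"

definition ctranspose :: "complex^'n^'m \<Rightarrow> complex^'m^'n" where
  "ctranspose A = map_matrix cnj (transpose A)"

lemma norm_mscale: "norm (c *\<^sub>M A) = cmod c * norm A"
proof -
  have "norm (c *\<^sub>M A) = L2_set (\<lambda>i. L2_set (\<lambda>j. cmod c * cmod (A $ i $ j)) UNIV) UNIV"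
    by (simp add: mscale_def norm_vec_def norm_mult)
  also have "\<dots> = cmod c * norm A"
    by (simp add: norm_vec_def L2_set_right_distrib)
  finally show ?thesis .
qed

lemma bounded_linear_mscale: "bounded_linear (\<lambda>A. c *\<^sub>M A)"
proof (rule bounded_linear_intro)
  show "c *\<^sub>M (A + B) = c *\<^sub>M A + c *\<^sub>M B" for A B :: "complex^'n^'m"
    by (simp add: mscale_def map_matrix_def vec_eq_iff algebra_simps)
  show "c *\<^sub>M (r *\<^sub>R A) = r *\<^sub>R (c *\<^sub>M A)" for r and A :: "complex^'n^'m"
    by (simp add: mscale_def map_matrix_def vec_eq_iff)
  show "norm (c *\<^sub>M A) \<le> norm A * cmod c" for A :: "complex^'n^'m"
    by (simp add: norm_mscale)
qed

lemma square_integrable_mscale: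
  assumes "square_integrable f"
  shows "square_integrable (\<lambda>x. c *\<^sub>M f x)"
proof (rule square_integrable_bound[OF assms])
  have "f \<in> borel_measurable lborel" using assms by (simp add: square_integrable_def)
  moreover have "(\<lambda>A. c *\<^sub>M A) \<in> borel_measurable borel"
    by (intro borel_measurable_continuous_onI linear_continuous_on bounded_linear_mscale)
  ultimately show "(\<lambda>x. c *\<^sub>M f x) \<in> borel_measurable lborel"
    by (rule measurable_compose)
  show "norm (c *\<^sub>M f x) \<le> cmod c * norm (f x)" for x by (simp add: norm_mscale)
qed

lift_definition scaleC :: "complex \<Rightarrow> (complex^'n^'m) L2 \<Rightarrow> (complex^'n^'m) L2"  (infixr "*\<^sub>C" 75)
  is "\<lambda>c f x. c *\<^sub>M f x"
  by (auto simp: L2_rel_def intro: square_integrable_mscale)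


section \<open>Fourier transform and Szego projector\<close>

definition fourier_L1 :: "(real \<Rightarrow> complex^'n^'m) \<Rightarrow> real \<Rightarrow> complex^'n^'m" where
  "fourier_L1 f \<xi> = (LINT x|lborel. exp (- \<i> * of_real (x * \<xi>)) *\<^sub>M f x)"

text \<open>The \<open>L\<^sup>2\<close> extension, as the limit in mean of \<open>\<integral>\<^bsub>-n\<^esub>\<^bsup>n\<^esup> e\<^bsup>-ix\<xi>\<^esup> U(x) dx\<close>.\<close>

definition fourier_L2 :: "(complex^'n^'m) L2 \<Rightarrow> (complex^'n^'m) L2" where
  "fourier_L2 U =
     lim (\<lambda>n::nat. abs_L2 (fourier_L1 (\<lambda>x. indicator {- real n..real n} x *\<^sub>R rep_L2 U x)))"

text \<open>
  The transform of a function that is integrable or square integrable; on the overlap both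
  branches agree almost everywhere.
\<close>

definition fourier :: "(real \<Rightarrow> complex^'n^'m) \<Rightarrow> real \<Rightarrow> complex^'n^'m" where
  "fourier f = (if integrable lborel f then fourier_L1 f else rep_L2 (fourier_L2 (abs_L2 f)))"

text \<open>
  The projector is defined on functions rather than on \<open>L2\<close>, because it has to be applied to
  products of two \<open>L\<^sup>2\<close> functions, which are in general only integrable. Its value is the element
  of \<open>L\<^sup>2\<close> with the prescribed Fourier transform.
\<close>

definition szego :: "(real \<Rightarrow> complex^'n^'m) \<Rightarrow> (complex^'n^'m) L2" where
  "szego f = (THE V. AE \<xi> in lborel. rep_L2 (fourier_L2 V) \<xi> = indicator {0..} \<xi> *\<^sub>R fourier f \<xi>)"

definition L2_plus :: "(complex^'n^'m) L2 set" where
  "L2_plus = range (\<lambda>F. szego (rep_L2 F))"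


section \<open>Sobolev spaces and smooth curves in them\<close>

definition Hs :: "real \<Rightarrow> (complex^'n^'m) L2 set" where
  "Hs s = {U. integrable lborel (\<lambda>\<xi>. (1 + \<xi>\<^sup>2) powr s * (norm (rep_L2 (fourier_L2 U) \<xi>))\<^sup>2)}"

definition Hs_norm :: "real \<Rightarrow> (complex^'n^'m) L2 \<Rightarrow> real" where
  "Hs_norm s U = sqrt (1 / (2 * pi) *
     (LINT \<xi>|lborel. (1 + \<xi>\<^sup>2) powr s * (norm (rep_L2 (fourier_L2 U) \<xi>))\<^sup>2))"

definition Hs_plus :: "real \<Rightarrow> (complex^'n^'m) L2 set" where
  "Hs_plus s = (\<lambda>U. szego (rep_L2 U)) ` Hs s"

text \<open>
  Differentiability with respect to the norm of \<open>H\<^sup>s\<close>; the membership conditions are needed because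
  \<^const>\<open>Hs_norm\<close> is meaningful on \<^const>\<open>Hs\<close> only.
\<close>

definition has_Hs_derivative ::
    "real \<Rightarrow> (real \<Rightarrow> (complex^'n^'m) L2) \<Rightarrow> (complex^'n^'m) L2 \<Rightarrow> real \<Rightarrow> bool" where
  "has_Hs_derivative s U V t \<longleftrightarrow> (\<forall>\<tau>. U \<tau> \<in> Hs s) \<and> V \<in> Hs s \<and>
     ((\<lambda>h. Hs_norm s ((1 / h) *\<^sub>R (U (t + h) - U t) - V)) \<longlongrightarrow> 0) (at 0)"

definition smooth_Hs_plus :: "real \<Rightarrow> (real \<Rightarrow> (complex^'n^'m) L2) \<Rightarrow> bool" where
  "smooth_Hs_plus s U \<longleftrightarrow> (\<exists>D :: nat \<Rightarrow> real \<Rightarrow> (complex^'n^'m) L2. D 0 = U \<and>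
     (\<forall>k t. D k t \<in> Hs_plus s \<and> has_Hs_derivative s (D k) (D (Suc k) t) t))"

definition solves_matrix_szego :: "real \<Rightarrow> (real \<Rightarrow> (complex^'n^'m) L2) \<Rightarrow> bool" where
  "solves_matrix_szego s U \<longleftrightarrow> (\<forall>t. \<exists>V. has_Hs_derivative s U V t \<and>
     \<i> *\<^sub>C V = szego (\<lambda>x. rep_L2 (U t) x ** ctranspose (rep_L2 (U t) x) ** rep_L2 (U t) x))"


section \<open>Poisson integral\<close>

definition poisson :: "(complex^'n^'m) L2 \<Rightarrow> complex \<Rightarrow> complex^'n^'m" where
  "poisson U z = (1 / (2 * pi)) *\<^sub>R
     (LINT \<xi>:{0..}|lborel. exp (\<i> * z * of_real \<xi>) *\<^sub>M rep_L2 (fourier_L2 U) \<xi>)"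


section \<open>The operator \<open>G\<close> and the functional \<open>I\<close>\<close>

definition test_fun_pos :: "(real \<Rightarrow> real) set" where
  "test_fun_pos = {\<phi>. (\<forall>k x. (deriv ^^ k) \<phi> differentiable (at x)) \<and>
     (\<exists>a b. 0 < a \<and> (\<forall>x. x \<notin> {a..b} \<longrightarrow> \<phi> x = 0))}"

text \<open>\<open>f\<close> restricted to \<open>(0, \<infinity>)\<close> belongs to \<open>H\<^sup>1((0, \<infinity>))\<close>, with a weak derivative \<open>g\<close>.\<close>

definition H1_pos :: "(real \<Rightarrow> complex^'n^'m) \<Rightarrow> bool" where
  "H1_pos f \<longleftrightarrow> square_integrable (\<lambda>\<xi>. indicator {0<..} \<xi> *\<^sub>R f \<xi>) \<and>
     (\<exists>g. square_integrable (\<lambda>\<xi>. indicator {0<..} \<xi> *\<^sub>R g \<xi>) \<and>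
       (\<forall>\<phi>\<in>test_fun_pos. (LINT \<xi>:{0<..}|lborel. deriv \<phi> \<xi> *\<^sub>R f \<xi>) =
                        - (LINT \<xi>:{0<..}|lborel. \<phi> \<xi> *\<^sub>R g \<xi>)))"

definition Dom_G :: "(complex^'n^'m) L2 set" where
  "Dom_G = {F \<in> L2_plus. H1_pos (rep_L2 (fourier_L2 F))}"

text \<open>\<open>S(\<eta>)\<^sup>* F\<close>, for \<open>\<eta> \<ge> 0\<close>.\<close>

definition shift_adj :: "real \<Rightarrow> (complex^'n^'m) L2 \<Rightarrow> (complex^'n^'m) L2" where
  "shift_adj \<eta> F = szego (\<lambda>x. exp (- \<i> * of_real (\<eta> * x)) *\<^sub>M rep_L2 F x)"

definition op_G :: "(complex^'n^'m) L2 \<Rightarrow> (complex^'n^'m) L2" where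
  "op_G F = \<i> *\<^sub>C vector_derivative (\<lambda>\<eta>. shift_adj \<eta> F) (at 0 within {0..})"

text \<open>
  \<open>I(F)\<close> is the right limit at \<open>0\<close> of the Fourier transform of \<open>F\<close>. As the latter is only defined
  almost everywhere, the limit is taken along a representative on \<open>(0, \<infinity>)\<close> for which it exists; its
  value does not depend on that representative.
\<close>

definition op_I :: "(complex^'n^'m) L2 \<Rightarrow> complex^'n^'m" where
  "op_I F = (THE c. \<exists>g. (AE \<xi> in lborel. 0 < \<xi> \<longrightarrow> g \<xi> = rep_L2 (fourier_L2 F) \<xi>) \<and>
     (g \<longlongrightarrow> c) (at_right 0))"


section \<open>Hankel operators and the operators \<open>L(t)\<close>\<close>

definition hankel_r :: "(complex^'n^'m) L2 \<Rightarrow> (complex^'n^'d) L2 \<Rightarrow> (complex^'d^'m) L2" where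
  "hankel_r U F = szego (\<lambda>x. rep_L2 U x ** ctranspose (rep_L2 F x))"

definition hankel_l :: "(complex^'n^'m) L2 \<Rightarrow> (complex^'d^'m) L2 \<Rightarrow> (complex^'n^'d) L2" where
  "hankel_l U G = szego (\<lambda>x. ctranspose (rep_L2 G x) ** rep_L2 U x)"

definition hankel_rl :: "(complex^'n^'m) L2 \<Rightarrow> (complex^'d^'m) L2 \<Rightarrow> (complex^'d^'m) L2" where
  "hankel_rl U G = hankel_r U (hankel_l U G)"

definition hankel_lr :: "(complex^'n^'m) L2 \<Rightarrow> (complex^'n^'d) L2 \<Rightarrow> (complex^'n^'d) L2" where
  "hankel_lr U F = hankel_l U (hankel_r U F)"

definition m_rl :: "(complex^'n^'m) L2 \<Rightarrow> (complex^'d^'m) L2 \<Rightarrow> (complex^'d^'m) L2" where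
  "m_rl U G = abs_L2 (\<lambda>x. rep_L2 U x ** (LINT y|lborel. ctranspose (rep_L2 U y) ** rep_L2 G y))"

definition m_lr :: "(complex^'n^'m) L2 \<Rightarrow> (complex^'n^'d) L2 \<Rightarrow> (complex^'n^'d) L2" where
  "m_lr U F = abs_L2 (\<lambda>x. (LINT y|lborel. rep_L2 F y ** ctranspose (rep_L2 U y)) ** rep_L2 U x)"

text \<open>\<open>e\<^bsup>cA\<^esup> F\<close> for a bounded operator \<open>A\<close>, by the exponential series.\<close>

definition exp_op ::
    "((complex^'n^'m) L2 \<Rightarrow> (complex^'n^'m) L2) \<Rightarrow> complex \<Rightarrow> (complex^'n^'m) L2 \<Rightarrow> (complex^'n^'m) L2"
  where "exp_op A c F = (\<Sum>k. (c ^ k / fact k) *\<^sub>C (A ^^ k) F)"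

definition oriented_integral :: "real \<Rightarrow> (real \<Rightarrow> (complex^'n^'m) L2) \<Rightarrow> (complex^'n^'m) L2" where
  "oriented_integral t f = (if 0 \<le> t then integral {0..t} f else - integral {t..0} f)"

text \<open>The operator-valued integrals, applied to a vector.\<close>

definition L_rl :: "(complex^'n^'m) L2 \<Rightarrow> real \<Rightarrow> (complex^'d^'m) L2 \<Rightarrow> (complex^'d^'m) L2" where
  "L_rl U t G = (1 / (2 * pi)) *\<^sub>R oriented_integral t (\<lambda>\<tau>.
     exp_op (hankel_rl U) (- \<i> * of_real \<tau>)
       (m_rl U (exp_op (hankel_rl U) (\<i> * of_real \<tau>) G)))"

definition L_lr :: "(complex^'n^'m) L2 \<Rightarrow> real \<Rightarrow> (complex^'n^'d) L2 \<Rightarrow> (complex^'n^'d) L2" where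
  "L_lr U t F = (1 / (2 * pi)) *\<^sub>R oriented_integral t (\<lambda>\<tau>.
     exp_op (hankel_lr U) (- \<i> * of_real \<tau>)
       (m_lr U (exp_op (hankel_lr U) (\<i> * of_real \<tau>) F)))"

text \<open>
  \<open>(G + L - z)\<^sup>-\<^sup>1 W\<close>, the inverse of the operator with domain \<^const>\<open>Dom_G\<close>.
\<close>

definition resolvent_G ::
    "((complex^'n^'m) L2 \<Rightarrow> (complex^'n^'m) L2) \<Rightarrow> complex \<Rightarrow> (complex^'n^'m) L2 \<Rightarrow> (complex^'n^'m) L2"
  where "resolvent_G L z = the_inv_into Dom_G (\<lambda>F. op_G F + L F - z *\<^sub>C F)"

end

theory Submission
  imports Defs "HOL-Probability.Probability"
begin

text \<open>
  Write \<open>\<Pi>\<close> for the Szego projector and call an element of \<open>L\<^sup>2\<close> \<^emph>\<open>plus\<close> if it is fixed by \<open>\<Pi>\<close>,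
  \<^emph>\<open>minus\<close> if it is annihilated. The unbounded operator \<open>G - z\<close> is replaced throughout by its inverse on the plus
  functions, the bounded operator \<open>R F = \<Pi> (F / (x - z))\<close>. Since \<open>F / (x - z)\<close> differs from \<open>R F\<close> by the minus
  function \<open>F(z) / (x - z)\<close>, where \<open>F(z)\<close> is the Poisson integral, all relations between \<open>R\<close>, evaluation at \<open>z\<close>,
  Hankel operators and Toeplitz operators become algebra with the rules "plus times plus is plus" and
  "the adjoint of a plus function is minus" (\<open>kern_decomposition\<close>, \<open>lmul_plus\<close>).

  Let \<open>H\<^sup>2\<close> be the squared Hankel operator of the solution \<open>u\<close>, \<open>T F = \<Pi> (u u\<^sup>* F)\<close>, \<open>A = \<i> H\<^sup>2\<close>, \<open>B = \<i> T\<close> and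
  \<open>m F = u \<integral> u\<^sup>* F\<close>. The equation reads \<open>u' = - B u\<close> and implies \<open>A' = [A, B]\<close> and \<open>m' = [m, B]\<close>
  (\<open>hankel_sq_derivative\<close>, \<open>rank_derivative\<close>). With \<open>C = A - B\<close>, the resolvent and the evaluation \<open>ev\<close> at \<open>z\<close> satisfy
  \<open>[R, C] = - R m R / (2 \<pi>)\<close> and \<open>ev C = - ev m R / (2 \<pi>)\<close> (\<open>res_commutators\<close>, \<open>pairing_res\<close>).

  These five relations imply the formula (\<open>lax_flow.explicit_solution\<close>). Let \<open>V' = C V\<close>, \<open>V(0) = 1\<close>. Conjugation by \<open>V\<close>
  freezes \<open>A\<close>, turns \<open>m\<close> into \<open>e\<^bsup>-tA\<^esup> m(0) e\<^bsup>tA\<^esup>\<close> for \<open>A = A(0)\<close>, whose primitive divided by \<open>2 \<pi>\<close> is the operator \<open>L(t)\<close>,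
  and turns \<open>u(t)\<close> into \<open>e\<^bsup>-tA\<^esup> u(0)\<close>. The conjugate \<open>X\<close> of \<open>R\<close> solves a Riccati equation \<open>X' = - X L' X\<close>, whose solution
  is \<open>X = (1 + R L)\<^sup>-\<^sup>1 R\<close>; that is, \<open>X\<close> is the resolvent of \<open>G + L(t)\<close> at \<open>z\<close>. The evaluation is handled in the same way.
  Finally \<open>R\<close> maps the plus functions onto the domain of \<open>G\<close> (\<open>res_in_Dom_G\<close>, \<open>Dom_G_imp_res\<close>), inverts \<open>G - z\<close> (\<open>op_G_res\<close>)
  and turns \<open>I\<close> into \<open>2 \<pi> \<i>\<close> times evaluation at \<open>z\<close> (\<open>op_I_res\<close>).

  For \<open>s > 1/2\<close> the space \<open>H\<^sup>s\<close> embeds into the bounded continuous functions, so that \<open>u\<close> and \<open>u'\<close> act as bounded multipliers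
  (\<open>szego_curve_of_solution\<close>). Transposition of matrices exchanges the two kinds of Hankel operators and maps solutions
  to solutions; the second formula is the first one for the transposed solution, transported back.
\<close>

section \<open>Square integrable functions and the space \<open>L\<^sup>2\<close>\<close>

lemma square_integrable_measurable [measurable_dest]:
  "square_integrable f \<Longrightarrow> f \<in> borel_measurable borel"
  by (simp add: square_integrable_def)

lemma square_integrable_norm_sq:
  "square_integrable f \<Longrightarrow> integrable lborel (\<lambda>x. (norm (f x))\<^sup>2)"
  by (simp add: square_integrable_def)

lemma square_integrable_norm: "square_integrable f \<Longrightarrow> square_integrable (\<lambda>x. norm (f x))"
  by (auto simp: square_integrable_def)

lemma square_integrable_AE_bound:
  assumes f: "square_integrable f" and g: "g \<in> borel_measurable borel"
    and le: "AE x in lborel. norm (g x) \<le> c * norm (f x)"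
  shows "square_integrable g"
proof -
  have "integrable lborel (\<lambda>x. c\<^sup>2 * (norm (f x))\<^sup>2)"
    using f by (simp add: square_integrable_def)
  then have "integrable lborel (\<lambda>x. (norm (g x))\<^sup>2)"
  proof (rule Bochner_Integration.integrable_bound)
    show "(\<lambda>x. (norm (g x))\<^sup>2) \<in> borel_measurable lborel" using g by measurable
    show "AE x in lborel. norm ((norm (g x))\<^sup>2) \<le> norm (c\<^sup>2 * (norm (f x))\<^sup>2)"
      using le
    proof eventually_elim
      case (elim x)
      then show ?case using power_mono[OF elim, of 2] by (simp add: power_mult_distrib)
    qed
  qed
  then show ?thesis using g by (simp add: square_integrable_def)
qed

lemma square_integrable_cong_AE:
  assumes "square_integrable f" "g \<in> borel_measurable borel" "AE x in lborel. g x = f x"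
  shows "square_integrable g"
  by (rule square_integrable_AE_bound[where c = 1, OF assms(1,2)]) (use assms(3) in auto)

lemma L2_rel_rep_L2: "L2_rel (rep_L2 F) (rep_L2 F)"
  by (rule Quotient3_rep_reflp[OF Quotient3_L2])

lemma abs_L2_rep_L2 [simp]: "abs_L2 (rep_L2 F) = F"
  by (rule Quotient3_abs_rep[OF Quotient3_L2])

lemma square_integrable_rep_L2 [simp, intro]: "square_integrable (rep_L2 F)"
  using L2_rel_rep_L2[of F] by (simp add: L2_rel_def)

lemma rep_L2_measurable [measurable, simp]: "rep_L2 F \<in> borel_measurable borel"
  by (rule square_integrable_measurable) simp

lemma L2_rel_refl [simp]: "L2_rel f f \<longleftrightarrow> square_integrable f"
  by (simp add: L2_rel_def)

lemma rep_L2_abs_L2: "square_integrable f \<Longrightarrow> AE x in lborel. rep_L2 (abs_L2 f) x = f x"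
  using Quotient3_rep_abs[OF Quotient3_L2, of f] by (simp add: L2_rel_def)

lemma abs_L2_eq_iff:
  assumes "square_integrable f" "square_integrable g"
  shows "abs_L2 f = abs_L2 g \<longleftrightarrow> (AE x in lborel. f x = g x)"
  using Quotient3_rel[OF Quotient3_L2, of f g] assms by (simp add: L2_rel_def)

lemma abs_L2_cong:
  "square_integrable f \<Longrightarrow> square_integrable g \<Longrightarrow> (AE x in lborel. f x = g x) \<Longrightarrow> abs_L2 f = abs_L2 g"
  by (simp add: abs_L2_eq_iff)

lemma L2_eqI: "(AE x in lborel. rep_L2 F x = rep_L2 G x) \<Longrightarrow> F = G"
  using abs_L2_cong[of "rep_L2 F" "rep_L2 G"] by simp

lemma L2_eq_absI: "square_integrable g \<Longrightarrow> (AE x in lborel. rep_L2 F x = g x) \<Longrightarrow> F = abs_L2 g"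
  using abs_L2_cong[of "rep_L2 F" g] by simp

lemma abs_L2_zero: "abs_L2 (\<lambda>x. 0) = 0"
  by (simp add: zero_L2_def)

lemma abs_L2_add:
  "square_integrable f \<Longrightarrow> square_integrable g \<Longrightarrow> abs_L2 (\<lambda>x. f x + g x) = abs_L2 f + abs_L2 g"
  by (simp add: plus_L2.abs_eq)

lemma abs_L2_diff:
  "square_integrable f \<Longrightarrow> square_integrable g \<Longrightarrow> abs_L2 (\<lambda>x. f x - g x) = abs_L2 f - abs_L2 g"
  by (simp add: minus_L2.abs_eq)

lemma abs_L2_scaleR: "square_integrable f \<Longrightarrow> abs_L2 (\<lambda>x. r *\<^sub>R f x) = r *\<^sub>R abs_L2 f"
  by (simp add: scaleR_L2.abs_eq)

lemma abs_L2_scaleC: "square_integrable f \<Longrightarrow> abs_L2 (\<lambda>x. c *\<^sub>M f x) = c *\<^sub>C abs_L2 f"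
  by (simp add: scaleC.abs_eq)

lemma inner_abs_L2:
  "square_integrable f \<Longrightarrow> square_integrable g \<Longrightarrow> abs_L2 f \<bullet> abs_L2 g = (LINT x|lborel. f x \<bullet> g x)"
  by (simp add: inner_L2.abs_eq)

lemma inner_L2: "F \<bullet> G = (LINT x|lborel. rep_L2 F x \<bullet> rep_L2 G x)"
  using inner_abs_L2[of "rep_L2 F" "rep_L2 G"] by simp

lemma norm_abs_L2: "square_integrable f \<Longrightarrow> (norm (abs_L2 f))\<^sup>2 = (LINT x|lborel. (norm (f x))\<^sup>2)"
  by (simp add: power2_norm_eq_inner inner_abs_L2)

lemma rep_L2_zero: "AE x in lborel. rep_L2 0 x = 0"
  using rep_L2_abs_L2[OF square_integrable_zero] by (simp add: abs_L2_zero)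

lemma rep_L2_add: "AE x in lborel. rep_L2 (F + G) x = rep_L2 F x + rep_L2 G x"
  using rep_L2_abs_L2[OF square_integrable_add, of "rep_L2 F" "rep_L2 G"] by (simp add: abs_L2_add)

lemma rep_L2_diff: "AE x in lborel. rep_L2 (F - G) x = rep_L2 F x - rep_L2 G x"
  using rep_L2_abs_L2[OF square_integrable_diff, of "rep_L2 F" "rep_L2 G"] by (simp add: abs_L2_diff)

lemma rep_L2_scaleR: "AE x in lborel. rep_L2 (r *\<^sub>R F) x = r *\<^sub>R rep_L2 F x"
  using rep_L2_abs_L2[OF square_integrable_scaleR, of "rep_L2 F" r] by (simp add: abs_L2_scaleR)

lemma rep_L2_scaleC: "AE x in lborel. rep_L2 (c *\<^sub>C F) x = c *\<^sub>M rep_L2 F x"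
  using rep_L2_abs_L2[OF square_integrable_mscale, of "rep_L2 F" c] by (simp add: abs_L2_scaleC)

lemma norm_abs_L2_le:
  assumes f: "square_integrable f" and g: "square_integrable g" and c: "0 \<le> c"
    and le: "AE x in lborel. norm (f x) \<le> c * norm (g x)"
  shows "norm (abs_L2 f) \<le> c * norm (abs_L2 g)"
proof (rule power2_le_imp_le)
  have "(LINT x|lborel. (norm (f x))\<^sup>2) \<le> (LINT x|lborel. c\<^sup>2 * (norm (g x))\<^sup>2)"
  proof (rule integral_mono_AE)
    show "AE x in lborel. (norm (f x))\<^sup>2 \<le> c\<^sup>2 * (norm (g x))\<^sup>2"
      using le
    proof eventually_elim
      case (elim x)
      then show ?case using power_mono[OF elim, of 2] by (simp add: power_mult_distrib)
    qed
  qed (use f g in \<open>auto simp: square_integrable_norm_sq\<close>)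
  then show "(norm (abs_L2 f))\<^sup>2 \<le> (c * norm (abs_L2 g))\<^sup>2"
    by (simp add: norm_abs_L2 f g power_mult_distrib)
  show "0 \<le> c * norm (abs_L2 g)" using c by simp
qed

lemma integrable_norm_mult:
  assumes f: "square_integrable f" and g: "square_integrable g"
  shows "integrable lborel (\<lambda>x. norm (f x) * norm (g x))"
  using square_integrable_inner[OF square_integrable_norm[OF f] square_integrable_norm[OF g]] by simp

lemma integral_norm_mult_le:
  assumes f: "square_integrable f" and g: "square_integrable g"
  shows "(LINT x|lborel. norm (f x) * norm (g x)) \<le> norm (abs_L2 f) * norm (abs_L2 g)"
proof -
  let ?f = "abs_L2 (\<lambda>x. norm (f x))" and ?g = "abs_L2 (\<lambda>x. norm (g x))"
  note nf = square_integrable_norm[OF f] and ng = square_integrable_norm[OF g]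
  have "(LINT x|lborel. norm (f x) * norm (g x)) = ?f \<bullet> ?g"
    by (simp add: inner_abs_L2 nf ng)
  also have "\<dots> \<le> norm ?f * norm ?g" by (rule norm_cauchy_schwarz)
  also have "norm ?f = norm (abs_L2 f)"
    by (rule power2_eq_imp_eq) (simp_all add: norm_abs_L2 f nf)
  also have "norm ?g = norm (abs_L2 g)"
    by (rule power2_eq_imp_eq) (simp_all add: norm_abs_L2 g ng)
  finally show ?thesis .
qed

lemma square_integrable_std_normal: "square_integrable std_normal_density"
proof -
  have "integrable lborel (\<lambda>x. (1 / sqrt (2 * pi)) * std_normal_density x)" by simp
  then have "integrable lborel (\<lambda>x. (norm (std_normal_density x))\<^sup>2)"
  proof (rule Bochner_Integration.integrable_bound)
    have "(std_normal_density x)\<^sup>2 \<le> 1 / sqrt (2 * pi) * std_normal_density x" for x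
      by (simp add: std_normal_density_def power2_eq_square divide_simps)
    then show "AE x in lborel. norm ((norm (std_normal_density x))\<^sup>2)
        \<le> norm (1 / sqrt (2 * pi) * std_normal_density x)"
      by simp
  qed simp
  then show ?thesis by (simp add: square_integrable_def)
qed

text \<open>
  Dominated convergence in the mean: the squared distances are dominated by \<open>4 |h|\<^sup>2\<close>.
\<close>

lemma L2_dominated_convergence:
  fixes f :: "nat \<Rightarrow> real \<Rightarrow> 'a::euclidean_space"
  assumes f: "\<And>n. f n \<in> borel_measurable borel" and g: "g \<in> borel_measurable borel"
    and h: "square_integrable h"
    and lim: "AE x in lborel. (\<lambda>n. f n x) \<longlonglongrightarrow> g x"
    and le: "\<And>n. AE x in lborel. norm (f n x) \<le> norm (h x)"
  shows "(\<lambda>n. abs_L2 (f n)) \<longlonglongrightarrow> abs_L2 g"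
proof -
  have sf: "square_integrable (f n)" for n
    by (rule square_integrable_AE_bound[where c = 1, OF h f]) (use le in auto)
  have "AE x in lborel. \<forall>n. norm (f n x) \<le> norm (h x)" using le by (simp add: AE_all_countable)
  with lim have leg: "AE x in lborel. norm (g x) \<le> norm (h x)"
  proof eventually_elim
    case (elim x)
    show ?case
      by (rule LIMSEQ_le_const2[OF tendsto_norm[OF elim(1)]]) (use elim in auto)
  qed
  then have sg: "square_integrable g"
    by (intro square_integrable_AE_bound[where c = 1, OF h g]) auto
  have "(\<lambda>n. LINT x|lborel. (norm (f n x - g x))\<^sup>2) \<longlonglongrightarrow> (LINT x|(lborel::real measure). 0)"
  proof (rule integral_dominated_convergence[where w = "\<lambda>x. 4 * (norm (h x))\<^sup>2"])
    show "integrable lborel (\<lambda>x. 4 * (norm (h x))\<^sup>2)" using h by (simp add: square_integrable_norm_sq)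
    show "AE x in lborel. (\<lambda>n. (norm (f n x - g x))\<^sup>2) \<longlonglongrightarrow> 0"
      using lim
    proof eventually_elim
      case (elim x)
      then show ?case using tendsto_power[OF tendsto_norm[OF LIM_zero[OF elim]], of 2] by simp
    qed
    show "AE x in lborel. norm ((norm (f n x - g x))\<^sup>2) \<le> 4 * (norm (h x))\<^sup>2" for n
      using le[of n] leg
    proof eventually_elim
      case (elim x)
      have "norm (f n x - g x) \<le> 2 * norm (h x)"
        using elim norm_triangle_ineq4[of "f n x" "g x"] by linarith
      from power_mono[OF this, of 2] show ?case by (simp add: power_mult_distrib)
    qed
  qed (use f g in auto)
  then have "(\<lambda>n. (norm (abs_L2 (f n) - abs_L2 g))\<^sup>2) \<longlonglongrightarrow> 0"
    by (simp add: abs_L2_diff[symmetric] norm_abs_L2 square_integrable_diff sf sg)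
  from tendsto_real_sqrt[OF this] have "(\<lambda>n. norm (abs_L2 (f n) - abs_L2 g)) \<longlonglongrightarrow> 0" by simp
  then show ?thesis by (simp add: tendsto_norm_zero_iff LIM_zero_iff)
qed

text \<open>
  A sequence converging in the mean has a subsequence that converges fast, hence almost everywhere.
\<close>

lemma L2_AE_limit_unique:
  fixes f :: "nat \<Rightarrow> real \<Rightarrow> 'a::euclidean_space"
  assumes f: "\<And>n. square_integrable (f n)" and F: "(\<lambda>n. abs_L2 (f n)) \<longlonglongrightarrow> F"
    and g: "AE x in lborel. (\<lambda>n. f n x) \<longlonglongrightarrow> g x"
  shows "AE x in lborel. rep_L2 F x = g x"
proof -
  let ?d = "\<lambda>n x. (norm (f n x - rep_L2 F x))\<^sup>2"
  have sd: "square_integrable (\<lambda>x. f n x - rep_L2 F x)" for n by (intro square_integrable_diff f) simp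
  have "(\<lambda>n. (norm (abs_L2 (f n) - F))\<^sup>2) \<longlonglongrightarrow> 0"
    using tendsto_power[OF tendsto_norm[OF LIM_zero[OF F]], of 2] by simp
  moreover have "(norm (abs_L2 (f n) - F))\<^sup>2 = (LINT x|lborel. norm (?d n x))" for n
    using norm_abs_L2[OF sd[of n]] by (simp add: abs_L2_diff f)
  ultimately have "(\<lambda>n. LINT x|lborel. norm (?d n x)) \<longlonglongrightarrow> 0" by simp
  then obtain r where r: "strict_mono r" "AE x in lborel. (\<lambda>n. ?d (r n) x) \<longlonglongrightarrow> 0"
    using tendsto_L1_AE_subseq[of lborel ?d] square_integrable_norm_sq[OF sd] by blast
  show ?thesis
    using r(2) g
  proof eventually_elim
    case (elim x)
    have "(\<lambda>n. norm (f (r n) x - rep_L2 F x)) \<longlonglongrightarrow> 0"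
      using tendsto_real_sqrt[OF elim(1)] by simp
    then have "(\<lambda>n. f (r n) x) \<longlonglongrightarrow> rep_L2 F x"
      by (simp add: tendsto_norm_zero_iff LIM_zero_iff)
    moreover have "(\<lambda>n. f (r n) x) \<longlonglongrightarrow> g x"
      using LIMSEQ_subseq_LIMSEQ[OF elim(2) r(1)] by (simp add: o_def)
    ultimately show ?case by (rule LIMSEQ_unique)
  qed
qed

text \<open>
  Multiplying by a Gaussian, which is square integrable and positive, turns summability of the norms into summability of
  integrals; the partial sums therefore stay finite almost everywhere.
\<close>

lemma AE_suminf_finite_of_L2:
  fixes d :: "nat \<Rightarrow> real \<Rightarrow> 'a::euclidean_space"
  assumes d: "\<And>n. square_integrable (d n)" and s: "summable (\<lambda>n. norm (abs_L2 (d n)))"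
  shows "AE x in lborel. summable (\<lambda>n. norm (d n x))"
proof -
  let ?w = "std_normal_density"
  have [measurable]: "d n \<in> borel_measurable borel" for n using d by (rule square_integrable_measurable)
  have "(\<integral>\<^sup>+x. (\<Sum>n. ennreal (?w x * norm (d n x))) \<partial>lborel)
      = (\<Sum>n. \<integral>\<^sup>+x. ennreal (?w x * norm (d n x)) \<partial>lborel)"
    by (rule nn_integral_suminf) measurable
  also have "\<dots> \<le> (\<Sum>n. ennreal (norm (abs_L2 ?w) * norm (abs_L2 (d n))))"
  proof (rule suminf_le)
    fix n
    have "(\<integral>\<^sup>+x. ennreal (?w x * norm (d n x)) \<partial>lborel) = ennreal (LINT x|lborel. ?w x * norm (d n x))"
      using integrable_norm_mult[OF square_integrable_std_normal d[of n]]
      by (intro nn_integral_eq_integral) auto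
    also have "\<dots> \<le> ennreal (norm (abs_L2 ?w) * norm (abs_L2 (d n)))"
      using integral_norm_mult_le[OF square_integrable_std_normal d[of n]] by (simp add: ennreal_leI)
    finally show "(\<integral>\<^sup>+x. ennreal (?w x * norm (d n x)) \<partial>lborel)
        \<le> ennreal (norm (abs_L2 ?w) * norm (abs_L2 (d n)))" .
  qed auto
  also have "\<dots> < \<infinity>"
    using summable_mult[OF s, of "norm (abs_L2 ?w)"] by (subst suminf_ennreal2) auto
  finally have "AE x in lborel. (\<Sum>n. ennreal (?w x * norm (d n x))) \<noteq> \<infinity>"
    by (intro nn_integral_noteq_infinite) auto
  then show ?thesis
  proof eventually_elim
    case (elim x)
    have "summable (\<lambda>n. ?w x * norm (d n x))"
      by (rule summable_suminf_not_top) (use elim in auto)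
    then have "summable (\<lambda>n. inverse (?w x) * (?w x * norm (d n x)))" by (rule summable_mult)
    moreover have "?w x \<noteq> 0" by (simp add: std_normal_density_def)
    ultimately show ?case by simp
  qed
qed

text \<open>
  Riesz and Fischer: a subsequence with summable increments converges almost everywhere, and its limit is square integrable.
\<close>

instance L2 :: (euclidean_space) banach
proof
  fix X :: "nat \<Rightarrow> 'a L2" assume X: "Cauchy X"
  have "\<exists>r. strict_mono r \<and> (\<forall>n. norm (X (r (Suc n)) - X (r n)) < (1/2)^n)"
  proof -
    have *: "\<exists>N. \<forall>m\<ge>N. \<forall>k\<ge>N. norm (X m - X k) < (1/2)^n" for n :: nat
      using CauchyD[OF X, of "(1/2)^n"] by auto
    then obtain N where N: "\<And>n m k. m \<ge> N n \<Longrightarrow> k \<ge> N n \<Longrightarrow> norm (X m - X k) < (1/2)^n"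
      by metis
    define r where "r n = (\<Sum>k\<le>n. Suc (N k))" for n
    have "strict_mono r" by (rule strict_monoI_Suc) (simp add: r_def)
    moreover have "r n \<ge> N n" for n
      by (cases n) (auto simp: r_def)
    moreover have "r (Suc n) \<ge> N n" for n
      using \<open>r n \<ge> N n\<close> \<open>strict_mono r\<close> by (meson le_trans lessI strict_mono_less_eq less_imp_le)
    ultimately show ?thesis using N by blast
  qed
  then obtain r where r: "strict_mono r" "\<And>n. norm (X (r (Suc n)) - X (r n)) < (1/2)^n" by blast
  define f where "f n = rep_L2 (X (r n))" for n
  have sf: "square_integrable (f n)" for n by (simp add: f_def)
  have [measurable]: "f n \<in> borel_measurable borel" for n by (simp add: f_def)
  have af: "abs_L2 (f n) = X (r n)" for n by (simp add: f_def)
  have "AE x in lborel. summable (\<lambda>n. norm (f (Suc n) x - f n x))"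
  proof (rule AE_suminf_finite_of_L2)
    show "square_integrable (\<lambda>x. f (Suc n) x - f n x)" for n by (intro square_integrable_diff sf)
    show "summable (\<lambda>n. norm (abs_L2 (\<lambda>x. f (Suc n) x - f n x)))"
    proof (rule summable_comparison_test')
      show "summable (\<lambda>n. (1/2::real)^n)" by (simp add: summable_geometric)
      show "norm (norm (abs_L2 (\<lambda>x. f (Suc n) x - f n x))) \<le> (1/2)^n" for n
        using r(2)[of n] by (simp add: abs_L2_diff sf af)
    qed
  qed
  then have conv: "AE x in lborel. convergent (\<lambda>n. f n x)"
  proof eventually_elim
    case (elim x)
    define l where "l = (\<Sum>i. f (Suc i) x - f i x)"
    have "(\<lambda>n. \<Sum>i<n. f (Suc i) x - f i x) \<longlonglongrightarrow> l"
      unfolding l_def by (rule summable_LIMSEQ[OF summable_norm_cancel[OF elim]])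
    then have "(\<lambda>n. f n x - f 0 x) \<longlonglongrightarrow> l"
      by (simp only: sum_lessThan_telescope[of "\<lambda>n. f n x"])
    from tendsto_add[OF this tendsto_const[of "f 0 x"]] have "(\<lambda>n. f n x) \<longlonglongrightarrow> l + f 0 x" by simp
    then show ?case by (rule convergentI)
  qed
  define g where "g x = lim (\<lambda>n. f n x)" for x
  have [measurable]: "g \<in> borel_measurable borel" unfolding g_def by measurable
  have lim: "AE x in lborel. (\<lambda>n. f n x) \<longlonglongrightarrow> g x"
    using conv by eventually_elim (simp add: g_def convergent_LIMSEQ_iff)
  have fat: "(\<integral>\<^sup>+x. ennreal ((norm (g x - f k x))\<^sup>2) \<partial>lborel) \<le> ennreal (e\<^sup>2)"
    if e: "e > 0" "\<And>n. n \<ge> k \<Longrightarrow> norm (X (r n) - X (r k)) \<le> e" for k e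
  proof -
    have "(\<integral>\<^sup>+x. ennreal ((norm (g x - f k x))\<^sup>2) \<partial>lborel)
        = (\<integral>\<^sup>+x. liminf (\<lambda>n. ennreal ((norm (f n x - f k x))\<^sup>2)) \<partial>lborel)"
    proof (rule nn_integral_cong_AE)
      show "AE x in lborel. ennreal ((norm (g x - f k x))\<^sup>2)
          = liminf (\<lambda>n. ennreal ((norm (f n x - f k x))\<^sup>2))"
        using lim
      proof eventually_elim
        case (elim x)
        have "(\<lambda>n. ennreal ((norm (f n x - f k x))\<^sup>2)) \<longlonglongrightarrow> ennreal ((norm (g x - f k x))\<^sup>2)"
          by (intro tendsto_ennrealI tendsto_power tendsto_norm tendsto_diff elim tendsto_const)
        from lim_imp_Liminf[OF _ this] show ?case by simp
      qed
    qed
    also have "\<dots> \<le> liminf (\<lambda>n. \<integral>\<^sup>+x. ennreal ((norm (f n x - f k x))\<^sup>2) \<partial>lborel)"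
      by (rule nn_integral_liminf) measurable
    also have "\<dots> \<le> ennreal (e\<^sup>2)"
    proof (rule Liminf_le)
      have "(\<integral>\<^sup>+x. ennreal ((norm (f n x - f k x))\<^sup>2) \<partial>lborel) \<le> ennreal (e\<^sup>2)" if "n \<ge> k" for n
      proof -
        have "(\<integral>\<^sup>+x. ennreal ((norm (f n x - f k x))\<^sup>2) \<partial>lborel) = ennreal ((norm (X (r n) - X (r k)))\<^sup>2)"
          using norm_abs_L2[OF square_integrable_diff[OF sf[of n] sf[of k]]]
            square_integrable_norm_sq[OF square_integrable_diff[OF sf[of n] sf[of k]]]
          by (subst nn_integral_eq_integral) (auto simp: abs_L2_diff sf af)
        also have "\<dots> \<le> ennreal (e\<^sup>2)" using e(2)[OF that] by (intro ennreal_leI power_mono) auto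
        finally show ?thesis .
      qed
      then show "\<forall>\<^sub>F n in sequentially. (\<integral>\<^sup>+x. ennreal ((norm (f n x - f k x))\<^sup>2) \<partial>lborel) \<le> ennreal (e\<^sup>2)"
        using eventually_sequentially by blast
    qed simp
    finally show ?thesis .
  qed
  have Cr: "\<exists>k0. \<forall>k\<ge>k0. \<forall>n\<ge>k. norm (X (r n) - X (r k)) \<le> e" if "e > 0" for e
  proof -
    obtain M where M: "\<And>m n. m \<ge> M \<Longrightarrow> n \<ge> M \<Longrightarrow> norm (X m - X n) < e"
      using CauchyD[OF X \<open>e > 0\<close>] by blast
    have "norm (X (r n) - X (r k)) \<le> e" if "k \<ge> M" "n \<ge> k" for n k
      using M[of "r n" "r k"] that seq_suble[OF r(1), of n] seq_suble[OF r(1), of k] by force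
    then show ?thesis by blast
  qed
  have sgk: "square_integrable (\<lambda>x. g x - f k x)" and ngk: "norm (abs_L2 (\<lambda>x. g x - f k x)) \<le> e"
    if e: "e > 0" "\<And>n. n \<ge> k \<Longrightarrow> norm (X (r n) - X (r k)) \<le> e" for k e
  proof -
    have "integrable lborel (\<lambda>x. (norm (g x - f k x))\<^sup>2)"
    proof (rule integrableI_bounded)
      show "(\<integral>\<^sup>+ x. ennreal (norm ((norm (g x - f k x))\<^sup>2)) \<partial>lborel) < \<infinity>"
        using order_le_less_trans[OF fat[OF e] ennreal_less_top] by simp
    qed measurable
    then show s: "square_integrable (\<lambda>x. g x - f k x)" by (simp add: square_integrable_def)
    have "ennreal ((norm (abs_L2 (\<lambda>x. g x - f k x)))\<^sup>2) \<le> ennreal (e\<^sup>2)"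
      using fat[OF e] square_integrable_norm_sq[OF s]
      by (simp add: norm_abs_L2[OF s] nn_integral_eq_integral)
    then have "(norm (abs_L2 (\<lambda>x. g x - f k x)))\<^sup>2 \<le> e\<^sup>2" by simp
    then show "norm (abs_L2 (\<lambda>x. g x - f k x)) \<le> e" by (rule power2_le_imp_le) (use e in simp)
  qed
  obtain k1 where k1: "\<forall>k\<ge>k1. \<forall>n\<ge>k. norm (X (r n) - X (r k)) \<le> 1"
    using Cr[OF zero_less_one] by blast
  have sg: "square_integrable g"
  proof -
    have "square_integrable (\<lambda>x. g x - f k1 x)" by (rule sgk[of 1]) (use k1 in simp_all)
    from square_integrable_add[OF this sf[of k1]] show ?thesis by simp
  qed
  have "(\<lambda>n. X (r n)) \<longlonglongrightarrow> abs_L2 g"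
  proof (rule LIMSEQ_I)
    fix e :: real assume "e > 0"
    then obtain k0 where k0: "\<forall>k\<ge>k0. \<forall>n\<ge>k. norm (X (r n) - X (r k)) \<le> e / 2"
      using Cr[OF half_gt_zero] by blast
    have "norm (X (r k) - abs_L2 g) < e" if "k \<ge> k0" for k
    proof -
      have "norm (abs_L2 (\<lambda>x. g x - f k x)) \<le> e / 2"
        by (rule ngk) (use k0 that \<open>e > 0\<close> in simp_all)
      then have "norm (abs_L2 g - X (r k)) \<le> e / 2" by (simp add: abs_L2_diff sf sg af)
      then show ?thesis using \<open>e > 0\<close> by (simp add: norm_minus_commute)
    qed
    then show "\<exists>no. \<forall>n\<ge>no. norm (X (r n) - abs_L2 g) < e" by blast
  qed
  then have "(X \<circ> r) \<longlonglongrightarrow> abs_L2 g" by (simp add: o_def)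
  then have "X \<longlonglongrightarrow> abs_L2 g" by (rule Cauchy_converges_subseq[OF X r(1)])
  then show "convergent X" by (rule convergentI)
qed

section \<open>Linear differential equations in Banach spaces\<close>

text \<open>
  Both signs of \<open>t\<close> are allowed, since the formula is to hold for all real times.
\<close>

lemma norm_bound_of_power_bound_derivative:
  fixes y :: "real \<Rightarrow> 'b::real_normed_vector"
  assumes y0: "y 0 = 0" and y: "\<And>t. \<bar>t\<bar> \<le> T \<Longrightarrow> (y has_vector_derivative y' t) (at t)"
    and le: "\<And>t. \<bar>t\<bar> \<le> T \<Longrightarrow> norm (y' t) \<le> c * \<bar>t\<bar> ^ n" and t: "\<bar>t\<bar> \<le> T"
  shows "norm (y t) \<le> c * \<bar>t\<bar> ^ Suc n / Suc n"
proof -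
  have pos: "norm (z \<tau>) \<le> c * \<tau> ^ Suc n / Suc n"
    if z0: "z 0 = 0" and z: "\<And>t. \<bar>t\<bar> \<le> T \<Longrightarrow> (z has_vector_derivative z' t) (at t)"
    and zle: "\<And>t. \<bar>t\<bar> \<le> T \<Longrightarrow> norm (z' t) \<le> c * \<bar>t\<bar> ^ n" and \<tau>: "0 < \<tau>" "\<tau> \<le> T"
    for z z' :: "real \<Rightarrow> 'b" and \<tau>
  proof -
    define \<phi> where "\<phi> s = c * s ^ Suc n / Suc n" for s :: real
    have d\<phi>: "(\<phi> has_vector_derivative c * s ^ n) (at s)" for s
    proof -
      have "((\<lambda>s. c / Suc n * s ^ Suc n) has_real_derivative c / Suc n * (Suc n * s ^ n)) (at s)"
        using DERIV_cmult[OF DERIV_pow[of "Suc n" s], of "c / Suc n"] by (simp only: diff_Suc_Suc minus_nat.diff_0)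
      moreover have "\<phi> = (\<lambda>s. c / Suc n * s ^ Suc n)" by (auto simp: \<phi>_def)
      ultimately show ?thesis
        unfolding has_real_derivative_iff_has_vector_derivative[symmetric] by (simp del: power_Suc of_nat_Suc)
    qed
    have "norm (z \<tau> - z 0) \<le> \<phi> \<tau> - \<phi> 0"
    proof (rule differentiable_bound_general[OF \<tau>(1)])
      show "continuous_on {0..\<tau>} z"
        by (rule continuous_at_imp_continuous_on) (use z \<tau> in \<open>auto intro!: has_vector_derivative_continuous[OF z]\<close>)
      show "continuous_on {0..\<tau>} \<phi>"
        by (rule continuous_at_imp_continuous_on) (use d\<phi> in \<open>auto intro!: has_vector_derivative_continuous[OF d\<phi>]\<close>)
      show "norm (z' x) \<le> c * x ^ n" if "0 < x" "x < \<tau>" for x using zle[of x] that \<tau> by simp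
    qed (use z d\<phi> \<tau> in \<open>force+\<close>)
    then show ?thesis by (simp add: \<phi>_def z0)
  qed
  consider "t = 0" | "t > 0" | "t < 0" by linarith
  then show ?thesis
  proof cases
    case 1 then show ?thesis by (simp add: y0)
  next
    case 2 then show ?thesis using pos[of y y' t] y0 y le t by simp
  next
    case 3
    have "norm ((\<lambda>s. y (- s)) (- t)) \<le> c * (- t) ^ Suc n / Suc n"
    proof (rule pos[where z' = "\<lambda>s. - y' (- s)"])
      fix s :: real assume s: "\<bar>s\<bar> \<le> T"
      have "((y \<circ> uminus) has_vector_derivative (- 1) *\<^sub>R y' (- s)) (at s)"
        by (rule vector_diff_chain_at) (use y[of "- s"] s in \<open>auto intro!: derivative_eq_intros\<close>)
      then show "((\<lambda>s. y (- s)) has_vector_derivative - y' (- s)) (at s)" by (simp add: o_def)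
      show "norm (- y' (- s)) \<le> c * \<bar>s\<bar> ^ n" using le[of "- s"] s by simp
    qed (use 3 t y0 in auto)
    then show ?thesis using 3 by simp
  qed
qed

lemma bounded_blinfun_on_interval:
  fixes A :: "real \<Rightarrow> 'b::real_normed_vector \<Rightarrow>\<^sub>L 'c::real_normed_vector"
  assumes "continuous_on UNIV A"
  obtains K where "K > 0" "\<And>t. \<bar>t\<bar> \<le> T \<Longrightarrow> norm (A t) \<le> K"
proof -
  have "compact (A ` {-T..T})"
    by (rule compact_continuous_image) (auto intro: continuous_on_subset[OF assms])
  then obtain K where K: "K > 0" "\<And>x. x \<in> A ` {-T..T} \<Longrightarrow> norm x \<le> K"
    using compact_imp_bounded bounded_pos by metis
  have "\<bar>t\<bar> \<le> T \<Longrightarrow> norm (A t) \<le> K" for t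
    using K(2)[of "A t"] by (auto simp: abs_le_iff)
  with K(1) that show ?thesis by blast
qed

lemma picard_iterates_bound:
  fixes A :: "real \<Rightarrow> 'b::real_normed_vector \<Rightarrow>\<^sub>L 'b"
  assumes y0: "\<And>t. \<bar>t\<bar> \<le> T \<Longrightarrow> norm (y 0 t) \<le> S"
    and ySuc0: "\<And>n. y (Suc n) 0 = 0"
    and yd: "\<And>n t. \<bar>t\<bar> \<le> T \<Longrightarrow> (y (Suc n) has_vector_derivative A t (y n t)) (at t)"
    and K: "\<And>t. \<bar>t\<bar> \<le> T \<Longrightarrow> norm (A t) \<le> K" and t: "\<bar>t\<bar> \<le> T"
  shows "norm (y n t) \<le> S * (K ^ n * \<bar>t\<bar> ^ n / fact n)"
  using t
proof (induction n arbitrary: t)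
  case 0 then show ?case using y0 by simp
next
  case (Suc n)
  have K0: "K \<ge> 0" using K[of t] Suc.prems norm_ge_zero order_trans by blast
  have "norm (y (Suc n) t) \<le> (S * K ^ Suc n / fact n) * \<bar>t\<bar> ^ Suc n / Suc n"
  proof (rule norm_bound_of_power_bound_derivative[OF ySuc0 yd])
    fix s :: real assume s: "\<bar>s\<bar> \<le> T"
    have "norm (A s (y n s)) \<le> norm (A s) * norm (y n s)" by (rule norm_blinfun)
    also have "\<dots> \<le> K * (S * (K ^ n * \<bar>s\<bar> ^ n / fact n))"
      by (intro mult_mono K Suc.IH s K0) auto
    finally show "norm (A s (y n s)) \<le> S * K ^ Suc n / fact n * \<bar>s\<bar> ^ n" by (simp add: ac_simps)
  qed (use Suc.prems in auto)
  then show ?case by (simp add: field_simps)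
qed

text \<open>
  The iterates are allowed to be given explicitly, so that the same theorem yields existence of solutions and identifies the
  exponential series of a bounded operator as the solution for constant \<open>A\<close>.
\<close>

theorem picard_series:
  fixes A :: "real \<Rightarrow> 'b::banach \<Rightarrow>\<^sub>L 'b"
  assumes A: "continuous_on UNIV A" and y0: "\<And>t. y 0 t = a"
    and ySuc0: "\<And>n. y (Suc n) 0 = 0"
    and yd: "\<And>n t. (y (Suc n) has_vector_derivative A t (y n t)) (at t)"
  shows "summable (\<lambda>n. y n t)"
    and "((\<lambda>t. \<Sum>n. y n t) has_vector_derivative A t (\<Sum>n. y n t)) (at t)"
    and "(\<Sum>n. y n 0) = a"
proof -
  define T where "T = \<bar>t\<bar> + 1"
  obtain K where K: "K > 0" "\<And>t. \<bar>t\<bar> \<le> T \<Longrightarrow> norm (A t) \<le> K"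
    using bounded_blinfun_on_interval[OF A] by blast
  have bnd: "norm (y n s) \<le> norm a * (K ^ n * \<bar>s\<bar> ^ n / fact n)" if "\<bar>s\<bar> \<le> T" for n s
    by (rule picard_iterates_bound[where A = A and T = T and y = y]) (use y0 ySuc0 yd K that in auto)
  have bnd': "norm (y n s) \<le> norm a * ((K * T) ^ n / fact n)" if "\<bar>s\<bar> \<le> T" for n s
  proof -
    have "K ^ n * \<bar>s\<bar> ^ n \<le> (K * T) ^ n"
      using K(1) that by (simp add: power_mult_distrib power_mono)
    then show ?thesis
      by (intro order_trans[OF bnd[OF that]] mult_left_mono divide_right_mono) auto
  qed
  have sume: "summable (\<lambda>n. norm a * ((K * T) ^ n / fact n))"
    using summable_exp[of "K * T"] by (intro summable_mult) (simp add: divide_inverse mult.commute)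
  have summ: "summable (\<lambda>n. y n s)" if "\<bar>s\<bar> \<le> T" for s
    by (rule summable_comparison_test'[OF sume]) (use bnd'[OF that] in auto)
  show "summable (\<lambda>n. y n t)" by (rule summ) (simp add: T_def)
  show "(\<Sum>n. y n 0) = a"
  proof -
    have "(\<lambda>n. y n 0) = (\<lambda>n. if n = 0 then a else 0)"
      using y0 ySuc0 by (intro ext) (metis not0_implies_Suc)
    then show ?thesis using suminf_finite[of "{0}" "\<lambda>n. if n = 0 then a else 0"] by simp
  qed
  define D where "D n s = (case n of 0 \<Rightarrow> 0 | Suc k \<Rightarrow> A s (y k s))" for n s
  have yD: "(y n has_vector_derivative D n s) (at s)" for n s
    by (cases n) (use yd y0 in \<open>auto simp: D_def fun_eq_iff[symmetric] y0[abs_def]\<close>)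
  let ?I = "{-T<..<T}"
  have Dbnd: "norm (D (Suc n) s) \<le> K * (norm a * ((K * T) ^ n / fact n))" if "\<bar>s\<bar> \<le> T" for n s
  proof -
    have "norm (A s (y n s)) \<le> norm (A s) * norm (y n s)" by (rule norm_blinfun)
    also have "\<dots> \<le> K * (norm a * ((K * T) ^ n / fact n))"
      by (intro mult_mono K bnd' that less_imp_le[OF K(1)]) auto
    finally show ?thesis by (simp add: D_def)
  qed
  define M where "M n = (case n of 0 \<Rightarrow> 0 | Suc k \<Rightarrow> K * (norm a * ((K * T) ^ k / fact k)))" for n
  have sM: "summable M"
    by (subst summable_Suc_iff[symmetric]) (unfold M_def nat.case, rule summable_mult[OF sume])
  have DM: "norm (D n s) \<le> M n" if "\<bar>s\<bar> \<le> T" for n s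
    using Dbnd[OF that] by (cases n) (auto simp: M_def D_def)
  have ul: "uniform_limit ?I (\<lambda>n s. \<Sum>i<n. D i s) (\<lambda>s. \<Sum>i. D i s) sequentially"
    by (rule Weierstrass_m_test[OF _ sM]) (use DM in auto)
  have ule: "\<forall>\<^sub>F n in sequentially. \<forall>s\<in>?I. \<forall>h. norm ((\<Sum>i<n. h *\<^sub>R D i s) - h *\<^sub>R (\<Sum>i. D i s)) \<le> e * norm h"
    if "e > 0" for e
  proof -
    have "\<forall>\<^sub>F n in sequentially. \<forall>s\<in>?I. dist (\<Sum>i<n. D i s) (\<Sum>i. D i s) < e"
      using ul that by (auto simp: uniform_limit_iff)
    then show ?thesis
    proof (rule eventually_mono, intro ballI allI)
      fix n s h assume *: "\<forall>s\<in>?I. dist (\<Sum>i<n. D i s) (\<Sum>i. D i s) < e" and s: "s \<in> ?I"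
      have "(\<Sum>i<n. h *\<^sub>R D i s) - h *\<^sub>R (\<Sum>i. D i s) = h *\<^sub>R ((\<Sum>i<n. D i s) - (\<Sum>i. D i s))"
        by (simp add: scaleR_sum_right scaleR_diff_right)
      then show "norm ((\<Sum>i<n. h *\<^sub>R D i s) - h *\<^sub>R (\<Sum>i. D i s)) \<le> e * norm h"
        using *[rule_format, OF s] by (simp add: dist_norm mult.commute[of e] mult_left_mono)
    qed
  qed
  have tI: "t \<in> ?I" by (auto simp: T_def)
  have "\<exists>g. \<forall>x\<in>?I. (\<lambda>n. y n x) sums g x \<and> (g has_derivative (\<lambda>h. h *\<^sub>R (\<Sum>i. D i x))) (at x within ?I)"
  proof (rule has_derivative_series[where x = t and l = "\<Sum>n. y n t"])
    show "(y n has_derivative (\<lambda>h. h *\<^sub>R D n x)) (at x within ?I)" for n x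
      using yD[of n x] by (simp add: has_vector_derivative_def has_derivative_at_withinI)
  qed (use ule tI summ[of t] in \<open>auto simp: T_def summable_sums\<close>)
  then obtain g where g: "\<And>x. x \<in> ?I \<Longrightarrow> (\<lambda>n. y n x) sums g x"
      "\<And>x. x \<in> ?I \<Longrightarrow> (g has_derivative (\<lambda>h. h *\<^sub>R (\<Sum>i. D i x))) (at x within ?I)" by blast
  have "(g has_derivative (\<lambda>h. h *\<^sub>R (\<Sum>i. D i t))) (at t)"
    using g(2)[OF tI] at_within_open[OF tI] by simp
  then have "(g has_vector_derivative (\<Sum>i. D i t)) (at t)" by (simp add: has_vector_derivative_def)
  then have "((\<lambda>t. \<Sum>n. y n t) has_vector_derivative (\<Sum>i. D i t)) (at t)"
    by (rule has_vector_derivative_transform_within_open[of _ _ _ ?I]) (use g(1) tI in \<open>auto simp: sums_iff\<close>)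
  moreover have "(\<Sum>i. D i t) = A t (\<Sum>n. y n t)"
  proof -
    have "(\<Sum>i. D i t) = D 0 t + (\<Sum>i. D (Suc i) t)"
      by (subst suminf_split_head) (auto intro!: summable_comparison_test'[OF sM] DM simp: T_def)
    also have "\<dots> = (\<Sum>i. A t (y i t))" by (simp add: D_def)
    also have "\<dots> = A t (\<Sum>n. y n t)"
      using summ[of t] by (intro bounded_linear.suminf[OF blinfun.bounded_linear_right, symmetric]) (simp add: T_def)
    finally show ?thesis .
  qed
  ultimately show "((\<lambda>t. \<Sum>n. y n t) has_vector_derivative A t (\<Sum>n. y n t)) (at t)" by simp
qed

text \<open>
  A solution serves as every Picard iterate of itself, so its norm is bounded by the general term of a convergent exponential series.
\<close>

lemma linear_ode_unique_zero:
  fixes A :: "real \<Rightarrow> 'b::real_normed_vector \<Rightarrow>\<^sub>L 'b"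
  assumes A: "continuous_on UNIV A" and y0: "y 0 = 0"
    and y: "\<And>t. (y has_vector_derivative A t (y t)) (at t)"
  shows "y t = 0"
proof -
  define T where "T = \<bar>t\<bar>"
  obtain K where K: "K > 0" "\<And>t. \<bar>t\<bar> \<le> T \<Longrightarrow> norm (A t) \<le> K"
    using bounded_blinfun_on_interval[OF A] by blast
  have "continuous_on UNIV y"
    by (rule continuous_at_imp_continuous_on) (use y in \<open>auto intro!: has_vector_derivative_continuous[OF y]\<close>)
  then have "compact (y ` {-T..T})"
    by (intro compact_continuous_image) (auto intro: continuous_on_subset)
  then obtain S where S: "\<And>x. x \<in> y ` {-T..T} \<Longrightarrow> norm x \<le> S"
    using compact_imp_bounded bounded_pos by metis
  have bnd: "norm (y t) \<le> S * (K ^ n * \<bar>t\<bar> ^ n / fact n)" for n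
  proof (rule picard_iterates_bound[where y = "\<lambda>_. y" and A = A and T = T])
    show "norm (y s) \<le> S" if "\<bar>s\<bar> \<le> T" for s using S[of "y s"] that by (auto simp: abs_le_iff)
  qed (use y y0 K in \<open>auto simp: T_def\<close>)
  have "(\<lambda>n. S * ((K * \<bar>t\<bar>) ^ n / fact n)) \<longlonglongrightarrow> S * 0"
    using summable_LIMSEQ_zero[OF summable_exp[of "K * \<bar>t\<bar>"]]
    by (intro tendsto_mult tendsto_const) (simp add: divide_inverse mult.commute)
  then have "norm (y t) \<le> S * 0"
    by (rule LIMSEQ_le_const) (use bnd in \<open>auto simp: power_mult_distrib\<close>)
  then show ?thesis by simp
qed

lemma linear_ode_unique:
  fixes A :: "real \<Rightarrow> 'b::real_normed_vector \<Rightarrow>\<^sub>L 'b"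
  assumes A: "continuous_on UNIV A" and "y 0 = z 0"
    and "\<And>t. (y has_vector_derivative A t (y t)) (at t)"
    and "\<And>t. (z has_vector_derivative A t (z t)) (at t)"
  shows "y t = z t"
proof -
  have "y t - z t = 0"
    by (rule linear_ode_unique_zero[OF A, of "\<lambda>t. y t - z t"])
      (use assms in \<open>auto simp: blinfun.diff_right intro!: derivative_eq_intros\<close>)
  then show ?thesis by simp
qed

lemma constant_of_zero_derivative:
  fixes y :: "real \<Rightarrow> 'b::real_normed_vector"
  assumes "\<And>t. (y has_vector_derivative 0) (at t)"
  shows "y t = y 0"
  by (rule linear_ode_unique[where A = "\<lambda>_. 0"]) (use assms in auto)

text \<open>
  The integral over \<open>[0, t]\<close>, oriented for negative \<open>t\<close>.
\<close>

definition antideriv :: "(real \<Rightarrow> 'b::banach) \<Rightarrow> real \<Rightarrow> 'b" where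
  "antideriv f t = (if 0 \<le> t then integral {0..t} f else - integral {t..0} f)"

lemma antideriv_zero [simp]: "antideriv f 0 = 0"
  by (simp add: antideriv_def)

lemma has_vector_derivative_antideriv:
  fixes f :: "real \<Rightarrow> 'b::banach"
  assumes f: "continuous_on UNIV f"
  shows "(antideriv f has_vector_derivative f t) (at t)"
proof -
  define T where "T = \<bar>t\<bar> + 1"
  have int: "f integrable_on {a..b}" for a b :: real
    by (rule integrable_continuous_interval) (rule continuous_on_subset[OF f], simp)
  have eq: "antideriv f s = integral {-T..s} f - integral {-T..0} f" if "s \<in> {-T<..<T}" for s
  proof (cases "0 \<le> s")
    case True
    then have "integral {-T..0} f + integral {0..s} f = integral {-T..s} f"
      by (intro Henstock_Kurzweil_Integration.integral_combine int) (auto simp: T_def)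
    then show ?thesis using True by (simp add: antideriv_def algebra_simps)
  next
    case False
    then have "integral {-T..s} f + integral {s..0} f = integral {-T..0} f"
      using that by (intro Henstock_Kurzweil_Integration.integral_combine int) auto
    then show ?thesis using False by (simp add: antideriv_def algebra_simps)
  qed
  have tI: "t \<in> {-T<..<T}" by (auto simp: T_def)
  have "((\<lambda>u. integral {-T..u} f) has_vector_derivative f t) (at t within {-T..T})"
    by (rule integral_has_vector_derivative) (use tI in \<open>auto intro: continuous_on_subset[OF f]\<close>)
  then have "((\<lambda>u. integral {-T..u} f) has_vector_derivative f t) (at t)"
    using tI by (subst (asm) at_within_interior) auto
  then have "((\<lambda>u. integral {-T..u} f - integral {-T..0} f) has_vector_derivative f t) (at t)"
    by (auto intro!: derivative_eq_intros)
  then show ?thesis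
    by (rule has_vector_derivative_transform_within_open[of _ _ _ "{-T<..<T}"]) (use eq tI in auto)
qed

theorem linear_ode_solution_exists:
  fixes A :: "real \<Rightarrow> 'b::banach \<Rightarrow>\<^sub>L 'b"
  assumes A: "continuous_on UNIV A"
  obtains y where "y 0 = a" "\<And>t. (y has_vector_derivative A t (y t)) (at t)"
proof -
  define y where "y = rec_nat (\<lambda>_. a) (\<lambda>_ f. antideriv (\<lambda>s. A s (f s)))"
  have y0: "y 0 t = a" for t by (simp add: y_def)
  have yS: "y (Suc n) = antideriv (\<lambda>s. A s (y n s))" for n by (simp add: y_def)
  have cont: "continuous_on UNIV (y n)" for n
  proof (induction n)
    case 0 show ?case by (simp add: y0[abs_def])
  next
    case (Suc n)
    have "continuous_on UNIV (\<lambda>s. A s (y n s))"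
      by (intro continuous_intros A Suc)
    from has_vector_derivative_antideriv[OF this] show ?case
      unfolding yS by (intro continuous_at_imp_continuous_on ballI has_vector_derivative_continuous)
  qed
  have yd: "(y (Suc n) has_vector_derivative A t (y n t)) (at t)" for n t
    unfolding yS by (rule has_vector_derivative_antideriv) (intro continuous_intros A cont)
  have yS0: "y (Suc n) 0 = 0" for n by (simp add: yS)
  note ps = picard_series[OF A y0 yS0 yd]
  show ?thesis by (rule that[OF ps(3) ps(2)])
qed

section \<open>Matrix algebra\<close>

lemma mscale_nth [simp]: "(c *\<^sub>M A) $ i $ j = c * A $ i $ j"
  by (simp add: mscale_def)

lemma ctranspose_nth [simp]: "ctranspose A $ i $ j = cnj (A $ j $ i)"
  by (simp add: ctranspose_def transpose_def)

lemma matrix_mult_nth: "(A ** B) $ i $ j = (\<Sum>k\<in>UNIV. A $ i $ k * B $ k $ j)"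
  by (simp add: matrix_matrix_mult_def)

lemma mscale_simps [simp]:
  "1 *\<^sub>M A = A" "0 *\<^sub>M A = 0" "c *\<^sub>M 0 = 0" "c *\<^sub>M (d *\<^sub>M A) = (c * d) *\<^sub>M A"
  "(- c) *\<^sub>M A = - (c *\<^sub>M A)" "c *\<^sub>M (- A) = - (c *\<^sub>M A)"
  by (simp_all add: vec_eq_iff)

lemma mscale_add_right: "c *\<^sub>M (A + B) = c *\<^sub>M A + c *\<^sub>M B"
  by (simp add: vec_eq_iff distrib_left)

lemma mscale_diff_right: "c *\<^sub>M (A - B) = c *\<^sub>M A - c *\<^sub>M B"
  by (simp add: vec_eq_iff right_diff_distrib)

lemma mscale_add_left: "(c + d) *\<^sub>M A = c *\<^sub>M A + d *\<^sub>M A"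
  by (simp add: vec_eq_iff distrib_right)

lemma mscale_diff_left: "(c - d) *\<^sub>M A = c *\<^sub>M A - d *\<^sub>M A"
  by (simp add: vec_eq_iff left_diff_distrib)

lemma mscale_of_real: "of_real r *\<^sub>M A = r *\<^sub>R A"
  by (simp add: vec_eq_iff) (simp add: scaleR_conv_of_real)

lemma mscale_scaleR_right: "c *\<^sub>M (r *\<^sub>R A) = r *\<^sub>R (c *\<^sub>M A)"
  by (simp add: vec_eq_iff)

lemma mscale_scaleR_left: "(r *\<^sub>R c) *\<^sub>M A = r *\<^sub>R (c *\<^sub>M A)"
  by (simp add: vec_eq_iff)

lemma bounded_bilinear_mscale: "bounded_bilinear (*\<^sub>M)"
proof (rule bounded_bilinear.intro)
  show "\<exists>K. \<forall>(a::complex) (b::complex^'a^'b). norm (a *\<^sub>M b) \<le> norm a * norm b * K"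
    by (rule exI[of _ 1]) (simp add: norm_mscale)
qed (simp_all add: mscale_add_left mscale_add_right mscale_scaleR_left mscale_scaleR_right)

lemma bounded_linear_mscale_left: "bounded_linear (\<lambda>c. c *\<^sub>M A)"
  by (rule bounded_bilinear.bounded_linear_left[OF bounded_bilinear_mscale])

lemma continuous_on_mscale [continuous_intros]:
  "continuous_on S f \<Longrightarrow> continuous_on S g \<Longrightarrow> continuous_on S (\<lambda>x. f x *\<^sub>M g x)"
  by (rule bounded_bilinear.continuous_on[OF bounded_bilinear_mscale])

lemma measurable_mscale [measurable]:
  assumes "f \<in> borel_measurable M" "g \<in> borel_measurable M"
  shows "(\<lambda>x. f x *\<^sub>M g x) \<in> borel_measurable M"
  by (rule borel_measurable_continuous_Pair[OF assms]) (intro continuous_intros)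

lemma ctranspose_simps [simp]:
  "ctranspose (ctranspose A) = A" "ctranspose 0 = 0"
  "ctranspose (- A) = - ctranspose A"
  "ctranspose (c *\<^sub>M A) = cnj c *\<^sub>M ctranspose A"
  by (simp_all add: vec_eq_iff)

lemma ctranspose_add: "ctranspose (A + B) = ctranspose A + ctranspose B"
  by (simp add: vec_eq_iff)

lemma ctranspose_diff: "ctranspose (A - B) = ctranspose A - ctranspose B"
  by (simp add: vec_eq_iff)

lemma ctranspose_mult: "ctranspose (A ** B) = ctranspose B ** ctranspose A"
  by (simp add: vec_eq_iff matrix_mult_nth mult.commute)

lemma inner_matrix: "A \<bullet> B = Re (\<Sum>i\<in>UNIV. \<Sum>j\<in>UNIV. A $ i $ j * cnj (B $ i $ j))"
  by (simp add: inner_vec_def inner_complex_def)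

lemma inner_ctranspose [simp]: "ctranspose A \<bullet> ctranspose B = A \<bullet> B"
  unfolding inner_vec_def by (subst sum.swap) (simp add: inner_complex_def)

lemma norm_ctranspose [simp]: "norm (ctranspose A) = norm A"
  by (simp add: norm_eq_sqrt_inner)

lemma bounded_linear_ctranspose: "bounded_linear ctranspose"
  by (rule bounded_linear_intro[where K = 1]) (simp_all add: ctranspose_add, simp add: vec_eq_iff)

lemma inner_mscale_left: "(c *\<^sub>M A) \<bullet> B = A \<bullet> (cnj c *\<^sub>M B)"
  by (simp add: inner_matrix ac_simps)

lemma inner_mult_left: "(A ** B) \<bullet> C = B \<bullet> (ctranspose A ** C)"
proof -
  have "(\<Sum>i\<in>UNIV. \<Sum>j\<in>UNIV. (A ** B) $ i $ j * cnj (C $ i $ j))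
      = (\<Sum>i\<in>UNIV. \<Sum>j\<in>UNIV. \<Sum>k\<in>UNIV. A $ i $ k * B $ k $ j * cnj (C $ i $ j))"
    by (simp add: matrix_mult_nth sum_distrib_right)
  also have "\<dots> = (\<Sum>j\<in>UNIV. \<Sum>i\<in>UNIV. \<Sum>k\<in>UNIV. A $ i $ k * B $ k $ j * cnj (C $ i $ j))"
    by (rule sum.swap)
  also have "\<dots> = (\<Sum>j\<in>UNIV. \<Sum>k\<in>UNIV. \<Sum>i\<in>UNIV. A $ i $ k * B $ k $ j * cnj (C $ i $ j))"
    by (intro sum.cong refl sum.swap)
  also have "\<dots> = (\<Sum>k\<in>UNIV. \<Sum>j\<in>UNIV. \<Sum>i\<in>UNIV. A $ i $ k * B $ k $ j * cnj (C $ i $ j))"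
    by (rule sum.swap)
  also have "\<dots> = (\<Sum>k\<in>UNIV. \<Sum>j\<in>UNIV. B $ k $ j * cnj ((ctranspose A ** C) $ k $ j))"
    by (simp add: matrix_mult_nth sum_distrib_left ac_simps)
  finally show ?thesis by (simp add: inner_matrix)
qed

lemma mult_add_left: "((A::complex^'b^'a) + B) ** C = A ** C + B ** C"
  by (simp add: vec_eq_iff matrix_mult_nth distrib_right sum.distrib)

lemma mult_diff_left: "((A::complex^'b^'a) - B) ** C = A ** C - B ** C"
  by (simp add: vec_eq_iff matrix_mult_nth left_diff_distrib sum_subtractf)

lemma mult_add_right: "(C::complex^'b^'a) ** (A + B) = C ** A + C ** B"
  by (simp add: vec_eq_iff matrix_mult_nth distrib_left sum.distrib)

lemma mult_diff_right: "(C::complex^'b^'a) ** (A - B) = C ** A - C ** B"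
  by (simp add: vec_eq_iff matrix_mult_nth right_diff_distrib sum_subtractf)

lemma mult_mscale_left [simp]: "(c *\<^sub>M A) ** B = c *\<^sub>M (A ** B)"
  by (simp add: vec_eq_iff matrix_mult_nth sum_distrib_left ac_simps)

lemma mult_mscale_right [simp]: "A ** (c *\<^sub>M B) = c *\<^sub>M (A ** B)"
  by (simp add: vec_eq_iff matrix_mult_nth sum_distrib_left ac_simps)

lemma norm_mult_le: "norm ((A::complex^'b^'a) ** (B::complex^'c^'b)) \<le> norm A * norm B"
proof -
  define a where "a i = L2_set (\<lambda>k. cmod (A $ i $ k)) UNIV" for i
  define b where "b j = L2_set (\<lambda>k. cmod (B $ k $ j)) UNIV" for j
  have e: "cmod ((A ** B) $ i $ j) \<le> a i * b j" for i j
  proof -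
    have "cmod ((A ** B) $ i $ j) \<le> (\<Sum>k\<in>UNIV. cmod (A $ i $ k) * cmod (B $ k $ j))"
      unfolding matrix_mult_nth by (rule order_trans[OF norm_sum]) (simp add: norm_mult)
    also have "\<dots> \<le> a i * b j"
      unfolding a_def b_def using L2_set_mult_ineq[of "\<lambda>k. cmod (A $ i $ k)" "\<lambda>k. cmod (B $ k $ j)" UNIV]
      by simp
    finally show ?thesis .
  qed
  have A: "(norm A)\<^sup>2 = (\<Sum>i\<in>UNIV. (a i)\<^sup>2)"
    by (simp add: a_def norm_vec_def L2_set_def sum_nonneg)
  have B: "(norm B)\<^sup>2 = (\<Sum>j\<in>UNIV. (b j)\<^sup>2)"
    unfolding b_def by (subst norm_ctranspose[symmetric]) (simp add: norm_vec_def L2_set_def sum_nonneg)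
  have "(norm (A ** B))\<^sup>2 = (\<Sum>i\<in>UNIV. \<Sum>j\<in>UNIV. (cmod ((A ** B) $ i $ j))\<^sup>2)"
    by (simp add: norm_vec_def L2_set_def sum_nonneg)
  also have "\<dots> \<le> (\<Sum>i\<in>UNIV. \<Sum>j\<in>UNIV. (a i * b j)\<^sup>2)"
    by (intro sum_mono power_mono e) simp
  also have "\<dots> = (norm A * norm B)\<^sup>2"
    by (simp add: A B power_mult_distrib sum_product)
  finally show ?thesis by (rule power2_le_imp_le) simp
qed

lemma bounded_bilinear_mult: "bounded_bilinear ((**) :: complex^'b^'a \<Rightarrow> complex^'c^'b \<Rightarrow> complex^'c^'a)"
proof (rule bounded_bilinear.intro)
  show "\<exists>K. \<forall>(a::complex^'b^'a) (b::complex^'c^'b). norm (a ** b) \<le> norm a * norm b * K"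
    by (rule exI[of _ 1]) (simp add: norm_mult_le)
  show "(r *\<^sub>R a) ** b = r *\<^sub>R (a ** b)" for r and a :: "complex^'b^'a" and b :: "complex^'c^'b"
    by (simp add: mscale_of_real[symmetric])
  show "a ** (r *\<^sub>R b) = r *\<^sub>R (a ** b)" for r and a :: "complex^'b^'a" and b :: "complex^'c^'b"
    by (simp add: mscale_of_real[symmetric])
qed (simp_all add: mult_add_left mult_add_right)

lemmas continuous_on_matrix_mult [continuous_intros] =
  bounded_bilinear.continuous_on[OF bounded_bilinear_mult]

lemma measurable_matrix_mult [measurable]:
  fixes f :: "'x \<Rightarrow> complex^'b^'a" and g :: "'x \<Rightarrow> complex^'c^'b"
  assumes "f \<in> borel_measurable M" "g \<in> borel_measurable M"
  shows "(\<lambda>x. f x ** g x) \<in> borel_measurable M"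
  by (rule borel_measurable_continuous_Pair[OF assms]) (intro continuous_intros)

lemmas continuous_on_ctranspose [continuous_intros] =
  bounded_linear.continuous_on[OF bounded_linear_ctranspose]

lemma measurable_ctranspose [measurable]:
  "f \<in> borel_measurable M \<Longrightarrow> (\<lambda>x. ctranspose (f x)) \<in> borel_measurable M"
  by (rule measurable_compose[of _ _ borel])
    (auto intro!: borel_measurable_continuous_onI linear_continuous_on bounded_linear_ctranspose)

section \<open>Bounded multipliers and affine changes of variable\<close>

text \<open>
  A measurable field of uniformly bounded linear maps. One notion covers multiplication by functions, constant linear maps
  such as the adjoint, cutoffs and modulations.
\<close>

definition multiplier :: "real \<Rightarrow> (real \<Rightarrow> 'a::euclidean_space \<Rightarrow> 'b::euclidean_space) \<Rightarrow> bool" where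
  "multiplier K b \<longleftrightarrow> 0 \<le> K \<and> (\<forall>x. linear (b x)) \<and> (\<forall>x v. norm (b x v) \<le> K * norm v) \<and>
     (\<forall>f\<in>borel_measurable borel. (\<lambda>x. b x (f x)) \<in> borel_measurable borel)"

definition L2_map :: "(real \<Rightarrow> 'a::euclidean_space \<Rightarrow> 'b::euclidean_space) \<Rightarrow> 'a L2 \<Rightarrow> 'b L2" where
  "L2_map b F = abs_L2 (\<lambda>x. b x (rep_L2 F x))"

lemma square_integrable_multiplier:
  assumes b: "multiplier K b" and f: "square_integrable f"
  shows "square_integrable (\<lambda>x. b x (f x))"
  by (rule square_integrable_AE_bound[OF f, where c = K])
    (use b square_integrable_measurable[OF f] in \<open>auto simp: multiplier_def\<close>)

lemma L2_map_abs:
  assumes b: "multiplier K b" and f: "square_integrable f"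
  shows "L2_map b (abs_L2 f) = abs_L2 (\<lambda>x. b x (f x))"
  unfolding L2_map_def
proof (rule abs_L2_cong)
  show "AE x in lborel. b x (rep_L2 (abs_L2 f) x) = b x (f x)"
    using rep_L2_abs_L2[OF f] by eventually_elim simp
qed (intro square_integrable_multiplier[OF b] f square_integrable_rep_L2)+

lemma rep_L2_map: "multiplier K b \<Longrightarrow> AE x in lborel. rep_L2 (L2_map b F) x = b x (rep_L2 F x)"
  unfolding L2_map_def by (rule rep_L2_abs_L2[OF square_integrable_multiplier[OF _ square_integrable_rep_L2]])

lemma norm_L2_map_le:
  assumes b: "multiplier K b"
  shows "norm (L2_map b F) \<le> K * norm F"
  using norm_abs_L2_le[OF square_integrable_multiplier[OF b square_integrable_rep_L2, of F]
      square_integrable_rep_L2[of F], of K] b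
  by (simp add: L2_map_def multiplier_def)

lemma bounded_linear_L2_map:
  assumes b: "multiplier K b"
  shows "bounded_linear (L2_map b)"
proof (rule bounded_linear_intro[where K = K])
  have l: "linear (b x)" for x using b by (simp add: multiplier_def)
  have sq: "square_integrable (\<lambda>x. b x (rep_L2 F x))" for F
    by (intro square_integrable_multiplier[OF b] square_integrable_rep_L2)
  show "L2_map b (F + G) = L2_map b F + L2_map b G" for F G
  proof -
    have "L2_map b (F + G) = abs_L2 (\<lambda>x. b x (rep_L2 F x) + b x (rep_L2 G x))"
      unfolding L2_map_def
    proof (rule abs_L2_cong)
      show "AE x in lborel. b x (rep_L2 (F + G) x) = b x (rep_L2 F x) + b x (rep_L2 G x)"
        using rep_L2_add[of F G] by eventually_elim (simp add: linear_add[OF l])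
    qed (intro sq square_integrable_add)+
    then show ?thesis by (simp add: abs_L2_add sq L2_map_def)
  qed
  show "L2_map b (r *\<^sub>R F) = r *\<^sub>R L2_map b F" for r F
  proof -
    have "L2_map b (r *\<^sub>R F) = abs_L2 (\<lambda>x. r *\<^sub>R b x (rep_L2 F x))"
      unfolding L2_map_def
    proof (rule abs_L2_cong)
      show "AE x in lborel. b x (rep_L2 (r *\<^sub>R F) x) = r *\<^sub>R b x (rep_L2 F x)"
        using rep_L2_scaleR[of r F] by eventually_elim (simp add: linear_cmul[OF l])
    qed (intro sq square_integrable_scaleR)+
    then show ?thesis by (simp add: abs_L2_scaleR sq L2_map_def)
  qed
  show "norm (L2_map b F) \<le> norm F * K" for F
    using norm_L2_map_le[OF b, of F] by (simp add: mult.commute)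
qed

lemma multiplier_const:
  assumes "bounded_linear l"
  obtains K where "multiplier K (\<lambda>_. l)"
proof -
  interpret l: bounded_linear l by fact
  obtain K where "0 \<le> K" "\<And>x. norm (l x) \<le> norm x * K" using l.nonneg_bounded by blast
  then have "multiplier K (\<lambda>_. l)"
    by (auto simp: multiplier_def mult.commute l.linear_axioms
        intro: measurable_compose[OF _ borel_measurable_continuous_onI[OF linear_continuous_on[OF assms]]])
  then show ?thesis by (rule that)
qed

lemma multiplier_mscale:
  assumes "c \<in> borel_measurable borel" "\<And>x. cmod (c x) \<le> K"
  shows "multiplier K (\<lambda>x A. c x *\<^sub>M (A::complex^'n^'m))"
  unfolding multiplier_def
proof (intro conjI allI ballI)
  show "0 \<le> K" using assms(2)[of 0] norm_ge_zero order_trans by blast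
  show "linear (\<lambda>A. c x *\<^sub>M (A::complex^'n^'m))" for x
    by (rule bounded_linear.linear) (rule bounded_linear_mscale)
  show "norm (c x *\<^sub>M v) \<le> K * norm v" for x and v :: "complex^'n^'m"
    by (simp add: norm_mscale mult_right_mono assms(2))
  show "(\<lambda>x. c x *\<^sub>M f x) \<in> borel_measurable borel" if "f \<in> borel_measurable borel" for f :: "real \<Rightarrow> complex^'n^'m"
    by (intro measurable_mscale assms(1) that)
qed

lemma multiplier_lmult:
  fixes u :: "real \<Rightarrow> complex^'k^'m"
  assumes "u \<in> borel_measurable borel" "\<And>x. norm (u x) \<le> K"
  shows "multiplier K (\<lambda>x A. u x ** (A::complex^'n^'k))"
  unfolding multiplier_def
proof (intro conjI allI ballI)
  show "0 \<le> K" using assms(2)[of 0] norm_ge_zero order_trans by blast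
  show "linear (\<lambda>A. u x ** (A::complex^'n^'k))" for x
    by (rule bounded_linear.linear) (rule bounded_bilinear.bounded_linear_right[OF bounded_bilinear_mult])
  show "norm (u x ** v) \<le> K * norm v" for x and v :: "complex^'n^'k"
    by (rule order_trans[OF norm_mult_le]) (simp add: mult_right_mono assms(2))
  show "(\<lambda>x. u x ** f x) \<in> borel_measurable borel" if "f \<in> borel_measurable borel" for f :: "real \<Rightarrow> complex^'n^'k"
    by (intro measurable_matrix_mult assms(1) that)
qed

lemma multiplier_indicator:
  assumes "S \<in> sets borel"
  shows "multiplier 1 (\<lambda>x A. indicator S x *\<^sub>R (A::'a::euclidean_space))"
  using assms by (auto simp: multiplier_def linear_iff scaleR_add_right indicator_def
      intro!: borel_measurable_scaleR borel_measurable_indicator)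

text \<open>
  Covers the reflection and the translations, which correspond to adjoints and modulations under the Fourier transform.
\<close>

definition L2_affine :: "real \<Rightarrow> real \<Rightarrow> 'a::euclidean_space L2 \<Rightarrow> 'a L2" where
  "L2_affine c t F = abs_L2 (\<lambda>x. rep_L2 F (t + c * x))"

lemma square_integrable_affine:
  assumes c: "c \<noteq> 0" and f: "square_integrable f"
  shows "square_integrable (\<lambda>x. f (t + c * x))"
proof -
  note [measurable] = square_integrable_measurable[OF f]
  show ?thesis
    using lborel_integrable_real_affine[OF square_integrable_norm_sq[OF f] c, of t]
    by (auto simp: square_integrable_def)
qed

lemma AE_lborel_affine:
  assumes c: "c \<noteq> 0" and P: "AE x in lborel. P (x::real)"
  shows "AE x in lborel. P (t + c * x)"
proof -
  obtain N where N: "{x. \<not> P x} \<subseteq> N" "N \<in> null_sets lborel" using P by (auto elim!: AE_E simp: null_sets_def)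
  then have "AE x in lborel. x \<notin> N" by (intro AE_not_in)
  moreover have "{x. x \<notin> N} \<in> sets borel" using N(2) by (auto simp: null_sets_def)
  ultimately have "AE x in lborel. t + c * x \<notin> N"
    by (intro AE_borel_affine[OF c]) (auto simp: pred_def Compl_eq[symmetric] simp del: mem_Collect_eq)
  then show ?thesis by eventually_elim (use N(1) in auto)
qed

lemma L2_affine_abs:
  assumes c: "c \<noteq> 0" and f: "square_integrable f"
  shows "L2_affine c t (abs_L2 f) = abs_L2 (\<lambda>x. f (t + c * x))"
  unfolding L2_affine_def
  by (intro abs_L2_cong square_integrable_affine[OF c] f square_integrable_rep_L2
      AE_lborel_affine[OF c rep_L2_abs_L2])

lemma rep_L2_affine: "c \<noteq> 0 \<Longrightarrow> AE x in lborel. rep_L2 (L2_affine c t F) x = rep_L2 F (t + c * x)"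
  unfolding L2_affine_def by (rule rep_L2_abs_L2[OF square_integrable_affine[OF _ square_integrable_rep_L2]])

lemma inner_L2_affine:
  assumes c: "c \<noteq> 0"
  shows "L2_affine c t F \<bullet> L2_affine c t G = (F \<bullet> G) / \<bar>c\<bar>"
proof -
  have "F \<bullet> G = \<bar>c\<bar> *\<^sub>R (LINT x|lborel. rep_L2 F (t + c * x) \<bullet> rep_L2 G (t + c * x))"
    unfolding inner_L2 by (rule lborel_integral_real_affine[OF c])
  also have "(LINT x|lborel. rep_L2 F (t + c * x) \<bullet> rep_L2 G (t + c * x)) = L2_affine c t F \<bullet> L2_affine c t G"
    unfolding L2_affine_def by (intro inner_abs_L2[symmetric] square_integrable_affine[OF c] square_integrable_rep_L2)
  finally show ?thesis using c by simp
qed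

lemma bounded_linear_L2_affine:
  assumes c: "c \<noteq> 0"
  shows "bounded_linear (L2_affine c t)"
proof (rule bounded_linear_intro[where K = "1 / sqrt \<bar>c\<bar>"])
  note sq = square_integrable_affine[OF c square_integrable_rep_L2]
  show "L2_affine c t (F + G) = L2_affine c t F + L2_affine c t G" for F G :: "'a L2"
    unfolding L2_affine_def
    by (subst abs_L2_add[symmetric], rule sq, rule sq)
      (intro abs_L2_cong square_integrable_add sq AE_lborel_affine[OF c rep_L2_add])
  show "L2_affine c t (r *\<^sub>R F) = r *\<^sub>R L2_affine c t F" for r and F :: "'a L2"
    unfolding L2_affine_def
    by (subst abs_L2_scaleR[symmetric], rule sq)
      (intro abs_L2_cong square_integrable_scaleR sq AE_lborel_affine[OF c rep_L2_scaleR])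
  show "norm (L2_affine c t F) \<le> norm F * (1 / sqrt \<bar>c\<bar>)" for F :: "'a L2"
    by (simp add: norm_eq_sqrt_inner inner_L2_affine[OF c] real_sqrt_divide)
qed

section \<open>Density\<close>

lemma emeasure_Icc_finite: "emeasure lborel {a..b::real} < top"
  by (simp add: emeasure_lborel_Icc_eq)

definition trunc :: "nat \<Rightarrow> (real \<Rightarrow> 'a::euclidean_space) \<Rightarrow> real \<Rightarrow> 'a" where
  "trunc n f x = indicator {-real n..real n} x *\<^sub>R f x"

lemma square_integrable_trunc:
  assumes "square_integrable f" shows "square_integrable (trunc n f)"
  using square_integrable_multiplier[OF multiplier_indicator assms, of "{- real n..real n}"]
  by (simp add: trunc_def[abs_def])

lemma square_integrable_set_integrable:
  fixes f :: "real \<Rightarrow> 'a::euclidean_space"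
  assumes f: "square_integrable f" and S: "S \<in> sets borel" "emeasure lborel S < \<infinity>"
  shows "integrable lborel (\<lambda>x. indicator S x *\<^sub>R f x)"
proof -
  have "square_integrable (indicator S :: real \<Rightarrow> real)"
  proof -
    have "(\<lambda>x. (norm (indicator S x :: real))\<^sup>2) = (indicator S :: real \<Rightarrow> real)"
      by (auto simp: indicator_def)
    then show ?thesis using S by (simp add: square_integrable_def integrable_real_indicator)
  qed
  from integrable_norm_mult[OF this f] show ?thesis
    by (rule Bochner_Integration.integrable_bound) (use square_integrable_measurable[OF f] S in auto)
qed

lemma integrable_trunc: "square_integrable f \<Longrightarrow> integrable lborel (trunc n f)"
  unfolding trunc_def[abs_def] by (rule square_integrable_set_integrable) (auto simp: emeasure_Icc_finite)

lemma trunc_tendsto: "(\<lambda>n. trunc n f x) \<longlonglongrightarrow> f x"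
proof (rule tendsto_eventually)
  obtain N :: nat where "\<bar>x\<bar> \<le> N" using real_arch_simple by blast
  then have "trunc n f x = f x" if "n \<ge> N" for n
    using that by (auto simp: trunc_def indicator_def)
  then show "\<forall>\<^sub>F n in sequentially. trunc n f x = f x" using eventually_sequentially by blast
qed

lemma norm_trunc_le: "norm (trunc n f x) \<le> norm (f x)"
  by (simp add: trunc_def indicator_def)

lemma abs_trunc_tendsto:
  assumes f: "square_integrable f"
  shows "(\<lambda>n. abs_L2 (trunc n f)) \<longlonglongrightarrow> abs_L2 f"
  by (rule L2_dominated_convergence[OF _ _ f])
    (auto intro!: AE_I2 trunc_tendsto norm_trunc_le square_integrable_measurable[OF f]
        square_integrable_measurable[OF square_integrable_trunc[OF f]])

text \<open>
  Truncations are dense and integrable, so identities between continuous operators need to be checked on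
  integrable functions only, where the Fourier transform is an integral.
\<close>

lemma L2_closed_induct:
  assumes cl: "closed {F. P F}"
    and P: "\<And>f. square_integrable f \<Longrightarrow> integrable lborel f \<Longrightarrow> P (abs_L2 f)"
  shows "P F"
proof -
  have "(\<lambda>n. abs_L2 (trunc n (rep_L2 F))) \<longlonglongrightarrow> F"
    using abs_trunc_tendsto[of "rep_L2 F"] by simp
  then have "F \<in> {F. P F}"
    by (rule closed_sequentially[OF cl, rotated])
      (auto intro: P square_integrable_trunc integrable_trunc)
  then show ?thesis by simp
qed

lemma L2_linear_eq:
  assumes S: "bounded_linear S" and T: "bounded_linear T"
    and eq: "\<And>f. square_integrable f \<Longrightarrow> integrable lborel f \<Longrightarrow> S (abs_L2 f) = T (abs_L2 f)"
  shows "S F = T F"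
proof (rule L2_closed_induct[where P = "\<lambda>F. S F = T F"])
  show "closed {F. S F = T F}"
    by (intro closed_Collect_eq linear_continuous_on S T)
qed (rule eq)

text \<open>
  The positive and the negative part are the densities of two finite measures with the same distribution function.
\<close>

lemma AE_zero_of_half_line_integrals:
  fixes f :: "real \<Rightarrow> real"
  assumes f: "integrable lborel f" and zero: "\<And>a. (LINT x|lborel. indicator {..a} x *\<^sub>R f x) = 0"
  shows "AE x in lborel. f x = 0"
proof -
  have [measurable]: "f \<in> borel_measurable borel" using f by auto
  define M where "M g = density lborel (\<lambda>x. ennreal (g x))" for g :: "real \<Rightarrow> real"
  have em: "emeasure (M g) A = ennreal (LINT x|lborel. indicator A x * max 0 (g x))"
    and intg: "integrable lborel (\<lambda>x. indicator A x * max 0 (g x))"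
    if A: "A \<in> sets borel" and g: "integrable lborel g" for g A
  proof -
    have [measurable]: "g \<in> borel_measurable borel" using g by auto
    show int: "integrable lborel (\<lambda>x. indicator A x * max 0 (g x))"
      by (rule Bochner_Integration.integrable_bound[OF g]) (use A in \<open>auto simp: indicator_def\<close>)
    have "emeasure (M g) A = (\<integral>\<^sup>+x. ennreal (g x) * indicator A x \<partial>lborel)"
      using A by (simp add: M_def emeasure_density)
    also have "\<dots> = (\<integral>\<^sup>+x. ennreal (indicator A x * max 0 (g x)) \<partial>lborel)"
      by (rule nn_integral_cong) (auto simp: indicator_def max_def ennreal_neg)
    also have "\<dots> = ennreal (LINT x|lborel. indicator A x * max 0 (g x))"
      by (rule nn_integral_eq_integral[OF int]) auto
    finally show "emeasure (M g) A = ennreal (LINT x|lborel. indicator A x * max 0 (g x))" .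
  qed
  have fin: "finite_borel_measure (M g)" if g: "integrable lborel g" for g
  proof -
    have "emeasure (M g) (space (M g)) < \<infinity>"
      using em[OF _ g, of UNIV] by (simp add: M_def)
    then have "finite_measure (M g)" by (intro finite_measureI) auto
    then show ?thesis by (simp add: finite_borel_measure_def finite_borel_measure_axioms_def M_def)
  qed
  have mf: "integrable lborel (\<lambda>x. - f x)" using f by simp
  have "M f = M (\<lambda>x. - f x)"
  proof (rule cdf_unique'[OF fin[OF f] fin[OF mf]], rule ext)
    fix a
    have "(LINT x|lborel. indicator {..a} x * max 0 (f x)) - (LINT x|lborel. indicator {..a} x * max 0 (- f x))
        = (LINT x|lborel. indicator {..a} x * max 0 (f x) - indicator {..a} x * max 0 (- f x))"
      by (rule Bochner_Integration.integral_diff[symmetric]) (intro intg f mf, simp)+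
    also have "\<dots> = (LINT x|lborel. indicator {..a} x *\<^sub>R f x)"
      by (rule Bochner_Integration.integral_cong) (auto simp: indicator_def)
    finally have "(LINT x|lborel. indicator {..a} x * max 0 (f x)) = (LINT x|lborel. indicator {..a} x * max 0 (- f x))"
      using zero[of a] by simp
    then show "cdf (M f) a = cdf (M (\<lambda>x. - f x)) a"
      by (simp add: cdf_def measure_def em[OF _ f] em[OF _ mf])
  qed
  then have "AE x in lborel. ennreal (f x) = ennreal (- f x)"
    unfolding M_def
  proof (subst (asm) finite_density_unique)
    show "(\<integral>\<^sup>+ x. ennreal (f x) \<partial>lborel) \<noteq> \<infinity>"
      using em[OF _ f, of UNIV] by (simp add: M_def emeasure_density)
  qed auto
  then show ?thesis
  proof eventually_elim
    case (elim x)
    then show ?case by (cases "f x \<ge> 0") (auto simp: ennreal_neg ennreal_eq_0_iff not_le)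
  qed
qed

lemma AE_zero_of_interval_integrals:
  fixes f :: "real \<Rightarrow> 'a::euclidean_space"
  assumes f: "\<And>a b. integrable lborel (\<lambda>x. indicator {a..b} x *\<^sub>R f x)"
    and zero: "\<And>a b. a < b \<Longrightarrow> (LINT x|lborel. indicator {a..b} x *\<^sub>R f x) = 0"
  shows "AE x in lborel. f x = 0"
proof -
  have "AE x in lborel. indicator {- real n..real n} x * (f x \<bullet> i) = 0" if "i \<in> Basis" for n i
  proof (rule AE_zero_of_half_line_integrals)
    have "integrable lborel (\<lambda>x. (indicator {- real n..real n} x *\<^sub>R f x) \<bullet> i)"
      by (intro integrable_inner_left f)
    then show "integrable lborel (\<lambda>x. indicator {- real n..real n} x * (f x \<bullet> i))" by simp
    fix a
    define c where "c = min a (real n)"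
    have "(LINT x|lborel. indicator {..a} x *\<^sub>R (indicator {- real n..real n} x * (f x \<bullet> i)))
        = (LINT x|lborel. (indicator {- real n..c} x *\<^sub>R f x) \<bullet> i)"
      by (rule Bochner_Integration.integral_cong) (auto simp: indicator_def c_def)
    also have "\<dots> = (LINT x|lborel. indicator {- real n..c} x *\<^sub>R f x) \<bullet> i"
      by (rule integral_inner_left) (use f in auto)
    also have "(LINT x|lborel. indicator {- real n..c} x *\<^sub>R f x) = 0"
    proof (cases "- real n < c")
      case True then show ?thesis by (rule zero)
    next
      case False
      have "(LINT x|lborel. indicator {- real n..c} x *\<^sub>R f x) = (LINT x|(lborel::real measure). 0)"
      proof (rule integral_cong_AE)
        show "AE x in lborel. indicator {- real n..c} x *\<^sub>R f x = 0"
          using AE_lborel_singleton[of c] by eventually_elim (use False in \<open>auto simp: indicator_def\<close>)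
      qed (use f in auto)
      then show ?thesis by simp
    qed
    finally show "(LINT x|lborel. indicator {..a} x *\<^sub>R (indicator {- real n..real n} x * (f x \<bullet> i))) = 0" by simp
  qed
  then have "AE x in lborel. \<forall>n. \<forall>i\<in>Basis. indicator {- real n..real n} x * (f x \<bullet> i) = 0"
    unfolding AE_all_countable by (intro allI AE_finite_allI) auto
  then show ?thesis
  proof eventually_elim
    case (elim x)
    obtain N :: nat where N: "\<bar>x\<bar> \<le> N" using real_arch_simple by blast
    have "indicator {- real N..real N} x = (1::real)" using N by (auto simp: abs_le_iff)
    with elim have "\<forall>i\<in>Basis. f x \<bullet> i = 0" by (metis mult_1)
    then show ?case by (simp only: euclidean_all_zero_iff)
  qed
qed

definition step :: "real \<Rightarrow> real \<Rightarrow> 'a::euclidean_space \<Rightarrow> real \<Rightarrow> 'a" where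
  "step a b A x = indicator {a..b} x *\<^sub>R A"

lemma integrable_step: "integrable lborel (step a b A)"
  unfolding step_def[abs_def] by (intro integrable_scaleR_left integrable_real_indicator) (auto simp: emeasure_Icc_finite)

lemma square_integrable_step: "square_integrable (step a b A)"
proof -
  have "integrable lborel (\<lambda>x. indicator {a..b} x *\<^sub>R (norm A)\<^sup>2)"
    by (intro integrable_scaleR_left integrable_real_indicator) (auto simp: emeasure_Icc_finite)
  moreover have "(\<lambda>x. (norm (step a b A x))\<^sup>2) = (\<lambda>x. indicator {a..b} x *\<^sub>R (norm A)\<^sup>2)"
    by (auto simp: step_def indicator_def)
  ultimately show ?thesis
    using borel_measurable_integrable[OF integrable_step[of a b A]] by (simp add: square_integrable_def)
qed

text \<open>
  Step functions are total in \<open>L\<^sup>2\<close>; they are the test functions for Plancherel's theorem because their Gaussian means converge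
  boundedly and pointwise.
\<close>

lemma L2_eq_zero_of_step:
  assumes "\<And>a b A. a < b \<Longrightarrow> F \<bullet> abs_L2 (step a b A) = 0"
  shows "F = 0"
proof -
  have int: "integrable lborel (\<lambda>x. indicator {a..b} x *\<^sub>R rep_L2 F x)" for a b
    by (rule square_integrable_set_integrable) (auto simp: emeasure_Icc_finite)
  have "AE x in lborel. rep_L2 F x = 0"
  proof (rule AE_zero_of_interval_integrals[OF int])
    fix a b :: real assume "a < b"
    have "(LINT x|lborel. indicator {a..b} x *\<^sub>R rep_L2 F x) \<bullet> A = F \<bullet> abs_L2 (step a b A)" for A
    proof -
      have "(LINT x|lborel. indicator {a..b} x *\<^sub>R rep_L2 F x) \<bullet> A
          = (LINT x|lborel. (indicator {a..b} x *\<^sub>R rep_L2 F x) \<bullet> A)"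
        by (rule integral_inner_left[symmetric]) (use int in auto)
      also have "\<dots> = F \<bullet> abs_L2 (step a b A)"
        using inner_abs_L2[of "rep_L2 F" "step a b A"] by (simp add: square_integrable_step) (simp add: step_def)
      finally show ?thesis .
    qed
    with assms[OF \<open>a < b\<close>] show "(LINT x|lborel. indicator {a..b} x *\<^sub>R rep_L2 F x) = 0"
      by (metis inner_eq_zero_iff)
  qed
  then have "AE x in lborel. rep_L2 F x = rep_L2 0 x" using rep_L2_zero by eventually_elim simp
  then show ?thesis by (rule L2_eqI)
qed

section \<open>The Fourier transform of integrable functions\<close>

lemma measurable_cis [measurable]: "f \<in> borel_measurable M \<Longrightarrow> (\<lambda>x. cis (f x)) \<in> borel_measurable M"
  by (rule measurable_compose[of _ _ borel]) (auto intro!: borel_measurable_continuous_onI continuous_intros)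

lemma tendsto_cis [tendsto_intros]: "(f \<longlongrightarrow> a) F \<Longrightarrow> ((\<lambda>x. cis (f x)) \<longlongrightarrow> cis a) F"
  unfolding cis_conv_exp by (intro tendsto_intros)

lemma fourier_L1_cis: "fourier_L1 f \<xi> = (LINT x|lborel. cis (- (x * \<xi>)) *\<^sub>M f x)"
  by (simp add: fourier_L1_def cis_conv_exp)

lemma integrable_cis_mscale:
  fixes f :: "real \<Rightarrow> complex^'n^'m"
  assumes f: "integrable lborel f" and [measurable]: "\<phi> \<in> borel_measurable borel"
  shows "integrable lborel (\<lambda>x. cis (\<phi> x) *\<^sub>M f x)"
proof (rule Bochner_Integration.integrable_bound[OF f])
  show "(\<lambda>x. cis (\<phi> x) *\<^sub>M f x) \<in> borel_measurable lborel"
    using borel_measurable_integrable[OF f] by measurable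
qed (simp add: norm_mscale)

lemma norm_fourier_L1_le: "norm (fourier_L1 f \<xi>) \<le> (LINT x|lborel. norm (f x))"
  unfolding fourier_L1_cis
  by (rule order_trans[OF integral_norm_bound]) (simp add: norm_mscale)

lemma continuous_fourier_L1:
  fixes f :: "real \<Rightarrow> complex^'n^'m"
  assumes f: "integrable lborel f"
  shows "continuous_on UNIV (fourier_L1 f)"
proof (intro continuous_at_imp_continuous_on ballI continuous_at_sequentiallyI)
  fix a and u :: "nat \<Rightarrow> real" assume u: "u \<longlonglongrightarrow> a"
  note [measurable] = borel_measurable_integrable[OF f]
  show "(\<lambda>n. fourier_L1 f (u n)) \<longlonglongrightarrow> fourier_L1 f a"
    unfolding fourier_L1_cis
  proof (rule integral_dominated_convergence[where w = "\<lambda>x. norm (f x)"])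
    have "(\<lambda>n. cis (- (x * u n)) *\<^sub>M f x) \<longlonglongrightarrow> cis (- (x * a)) *\<^sub>M f x" for x
      by (intro bounded_bilinear.tendsto[OF bounded_bilinear_mscale] tendsto_const
          tendsto_cis tendsto_minus tendsto_mult u)
    then show "AE x in lborel. (\<lambda>n. cis (- (x * u n)) *\<^sub>M f x) \<longlonglongrightarrow> cis (- (x * a)) *\<^sub>M f x" by simp
  qed (use f in \<open>auto simp: norm_mscale\<close>)
qed

lemma measurable_fourier_L1:
  "integrable lborel f \<Longrightarrow> fourier_L1 f \<in> borel_measurable borel"
  by (rule borel_measurable_continuous_onI[OF continuous_fourier_L1])

lemma fourier_L1_add:
  "integrable lborel f \<Longrightarrow> integrable lborel g \<Longrightarrow> fourier_L1 (\<lambda>x. f x + g x) \<xi> = fourier_L1 f \<xi> + fourier_L1 g \<xi>"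
  by (simp add: fourier_L1_cis mscale_add_right integrable_cis_mscale)

lemma fourier_L1_diff:
  "integrable lborel f \<Longrightarrow> integrable lborel g \<Longrightarrow> fourier_L1 (\<lambda>x. f x - g x) \<xi> = fourier_L1 f \<xi> - fourier_L1 g \<xi>"
  by (simp add: fourier_L1_cis mscale_diff_right integrable_cis_mscale)

lemma fourier_L1_scaleR: "fourier_L1 (\<lambda>x. r *\<^sub>R f x) \<xi> = r *\<^sub>R fourier_L1 f \<xi>"
  by (simp add: fourier_L1_cis mscale_scaleR_right)

lemma fourier_L1_cong_AE:
  assumes "f \<in> borel_measurable borel" "g \<in> borel_measurable borel" "AE x in lborel. f x = g x"
  shows "fourier_L1 f = fourier_L1 g"
proof
  fix \<xi>
  note [measurable] = assms(1,2)
  show "fourier_L1 f \<xi> = fourier_L1 g \<xi>"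
    unfolding fourier_L1_cis by (rule integral_cong_AE) (use assms(3) in auto)
qed

lemma fourier_L1_linear_map:
  fixes l :: "complex^'n^'m \<Rightarrow> complex^'q^'p"
  assumes l: "bounded_linear l" and c: "\<And>c A. l (c *\<^sub>M A) = c *\<^sub>M l A" and f: "integrable lborel f"
  shows "fourier_L1 (\<lambda>x. l (f x)) \<xi> = l (fourier_L1 f \<xi>)"
  by (simp add: fourier_L1_cis c[symmetric] integral_bounded_linear[OF l integrable_cis_mscale[OF f]])

lemma integrable_pair_bound:
  fixes h :: "real \<times> real \<Rightarrow> 'a::{banach,second_countable_topology}"
  assumes f: "integrable lborel f" and g: "integrable lborel g"
    and h: "h \<in> borel_measurable (lborel \<Otimes>\<^sub>M lborel)"
    and le: "\<And>x y. norm (h (x, y)) \<le> norm (f x :: 'b::{banach,second_countable_topology})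
       * norm (g y :: 'c::{banach,second_countable_topology})"
  shows "integrable (lborel \<Otimes>\<^sub>M lborel) h"
proof (rule Bochner_Integration.integrable_bound[OF _ h])
  note [measurable] = borel_measurable_integrable[OF f] borel_measurable_integrable[OF g]
  show "integrable (lborel \<Otimes>\<^sub>M lborel) (\<lambda>(x, y). norm (f x) * norm (g y))"
  proof (rule lborel_pair.Fubini_integrable)
    show "integrable lborel (\<lambda>x. LINT y|lborel. norm (case (x, y) of (x, y) \<Rightarrow> norm (f x) * norm (g y)))"
      using f by simp
  qed (use g in auto)
qed (use le in auto)

text \<open>
  Fubini. The reflection comes from the real inner product, which conjugates the exponential.
\<close>

lemma fourier_L1_adjoint:
  fixes f g :: "real \<Rightarrow> complex^'n^'m"
  assumes f: "integrable lborel f" and g: "integrable lborel g"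
  shows "(LINT \<xi>|lborel. fourier_L1 f \<xi> \<bullet> g \<xi>) = (LINT x|lborel. f x \<bullet> fourier_L1 g (- x))"
proof -
  note [measurable] = borel_measurable_integrable[OF f] borel_measurable_integrable[OF g]
  have "(LINT \<xi>|lborel. fourier_L1 f \<xi> \<bullet> g \<xi>) = (LINT \<xi>|lborel. LINT x|lborel. (cis (- (x * \<xi>)) *\<^sub>M f x) \<bullet> g \<xi>)"
    unfolding fourier_L1_cis
    by (intro Bochner_Integration.integral_cong refl integral_inner_left[symmetric]) (intro integrable_cis_mscale f, measurable)
  also have "\<dots> = (LINT x|lborel. LINT \<xi>|lborel. (cis (- (x * \<xi>)) *\<^sub>M f x) \<bullet> g \<xi>)"
  proof (rule lborel_pair.Fubini_integral, rule integrable_pair_bound[OF f g])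
    show "norm (case (x, \<xi>) of (x, \<xi>) \<Rightarrow> (cis (- (x * \<xi>)) *\<^sub>M f x) \<bullet> g \<xi>) \<le> norm (f x) * norm (g \<xi>)" for x \<xi>
      using Cauchy_Schwarz_ineq2[of "cis (- (x * \<xi>)) *\<^sub>M f x" "g \<xi>"] by (simp add: norm_mscale)
  qed measurable
  also have "\<dots> = (LINT x|lborel. LINT \<xi>|lborel. f x \<bullet> (cis (- (\<xi> * - x)) *\<^sub>M g \<xi>))"
    by (simp add: inner_mscale_left cis_cnj mult.commute)
  also have "\<dots> = (LINT x|lborel. f x \<bullet> fourier_L1 g (- x))"
    unfolding fourier_L1_cis
    by (intro Bochner_Integration.integral_cong refl integral_inner_right) (intro integrable_cis_mscale g, measurable)
  finally show ?thesis .
qed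

section \<open>Gaussian summation\<close>

text \<open>
  The weight tends to 1 as \<open>c\<close> grows; its Fourier transform \<open>gauss_kernel c\<close> concentrates at 0 with total mass \<open>2 \<pi>\<close>.
\<close>

definition gauss_weight :: "real \<Rightarrow> real \<Rightarrow> real" where
  "gauss_weight c \<xi> = exp (- (\<xi> / c)\<^sup>2 / 2)"

definition gauss_kernel :: "real \<Rightarrow> real \<Rightarrow> real" where
  "gauss_kernel c u = 2 * pi * c * std_normal_density (c * u)"

lemma gauss_weight_eq: "gauss_weight c \<xi> = sqrt (2 * pi) * std_normal_density (\<xi> / c)"
  by (simp add: gauss_weight_def std_normal_density_def)

lemma gauss_weight_bounds: "0 < gauss_weight c \<xi>" "gauss_weight c \<xi> \<le> 1"
  by (auto simp: gauss_weight_def)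

lemma gauss_weight_measurable [measurable]: "gauss_weight c \<in> borel_measurable borel"
  unfolding gauss_weight_def[abs_def] by measurable

lemma gauss_kernel_measurable [measurable]: "gauss_kernel c \<in> borel_measurable borel"
  unfolding gauss_kernel_def[abs_def] by measurable

lemma integrable_gauss_weight: "c \<noteq> 0 \<Longrightarrow> integrable lborel (gauss_weight c)"
  using lborel_integrable_real_affine[of std_normal_density "1 / c" 0]
  unfolding gauss_weight_eq[abs_def] by simp

lemma gauss_kernel_nonneg: "0 < c \<Longrightarrow> 0 \<le> gauss_kernel c u"
  by (simp add: gauss_kernel_def)

lemma gauss_kernel_even: "gauss_kernel c (- u) = gauss_kernel c u"
  by (simp add: gauss_kernel_def std_normal_density_def)

lemma integrable_gauss_kernel: "c \<noteq> 0 \<Longrightarrow> integrable lborel (\<lambda>y. gauss_kernel c (x - y))"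
  using lborel_integrable_real_affine[of std_normal_density "- c" "c * x"]
  unfolding gauss_kernel_def[abs_def] by (simp add: right_diff_distrib)

lemma integral_gauss_kernel:
  assumes "c > 0" shows "(LINT y|lborel. gauss_kernel c (x - y)) = 2 * pi"
proof -
  have "1 = \<bar>- c\<bar> *\<^sub>R (LINT y|lborel. std_normal_density (c * x + (- c) * y))"
    using assms by (subst lborel_integral_real_affine[symmetric]) auto
  then have "(LINT y|lborel. std_normal_density (c * (x - y))) = 1 / c"
    using assms by (simp add: right_diff_distrib field_simps)
  then show ?thesis using assms by (simp add: gauss_kernel_def)
qed

lemma gauss_transform:
  assumes c: "c > 0"
  shows "(LINT \<xi>|lborel. cis (u * \<xi>) * of_real (gauss_weight c \<xi>)) = of_real (gauss_kernel c u)"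
proof -
  have "char std_normal_distribution (c * u)
      = (LINT x|lborel. std_normal_density x *\<^sub>R iexp (c * u * x))"
    unfolding char_def by (rule integral_density) (auto simp: measurable_compose)
  then have *: "(LINT x|lborel. std_normal_density x *\<^sub>R iexp (c * u * x)) = of_real (exp (- (c * u)\<^sup>2 / 2))"
    by (simp add: char_std_normal_distribution)
  have "(LINT \<xi>|lborel. cis (u * \<xi>) * of_real (gauss_weight c \<xi>))
      = \<bar>c\<bar> *\<^sub>R (LINT x|lborel. cis (u * (0 + c * x)) * of_real (gauss_weight c (0 + c * x)))"
    by (rule lborel_integral_real_affine) (use c in simp)
  also have "(LINT x|lborel. cis (u * (0 + c * x)) * of_real (gauss_weight c (0 + c * x)))
      = (LINT x|lborel. of_real (sqrt (2 * pi)) * (std_normal_density x *\<^sub>R iexp (c * u * x)))"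
    using c by (intro Bochner_Integration.integral_cong refl)
      (simp add: gauss_weight_eq cis_conv_exp scaleR_conv_of_real ac_simps)
  also have "\<dots> = of_real (sqrt (2 * pi)) * of_real (exp (- (c * u)\<^sup>2 / 2))"
    by (simp only: integral_mult_right_zero *)
  also have "\<bar>c\<bar> *\<^sub>R (complex_of_real (sqrt (2 * pi)) * of_real (exp (- (c * u)\<^sup>2 / 2))) = of_real (gauss_kernel c u)"
  proof -
    have "sqrt (2 * pi) = 2 * pi * (1 / sqrt (2 * pi))"
      by (simp add: real_div_sqrt)
    moreover have "gauss_kernel c u = c * ((2 * pi * (1 / sqrt (2 * pi))) * exp (- (c * u)\<^sup>2 / 2))"
      by (simp add: gauss_kernel_def std_normal_density_def)
    ultimately have "c * (sqrt (2 * pi) * exp (- (c * u)\<^sup>2 / 2)) = gauss_kernel c u" by metis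
    moreover have "\<bar>c\<bar> *\<^sub>R (complex_of_real (sqrt (2 * pi)) * of_real (exp (- (c * u)\<^sup>2 / 2)))
        = of_real (c * (sqrt (2 * pi) * exp (- (c * u)\<^sup>2 / 2)))"
      using c by (simp only: scaleR_conv_of_real of_real_mult abs_of_pos)
    ultimately show ?thesis by simp
  qed
  finally show ?thesis .
qed

text \<open>
  Fubini after inserting a Gaussian weight, which makes the triple integral absolutely convergent.
\<close>

lemma gauss_parseval:
  fixes f g :: "real \<Rightarrow> complex^'n^'m"
  assumes f: "integrable lborel f" and g: "integrable lborel g" and c: "c > 0"
  shows "(LINT \<xi>|lborel. fourier_L1 f \<xi> \<bullet> (gauss_weight c \<xi> *\<^sub>R fourier_L1 g \<xi>))
     = (LINT x|lborel. f x \<bullet> (LINT y|lborel. gauss_kernel c (x - y) *\<^sub>R g y))"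
proof -
  note [measurable] = borel_measurable_integrable[OF f] borel_measurable_integrable[OF g]
    measurable_fourier_L1[OF g]
  have w: "integrable lborel (gauss_weight c)" using c by (intro integrable_gauss_weight) simp
  have h: "integrable lborel (\<lambda>\<xi>. gauss_weight c \<xi> *\<^sub>R fourier_L1 g \<xi>)"
  proof (rule Bochner_Integration.integrable_bound)
    show "integrable lborel (\<lambda>\<xi>. gauss_weight c \<xi> * (LINT x|lborel. norm (g x)))" using w by simp
    show "AE \<xi> in lborel. norm (gauss_weight c \<xi> *\<^sub>R fourier_L1 g \<xi>) \<le> norm (gauss_weight c \<xi> * (LINT x|lborel. norm (g x)))"
      by (auto simp: abs_mult intro!: mult_left_mono order_trans[OF norm_fourier_L1_le])
  qed measurable
  have "fourier_L1 (\<lambda>\<xi>. gauss_weight c \<xi> *\<^sub>R fourier_L1 g \<xi>) (- x) = (LINT y|lborel. gauss_kernel c (x - y) *\<^sub>R g y)" for x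
  proof -
    have "fourier_L1 (\<lambda>\<xi>. gauss_weight c \<xi> *\<^sub>R fourier_L1 g \<xi>) (- x)
        = (LINT \<xi>|lborel. LINT y|lborel. (cis ((x - y) * \<xi>) * of_real (gauss_weight c \<xi>)) *\<^sub>M g y)"
    proof -
      have "cis (- (\<xi> * - x)) *\<^sub>M (gauss_weight c \<xi> *\<^sub>R fourier_L1 g \<xi>)
          = (LINT y|lborel. (cis ((x - y) * \<xi>) * of_real (gauss_weight c \<xi>)) *\<^sub>M g y)" for \<xi>
      proof -
        have "cis (- (\<xi> * - x)) *\<^sub>M (gauss_weight c \<xi> *\<^sub>R fourier_L1 g \<xi>)
            = (cis (x * \<xi>) * of_real (gauss_weight c \<xi>)) *\<^sub>M fourier_L1 g \<xi>"
          by (simp add: mscale_of_real[symmetric] mult.commute)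
        also have "\<dots> = (LINT y|lborel. (cis (x * \<xi>) * of_real (gauss_weight c \<xi>)) *\<^sub>M (cis (- (y * \<xi>)) *\<^sub>M g y))"
          unfolding fourier_L1_cis
          by (intro integral_bounded_linear[symmetric, OF bounded_linear_mscale] integrable_cis_mscale g) measurable
        also have "\<dots> = (LINT y|lborel. (cis ((x - y) * \<xi>) * of_real (gauss_weight c \<xi>)) *\<^sub>M g y)"
        proof (intro Bochner_Integration.integral_cong refl)
          fix y
          have "cis ((x - y) * \<xi>) = cis (x * \<xi>) * cis (- (y * \<xi>))"
            by (simp add: cis_mult left_diff_distrib)
          then show "(cis (x * \<xi>) * of_real (gauss_weight c \<xi>)) *\<^sub>M (cis (- (y * \<xi>)) *\<^sub>M g y)
              = (cis ((x - y) * \<xi>) * of_real (gauss_weight c \<xi>)) *\<^sub>M g y"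
            by (simp only: mscale_simps mult.assoc mult.left_commute mult.commute)
        qed
        finally show ?thesis .
      qed
      then show ?thesis unfolding fourier_L1_cis by simp
    qed
    also have "\<dots> = (LINT y|lborel. LINT \<xi>|lborel. (cis ((x - y) * \<xi>) * of_real (gauss_weight c \<xi>)) *\<^sub>M g y)"
    proof (rule lborel_pair.Fubini_integral, rule integrable_pair_bound[OF g w])
      show "norm (case (y, \<xi>) of (y, \<xi>) \<Rightarrow> (cis ((x - y) * \<xi>) * of_real (gauss_weight c \<xi>)) *\<^sub>M g y) \<le> norm (g y) * norm (gauss_weight c \<xi>)" for y \<xi>
        by (simp add: norm_mscale norm_mult mult.commute)
    qed measurable
    also have "\<dots> = (LINT y|lborel. gauss_kernel c (x - y) *\<^sub>R g y)"
    proof (intro Bochner_Integration.integral_cong refl)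
      fix y
      have "(LINT \<xi>|lborel. (cis ((x - y) * \<xi>) * of_real (gauss_weight c \<xi>)) *\<^sub>M g y)
          = (LINT \<xi>|lborel. cis ((x - y) * \<xi>) * of_real (gauss_weight c \<xi>)) *\<^sub>M g y"
      proof (rule integral_bounded_linear[OF bounded_linear_mscale_left])
        show "integrable lborel (\<lambda>\<xi>. cis ((x - y) * \<xi>) * complex_of_real (gauss_weight c \<xi>))"
          by (rule Bochner_Integration.integrable_bound[OF w]) (auto simp: norm_mult)
      qed
      then show "(LINT \<xi>|lborel. (cis ((x - y) * \<xi>) * of_real (gauss_weight c \<xi>)) *\<^sub>M g y) = gauss_kernel c (x - y) *\<^sub>R g y"
        by (simp add: gauss_transform[OF c] mscale_of_real)
    qed
    finally show ?thesis .
  qed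
  then show ?thesis using fourier_L1_adjoint[OF f h] by simp
qed

lemma gauss_convolution:
  fixes \<phi> :: "real \<Rightarrow> real"
  assumes \<phi>: "integrable lborel \<phi>" and c: "c > 0"
  shows "integrable lborel (\<lambda>x. LINT y|lborel. gauss_kernel c (x - y) * \<phi> y)"
    and "(LINT x|lborel. LINT y|lborel. gauss_kernel c (x - y) * \<phi> y) = 2 * pi * (LINT y|lborel. \<phi> y)"
proof -
  note [measurable] = borel_measurable_integrable[OF \<phi>]
  have sym: "gauss_kernel c (x - y) = gauss_kernel c (y - x)" for x y
    using gauss_kernel_even[of c "x - y"] by simp
  have "integrable (lborel \<Otimes>\<^sub>M lborel) (\<lambda>(y, x). gauss_kernel c (x - y) * \<phi> y)"
  proof (rule lborel_pair.Fubini_integrable)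
    have "(LINT x|lborel. norm (case (y, x) of (y, x) \<Rightarrow> gauss_kernel c (x - y) * \<phi> y)) = 2 * pi * \<bar>\<phi> y\<bar>" for y
      using integral_gauss_kernel[OF c, of y] gauss_kernel_nonneg[OF c] by (simp add: abs_mult sym[of _ y])
    then show "integrable lborel (\<lambda>y. LINT x|lborel. norm (case (y, x) of (y, x) \<Rightarrow> gauss_kernel c (x - y) * \<phi> y))"
      using \<phi> by simp
    show "AE y in lborel. integrable lborel (\<lambda>x. case (y, x) of (y, x) \<Rightarrow> gauss_kernel c (x - y) * \<phi> y)"
      using integrable_gauss_kernel[of c] c by (simp add: sym)
  qed measurable
  from lborel_pair.integrable_product_swap[OF this]
  have int: "integrable (lborel \<Otimes>\<^sub>M lborel) (\<lambda>(x, y). gauss_kernel c (x - y) * \<phi> y)" by simp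
  from lborel_pair.integrable_fst'[OF int]
  show "integrable lborel (\<lambda>x. LINT y|lborel. gauss_kernel c (x - y) * \<phi> y)" by simp
  have "(LINT x|lborel. LINT y|lborel. gauss_kernel c (x - y) * \<phi> y) = (LINT y|lborel. LINT x|lborel. gauss_kernel c (x - y) * \<phi> y)"
    by (rule lborel_pair.Fubini_integral[symmetric]) (use int in simp)
  also have "\<dots> = (LINT y|lborel. 2 * pi * \<phi> y)"
    using integral_gauss_kernel[OF c] by (simp add: sym)
  finally show "(LINT x|lborel. LINT y|lborel. gauss_kernel c (x - y) * \<phi> y) = 2 * pi * (LINT y|lborel. \<phi> y)" by simp
qed

lemma gauss_kernel_bounded: "c > 0 \<Longrightarrow> gauss_kernel c u \<le> 2 * pi * c"
proof -
  assume c: "c > 0"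
  have "sqrt 1 \<le> sqrt (2 * pi)" using pi_gt3 by (intro real_sqrt_le_mono) simp
  then have "std_normal_density (c * u) \<le> 1" by (simp add: std_normal_density_def divide_simps order_trans[of _ 1])
  then show ?thesis using c unfolding gauss_kernel_def by (simp add: mult_left_le)
qed

lemma integrable_gauss_kernel_mult:
  fixes g :: "real \<Rightarrow> 'a::euclidean_space"
  assumes g: "integrable lborel g" and c: "c > 0"
  shows "integrable lborel (\<lambda>y. gauss_kernel c (x - y) *\<^sub>R g y)"
proof (rule Bochner_Integration.integrable_bound)
  note [measurable] = borel_measurable_integrable[OF g]
  show "integrable lborel (\<lambda>y. (2 * pi * c) *\<^sub>R g y)" using g by simp
  show "AE y in lborel. norm (gauss_kernel c (x - y) *\<^sub>R g y) \<le> norm ((2 * pi * c) *\<^sub>R g y)"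
    using gauss_kernel_bounded[OF c] gauss_kernel_nonneg[OF c] c by (auto intro!: mult_right_mono)
qed (use borel_measurable_integrable[OF g] in measurable)

text \<open>
  In the Parseval identity with \<open>f = g\<close>, bound the inner product by half the sum of the squares and integrate out the kernel.
\<close>

lemma gauss_weighted_energy_le:
  fixes f :: "real \<Rightarrow> complex^'n^'m"
  assumes f: "integrable lborel f" and sf: "square_integrable f" and c: "c > 0"
  shows "(LINT \<xi>|lborel. gauss_weight c \<xi> * (norm (fourier_L1 f \<xi>))\<^sup>2) \<le> 2 * pi * (LINT x|lborel. (norm (f x))\<^sup>2)"
proof -
  note sq = square_integrable_norm_sq[OF sf]
  note [measurable] = borel_measurable_integrable[OF f]
  let ?k = "gauss_kernel c"
  have "(LINT \<xi>|lborel. gauss_weight c \<xi> * (norm (fourier_L1 f \<xi>))\<^sup>2)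
     = (LINT x|lborel. f x \<bullet> (LINT y|lborel. ?k (x - y) *\<^sub>R f y))"
    using gauss_parseval[OF f f c] by (simp add: power2_norm_eq_inner)
  also have "\<dots> \<le> (LINT x|lborel. pi * (norm (f x))\<^sup>2 + (1/2) * (LINT y|lborel. ?k (x - y) * (norm (f y))\<^sup>2))"
  proof (rule integral_mono_AE')
    show "integrable lborel (\<lambda>x. pi * (norm (f x))\<^sup>2 + (1/2) * (LINT y|lborel. ?k (x - y) * (norm (f y))\<^sup>2))"
      using sq gauss_convolution(1)[OF sq c] by simp
    have iy: "integrable lborel (\<lambda>y. ?k (x - y) * (norm (f y))\<^sup>2)" for x
      using integrable_gauss_kernel_mult[OF sq c, of x] by simp
    have ik: "integrable lborel (\<lambda>y. ?k (x - y))" for x using integrable_gauss_kernel c by simp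
    show "AE x in lborel. f x \<bullet> (LINT y|lborel. ?k (x - y) *\<^sub>R f y)
        \<le> pi * (norm (f x))\<^sup>2 + (1/2) * (LINT y|lborel. ?k (x - y) * (norm (f y))\<^sup>2)"
    proof (rule AE_I2)
      fix x
      have "f x \<bullet> (LINT y|lborel. ?k (x - y) *\<^sub>R f y) = (LINT y|lborel. f x \<bullet> (?k (x - y) *\<^sub>R f y))"
        by (rule integral_inner_right[symmetric]) (use integrable_gauss_kernel_mult[OF f c] in simp)
      also have "\<dots> \<le> (LINT y|lborel. (1/2) * (norm (f x))\<^sup>2 * ?k (x - y) + (1/2) * (?k (x - y) * (norm (f y))\<^sup>2))"
      proof (rule integral_mono)
        show "integrable lborel (\<lambda>y. f x \<bullet> (?k (x - y) *\<^sub>R f y))"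
          by (intro integrable_inner_right integrable_gauss_kernel_mult[OF f c])
        show "integrable lborel (\<lambda>y. (1/2) * (norm (f x))\<^sup>2 * ?k (x - y) + (1/2) * (?k (x - y) * (norm (f y))\<^sup>2))"
          using iy ik by simp
        fix y
        have "f x \<bullet> f y \<le> norm (f x) * norm (f y)" by (rule norm_cauchy_schwarz)
        also have "\<dots> \<le> (1/2) * ((norm (f x))\<^sup>2 + (norm (f y))\<^sup>2)"
          using zero_le_power2[of "norm (f x) - norm (f y)"] by (simp add: power2_diff)
        finally have "?k (x - y) * (f x \<bullet> f y) \<le> ?k (x - y) * ((1/2) * ((norm (f x))\<^sup>2 + (norm (f y))\<^sup>2))"
          by (rule mult_left_mono) (rule gauss_kernel_nonneg[OF c])
        then show "f x \<bullet> (?k (x - y) *\<^sub>R f y) \<le> (1/2) * (norm (f x))\<^sup>2 * ?k (x - y) + (1/2) * (?k (x - y) * (norm (f y))\<^sup>2)"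
          by (simp add: algebra_simps)
      qed
      also have "\<dots> = pi * (norm (f x))\<^sup>2 + (1/2) * (LINT y|lborel. ?k (x - y) * (norm (f y))\<^sup>2)"
        using iy[of x] ik[of x] integral_gauss_kernel[OF c, of x] by simp
      finally show "f x \<bullet> (LINT y|lborel. ?k (x - y) *\<^sub>R f y)
        \<le> pi * (norm (f x))\<^sup>2 + (1/2) * (LINT y|lborel. ?k (x - y) * (norm (f y))\<^sup>2)" .
    qed
    show "AE x in lborel. 0 \<le> pi * (norm (f x))\<^sup>2 + (1/2) * (LINT y|lborel. ?k (x - y) * (norm (f y))\<^sup>2)"
      by (intro AE_I2 add_nonneg_nonneg mult_nonneg_nonneg integral_nonneg) (auto simp: gauss_kernel_nonneg[OF c])
  qed
  also have "\<dots> = 2 * pi * (LINT x|lborel. (norm (f x))\<^sup>2)"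
    using sq gauss_convolution[OF sq c] by simp
  finally show ?thesis .
qed

lemma gauss_weight_tendsto: "(\<lambda>n. gauss_weight (real (Suc n)) \<xi>) \<longlonglongrightarrow> 1"
proof -
  have "(\<lambda>n. exp (- (\<xi> / real (Suc n))\<^sup>2 / 2)) \<longlonglongrightarrow> exp (- 0\<^sup>2 / 2)"
    by (intro tendsto_intros LIMSEQ_Suc lim_const_over_n) auto
  then show ?thesis by (simp add: gauss_weight_def)
qed

text \<open>
  Fatou's lemma as the Gaussian weight tends to 1.
\<close>

lemma fourier_L1_square_integrable:
  fixes f :: "real \<Rightarrow> complex^'n^'m"
  assumes f: "integrable lborel f" and sf: "square_integrable f"
  shows "square_integrable (fourier_L1 f)"
    and "(LINT \<xi>|lborel. (norm (fourier_L1 f \<xi>))\<^sup>2) \<le> 2 * pi * (LINT x|lborel. (norm (f x))\<^sup>2)"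
proof -
  note [measurable] = measurable_fourier_L1[OF f]
  let ?C = "2 * pi * (LINT x|lborel. (norm (f x))\<^sup>2)"
  have "(\<integral>\<^sup>+\<xi>. ennreal ((norm (fourier_L1 f \<xi>))\<^sup>2) \<partial>lborel)
     = (\<integral>\<^sup>+\<xi>. liminf (\<lambda>n. ennreal (gauss_weight (real (Suc n)) \<xi> * (norm (fourier_L1 f \<xi>))\<^sup>2)) \<partial>lborel)"
  proof (rule nn_integral_cong)
    fix \<xi>
    have "(\<lambda>n. gauss_weight (real (Suc n)) \<xi> * (norm (fourier_L1 f \<xi>))\<^sup>2) \<longlonglongrightarrow> 1 * (norm (fourier_L1 f \<xi>))\<^sup>2"
      by (intro tendsto_mult tendsto_const gauss_weight_tendsto)
    then have "(\<lambda>n. ennreal (gauss_weight (real (Suc n)) \<xi> * (norm (fourier_L1 f \<xi>))\<^sup>2)) \<longlonglongrightarrow> ennreal ((norm (fourier_L1 f \<xi>))\<^sup>2)"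
      by (intro tendsto_ennrealI) simp
    from lim_imp_Liminf[OF _ this]
    show "ennreal ((norm (fourier_L1 f \<xi>))\<^sup>2) = liminf (\<lambda>n. ennreal (gauss_weight (real (Suc n)) \<xi> * (norm (fourier_L1 f \<xi>))\<^sup>2))"
      by simp
  qed
  also have "\<dots> \<le> liminf (\<lambda>n. \<integral>\<^sup>+\<xi>. ennreal (gauss_weight (real (Suc n)) \<xi> * (norm (fourier_L1 f \<xi>))\<^sup>2) \<partial>lborel)"
    by (rule nn_integral_liminf) measurable
  also have "\<dots> \<le> ennreal ?C"
  proof (rule Liminf_le)
    have "(\<integral>\<^sup>+\<xi>. ennreal (gauss_weight (real (Suc n)) \<xi> * (norm (fourier_L1 f \<xi>))\<^sup>2) \<partial>lborel) \<le> ennreal ?C" for n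
    proof -
      let ?B = "LINT x|lborel. norm (f x)"
      have "integrable lborel (\<lambda>\<xi>. gauss_weight (real (Suc n)) \<xi> * (norm (fourier_L1 f \<xi>))\<^sup>2)"
      proof (rule Bochner_Integration.integrable_bound)
        show "integrable lborel (\<lambda>\<xi>. gauss_weight (real (Suc n)) \<xi> * ?B\<^sup>2)"
          by (intro integrable_mult_left integrable_gauss_weight) simp
        have "(norm (fourier_L1 f \<xi>))\<^sup>2 \<le> ?B\<^sup>2" for \<xi>
          by (intro power_mono norm_fourier_L1_le) simp
        then show "AE \<xi> in lborel. norm (gauss_weight (real (Suc n)) \<xi> * (norm (fourier_L1 f \<xi>))\<^sup>2) \<le> norm (gauss_weight (real (Suc n)) \<xi> * ?B\<^sup>2)"
          by (auto simp: abs_mult intro!: mult_left_mono)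
      qed measurable
      then have "(\<integral>\<^sup>+\<xi>. ennreal (gauss_weight (real (Suc n)) \<xi> * (norm (fourier_L1 f \<xi>))\<^sup>2) \<partial>lborel)
          = ennreal (LINT \<xi>|lborel. gauss_weight (real (Suc n)) \<xi> * (norm (fourier_L1 f \<xi>))\<^sup>2)"
        by (rule nn_integral_eq_integral) (auto intro!: AE_I2 mult_nonneg_nonneg less_imp_le[OF gauss_weight_bounds(1)])
      also have "\<dots> \<le> ennreal ?C" by (intro ennreal_leI gauss_weighted_energy_le f sf) simp
      finally show ?thesis .
    qed
    then show "\<forall>\<^sub>F n in sequentially. (\<integral>\<^sup>+\<xi>. ennreal (gauss_weight (real (Suc n)) \<xi> * (norm (fourier_L1 f \<xi>))\<^sup>2) \<partial>lborel) \<le> ennreal ?C"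
      by simp
  qed simp
  finally have fin: "(\<integral>\<^sup>+\<xi>. ennreal ((norm (fourier_L1 f \<xi>))\<^sup>2) \<partial>lborel) \<le> ennreal ?C" .
  have int: "integrable lborel (\<lambda>\<xi>. (norm (fourier_L1 f \<xi>))\<^sup>2)"
  proof (rule integrableI_bounded)
    show "(\<integral>\<^sup>+ x. ennreal (norm ((norm (fourier_L1 f x))\<^sup>2)) \<partial>lborel) < \<infinity>"
      using order_le_less_trans[OF fin ennreal_less_top] by simp
  qed measurable
  then show "square_integrable (fourier_L1 f)" by (simp add: square_integrable_def)
  have "ennreal (LINT \<xi>|lborel. (norm (fourier_L1 f \<xi>))\<^sup>2) \<le> ennreal ?C"
    using fin by (simp add: nn_integral_eq_integral[OF int])
  then show "(LINT \<xi>|lborel. (norm (fourier_L1 f \<xi>))\<^sup>2) \<le> ?C"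
    by (subst (asm) ennreal_le_iff) (auto intro!: mult_nonneg_nonneg integral_nonneg)
qed

lemma gauss_kernel_interval_tendsto:
  assumes x: "x \<noteq> a" "x \<noteq> b"
  shows "(\<lambda>n. LINT y|lborel. gauss_kernel (real (Suc n)) (x - y) * indicator {a..b} y) \<longlonglongrightarrow> 2 * pi * indicator {a..b} x"
proof -
  have eq: "(LINT y|lborel. gauss_kernel (real (Suc n)) (x - y) * indicator {a..b} y)
      = (LINT v|lborel. 2 * pi * std_normal_density v * indicator {a..b} (x - v / real (Suc n)))" for n
  proof -
    let ?c = "real (Suc n)"
    have "(LINT y|lborel. gauss_kernel ?c (x - y) * indicator {a..b} y)
       = \<bar>- 1 / ?c\<bar> *\<^sub>R (LINT v|lborel. gauss_kernel ?c (x - (x + (- 1 / ?c) * v)) * indicator {a..b} (x + (- 1 / ?c) * v))"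
      by (rule lborel_integral_real_affine) simp
    also have "\<dots> = (LINT v|lborel. \<bar>- 1 / ?c\<bar> * (gauss_kernel ?c (x - (x + (- 1 / ?c) * v)) * indicator {a..b} (x + (- 1 / ?c) * v)))"
      by simp
    also have "\<dots> = (LINT v|lborel. 2 * pi * std_normal_density v * indicator {a..b} (x - v / ?c))"
    proof (intro Bochner_Integration.integral_cong refl)
      fix v
      define c where "c = ?c"
      have c: "c > 0" by (simp add: c_def)
      have "gauss_kernel c (x - (x + (- 1 / c) * v)) = 2 * pi * c * std_normal_density v"
        using c by (simp add: gauss_kernel_def)
      moreover have "x + (- 1 / c) * v = x - v / c" by simp
      ultimately have "\<bar>- 1 / c\<bar> * (gauss_kernel c (x - (x + (- 1 / c) * v)) * indicator {a..b} (x + (- 1 / c) * v))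
          = 2 * pi * std_normal_density v * indicator {a..b} (x - v / c)"
        using c by simp
      then show "\<bar>- 1 / ?c\<bar> * (gauss_kernel ?c (x - (x + (- 1 / ?c) * v)) * indicator {a..b} (x + (- 1 / ?c) * v))
          = 2 * pi * std_normal_density v * indicator {a..b} (x - v / ?c)"
        unfolding c_def .
    qed
    finally show ?thesis .
  qed
  have "(\<lambda>n. LINT v|lborel. 2 * pi * std_normal_density v * indicator {a..b} (x - v / real (Suc n)))
     \<longlonglongrightarrow> (LINT v|lborel. 2 * pi * std_normal_density v * indicator {a..b} x)"
  proof (rule integral_dominated_convergence[where w = "\<lambda>v. 2 * pi * std_normal_density v"])
    show "AE v in lborel. (\<lambda>n. 2 * pi * std_normal_density v * indicator {a..b} (x - v / real (Suc n)))
        \<longlonglongrightarrow> 2 * pi * std_normal_density v * indicator {a..b} x"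
    proof (intro AE_I2 tendsto_mult tendsto_const)
      fix v
      have "(\<lambda>n. x - v / real (Suc n)) \<longlonglongrightarrow> x - 0"
        by (intro tendsto_intros LIMSEQ_Suc lim_const_over_n)
      then have l: "(\<lambda>n. x - v / real (Suc n)) \<longlonglongrightarrow> x" by simp
      have "isCont (indicator {a..b} :: real \<Rightarrow> real) x"
        using x by (intro isCont_indicator[THEN iffD2]) (auto simp: frontier_def closure_closed interior_atLeastAtMost_real)
      from isCont_tendsto_compose[OF this l]
      show "(\<lambda>n. indicator {a..b} (x - v / real (Suc n))) \<longlonglongrightarrow> (indicator {a..b} x :: real)" .
    qed
    show "AE v in lborel. norm (2 * pi * std_normal_density v * indicator {a..b} (x - v / real (Suc n))) \<le> 2 * pi * std_normal_density v" for n
      by (auto simp: indicator_def abs_mult)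
  qed auto
  then show ?thesis unfolding eq by simp
qed

text \<open>
  The exact Parseval identity, first against step functions: on one side the weight disappears by dominated convergence, on the
  other the Gaussian means of the step converge.
\<close>

lemma fourier_L1_inner_step:
  fixes f :: "real \<Rightarrow> complex^'n^'m"
  assumes f: "integrable lborel f" and sf: "square_integrable f"
  shows "(LINT \<xi>|lborel. fourier_L1 f \<xi> \<bullet> fourier_L1 (step a b A) \<xi>) = 2 * pi * (LINT x|lborel. f x \<bullet> step a b A x)"
proof (rule LIMSEQ_unique)
  let ?g = "step a b A" and ?c = "\<lambda>n. real (Suc n)"
  note g = integrable_step[of a b A] and sg = square_integrable_step[of a b A]
  note [measurable] = measurable_fourier_L1[OF f] measurable_fourier_L1[OF g] borel_measurable_integrable[OF f]
  have fg: "integrable lborel (\<lambda>\<xi>. norm (fourier_L1 f \<xi>) * norm (fourier_L1 ?g \<xi>))"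
    by (intro integrable_norm_mult fourier_L1_square_integrable f sf g sg)
  show "(\<lambda>n. LINT \<xi>|lborel. fourier_L1 f \<xi> \<bullet> (gauss_weight (?c n) \<xi> *\<^sub>R fourier_L1 ?g \<xi>))
      \<longlonglongrightarrow> (LINT \<xi>|lborel. fourier_L1 f \<xi> \<bullet> fourier_L1 ?g \<xi>)"
  proof (rule integral_dominated_convergence[OF _ _ fg])
    have "(\<lambda>n. fourier_L1 f \<xi> \<bullet> (gauss_weight (?c n) \<xi> *\<^sub>R fourier_L1 ?g \<xi>)) \<longlonglongrightarrow> fourier_L1 f \<xi> \<bullet> (1 *\<^sub>R fourier_L1 ?g \<xi>)" for \<xi>
      by (intro tendsto_inner tendsto_scaleR tendsto_const gauss_weight_tendsto)
    then show "AE \<xi> in lborel. (\<lambda>n. fourier_L1 f \<xi> \<bullet> (gauss_weight (?c n) \<xi> *\<^sub>R fourier_L1 ?g \<xi>)) \<longlonglongrightarrow> fourier_L1 f \<xi> \<bullet> fourier_L1 ?g \<xi>"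
      by simp
    show "AE \<xi> in lborel. norm (fourier_L1 f \<xi> \<bullet> (gauss_weight (?c n) \<xi> *\<^sub>R fourier_L1 ?g \<xi>)) \<le> norm (fourier_L1 f \<xi>) * norm (fourier_L1 ?g \<xi>)" for n
    proof (rule AE_I2)
      fix \<xi>
      have "\<bar>gauss_weight (?c n) \<xi> * (fourier_L1 f \<xi> \<bullet> fourier_L1 ?g \<xi>)\<bar> \<le> 1 * (norm (fourier_L1 f \<xi>) * norm (fourier_L1 ?g \<xi>))"
        unfolding abs_mult
        by (intro mult_mono Cauchy_Schwarz_ineq2) (use gauss_weight_bounds[of "?c n" \<xi>] in auto)
      then show "norm (fourier_L1 f \<xi> \<bullet> (gauss_weight (?c n) \<xi> *\<^sub>R fourier_L1 ?g \<xi>)) \<le> norm (fourier_L1 f \<xi>) * norm (fourier_L1 ?g \<xi>)" by simp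
    qed
  qed measurable
  have conv: "(LINT y|lborel. gauss_kernel (?c n) (x - y) *\<^sub>R ?g y)
      = (LINT y|lborel. gauss_kernel (?c n) (x - y) * indicator {a..b} y) *\<^sub>R A" for n x
  proof -
    have "integrable lborel (\<lambda>y. gauss_kernel (?c n) (x - y) *\<^sub>R (indicator {a..b} y :: real))"
      by (intro integrable_gauss_kernel_mult integrable_real_indicator) (auto simp: emeasure_Icc_finite)
    then have "(LINT y|lborel. (gauss_kernel (?c n) (x - y) * indicator {a..b} y) *\<^sub>R A)
       = (LINT y|lborel. gauss_kernel (?c n) (x - y) * indicator {a..b} y) *\<^sub>R A"
      by (intro integral_scaleR_left) auto
    then show ?thesis by (simp add: step_def)
  qed
  have "(\<lambda>n. LINT x|lborel. f x \<bullet> ((LINT y|lborel. gauss_kernel (?c n) (x - y) * indicator {a..b} y) *\<^sub>R A))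
      \<longlonglongrightarrow> (LINT x|lborel. f x \<bullet> ((2 * pi * indicator {a..b} x) *\<^sub>R A))"
  proof (rule integral_dominated_convergence[where w = "\<lambda>x. 2 * pi * norm (f x) * norm A"])
    show "integrable lborel (\<lambda>x. 2 * pi * norm (f x) * norm A)" using f by simp
    show "AE x in lborel. (\<lambda>n. f x \<bullet> ((LINT y|lborel. gauss_kernel (?c n) (x - y) * indicator {a..b} y) *\<^sub>R A))
        \<longlonglongrightarrow> f x \<bullet> ((2 * pi * indicator {a..b} x) *\<^sub>R A)"
      using AE_lborel_singleton[of a] AE_lborel_singleton[of b]
    proof eventually_elim
      case (elim x)
      then show ?case by (intro tendsto_inner tendsto_scaleR tendsto_const gauss_kernel_interval_tendsto)
    qed
    show "AE x in lborel. norm (f x \<bullet> ((LINT y|lborel. gauss_kernel (?c n) (x - y) * indicator {a..b} y) *\<^sub>R A)) \<le> 2 * pi * norm (f x) * norm A" for n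
    proof (rule AE_I2)
      fix x
      let ?k = "LINT y|lborel. gauss_kernel (?c n) (x - y) * indicator {a..b} y"
      have k0: "0 \<le> ?k" by (intro Bochner_Integration.integral_nonneg) (auto simp: gauss_kernel_nonneg)
      have "?k \<le> (LINT y|lborel. gauss_kernel (?c n) (x - y))"
        by (rule integral_mono_AE') (auto simp: gauss_kernel_nonneg indicator_def integrable_gauss_kernel)
      then have k1: "?k \<le> 2 * pi" using integral_gauss_kernel[of "?c n" x] by simp
      have "\<bar>?k * (f x \<bullet> A)\<bar> \<le> 2 * pi * (norm (f x) * norm A)"
        unfolding abs_mult by (intro mult_mono Cauchy_Schwarz_ineq2) (use k0 k1 in auto)
      then show "norm (f x \<bullet> (?k *\<^sub>R A)) \<le> 2 * pi * norm (f x) * norm A" by (simp add: mult.assoc)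
    qed
  qed measurable
  moreover have "(LINT x|lborel. f x \<bullet> ((2 * pi * indicator {a..b} x) *\<^sub>R A)) = 2 * pi * (LINT x|lborel. f x \<bullet> ?g x)"
    by (simp add: step_def mult.assoc)
  moreover have "(LINT \<xi>|lborel. fourier_L1 f \<xi> \<bullet> (gauss_weight (?c n) \<xi> *\<^sub>R fourier_L1 ?g \<xi>))
      = (LINT x|lborel. f x \<bullet> ((LINT y|lborel. gauss_kernel (?c n) (x - y) * indicator {a..b} y) *\<^sub>R A))" for n
    unfolding conv[symmetric] by (rule gauss_parseval[OF f g]) simp
  ultimately show "(\<lambda>n. LINT \<xi>|lborel. fourier_L1 f \<xi> \<bullet> (gauss_weight (?c n) \<xi> *\<^sub>R fourier_L1 ?g \<xi>))
      \<longlonglongrightarrow> 2 * pi * (LINT x|lborel. f x \<bullet> ?g x)"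
    by (simp only:)
qed

section \<open>Plancherel's theorem\<close>

lemma norm_abs_fourier_L1_le:
  assumes f: "integrable lborel f" and sf: "square_integrable f"
  shows "norm (abs_L2 (fourier_L1 f)) \<le> sqrt (2 * pi) * norm (abs_L2 f)"
proof (rule power2_le_imp_le)
  show "(norm (abs_L2 (fourier_L1 f)))\<^sup>2 \<le> (sqrt (2 * pi) * norm (abs_L2 f))\<^sup>2"
    using fourier_L1_square_integrable[OF f sf] by (simp add: norm_abs_L2 sf power_mult_distrib)
qed simp

lemma abs_fourier_L1_diff:
  assumes "integrable lborel f" "square_integrable f" "integrable lborel g" "square_integrable g"
  shows "abs_L2 (fourier_L1 f) - abs_L2 (fourier_L1 g) = abs_L2 (fourier_L1 (\<lambda>x. f x - g x))"
proof -
  have "fourier_L1 (\<lambda>x. f x - g x) = (\<lambda>\<xi>. fourier_L1 f \<xi> - fourier_L1 g \<xi>)"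
    using assms by (auto simp: fourier_L1_diff)
  then show ?thesis using assms by (simp add: abs_L2_diff fourier_L1_square_integrable)
qed

lemma norm_abs_fourier_L1_diff_le:
  assumes "integrable lborel f" "square_integrable f" "integrable lborel g" "square_integrable g"
  shows "norm (abs_L2 (fourier_L1 f) - abs_L2 (fourier_L1 g)) \<le> sqrt (2 * pi) * norm (abs_L2 f - abs_L2 g)"
  using norm_abs_fourier_L1_le[of "\<lambda>x. f x - g x"] assms
  by (simp add: abs_fourier_L1_diff abs_L2_diff square_integrable_diff)

definition fourier_trunc :: "nat \<Rightarrow> (complex^'n^'m) L2 \<Rightarrow> (complex^'n^'m) L2" where
  "fourier_trunc n F = abs_L2 (fourier_L1 (trunc n (rep_L2 F)))"

text \<open>
  The energy inequality makes the transforms of the truncations a Cauchy sequence.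
\<close>

lemma fourier_trunc_tendsto: "(\<lambda>n. fourier_trunc n F) \<longlonglongrightarrow> fourier_L2 F"
proof -
  let ?t = "\<lambda>n. trunc n (rep_L2 F)"
  have t: "integrable lborel (?t n)" "square_integrable (?t n)" for n
    by (simp_all add: integrable_trunc square_integrable_trunc)
  have C: "Cauchy (\<lambda>n. abs_L2 (?t n))"
    by (rule LIMSEQ_imp_Cauchy[OF abs_trunc_tendsto]) simp
  have "Cauchy (\<lambda>n. fourier_trunc n F)"
  proof (rule CauchyI)
    fix e :: real assume e: "e > 0"
    have p: "sqrt (2 * pi) > 0" by simp
    then obtain M where M: "\<forall>m\<ge>M. \<forall>n\<ge>M. norm (abs_L2 (?t m) - abs_L2 (?t n)) < e / sqrt (2 * pi)"
      using CauchyD[OF C, of "e / sqrt (2 * pi)"] e by auto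
    have "norm (fourier_trunc m F - fourier_trunc n F) < e" if "m \<ge> M" "n \<ge> M" for m n
    proof -
      have "norm (fourier_trunc m F - fourier_trunc n F) \<le> sqrt (2 * pi) * norm (abs_L2 (?t m) - abs_L2 (?t n))"
        unfolding fourier_trunc_def by (rule norm_abs_fourier_L1_diff_le) (rule t)+
      also have "\<dots> < sqrt (2 * pi) * (e / sqrt (2 * pi))"
        using M that p by (intro mult_strict_left_mono) auto
      finally show ?thesis by simp
    qed
    then show "\<exists>M. \<forall>m\<ge>M. \<forall>n\<ge>M. norm (fourier_trunc m F - fourier_trunc n F) < e" by blast
  qed
  then have "convergent (\<lambda>n. fourier_trunc n F)" by (rule Cauchy_convergent)
  moreover have "fourier_L2 F = lim (\<lambda>n. fourier_trunc n F)"
    by (simp add: fourier_L2_def fourier_trunc_def trunc_def[abs_def])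
  ultimately show ?thesis by (simp add: convergent_LIMSEQ_iff)
qed

text \<open>
  Truncations converge in \<open>L\<^sup>2\<close>, and by the energy inequality so do their transforms; hence the limit in mean is the integral.
\<close>

lemma fourier_L2_abs:
  assumes f: "integrable lborel f" and sf: "square_integrable f"
  shows "fourier_L2 (abs_L2 f) = abs_L2 (fourier_L1 f)"
proof (rule LIMSEQ_unique[OF fourier_trunc_tendsto])
  let ?t = "\<lambda>n. trunc n (rep_L2 (abs_L2 f))"
  have t: "integrable lborel (?t n)" "square_integrable (?t n)" for n
    by (simp_all add: integrable_trunc square_integrable_trunc)
  have "(\<lambda>n. sqrt (2 * pi) * norm (abs_L2 (?t n) - abs_L2 f)) \<longlonglongrightarrow> sqrt (2 * pi) * 0"
    using abs_trunc_tendsto[of "rep_L2 (abs_L2 f)"]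
    by (intro tendsto_mult tendsto_const tendsto_norm_zero LIM_zero) simp
  then have *: "(\<lambda>n. sqrt (2 * pi) * norm (abs_L2 (?t n) - abs_L2 f)) \<longlonglongrightarrow> 0" by simp
  have "(\<lambda>n. fourier_trunc n (abs_L2 f) - abs_L2 (fourier_L1 f)) \<longlonglongrightarrow> 0"
  proof (rule Lim_null_comparison[OF _ *])
    show "\<forall>\<^sub>F n in sequentially. norm (fourier_trunc n (abs_L2 f) - abs_L2 (fourier_L1 f))
        \<le> sqrt (2 * pi) * norm (abs_L2 (?t n) - abs_L2 f)"
      unfolding fourier_trunc_def by (rule always_eventually, rule allI, rule norm_abs_fourier_L1_diff_le[OF t f sf])
  qed
  then show "(\<lambda>n. fourier_trunc n (abs_L2 f)) \<longlonglongrightarrow> abs_L2 (fourier_L1 f)"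
    by (rule LIM_zero_cancel)
qed

lemma trunc_measurable [measurable]: "f \<in> borel_measurable borel \<Longrightarrow> trunc n f \<in> borel_measurable borel"
  unfolding trunc_def[abs_def] by measurable

lemma bounded_linear_fourier_L2: "bounded_linear (fourier_L2 :: (complex^'n^'m) L2 \<Rightarrow> _)"
proof (rule bounded_linear_intro[where K = "sqrt (2 * pi)"])
  fix F G :: "(complex^'n^'m) L2" and r :: real
  have t: "integrable lborel (trunc n (rep_L2 F))" "square_integrable (trunc n (rep_L2 F))" for n and F :: "(complex^'n^'m) L2"
    by (simp_all add: integrable_trunc square_integrable_trunc)
  have "fourier_trunc n (F + G) = fourier_trunc n F + fourier_trunc n G" for n
  proof -
    have "fourier_L1 (trunc n (rep_L2 (F + G))) = fourier_L1 (\<lambda>x. trunc n (rep_L2 F) x + trunc n (rep_L2 G) x)"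
    proof (rule fourier_L1_cong_AE)
      show "AE x in lborel. trunc n (rep_L2 (F + G)) x = trunc n (rep_L2 F) x + trunc n (rep_L2 G) x"
        using rep_L2_add[of F G] by eventually_elim (simp add: trunc_def scaleR_add_right)
    qed measurable
    also have "\<dots> = (\<lambda>\<xi>. fourier_L1 (trunc n (rep_L2 F)) \<xi> + fourier_L1 (trunc n (rep_L2 G)) \<xi>)"
      by (rule ext) (rule fourier_L1_add[OF t(1) t(1)])
    finally show ?thesis
      by (simp add: fourier_trunc_def abs_L2_add fourier_L1_square_integrable t)
  qed
  then have "(\<lambda>n. fourier_trunc n (F + G)) \<longlonglongrightarrow> fourier_L2 F + fourier_L2 G"
    by (simp add: tendsto_add fourier_trunc_tendsto)
  then show "fourier_L2 (F + G) = fourier_L2 F + fourier_L2 G"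
    by (rule LIMSEQ_unique[OF fourier_trunc_tendsto])
  have "fourier_trunc n (r *\<^sub>R F) = r *\<^sub>R fourier_trunc n F" for n
  proof -
    have "fourier_L1 (trunc n (rep_L2 (r *\<^sub>R F))) = fourier_L1 (\<lambda>x. r *\<^sub>R trunc n (rep_L2 F) x)"
    proof (rule fourier_L1_cong_AE)
      show "AE x in lborel. trunc n (rep_L2 (r *\<^sub>R F)) x = r *\<^sub>R trunc n (rep_L2 F) x"
        using rep_L2_scaleR[of r F] by eventually_elim (simp add: trunc_def)
    qed measurable
    also have "\<dots> = (\<lambda>\<xi>. r *\<^sub>R fourier_L1 (trunc n (rep_L2 F)) \<xi>)"
      by (rule ext) (rule fourier_L1_scaleR)
    finally show ?thesis
      by (simp add: fourier_trunc_def abs_L2_scaleR fourier_L1_square_integrable t)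
  qed
  then have "(\<lambda>n. fourier_trunc n (r *\<^sub>R F)) \<longlonglongrightarrow> r *\<^sub>R fourier_L2 F"
    by (simp add: tendsto_scaleR fourier_trunc_tendsto)
  then show "fourier_L2 (r *\<^sub>R F) = r *\<^sub>R fourier_L2 F"
    by (rule LIMSEQ_unique[OF fourier_trunc_tendsto])
  have "norm (fourier_L2 F) \<le> sqrt (2 * pi) * norm F"
  proof (rule LIMSEQ_le)
    show "(\<lambda>n. norm (fourier_trunc n F)) \<longlonglongrightarrow> norm (fourier_L2 F)"
      by (intro tendsto_norm fourier_trunc_tendsto)
    show "(\<lambda>n. sqrt (2 * pi) * norm (abs_L2 (trunc n (rep_L2 F)))) \<longlonglongrightarrow> sqrt (2 * pi) * norm F"
      using abs_trunc_tendsto[of "rep_L2 F"] by (intro tendsto_mult tendsto_const tendsto_norm) simp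
    show "\<exists>N. \<forall>n\<ge>N. norm (fourier_trunc n F) \<le> sqrt (2 * pi) * norm (abs_L2 (trunc n (rep_L2 F)))"
      unfolding fourier_trunc_def using norm_abs_fourier_L1_le[OF t] by blast
  qed
  then show "norm (fourier_L2 F) \<le> norm F * sqrt (2 * pi)" by (simp add: mult.commute)
qed

abbreviation reflect :: "'a::euclidean_space L2 \<Rightarrow> 'a L2" where
  "reflect \<equiv> L2_affine (- 1) 0"

lemma bounded_linear_reflect: "bounded_linear reflect"
  by (rule bounded_linear_L2_affine) simp

lemma rep_reflect: "AE x in lborel. rep_L2 (reflect F) x = rep_L2 F (- x)"
  using rep_L2_affine[of "- 1" 0 F] by simp

lemma reflect_abs: "square_integrable f \<Longrightarrow> reflect (abs_L2 f) = abs_L2 (\<lambda>x. f (- x))"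
  using L2_affine_abs[of "- 1" f 0] by simp

lemma reflect_reflect [simp]: "reflect (reflect F) = F"
proof (rule L2_eqI)
  show "AE x in lborel. rep_L2 (reflect (reflect F)) x = rep_L2 F x"
    using rep_reflect[of "reflect F"] AE_lborel_affine[OF _ rep_reflect[of F], of "- 1" 0]
    by auto
qed

lemma closed_inner_eq:
  assumes "bounded_linear S" "bounded_linear T"
  shows "closed {F. S F \<bullet> G = c * (T F \<bullet> H)}"
  by (intro closed_Collect_eq continuous_intros linear_continuous_on assms)

lemma fourier_L2_adjoint:
  fixes F G :: "(complex^'n^'m) L2"
  shows "fourier_L2 F \<bullet> G = F \<bullet> reflect (fourier_L2 G)"
proof -
  have cl: "closed {F. fourier_L2 F \<bullet> G = F \<bullet> H}" for G H :: "(complex^'n^'m) L2"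
    using closed_inner_eq[OF bounded_linear_fourier_L2 bounded_linear_ident, of G 1 H] by simp
  have "closed {G. reflect (fourier_L2 G) \<bullet> F = G \<bullet> H}" for F H :: "(complex^'n^'m) L2"
    using closed_inner_eq[OF bounded_linear_compose[OF bounded_linear_reflect bounded_linear_fourier_L2]
        bounded_linear_ident, of F 1 H] by simp
  then have cl2: "closed {G. fourier_L2 F \<bullet> G = F \<bullet> reflect (fourier_L2 G)}" for F :: "(complex^'n^'m) L2"
  proof -
    have "{G. fourier_L2 F \<bullet> G = F \<bullet> reflect (fourier_L2 G)} = {G. reflect (fourier_L2 G) \<bullet> F = G \<bullet> fourier_L2 F}"
      by (intro Collect_cong) (metis inner_commute)
    then show ?thesis by (simp only: \<open>\<And>H F. closed {G. reflect (fourier_L2 G) \<bullet> F = G \<bullet> H}\<close>)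
  qed
  show ?thesis
  proof (rule L2_closed_induct[OF cl])
    fix f :: "real \<Rightarrow> complex^'n^'m" assume f: "square_integrable f" "integrable lborel f"
    show "fourier_L2 (abs_L2 f) \<bullet> G = abs_L2 f \<bullet> reflect (fourier_L2 G)"
    proof (rule L2_closed_induct[OF cl2])
      fix g :: "real \<Rightarrow> complex^'n^'m" assume g: "square_integrable g" "integrable lborel g"
      have "square_integrable (\<lambda>x. fourier_L1 g (- x))"
        using square_integrable_affine[of "- 1" "fourier_L1 g" 0] fourier_L1_square_integrable(1)[OF g(2,1)] by simp
      then show "fourier_L2 (abs_L2 f) \<bullet> abs_L2 g = abs_L2 f \<bullet> reflect (fourier_L2 (abs_L2 g))"
        using f g fourier_L1_adjoint[OF f(2) g(2)]
        by (simp add: fourier_L2_abs reflect_abs fourier_L1_square_integrable inner_abs_L2)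
    qed
  qed
qed

text \<open>
  Fourier inversion. The Parseval identity against step functions and the adjoint relation show that the difference of
  both sides is orthogonal to all steps.
\<close>

lemma fourier_fourier:
  fixes F :: "(complex^'n^'m) L2"
  shows "reflect (fourier_L2 (fourier_L2 F)) = (2 * pi) *\<^sub>R F"
proof -
  have "reflect (fourier_L2 (fourier_L2 F)) - (2 * pi) *\<^sub>R F = 0"
  proof (rule L2_eq_zero_of_step)
    fix a b :: real and A :: "complex^'n^'m"
    let ?s = "abs_L2 (step a b A)"
    have "fourier_L2 F \<bullet> fourier_L2 ?s = 2 * pi * (F \<bullet> ?s)"
    proof (rule L2_closed_induct[where P = "\<lambda>F. fourier_L2 F \<bullet> fourier_L2 ?s = 2 * pi * (F \<bullet> ?s)"])
      show "closed {F. fourier_L2 F \<bullet> fourier_L2 ?s = 2 * pi * (F \<bullet> ?s)}"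
        by (rule closed_inner_eq[OF bounded_linear_fourier_L2 bounded_linear_ident])
      fix f :: "real \<Rightarrow> complex^'n^'m" assume f: "square_integrable f" "integrable lborel f"
      show "fourier_L2 (abs_L2 f) \<bullet> fourier_L2 ?s = 2 * pi * (abs_L2 f \<bullet> ?s)"
        using fourier_L1_inner_step[OF f(2,1), of a b A] f
        by (simp add: fourier_L2_abs inner_abs_L2 fourier_L1_square_integrable integrable_step square_integrable_step)
    qed
    moreover have "reflect (fourier_L2 (fourier_L2 F)) \<bullet> ?s = fourier_L2 F \<bullet> fourier_L2 ?s"
      using fourier_L2_adjoint[of ?s "fourier_L2 F"] by (simp add: inner_commute)
    ultimately show "(reflect (fourier_L2 (fourier_L2 F)) - (2 * pi) *\<^sub>R F) \<bullet> ?s = 0"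
      by (simp add: inner_diff_left)
  qed
  then show ?thesis by simp
qed

theorem plancherel: "fourier_L2 F \<bullet> fourier_L2 G = 2 * pi * (F \<bullet> G)"
  by (simp add: fourier_L2_adjoint fourier_fourier)

lemma fourier_L2_reflect: "fourier_L2 (reflect F) = reflect (fourier_L2 F)"
proof (rule L2_linear_eq[of "\<lambda>F. fourier_L2 (reflect F)" "\<lambda>F. reflect (fourier_L2 F)"])
  show "bounded_linear (\<lambda>F. fourier_L2 (reflect F))" "bounded_linear (\<lambda>F. reflect (fourier_L2 F))"
    by (intro bounded_linear_compose[OF bounded_linear_fourier_L2 bounded_linear_reflect]
        bounded_linear_compose[OF bounded_linear_reflect bounded_linear_fourier_L2])+
  fix f :: "real \<Rightarrow> complex^'n^'m" assume f: "square_integrable f" "integrable lborel f"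
  have g: "square_integrable (\<lambda>x. f (- x))" "integrable lborel (\<lambda>x. f (- x))"
    using square_integrable_affine[of "- 1" f 0] lborel_integrable_real_affine[of f "- 1" 0] f by auto
  have "fourier_L1 (\<lambda>x. f (- x)) = (\<lambda>\<xi>. fourier_L1 f (- \<xi>))"
  proof
    fix \<xi>
    show "fourier_L1 (\<lambda>x. f (- x)) \<xi> = fourier_L1 f (- \<xi>)"
      unfolding fourier_L1_cis by (subst lborel_integral_real_affine[of "- 1" _ 0]) auto
  qed
  then show "fourier_L2 (reflect (abs_L2 f)) = reflect (fourier_L2 (abs_L2 f))"
    using f g by (simp add: reflect_abs fourier_L2_abs fourier_L1_square_integrable)
qed

definition ifourier_L2 :: "(complex^'n^'m) L2 \<Rightarrow> (complex^'n^'m) L2" where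
  "ifourier_L2 F = (1 / (2 * pi)) *\<^sub>R reflect (fourier_L2 F)"

lemma fourier_ifourier [simp]: "fourier_L2 (ifourier_L2 F) = F"
proof -
  have "fourier_L2 (ifourier_L2 F) = (1 / (2 * pi)) *\<^sub>R reflect (fourier_L2 (fourier_L2 F))"
    by (simp add: ifourier_L2_def linear_cmul[OF bounded_linear.linear[OF bounded_linear_fourier_L2]] fourier_L2_reflect)
  then show ?thesis by (simp add: fourier_fourier)
qed

lemma ifourier_fourier [simp]: "ifourier_L2 (fourier_L2 F) = F"
  by (simp add: ifourier_L2_def fourier_fourier)

lemma fourier_L2_inject: "fourier_L2 F = fourier_L2 G \<longleftrightarrow> F = G"
  by (metis ifourier_fourier)

lemma bounded_linear_ifourier_L2: "bounded_linear ifourier_L2"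
  unfolding ifourier_L2_def[abs_def]
  by (intro bounded_linear_compose[OF bounded_linear_scaleR_right]
      bounded_linear_compose[OF bounded_linear_reflect bounded_linear_fourier_L2])

lemma fourier_L2_linear_map:
  fixes l :: "complex^'n^'m \<Rightarrow> complex^'q^'p"
  assumes l: "bounded_linear l" and c: "\<And>c A. l (c *\<^sub>M A) = c *\<^sub>M l A"
  shows "fourier_L2 (L2_map (\<lambda>_. l) F) = L2_map (\<lambda>_. l) (fourier_L2 F)"
proof -
  obtain K where K: "multiplier K (\<lambda>_. l)" by (rule multiplier_const[OF l])
  show ?thesis
  proof (rule L2_linear_eq[of "\<lambda>F. fourier_L2 (L2_map (\<lambda>_. l) F)" "\<lambda>F. L2_map (\<lambda>_. l) (fourier_L2 F)"])
    show "bounded_linear (\<lambda>F. fourier_L2 (L2_map (\<lambda>_. l) F))" "bounded_linear (\<lambda>F. L2_map (\<lambda>_. l) (fourier_L2 F))"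
      by (intro bounded_linear_compose[OF bounded_linear_fourier_L2 bounded_linear_L2_map[OF K]]
          bounded_linear_compose[OF bounded_linear_L2_map[OF K] bounded_linear_fourier_L2])+
    fix f :: "real \<Rightarrow> complex^'n^'m" assume f: "square_integrable f" "integrable lborel f"
    have "fourier_L1 (\<lambda>x. l (f x)) = (\<lambda>\<xi>. l (fourier_L1 f \<xi>))"
      by (rule ext) (rule fourier_L1_linear_map[OF l c f(2)])
    then show "fourier_L2 (L2_map (\<lambda>_. l) (abs_L2 f)) = L2_map (\<lambda>_. l) (fourier_L2 (abs_L2 f))"
      using f square_integrable_multiplier[OF K f(1)] integrable_bounded_linear[OF l f(2)]
      by (simp add: L2_map_abs[OF K] fourier_L2_abs fourier_L1_square_integrable)
  qed
qed

abbreviation star :: "(complex^'n^'m) L2 \<Rightarrow> (complex^'m^'n) L2" where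
  "star \<equiv> L2_map (\<lambda>_. ctranspose)"

lemma multiplier_ctranspose: "multiplier 1 (\<lambda>_::real. ctranspose :: complex^'n^'m \<Rightarrow> _)"
  by (auto simp: multiplier_def intro: bounded_linear.linear bounded_linear_ctranspose)

lemma fourier_L2_star: "fourier_L2 (star F) = star (reflect (fourier_L2 F))"
proof (rule L2_linear_eq[of "\<lambda>F. fourier_L2 (star F)" "\<lambda>F. star (reflect (fourier_L2 F))"])
  note bs = bounded_linear_L2_map[OF multiplier_ctranspose]
  show "bounded_linear (\<lambda>F::(complex^'n^'m) L2. fourier_L2 (star F))"
    by (intro bounded_linear_compose[OF bounded_linear_fourier_L2 bs])
  show "bounded_linear (\<lambda>F::(complex^'n^'m) L2. star (reflect (fourier_L2 F)))"
    by (intro bounded_linear_compose[OF bs bounded_linear_compose[OF bounded_linear_reflect bounded_linear_fourier_L2]])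
  fix f :: "real \<Rightarrow> complex^'n^'m" assume f: "square_integrable f" "integrable lborel f"
  have g: "square_integrable (\<lambda>x. ctranspose (f x))" "integrable lborel (\<lambda>x. ctranspose (f x))"
    using square_integrable_multiplier[OF multiplier_ctranspose f(1)]
      integrable_bounded_linear[OF bounded_linear_ctranspose f(2)] by auto
  have h: "square_integrable (\<lambda>x. fourier_L1 f (- x))"
    using square_integrable_affine[of "- 1" "fourier_L1 f" 0] fourier_L1_square_integrable(1)[OF f(2,1)] by simp
  have "fourier_L1 (\<lambda>x. ctranspose (f x)) = (\<lambda>\<xi>. ctranspose (fourier_L1 f (- \<xi>)))"
  proof
    fix \<xi>
    have "fourier_L1 (\<lambda>x. ctranspose (f x)) \<xi> = (LINT x|lborel. ctranspose (cis (- (x * - \<xi>)) *\<^sub>M f x))"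
      unfolding fourier_L1_cis by (simp add: cis_cnj)
    also have "\<dots> = ctranspose (fourier_L1 f (- \<xi>))"
      unfolding fourier_L1_cis
      by (intro integral_bounded_linear[OF bounded_linear_ctranspose] integrable_cis_mscale f) measurable
    finally show "fourier_L1 (\<lambda>x. ctranspose (f x)) \<xi> = ctranspose (fourier_L1 f (- \<xi>))" .
  qed
  then show "fourier_L2 (star (abs_L2 f)) = star (reflect (fourier_L2 (abs_L2 f)))"
    using f g h by (simp add: L2_map_abs[OF multiplier_ctranspose] fourier_L2_abs reflect_abs fourier_L1_square_integrable)
qed

definition modulate :: "real \<Rightarrow> (complex^'n^'m) L2 \<Rightarrow> (complex^'n^'m) L2" where
  "modulate \<eta> = L2_map (\<lambda>x A. cis (\<eta> * x) *\<^sub>M A)"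

lemma multiplier_cis: "multiplier 1 (\<lambda>x A. cis (\<eta> * x) *\<^sub>M (A :: complex^'n^'m))"
  by (rule multiplier_mscale) auto

lemma fourier_L2_modulate: "fourier_L2 (modulate \<eta> F) = L2_affine 1 (- \<eta>) (fourier_L2 F)"
proof (rule L2_linear_eq[of "\<lambda>F. fourier_L2 (modulate \<eta> F)" "\<lambda>F. L2_affine 1 (- \<eta>) (fourier_L2 F)"])
  have a: "bounded_linear (L2_affine 1 (- \<eta>))" by (rule bounded_linear_L2_affine) simp
  show "bounded_linear (\<lambda>F. fourier_L2 (modulate \<eta> F))" "bounded_linear (\<lambda>F. L2_affine 1 (- \<eta>) (fourier_L2 F))"
    unfolding modulate_def
    by (intro bounded_linear_compose[OF bounded_linear_fourier_L2 bounded_linear_L2_map[OF multiplier_cis]]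
        bounded_linear_compose[OF a bounded_linear_fourier_L2])+
  fix f :: "real \<Rightarrow> complex^'n^'m" assume f: "square_integrable f" "integrable lborel f"
  have g: "square_integrable (\<lambda>x. cis (\<eta> * x) *\<^sub>M f x)" "integrable lborel (\<lambda>x. cis (\<eta> * x) *\<^sub>M f x)"
    using square_integrable_multiplier[OF multiplier_cis f(1), of \<eta>] integrable_cis_mscale[OF f(2), of "\<lambda>x. \<eta> * x"] by auto
  have "fourier_L1 (\<lambda>x. cis (\<eta> * x) *\<^sub>M f x) = (\<lambda>\<xi>. fourier_L1 f (- \<eta> + 1 * \<xi>))"
  proof
    fix \<xi>
    have "- (x * \<xi>) + \<eta> * x = - (x * (- \<eta> + 1 * \<xi>))" for x by (simp add: algebra_simps)
    then show "fourier_L1 (\<lambda>x. cis (\<eta> * x) *\<^sub>M f x) \<xi> = fourier_L1 f (- \<eta> + 1 * \<xi>)"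
      unfolding fourier_L1_cis mscale_simps cis_mult by simp
  qed
  then show "fourier_L2 (modulate \<eta> (abs_L2 f)) = L2_affine 1 (- \<eta>) (fourier_L2 (abs_L2 f))"
    using f g by (simp add: modulate_def L2_map_abs[OF multiplier_cis] fourier_L2_abs L2_affine_abs fourier_L1_square_integrable)
qed

lemma fourier_AE:
  assumes f: "square_integrable f"
  shows "AE \<xi> in lborel. fourier f \<xi> = rep_L2 (fourier_L2 (abs_L2 f)) \<xi>"
proof (cases "integrable lborel f")
  case True
  have "AE \<xi> in lborel. rep_L2 (abs_L2 (fourier_L1 f)) \<xi> = fourier_L1 f \<xi>"
    by (intro rep_L2_abs_L2 fourier_L1_square_integrable True f)
  then show ?thesis using True by (simp add: fourier_def fourier_L2_abs f eq_commute)
qed (simp add: fourier_def)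

section \<open>The Szego projector on square integrable functions\<close>

text \<open>
  The Szego projector on the Fourier side.
\<close>

definition cutoff :: "'a::euclidean_space L2 \<Rightarrow> 'a L2" where
  "cutoff = L2_map (\<lambda>\<xi> A. indicator {0..} \<xi> *\<^sub>R A)"

definition szego_L2 :: "(complex^'n^'m) L2 \<Rightarrow> (complex^'n^'m) L2" where
  "szego_L2 F = ifourier_L2 (cutoff (fourier_L2 F))"

lemma multiplier_half_line: "multiplier 1 (\<lambda>\<xi> A. indicator {0::real..} \<xi> *\<^sub>R (A::'a::euclidean_space))"
  by (rule multiplier_indicator) simp

lemma bounded_linear_cutoff: "bounded_linear cutoff"
  unfolding cutoff_def by (rule bounded_linear_L2_map[OF multiplier_half_line])

lemma rep_cutoff: "AE \<xi> in lborel. rep_L2 (cutoff F) \<xi> = indicator {0..} \<xi> *\<^sub>R rep_L2 F \<xi>"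
  unfolding cutoff_def by (rule rep_L2_map[OF multiplier_half_line])

lemma fourier_szego_L2 [simp]: "fourier_L2 (szego_L2 F) = cutoff (fourier_L2 F)"
  by (simp add: szego_L2_def)

lemma bounded_linear_szego_L2: "bounded_linear szego_L2"
  unfolding szego_L2_def[abs_def]
  by (intro bounded_linear_compose[OF bounded_linear_ifourier_L2]
      bounded_linear_compose[OF bounded_linear_cutoff bounded_linear_fourier_L2])

text \<open>
  The projector of the definitions is characterised by the Fourier transform of its value; injectivity of the transform makes
  the description unique.
\<close>

theorem szego_eq:
  assumes f: "square_integrable f"
  shows "szego f = szego_L2 (abs_L2 f)"
  unfolding szego_def
proof (rule the_equality)
  let ?F = "fourier_L2 (abs_L2 f)"
  have *: "AE \<xi> in lborel. rep_L2 (cutoff ?F) \<xi> = indicator {0..} \<xi> *\<^sub>R fourier f \<xi>"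
    using rep_cutoff[of ?F] fourier_AE[OF f] by eventually_elim simp
  then show "AE \<xi> in lborel. rep_L2 (fourier_L2 (szego_L2 (abs_L2 f))) \<xi> = indicator {0..} \<xi> *\<^sub>R fourier f \<xi>"
    by simp
  fix V assume V: "AE \<xi> in lborel. rep_L2 (fourier_L2 V) \<xi> = indicator {0..} \<xi> *\<^sub>R fourier f \<xi>"
  have "fourier_L2 V = cutoff ?F"
  proof (rule L2_eqI)
    show "AE \<xi> in lborel. rep_L2 (fourier_L2 V) \<xi> = rep_L2 (cutoff ?F) \<xi>"
      using * V by eventually_elim simp
  qed
  then show "V = szego_L2 (abs_L2 f)" by (metis fourier_szego_L2 fourier_L2_inject)
qed

lemma szego_rep: "szego (rep_L2 F) = szego_L2 F"
  by (simp add: szego_eq)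

lemma cutoff_cutoff [simp]: "cutoff (cutoff F) = cutoff F"
proof (rule L2_eqI)
  show "AE \<xi> in lborel. rep_L2 (cutoff (cutoff F)) \<xi> = rep_L2 (cutoff F) \<xi>"
    using rep_cutoff[of "cutoff F"] rep_cutoff[of F] by eventually_elim (auto simp: indicator_def)
qed

lemma szego_szego [simp]: "szego_L2 (szego_L2 F) = szego_L2 F"
  by (subst fourier_L2_inject[symmetric]) simp

lemma L2_plus_iff:
  fixes F :: "(complex^'a^'b) L2"
  shows "F \<in> L2_plus \<longleftrightarrow> szego_L2 F = F"
proof
  assume "F \<in> L2_plus"
  then obtain G :: "(complex^'a^'b) L2" where "F = szego (rep_L2 G)" unfolding L2_plus_def by blast
  then show "szego_L2 F = F" by (simp add: szego_rep)
next
  assume "szego_L2 F = F"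
  then have "F = szego (rep_L2 F)" by (simp add: szego_rep)
  then show "F \<in> L2_plus" unfolding L2_plus_def by (rule range_eqI)
qed

lemma cutoff_adjoint: "cutoff F \<bullet> G = F \<bullet> cutoff G"
proof -
  have "cutoff F \<bullet> G = (LINT \<xi>|lborel. (indicator {0..} \<xi> *\<^sub>R rep_L2 F \<xi>) \<bullet> rep_L2 G \<xi>)"
    unfolding inner_L2 by (intro integral_cong_AE) (use rep_cutoff[of F] in auto)
  also have "\<dots> = F \<bullet> cutoff G"
    unfolding inner_L2 by (intro integral_cong_AE) (use rep_cutoff[of G] in auto)
  finally show ?thesis .
qed

lemma szego_L2_adjoint: "szego_L2 F \<bullet> G = F \<bullet> szego_L2 G"
proof -
  have "2 * pi * (szego_L2 F \<bullet> G) = 2 * pi * (F \<bullet> szego_L2 G)"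
    by (simp add: plancherel[symmetric] cutoff_adjoint)
  then show ?thesis by simp
qed

lemma szego_plus_iff: "szego_L2 F = F \<longleftrightarrow> (AE \<xi> in lborel. \<xi> < 0 \<longrightarrow> rep_L2 (fourier_L2 F) \<xi> = 0)"
proof -
  have "szego_L2 F = F \<longleftrightarrow> cutoff (fourier_L2 F) = fourier_L2 F"
    by (metis fourier_szego_L2 fourier_L2_inject)
  also have "\<dots> \<longleftrightarrow> (AE \<xi> in lborel. \<xi> < 0 \<longrightarrow> rep_L2 (fourier_L2 F) \<xi> = 0)"
  proof
    assume "cutoff (fourier_L2 F) = fourier_L2 F"
    with rep_cutoff[of "fourier_L2 F"]
    have "AE \<xi> in lborel. rep_L2 (fourier_L2 F) \<xi> = indicator {0..} \<xi> *\<^sub>R rep_L2 (fourier_L2 F) \<xi>" by simp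
    then show "AE \<xi> in lborel. \<xi> < 0 \<longrightarrow> rep_L2 (fourier_L2 F) \<xi> = 0"
      by eventually_elim (auto simp: indicator_def)
  next
    assume *: "AE \<xi> in lborel. \<xi> < 0 \<longrightarrow> rep_L2 (fourier_L2 F) \<xi> = 0"
    show "cutoff (fourier_L2 F) = fourier_L2 F"
    proof (rule L2_eqI)
      show "AE \<xi> in lborel. rep_L2 (cutoff (fourier_L2 F)) \<xi> = rep_L2 (fourier_L2 F) \<xi>"
        using * rep_cutoff[of "fourier_L2 F"] by eventually_elim (auto simp: indicator_def not_le)
    qed
  qed
  finally show ?thesis .
qed

lemma szego_minus_iff: "szego_L2 F = 0 \<longleftrightarrow> (AE \<xi> in lborel. 0 \<le> \<xi> \<longrightarrow> rep_L2 (fourier_L2 F) \<xi> = 0)"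
proof -
  have z: "fourier_L2 (0 :: (complex^'n^'m) L2) = 0"
    by (rule linear_0[OF bounded_linear.linear[OF bounded_linear_fourier_L2]])
  have "szego_L2 F = 0 \<longleftrightarrow> cutoff (fourier_L2 F) = 0"
    by (metis z fourier_szego_L2 fourier_L2_inject)
  also have "\<dots> \<longleftrightarrow> (AE \<xi> in lborel. 0 \<le> \<xi> \<longrightarrow> rep_L2 (fourier_L2 F) \<xi> = 0)"
  proof
    assume *: "cutoff (fourier_L2 F) = 0"
    have "AE \<xi> in lborel. rep_L2 (cutoff (fourier_L2 F)) \<xi> = 0" unfolding * by (rule rep_L2_zero)
    with rep_cutoff[of "fourier_L2 F"] show "AE \<xi> in lborel. 0 \<le> \<xi> \<longrightarrow> rep_L2 (fourier_L2 F) \<xi> = 0"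
      by eventually_elim (simp add: indicator_def)
  next
    assume *: "AE \<xi> in lborel. 0 \<le> \<xi> \<longrightarrow> rep_L2 (fourier_L2 F) \<xi> = 0"
    show "cutoff (fourier_L2 F) = 0"
    proof (rule L2_eqI)
      show "AE \<xi> in lborel. rep_L2 (cutoff (fourier_L2 F)) \<xi> = rep_L2 0 \<xi>"
        using * rep_cutoff[of "fourier_L2 F"] rep_L2_zero by eventually_elim (auto simp: indicator_def)
    qed
  qed
  finally show ?thesis .
qed

lemma szego_orthogonal: "szego_L2 F = F \<Longrightarrow> szego_L2 G = 0 \<Longrightarrow> F \<bullet> G = 0"
  by (metis szego_L2_adjoint inner_zero_right)

lemma rep_fourier_star:
  "AE \<xi> in lborel. rep_L2 (fourier_L2 (star F)) \<xi> = ctranspose (rep_L2 (fourier_L2 F) (- \<xi>))"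
  using rep_L2_map[OF multiplier_ctranspose, of "reflect (fourier_L2 F)"] rep_reflect[of "fourier_L2 F"]
  unfolding fourier_L2_star by eventually_elim simp

text \<open>
  The adjoint reflects the Fourier transform, and the frequency 0 is a null set.
\<close>

lemma szego_star_of_plus:
  assumes "szego_L2 F = F" shows "szego_L2 (star F) = 0"
proof -
  have "AE \<xi> in lborel. 0 + - 1 * \<xi> < 0 \<longrightarrow> rep_L2 (fourier_L2 F) (0 + - 1 * \<xi>) = 0"
    by (rule AE_lborel_affine[OF _ assms[unfolded szego_plus_iff]]) simp
  with rep_fourier_star[of F] AE_lborel_singleton[of 0] show ?thesis
    unfolding szego_minus_iff by eventually_elim auto
qed

lemma szego_star_of_minus:
  assumes "szego_L2 F = 0" shows "szego_L2 (star F) = star F"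
proof -
  have "AE \<xi> in lborel. 0 \<le> 0 + - 1 * \<xi> \<longrightarrow> rep_L2 (fourier_L2 F) (0 + - 1 * \<xi>) = 0"
    by (rule AE_lborel_affine[OF _ assms[unfolded szego_minus_iff]]) simp
  with rep_fourier_star[of F] show ?thesis
    unfolding szego_plus_iff by eventually_elim auto
qed

lemma szego_modulate_plus:
  assumes "szego_L2 F = F" "0 \<le> \<eta>" shows "szego_L2 (modulate \<eta> F) = modulate \<eta> F"
  unfolding szego_plus_iff fourier_L2_modulate
proof -
  have "AE \<xi> in lborel. - \<eta> + 1 * \<xi> < 0 \<longrightarrow> rep_L2 (fourier_L2 F) (- \<eta> + 1 * \<xi>) = 0"
    by (rule AE_lborel_affine[OF _ assms(1)[unfolded szego_plus_iff]]) simp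
  with rep_L2_affine[OF one_neq_zero, of "- \<eta>" "fourier_L2 F"]
  show "AE \<xi> in lborel. \<xi> < 0 \<longrightarrow> rep_L2 (L2_affine 1 (- \<eta>) (fourier_L2 F)) \<xi> = 0"
  proof eventually_elim
    case (elim \<xi>)
    then show ?case using assms(2) by auto
  qed
qed

lemma szego_modulate_minus:
  assumes "szego_L2 F = 0" "\<eta> \<le> 0" shows "szego_L2 (modulate \<eta> F) = 0"
  unfolding szego_minus_iff fourier_L2_modulate
proof -
  have "AE \<xi> in lborel. 0 \<le> - \<eta> + 1 * \<xi> \<longrightarrow> rep_L2 (fourier_L2 F) (- \<eta> + 1 * \<xi>) = 0"
    by (rule AE_lborel_affine[OF _ assms(1)[unfolded szego_minus_iff]]) simp
  with rep_L2_affine[OF one_neq_zero, of "- \<eta>" "fourier_L2 F"]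
  show "AE \<xi> in lborel. 0 \<le> \<xi> \<longrightarrow> rep_L2 (L2_affine 1 (- \<eta>) (fourier_L2 F)) \<xi> = 0"
  proof eventually_elim
    case (elim \<xi>)
    then show ?case using assms(2) by auto
  qed
qed

text \<open>
  Maps that are complex linear in the matrix entries commute with the Fourier transform; used for transposition, scalar
  multiplication and right multiplication by a constant matrix.
\<close>

lemma szego_linear_map:
  fixes l :: "complex^'n^'m \<Rightarrow> complex^'q^'p"
  assumes l: "bounded_linear l" and c: "\<And>c A. l (c *\<^sub>M A) = c *\<^sub>M l A"
  shows "szego_L2 (L2_map (\<lambda>_. l) F) = L2_map (\<lambda>_. l) (szego_L2 F)"
proof -
  obtain K where K: "multiplier K (\<lambda>_. l)" by (rule multiplier_const[OF l])
  have "cutoff (L2_map (\<lambda>_. l) G) = L2_map (\<lambda>_. l) (cutoff G)" for G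
  proof (rule L2_eqI)
    show "AE \<xi> in lborel. rep_L2 (cutoff (L2_map (\<lambda>_. l) G)) \<xi> = rep_L2 (L2_map (\<lambda>_. l) (cutoff G)) \<xi>"
      using rep_cutoff[of "L2_map (\<lambda>_. l) G"] rep_cutoff[of G] rep_L2_map[OF K, of G] rep_L2_map[OF K, of "cutoff G"]
      by eventually_elim (simp add: linear_cmul[OF bounded_linear.linear[OF l]])
  qed
  then show ?thesis
    by (subst fourier_L2_inject[symmetric]) (simp add: fourier_L2_linear_map[OF l c])
qed

section \<open>Products and the Hardy space\<close>

lemma plus_of_orthogonal:
  assumes "\<And>H. szego_L2 H = 0 \<Longrightarrow> F \<bullet> H = 0"
  shows "szego_L2 F = F"
proof -
  let ?D = "F - szego_L2 F"
  interpret S: bounded_linear szego_L2 by (rule bounded_linear_szego_L2)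
  have D: "szego_L2 ?D = 0" by (simp add: S.diff)
  have "szego_L2 F \<bullet> ?D = 0" by (simp add: szego_L2_adjoint D)
  with assms[OF D] have "?D \<bullet> ?D = 0" by (simp add: inner_diff_left)
  then show ?thesis by simp
qed

lemma ifourier_abs:
  fixes k :: "real \<Rightarrow> complex^'n^'m"
  assumes k: "integrable lborel k" "square_integrable k"
  shows "ifourier_L2 (abs_L2 k) = abs_L2 (\<lambda>x. (1 / (2 * pi)) *\<^sub>R fourier_L1 k (- x))"
    and "square_integrable (\<lambda>x. fourier_L1 k (- x))"
proof -
  show s: "square_integrable (\<lambda>x. fourier_L1 k (- x))"
    using square_integrable_affine[of "- 1" "fourier_L1 k" 0] fourier_L1_square_integrable(1)[OF k] by simp
  show "ifourier_L2 (abs_L2 k) = abs_L2 (\<lambda>x. (1 / (2 * pi)) *\<^sub>R fourier_L1 k (- x))"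
    unfolding ifourier_L2_def by (simp add: fourier_L2_abs k reflect_abs fourier_L1_square_integrable abs_L2_scaleR s)
qed

text \<open>
  Plus functions whose Fourier transform is integrable are dense; on them the inverse transform is an absolutely convergent
  superposition of plane waves.
\<close>

lemma plus_approximation:
  fixes G :: "(complex^'n^'m) L2"
  assumes G: "szego_L2 G = G"
  obtains k where "\<And>n. integrable lborel (k n)" "\<And>n. square_integrable (k n)"
    "\<And>n \<xi>. \<xi> < 0 \<Longrightarrow> k n \<xi> = 0" "(\<lambda>n. ifourier_L2 (abs_L2 (k n))) \<longlonglongrightarrow> G"
    "\<And>\<xi>. (\<lambda>n. k n \<xi>) \<longlonglongrightarrow> indicator {0..} \<xi> *\<^sub>R rep_L2 (fourier_L2 G) \<xi>"
    "\<And>n \<xi>. norm (k n \<xi>) \<le> norm (rep_L2 (fourier_L2 G) \<xi>)"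
proof -
  define g where "g \<xi> = indicator {0..} \<xi> *\<^sub>R rep_L2 (fourier_L2 G) \<xi>" for \<xi> :: real
  have sg: "square_integrable g"
    unfolding g_def by (rule square_integrable_multiplier[OF multiplier_half_line]) simp
  have "fourier_L2 G = cutoff (fourier_L2 G)" by (metis G fourier_szego_L2)
  then have ag: "abs_L2 g = fourier_L2 G"
    by (simp add: cutoff_def L2_map_def g_def[abs_def])
  show thesis
  proof
    show "integrable lborel (trunc n g)" "square_integrable (trunc n g)" for n
      by (simp_all add: integrable_trunc square_integrable_trunc sg)
    show "trunc n g \<xi> = 0" if "\<xi> < 0" for n \<xi> using that by (simp add: trunc_def g_def)
    have "(\<lambda>n. ifourier_L2 (abs_L2 (trunc n g))) \<longlonglongrightarrow> ifourier_L2 (fourier_L2 G)"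
      unfolding ag[symmetric]
      by (intro bounded_linear.tendsto[OF bounded_linear_ifourier_L2] abs_trunc_tendsto sg)
    then show "(\<lambda>n. ifourier_L2 (abs_L2 (trunc n g))) \<longlonglongrightarrow> G" by simp
    show "(\<lambda>n. trunc n g \<xi>) \<longlonglongrightarrow> indicator {0..} \<xi> *\<^sub>R rep_L2 (fourier_L2 G) \<xi>" for \<xi>
      using trunc_tendsto[of g \<xi>] by (simp add: g_def)
    show "norm (trunc n g \<xi>) \<le> norm (rep_L2 (fourier_L2 G) \<xi>)" for n \<xi>
      by (rule order_trans[OF norm_trunc_le]) (simp add: g_def indicator_def)
  qed
qed

lemma bounded_linear_mult_const_right: "bounded_linear (\<lambda>A :: complex^'b^'a. A ** (B :: complex^'c^'b))"
  by (rule bounded_bilinear.bounded_linear_left[OF bounded_bilinear_mult])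

lemma bounded_linear_mult_const_left: "bounded_linear (\<lambda>B :: complex^'c^'b. (A :: complex^'b^'a) ** B)"
  by (rule bounded_bilinear.bounded_linear_right[OF bounded_bilinear_mult])

text \<open>
  A superposition of the functions \<open>e\<^bsup>ix\<eta>\<^esup> u\<close> with \<open>\<eta> \<ge> 0\<close>; each of them is plus, and Fubini exchanges the pairing with the superposition.
\<close>

lemma superposition_orthogonal:
  fixes u :: "real \<Rightarrow> complex^'k^'m" and k :: "real \<Rightarrow> complex^'n^'k"
  assumes u: "square_integrable u" "szego_L2 (abs_L2 u) = abs_L2 u"
    and k: "integrable lborel k" "\<And>\<eta>. \<eta> < 0 \<Longrightarrow> k \<eta> = 0"
    and H: "szego_L2 H = 0"
  shows "(LINT x|lborel. (u x ** fourier_L1 k (- x)) \<bullet> rep_L2 H x) = 0"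
proof -
  note [measurable] = square_integrable_measurable[OF u(1)] borel_measurable_integrable[OF k(1)]
  let ?h = "rep_L2 H"
  have "(u x ** fourier_L1 k (- x)) \<bullet> ?h x = (LINT \<eta>|lborel. (u x ** (cis (x * \<eta>) *\<^sub>M k \<eta>)) \<bullet> ?h x)" for x
  proof -
    have l: "bounded_linear (\<lambda>A. (u x ** A) \<bullet> ?h x)"
      by (rule bounded_linear_compose[OF bounded_linear_inner_left bounded_linear_mult_const_left])
    have "fourier_L1 k (- x) = (LINT \<eta>|lborel. cis (x * \<eta>) *\<^sub>M k \<eta>)"
      by (simp add: fourier_L1_cis mult.commute)
    then show ?thesis
      by (simp only:) (rule integral_bounded_linear[OF l, symmetric], rule integrable_cis_mscale[OF k(1)], measurable)
  qed
  then have "(LINT x|lborel. (u x ** fourier_L1 k (- x)) \<bullet> ?h x)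
      = (LINT x|lborel. LINT \<eta>|lborel. (u x ** (cis (x * \<eta>) *\<^sub>M k \<eta>)) \<bullet> ?h x)" by simp
  also have "\<dots> = (LINT \<eta>|lborel. LINT x|lborel. (u x ** (cis (x * \<eta>) *\<^sub>M k \<eta>)) \<bullet> ?h x)"
  proof (rule lborel_pair.Fubini_integral[symmetric])
    have uh: "integrable lborel (\<lambda>x. norm (u x) * norm (?h x))"
      by (rule integrable_norm_mult) (simp_all add: u)
    show "integrable (lborel \<Otimes>\<^sub>M lborel) (\<lambda>(x, \<eta>). (u x ** (cis (x * \<eta>) *\<^sub>M k \<eta>)) \<bullet> ?h x)"
    proof (rule integrable_pair_bound[OF uh k(1)])
      fix x \<eta>
      have "\<bar>(u x ** (cis (x * \<eta>) *\<^sub>M k \<eta>)) \<bullet> ?h x\<bar> \<le> norm (u x ** (cis (x * \<eta>) *\<^sub>M k \<eta>)) * norm (?h x)"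
        by (rule Cauchy_Schwarz_ineq2)
      also have "\<dots> \<le> (norm (u x) * norm (k \<eta>)) * norm (?h x)"
        using norm_mult_le[of "u x" "cis (x * \<eta>) *\<^sub>M k \<eta>"] by (intro mult_right_mono) (simp_all add: norm_mscale)
      finally show "norm (case (x, \<eta>) of (x, \<eta>) \<Rightarrow> (u x ** (cis (x * \<eta>) *\<^sub>M k \<eta>)) \<bullet> ?h x)
          \<le> norm (norm (u x) * norm (?h x)) * norm (k \<eta>)" by (simp add: ac_simps)
    qed measurable
  qed
  also have "\<dots> = (LINT \<eta>|(lborel::real measure). 0)"
  proof (intro Bochner_Integration.integral_cong refl)
    fix \<eta> :: real
    show "(LINT x|lborel. (u x ** (cis (x * \<eta>) *\<^sub>M k \<eta>)) \<bullet> ?h x) = 0"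
    proof (cases "\<eta> < 0")
      case True then show ?thesis by (simp add: k(2))
    next
      case False
      let ?l = "\<lambda>A :: complex^'k^'m. A ** k \<eta>"
      obtain K where K: "multiplier K (\<lambda>_. ?l)" by (rule multiplier_const[OF bounded_linear_mult_const_right])
      let ?F = "L2_map (\<lambda>_. ?l) (abs_L2 u)"
      have "szego_L2 ?F = ?F"
        by (subst szego_linear_map[OF bounded_linear_mult_const_right]) (simp_all add: u)
      then have "szego_L2 (modulate \<eta> ?F) = modulate \<eta> ?F" by (rule szego_modulate_plus) (use False in simp)
      then have "modulate \<eta> ?F \<bullet> H = 0" using H by (rule szego_orthogonal)
      moreover have "modulate \<eta> ?F = abs_L2 (\<lambda>x. cis (\<eta> * x) *\<^sub>M (u x ** k \<eta>))"
        using square_integrable_multiplier[OF K u(1)]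
        by (simp add: L2_map_abs[OF K u(1)] modulate_def L2_map_abs[OF multiplier_cis])
      moreover have "square_integrable (\<lambda>x. cis (\<eta> * x) *\<^sub>M (u x ** k \<eta>))"
        by (intro square_integrable_multiplier[OF multiplier_cis] square_integrable_multiplier[OF K] u)
      ultimately have "(LINT x|lborel. (cis (\<eta> * x) *\<^sub>M (u x ** k \<eta>)) \<bullet> ?h x) = 0"
        using inner_abs_L2[of "\<lambda>x. cis (\<eta> * x) *\<^sub>M (u x ** k \<eta>)" ?h] by simp
      then show ?thesis by (simp add: mult.commute)
    qed
  qed
  finally show ?thesis by simp
qed

definition lmul :: "(real \<Rightarrow>\<^sub>C (complex^'k^'m)) \<Rightarrow> (complex^'n^'k) L2 \<Rightarrow> (complex^'n^'m) L2" where
  "lmul u = L2_map (\<lambda>x A. apply_bcontfun u x ** A)"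

definition bstar :: "(real \<Rightarrow>\<^sub>C (complex^'n^'m)) \<Rightarrow> (real \<Rightarrow>\<^sub>C (complex^'m^'n))" where
  "bstar u = Bcontfun (\<lambda>x. ctranspose (apply_bcontfun u x))"

lemma continuous_apply_bcontfun: "continuous_on UNIV (apply_bcontfun u)"
  using apply_bcontfun[of u] by (simp add: bcontfun_def)

lemma measurable_apply_bcontfun [measurable]: "apply_bcontfun (u :: real \<Rightarrow>\<^sub>C 'a::real_normed_vector) \<in> borel_measurable borel"
  by (rule borel_measurable_continuous_onI[OF continuous_apply_bcontfun])

lemma apply_bstar [simp]: "apply_bcontfun (bstar u) x = ctranspose (apply_bcontfun u x)"
  unfolding bstar_def
  by (subst Bcontfun_inverse)
    (auto intro!: bcontfun_normI[of _ "norm u"] continuous_intros continuous_apply_bcontfun simp: norm_bounded)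

lemma bstar_bstar [simp]: "bstar (bstar u) = u"
  by (rule bcontfun_eqI) simp

lemma multiplier_lmul: "multiplier (norm u) (\<lambda>x A. apply_bcontfun u x ** (A :: complex^'n^'k))"
  by (rule multiplier_lmult) (auto simp: norm_bounded)

lemmas bounded_linear_lmul = bounded_linear_L2_map[OF multiplier_lmul, folded lmul_def]
lemmas rep_lmul = rep_L2_map[OF multiplier_lmul, folded lmul_def]
lemmas lmul_abs = L2_map_abs[OF multiplier_lmul, folded lmul_def]
lemmas norm_lmul_le = norm_L2_map_le[OF multiplier_lmul, folded lmul_def]
lemmas bounded_linear_star = bounded_linear_L2_map[OF multiplier_ctranspose]
lemmas rep_star = rep_L2_map[OF multiplier_ctranspose]

lemma lmul_adjoint: "lmul (bstar u) G \<bullet> W = G \<bullet> lmul u W"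
proof -
  have "lmul (bstar u) G \<bullet> W = (LINT x|lborel. (ctranspose (apply_bcontfun u x) ** rep_L2 G x) \<bullet> rep_L2 W x)"
    unfolding inner_L2 by (rule integral_cong_AE) (use rep_lmul[of "bstar u" G] in auto)
  also have "\<dots> = (LINT x|lborel. rep_L2 G x \<bullet> (apply_bcontfun u x ** rep_L2 W x))"
    by (simp add: inner_mult_left)
  also have "\<dots> = G \<bullet> lmul u W"
    unfolding inner_L2 by (rule integral_cong_AE) (use rep_lmul[of u W] in auto)
  finally show ?thesis .
qed

text \<open>
  Bounded continuous plus functions: the multipliers that preserve the Hardy space.
\<close>

definition bplus :: "(real \<Rightarrow>\<^sub>C (complex^'n^'m)) \<Rightarrow> bool" where
  "bplus u \<longleftrightarrow> square_integrable (apply_bcontfun u) \<and> szego_L2 (abs_L2 (apply_bcontfun u)) = abs_L2 (apply_bcontfun u)"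

text \<open>
  A product of plus functions is plus: the second factor is a limit of superpositions of plane waves with nonnegative
  frequency.
\<close>

theorem lmul_plus:
  assumes u: "bplus u" and G: "szego_L2 G = G"
  shows "szego_L2 (lmul u G) = lmul u G"
proof -
  note u = u[unfolded bplus_def]
  obtain k where k: "\<And>n. integrable lborel (k n)" "\<And>n. square_integrable (k n)"
    "\<And>n \<xi>. \<xi> < 0 \<Longrightarrow> k n \<xi> = 0" "(\<lambda>n. ifourier_L2 (abs_L2 (k n))) \<longlonglongrightarrow> G"
    using plus_approximation[OF G] by metis
  have "szego_L2 (lmul u (ifourier_L2 (abs_L2 (k n)))) = lmul u (ifourier_L2 (abs_L2 (k n)))" for n
  proof (rule plus_of_orthogonal)
    fix H :: "(complex^'c^'b) L2" assume H: "szego_L2 H = 0"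
    let ?g = "\<lambda>x. (1 / (2 * pi)) *\<^sub>R fourier_L1 (k n) (- x)"
    have sg: "square_integrable ?g" by (intro square_integrable_scaleR ifourier_abs(2) k)
    have sug: "square_integrable (\<lambda>x. apply_bcontfun u x ** ?g x)"
      by (rule square_integrable_multiplier[OF multiplier_lmul sg])
    have "lmul u (ifourier_L2 (abs_L2 (k n))) \<bullet> H = abs_L2 (\<lambda>x. apply_bcontfun u x ** ?g x) \<bullet> abs_L2 (rep_L2 H)"
      by (simp add: ifourier_abs(1)[OF k(1,2)] lmul_abs[OF sg])
    also have "\<dots> = (LINT x|lborel. (apply_bcontfun u x ** ?g x) \<bullet> rep_L2 H x)"
      by (rule inner_abs_L2[OF sug]) simp
    also have "\<dots> = (LINT x|lborel. (1 / (2 * pi)) * ((apply_bcontfun u x ** fourier_L1 (k n) (- x)) \<bullet> rep_L2 H x))"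
      by (simp add: bounded_bilinear.scaleR_right[OF bounded_bilinear_mult])
    also have "\<dots> = 0"
      using superposition_orthogonal[OF conjunct1[OF u] conjunct2[OF u] k(1)[of n] k(3) H] by simp
    finally show "lmul u (ifourier_L2 (abs_L2 (k n))) \<bullet> H = 0" .
  qed
  moreover have "(\<lambda>n. lmul u (ifourier_L2 (abs_L2 (k n)))) \<longlonglongrightarrow> lmul u G"
    by (rule bounded_linear.tendsto[OF bounded_linear_lmul k(4)])
  moreover from this have "(\<lambda>n. szego_L2 (lmul u (ifourier_L2 (abs_L2 (k n))))) \<longlonglongrightarrow> szego_L2 (lmul u G)"
    by (rule bounded_linear.tendsto[OF bounded_linear_szego_L2])
  ultimately show ?thesis by (simp only: LIMSEQ_unique)
qed

text \<open>
  Dual to the multiplicativity of plus functions.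
\<close>

lemma lmul_bstar_minus:
  assumes u: "bplus u" and G: "szego_L2 G = 0"
  shows "szego_L2 (lmul (bstar u) G) = 0"
proof -
  let ?W = "szego_L2 (lmul (bstar u) G)"
  have "?W \<bullet> ?W = lmul (bstar u) G \<bullet> ?W" by (simp add: szego_L2_adjoint)
  also have "\<dots> = lmul u ?W \<bullet> G" by (simp add: lmul_adjoint inner_commute)
  also have "\<dots> = 0" by (rule szego_orthogonal[OF lmul_plus[OF u] G]) simp
  finally show ?thesis by simp
qed

section \<open>The kernel of the Poisson integral\<close>

lemma exp_half_line:
  assumes a: "(a::real) > 0"
  shows "integrable lborel (\<lambda>\<xi>. indicator {0..} \<xi> * exp (- a * \<xi>))"
    and "(LINT \<xi>|lborel. indicator {0..} \<xi> * exp (- a * \<xi>)) = 1 / a"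
proof -
  have "emeasure (density lborel (exponential_density a)) UNIV = 1"
    using prob_space.emeasure_space_1[OF prob_space_exponential_density[OF a]] by simp
  then have "(\<integral>\<^sup>+\<xi>. exponential_density a \<xi> \<partial>lborel) = ennreal 1"
    by (simp add: emeasure_density)
  then have "has_bochner_integral lborel (exponential_density a) 1"
    by (intro has_bochner_integral_nn_integral) (use a in \<open>auto simp: exponential_density_def\<close>)
  then have "has_bochner_integral lborel (\<lambda>\<xi>. (1 / a) * exponential_density a \<xi>) ((1 / a) * 1)"
    by (rule has_bochner_integral_mult_right) 
  moreover have "(\<lambda>\<xi>. (1 / a) * exponential_density a \<xi>) = (\<lambda>\<xi>. indicator {0..} \<xi> * exp (- a * \<xi>))"
    using a by (auto simp: exponential_density_def indicator_def mult.commute)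
  ultimately have "has_bochner_integral lborel (\<lambda>\<xi>. indicator {0..} \<xi> * exp (- a * \<xi>)) (1 / a)" by simp
  then show "integrable lborel (\<lambda>\<xi>. indicator {0..} \<xi> * exp (- a * \<xi>))"
    and "(LINT \<xi>|lborel. indicator {0..} \<xi> * exp (- a * \<xi>)) = 1 / a"
    by (auto simp: has_bochner_integral_iff)
qed

lemma cmod_exp_iw: "cmod (exp (\<i> * w * of_real \<xi>)) = exp (- Im w * \<xi>)"
  by (simp add: norm_exp_eq_Re)

lemma exp_interval_integral:
  assumes w: "w \<noteq> 0" and \<eta>: "0 \<le> \<eta>"
  shows "(LINT \<xi>|lborel. indicator {0..\<eta>} \<xi> *\<^sub>R exp (\<i> * w * of_real \<xi>)) = (exp (\<i> * w * of_real \<eta>) - 1) / (\<i> * w)"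
proof -
  define F where "F \<xi> = exp (\<i> * w * of_real \<xi>) / (\<i> * w)" for \<xi> :: real
  have "(LINT \<xi>|lborel. indicator {0..\<eta>} \<xi> *\<^sub>R exp (\<i> * w * of_real \<xi>)) = F \<eta> - F 0"
  proof (rule integral_FTC_Icc[OF \<eta>])
    fix \<xi> assume "0 \<le> \<xi>" "\<xi> \<le> \<eta>"
    have "((\<lambda>s. exp (\<i> * w * s) / (\<i> * w)) has_field_derivative exp (\<i> * w * of_real \<xi>)) (at (of_real \<xi>))"
      using w by (auto intro!: derivative_eq_intros)
    then have "((\<lambda>s. exp (\<i> * w * of_real s) / (\<i> * w)) has_vector_derivative exp (\<i> * w * of_real \<xi>)) (at \<xi>)"
      by (rule has_vector_derivative_real_field)
    then show "(F has_vector_derivative exp (\<i> * w * of_real \<xi>)) (at \<xi> within {0..\<eta>})"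
      unfolding F_def by (rule has_vector_derivative_at_within)
  qed (intro continuous_intros)
  then show ?thesis by (simp add: F_def diff_divide_distrib)
qed

lemma exp_half_line_complex:
  assumes w: "Im w > 0"
  shows "integrable lborel (\<lambda>\<xi>. indicator {0..} \<xi> *\<^sub>R exp (\<i> * w * of_real \<xi>))"
    and "(LINT \<xi>|lborel. indicator {0..} \<xi> *\<^sub>R exp (\<i> * w * of_real \<xi>)) = \<i> / w"
proof -
  have nw: "norm (indicator {0..} \<xi> *\<^sub>R exp (\<i> * w * of_real \<xi>)) = indicator {0..} \<xi> * exp (- Im w * \<xi>)" for \<xi> :: real
    unfolding norm_scaleR cmod_exp_iw by simp
  have [measurable]: "(\<lambda>\<xi>. exp (\<i> * w * complex_of_real \<xi>)) \<in> borel_measurable borel"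
    by (intro borel_measurable_continuous_onI continuous_intros)
  show int: "integrable lborel (\<lambda>\<xi>. indicator {0..} \<xi> *\<^sub>R exp (\<i> * w * of_real \<xi>))"
    by (rule Bochner_Integration.integrable_bound[OF exp_half_line(1)[OF w]]) (simp_all add: nw)
  have "(\<lambda>n. LINT \<xi>|lborel. indicator {0..real n} \<xi> *\<^sub>R exp (\<i> * w * of_real \<xi>))
      \<longlonglongrightarrow> (LINT \<xi>|lborel. indicator {0..} \<xi> *\<^sub>R exp (\<i> * w * of_real \<xi>))"
  proof (rule integral_dominated_convergence[OF _ _ exp_half_line(1)[OF w]])
    show "AE \<xi> in lborel. (\<lambda>n. indicator {0..real n} \<xi> *\<^sub>R exp (\<i> * w * of_real \<xi>))
        \<longlonglongrightarrow> indicator {0..} \<xi> *\<^sub>R exp (\<i> * w * of_real \<xi>)"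
    proof (intro AE_I2 tendsto_scaleR tendsto_const tendsto_eventually)
      fix \<xi> :: real
      obtain N :: nat where "\<xi> \<le> N" using real_arch_simple by blast
      then have "indicator {0..real n} \<xi> = (indicator {0..} \<xi> :: real)" if "n \<ge> N" for n
        using that by (auto simp: indicator_def)
      then show "\<forall>\<^sub>F n in sequentially. indicator {0..real n} \<xi> = (indicator {0..} \<xi> :: real)"
        using eventually_sequentially by blast
    qed
    show "AE \<xi> in lborel. norm (indicator {0..real n} \<xi> *\<^sub>R exp (\<i> * w * of_real \<xi>)) \<le> indicator {0..} \<xi> * exp (- Im w * \<xi>)" for n
      unfolding norm_scaleR cmod_exp_iw by (auto simp: indicator_def)
  qed measurable
  moreover have "(\<lambda>n. LINT \<xi>|lborel. indicator {0..real n} \<xi> *\<^sub>R exp (\<i> * w * of_real \<xi>)) \<longlonglongrightarrow> (0 - 1) / (\<i> * w)"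
  proof -
    have w0: "w \<noteq> 0" using w by auto
    have "(\<lambda>n. exp (- Im w) ^ n) \<longlonglongrightarrow> 0" using w by (intro LIMSEQ_power_zero) simp
    then have "(\<lambda>n. exp (- Im w * real n)) \<longlonglongrightarrow> 0"
      by (simp add: exp_of_nat_mult[symmetric] mult.commute)
    then have "(\<lambda>n. exp (\<i> * w * of_real (real n))) \<longlonglongrightarrow> 0"
      by (rule tendsto_norm_zero_cancel[OF Lim_transform_eventually]) (simp add: cmod_exp_iw del: of_real_of_nat_eq)
    then have "(\<lambda>n. (exp (\<i> * w * of_real (real n)) - 1) / (\<i> * w)) \<longlonglongrightarrow> (0 - 1) / (\<i> * w)"
      using w0 by (intro tendsto_intros) auto
    then show ?thesis by (simp only: exp_interval_integral[OF w0 of_nat_0_le_iff])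
  qed
  ultimately have "(LINT \<xi>|lborel. indicator {0..} \<xi> *\<^sub>R exp (\<i> * w * of_real \<xi>)) = (0 - 1) / (\<i> * w)"
    by (rule LIMSEQ_unique)
  also have "\<dots> = \<i> / w" using w by (simp add: divide_simps)
  finally show "(LINT \<xi>|lborel. indicator {0..} \<xi> *\<^sub>R exp (\<i> * w * of_real \<xi>)) = \<i> / w" .
qed

definition cauchy_kernel :: "complex \<Rightarrow> real \<Rightarrow> complex" where
  "cauchy_kernel z x = 1 / (of_real x - z)"

lemma of_real_minus_nonzero: "Im z > 0 \<Longrightarrow> of_real x - z \<noteq> 0"
  by (auto simp: complex_eq_iff)

lemma cmod_cauchy_kernel_le: "Im z > 0 \<Longrightarrow> cmod (cauchy_kernel z x) \<le> 1 / Im z"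
  using abs_Im_le_cmod[of "of_real x - z"]
  by (auto simp: cauchy_kernel_def norm_divide intro!: divide_left_mono mult_pos_pos)

lemma continuous_cauchy_kernel: "Im z > 0 \<Longrightarrow> continuous_on UNIV (cauchy_kernel z)"
  unfolding cauchy_kernel_def[abs_def] using of_real_minus_nonzero by (intro continuous_intros) auto

lemma measurable_cauchy_kernel: "Im z > 0 \<Longrightarrow> cauchy_kernel z \<in> borel_measurable borel"
  by (intro borel_measurable_continuous_onI continuous_cauchy_kernel)

text \<open>
  On the positive half line the exponential of the Poisson integral is integrable, and its transform is the conjugate Cauchy kernel.
\<close>

definition poisson_symbol :: "complex \<Rightarrow> complex^'n^'m \<Rightarrow> real \<Rightarrow> complex^'n^'m" where
  "poisson_symbol z A \<xi> = (indicator {0..} \<xi> *\<^sub>R exp (\<i> * (- cnj z) * of_real \<xi>)) *\<^sub>M A"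

lemma poisson_symbol:
  assumes z: "Im z > 0"
  shows "integrable lborel (poisson_symbol z A)" "square_integrable (poisson_symbol z A)"
    and "fourier_L1 (poisson_symbol z A) (- x) = (\<i> * cnj (cauchy_kernel z x)) *\<^sub>M A"
proof -
  have z': "Im (- cnj z) > 0" using z by simp
  note e = exp_half_line_complex[OF z']
  have c: "(\<lambda>\<xi>. indicator {0..} \<xi> *\<^sub>R exp (\<i> * (- cnj z) * complex_of_real \<xi>)) \<in> borel_measurable borel"
    using borel_measurable_integrable[OF e(1)] by simp
  show 1: "integrable lborel (poisson_symbol z A)"
    unfolding poisson_symbol_def[abs_def]
    by (rule integrable_bounded_linear[OF bounded_linear_mscale_left e(1)])
  have n: "norm (poisson_symbol z A \<xi>) = indicator {0..} \<xi> * exp (- Im z * \<xi>) * norm A" for \<xi>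
    unfolding poisson_symbol_def norm_mscale norm_scaleR cmod_exp_iw by simp
  have n2: "(norm (poisson_symbol z A \<xi>))\<^sup>2 = indicator {0..} \<xi> * exp (- (2 * Im z) * \<xi>) * (norm A)\<^sup>2" for \<xi>
    unfolding n power_mult_distrib
    by (simp add: indicator_def power2_eq_square exp_add[symmetric])
  have "integrable lborel (\<lambda>\<xi>. indicator {0..} \<xi> * exp (- (2 * Im z) * \<xi>) * (norm A)\<^sup>2)"
    by (intro integrable_mult_left exp_half_line) (use z in simp)
  then show "square_integrable (poisson_symbol z A)"
    unfolding square_integrable_def n2 using borel_measurable_integrable[OF 1] by simp
  have w: "Im (of_real x - cnj z) > 0" using z by simp
  have "fourier_L1 (poisson_symbol z A) (- x)
      = (LINT \<xi>|lborel. (indicator {0..} \<xi> *\<^sub>R exp (\<i> * (of_real x - cnj z) * of_real \<xi>)) *\<^sub>M A)"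
    unfolding fourier_L1_cis poisson_symbol_def
  proof (intro Bochner_Integration.integral_cong refl)
    fix \<xi>
    have "cis (- (\<xi> * - x)) * exp (\<i> * (- cnj z) * of_real \<xi>) = exp (\<i> * (of_real x - cnj z) * of_real \<xi>)"
      unfolding cis_conv_exp exp_add[symmetric] by (simp add: algebra_simps)
    then show "cis (- (\<xi> * - x)) *\<^sub>M ((indicator {0..} \<xi> *\<^sub>R exp (\<i> * (- cnj z) * of_real \<xi>)) *\<^sub>M A)
        = (indicator {0..} \<xi> *\<^sub>R exp (\<i> * (of_real x - cnj z) * of_real \<xi>)) *\<^sub>M A"
      by (simp only: mscale_simps mult_scaleR_right)
  qed
  also have "\<dots> = (\<i> / (of_real x - cnj z)) *\<^sub>M A"
    by (subst integral_bounded_linear[OF bounded_linear_mscale_left])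
      (simp_all add: exp_half_line_complex[OF w])
  also have "\<i> / (of_real x - cnj z) = \<i> * cnj (cauchy_kernel z x)"
    by (simp add: cauchy_kernel_def)
  finally show "fourier_L1 (poisson_symbol z A) (- x) = (\<i> * cnj (cauchy_kernel z x)) *\<^sub>M A" .
qed

lemma fourier_conj_kernel:
  assumes z: "Im z > 0"
  shows "square_integrable (\<lambda>x. cnj (cauchy_kernel z x) *\<^sub>M A)"
    and "fourier_L2 (abs_L2 (\<lambda>x. cnj (cauchy_kernel z x) *\<^sub>M A)) = abs_L2 (\<lambda>\<xi>. (- 2 * pi * \<i>) *\<^sub>M poisson_symbol z A \<xi>)"
    and "szego_L2 (abs_L2 (\<lambda>x. cnj (cauchy_kernel z x) *\<^sub>M A)) = abs_L2 (\<lambda>x. cnj (cauchy_kernel z x) *\<^sub>M A)"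
proof -
  let ?B = "(- \<i>) *\<^sub>M A"
  note p = poisson_symbol[OF z, of ?B]
  have eq: "fourier_L1 (poisson_symbol z ?B) (- x) = cnj (cauchy_kernel z x) *\<^sub>M A" for x
  proof -
    have "(\<i> * w) * (- \<i>) = w" for w by (simp add: complex_eq_iff)
    then show ?thesis unfolding p(3) mscale_simps(4) by (simp only:)
  qed
  show s: "square_integrable (\<lambda>x. cnj (cauchy_kernel z x) *\<^sub>M A)"
    using ifourier_abs(2)[OF p(1,2)] by (simp only: eq)
  have "ifourier_L2 (abs_L2 (poisson_symbol z ?B)) = abs_L2 (\<lambda>x. (1 / (2 * pi)) *\<^sub>R (cnj (cauchy_kernel z x) *\<^sub>M A))"
    by (simp only: ifourier_abs(1)[OF p(1,2)] eq)
  also have "\<dots> = (1 / (2 * pi)) *\<^sub>R abs_L2 (\<lambda>x. cnj (cauchy_kernel z x) *\<^sub>M A)" by (rule abs_L2_scaleR[OF s])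
  finally have "abs_L2 (\<lambda>x. cnj (cauchy_kernel z x) *\<^sub>M A) = (2 * pi) *\<^sub>R ifourier_L2 (abs_L2 (poisson_symbol z ?B))"
    by simp
  then have "fourier_L2 (abs_L2 (\<lambda>x. cnj (cauchy_kernel z x) *\<^sub>M A)) = (2 * pi) *\<^sub>R abs_L2 (poisson_symbol z ?B)"
    by (simp add: linear_cmul[OF bounded_linear.linear[OF bounded_linear_fourier_L2]])
  also have "\<dots> = abs_L2 (\<lambda>\<xi>. (2 * pi) *\<^sub>R poisson_symbol z ?B \<xi>)" by (rule abs_L2_scaleR[OF p(2), symmetric])
  also have "(\<lambda>\<xi>. (2 * pi) *\<^sub>R poisson_symbol z ?B \<xi>) = (\<lambda>\<xi>. (- 2 * pi * \<i>) *\<^sub>M poisson_symbol z A \<xi>)"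
    by (rule ext) (simp add: poisson_symbol_def mscale_of_real[symmetric] ac_simps)
  finally show f: "fourier_L2 (abs_L2 (\<lambda>x. cnj (cauchy_kernel z x) *\<^sub>M A)) = abs_L2 (\<lambda>\<xi>. (- 2 * pi * \<i>) *\<^sub>M poisson_symbol z A \<xi>)" .
  have "square_integrable (\<lambda>\<xi>. (- 2 * pi * \<i>) *\<^sub>M poisson_symbol z A \<xi>)"
    by (intro square_integrable_mscale poisson_symbol z)
  from rep_L2_abs_L2[OF this]
  show "szego_L2 (abs_L2 (\<lambda>x. cnj (cauchy_kernel z x) *\<^sub>M A)) = abs_L2 (\<lambda>x. cnj (cauchy_kernel z x) *\<^sub>M A)"
    unfolding szego_plus_iff f by eventually_elim (simp add: poisson_symbol_def)
qed

lemma integrable_cauchy_kernel_mult: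
  fixes f :: "real \<Rightarrow> complex^'n^'m"
  assumes z: "Im z > 0" and f: "square_integrable f"
  shows "integrable lborel (\<lambda>x. cauchy_kernel z x *\<^sub>M f x)"
proof -
  let ?A = "axis undefined (axis undefined 1) :: complex^'n^'m"
  have A: "norm ?A = 1" by simp
  note [measurable] = measurable_cauchy_kernel[OF z] square_integrable_measurable[OF f]
  have "integrable lborel (\<lambda>x. norm (cnj (cauchy_kernel z x) *\<^sub>M ?A) * norm (f x))"
    by (intro integrable_norm_mult fourier_conj_kernel z f)
  then show ?thesis
    by (rule Bochner_Integration.integrable_bound) (simp_all add: norm_mscale A)
qed

text \<open>
  The Poisson integral as a Cauchy integral. Paired with a fixed matrix, both sides are inner products with the conjugate
  kernel, before and after the Fourier transform, so this is Plancherel's theorem.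
\<close>

theorem cauchy_kernel_integral:
  fixes f :: "real \<Rightarrow> complex^'n^'m"
  assumes z: "Im z > 0" and f: "square_integrable f"
  shows "(LINT x|lborel. cauchy_kernel z x *\<^sub>M f x) = (2 * pi * \<i>) *\<^sub>M poisson (abs_L2 f) z"
proof (rule vector_eq_rdot[THEN iffD1], rule allI)
  fix A :: "complex^'n^'m"
  let ?F = "fourier_L2 (abs_L2 f)"
  note p = poisson_symbol[OF z, of A] and k = fourier_conj_kernel[OF z, of A]
  have "(LINT x|lborel. cauchy_kernel z x *\<^sub>M f x) \<bullet> A = (LINT x|lborel. f x \<bullet> (cnj (cauchy_kernel z x) *\<^sub>M A))"
    by (subst integral_inner_left[symmetric]) (simp_all add: integrable_cauchy_kernel_mult z f inner_mscale_left)
  also have "\<dots> = abs_L2 f \<bullet> abs_L2 (\<lambda>x. cnj (cauchy_kernel z x) *\<^sub>M A)"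
    by (simp add: inner_abs_L2 f k(1))
  also have "\<dots> = (1 / (2 * pi)) * (?F \<bullet> abs_L2 (\<lambda>\<xi>. (- 2 * pi * \<i>) *\<^sub>M poisson_symbol z A \<xi>))"
    using plancherel[of "abs_L2 f" "abs_L2 (\<lambda>x. cnj (cauchy_kernel z x) *\<^sub>M A)"] by (simp add: k(2))
  also have "?F \<bullet> abs_L2 (\<lambda>\<xi>. (- 2 * pi * \<i>) *\<^sub>M poisson_symbol z A \<xi>)
      = (LINT \<xi>|lborel. rep_L2 ?F \<xi> \<bullet> ((- 2 * pi * \<i>) *\<^sub>M poisson_symbol z A \<xi>))"
    using inner_abs_L2[OF square_integrable_rep_L2 square_integrable_mscale[OF p(2)], of ?F "- 2 * pi * \<i>"]
    by (simp only: abs_L2_rep_L2)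
  also have "\<dots> = (LINT \<xi>|lborel. ((2 * pi * \<i>) *\<^sub>M (indicator {0..} \<xi> *\<^sub>R (exp (\<i> * z * of_real \<xi>) *\<^sub>M rep_L2 ?F \<xi>))) \<bullet> A)"
  proof (intro Bochner_Integration.integral_cong refl)
    fix \<xi>
    have "rep_L2 ?F \<xi> \<bullet> ((- 2 * pi * \<i>) *\<^sub>M poisson_symbol z A \<xi>)
       = (cnj ((- 2 * pi * \<i>) * (indicator {0..} \<xi> *\<^sub>R exp (\<i> * (- cnj z) * of_real \<xi>))) *\<^sub>M rep_L2 ?F \<xi>) \<bullet> A"
      unfolding inner_mscale_left poisson_symbol_def by simp
    also have "cnj ((- 2 * pi * \<i>) * (indicator {0..} \<xi> *\<^sub>R exp (\<i> * (- cnj z) * of_real \<xi>)))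
       = (2 * pi * \<i>) * (indicator {0..} \<xi> *\<^sub>R exp (\<i> * z * of_real \<xi>))"
      by (simp add: exp_cnj)
    finally show "rep_L2 ?F \<xi> \<bullet> ((- 2 * pi * \<i>) *\<^sub>M poisson_symbol z A \<xi>)
       = ((2 * pi * \<i>) *\<^sub>M (indicator {0..} \<xi> *\<^sub>R (exp (\<i> * z * of_real \<xi>) *\<^sub>M rep_L2 ?F \<xi>))) \<bullet> A"
      by (simp only: mscale_simps mscale_scaleR_left[symmetric] mult_scaleR_right)
  qed
  also have "\<dots> = ((2 * pi * \<i>) *\<^sub>M (LINT \<xi>|lborel. indicator {0..} \<xi> *\<^sub>R (exp (\<i> * z * of_real \<xi>) *\<^sub>M rep_L2 ?F \<xi>))) \<bullet> A"
  proof -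
    have m: "(\<lambda>\<xi>. exp (\<i> * z * complex_of_real \<xi>)) \<in> borel_measurable borel"
      by (intro borel_measurable_continuous_onI continuous_intros)
    let ?B = "axis undefined (axis undefined 1) :: complex^'n^'m"
    have i: "integrable lborel (\<lambda>\<xi>. norm (poisson_symbol z ?B \<xi>) * norm (rep_L2 ?F \<xi>))"
      by (intro integrable_norm_mult poisson_symbol z square_integrable_rep_L2)
    have n: "norm (poisson_symbol z ?B \<xi>) = indicator {0..} \<xi> * exp (- Im z * \<xi>)" for \<xi>
      unfolding poisson_symbol_def norm_mscale norm_scaleR cmod_exp_iw by simp
    have int: "integrable lborel (\<lambda>\<xi>. indicator {0..} \<xi> *\<^sub>R (exp (\<i> * z * of_real \<xi>) *\<^sub>M rep_L2 ?F \<xi>))"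
    proof (rule Bochner_Integration.integrable_bound[OF i])
      show "(\<lambda>\<xi>. indicator {0..} \<xi> *\<^sub>R (exp (\<i> * z * of_real \<xi>) *\<^sub>M rep_L2 ?F \<xi>)) \<in> borel_measurable lborel"
        using measurable_mscale[OF m rep_L2_measurable[of ?F]] by measurable
    qed (unfold n norm_scaleR norm_mscale cmod_exp_iw, simp)
    have "bounded_linear (\<lambda>B. ((2 * pi * \<i>) *\<^sub>M B) \<bullet> A)"
      by (rule bounded_linear_compose[OF bounded_linear_inner_left bounded_linear_mscale])
    from integral_bounded_linear[OF this int] show ?thesis .
  qed
  finally show "(LINT x|lborel. cauchy_kernel z x *\<^sub>M f x) \<bullet> A = ((2 * pi * \<i>) *\<^sub>M poisson (abs_L2 f) z) \<bullet> A"
    by (simp add: poisson_def set_lebesgue_integral_def mscale_scaleR_right)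
qed

section \<open>The resolvent of \<open>G\<close>\<close>

text \<open>
  The Cauchy kernel as a scalar matrix, to reuse the multiplication operators; its adjoint is plus.
\<close>

definition kern :: "complex \<Rightarrow> (real \<Rightarrow>\<^sub>C (complex^'m^'m))" where
  "kern z = Bcontfun (\<lambda>x. cauchy_kernel z x *\<^sub>M mat 1)"

lemma mat_1_mult [simp]: "(mat 1 :: complex^'m^'m) ** A = A" "A ** (mat 1 :: complex^'m^'m) = A"
  by simp_all

lemma apply_kern:
  assumes z: "Im z > 0"
  shows "apply_bcontfun (kern z) x = cauchy_kernel z x *\<^sub>M (mat 1 :: complex^'m^'m)"
proof -
  have "(\<lambda>x. cauchy_kernel z x *\<^sub>M (mat 1 :: complex^'m^'m)) \<in> bcontfun"
  proof (rule bcontfun_normI)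
    show "continuous_on UNIV (\<lambda>x. cauchy_kernel z x *\<^sub>M (mat 1 :: complex^'m^'m))"
      by (intro continuous_intros continuous_cauchy_kernel z)
    show "norm (cauchy_kernel z x *\<^sub>M (mat 1 :: complex^'m^'m)) \<le> (1 / Im z) * norm (mat 1 :: complex^'m^'m)" for x
      unfolding norm_mscale by (intro mult_right_mono cmod_cauchy_kernel_le z) simp
  qed
  then show ?thesis by (simp add: kern_def Bcontfun_inverse)
qed

lemma ctranspose_mat_1 [simp]: "ctranspose (mat 1 :: complex^'m^'m) = mat 1"
  by (simp add: vec_eq_iff mat_def)

lemma bplus_bstar_kern:
  assumes z: "Im z > 0" shows "bplus (bstar (kern z :: real \<Rightarrow>\<^sub>C (complex^'m^'m)))"
proof -
  have "apply_bcontfun (bstar (kern z :: real \<Rightarrow>\<^sub>C (complex^'m^'m))) = (\<lambda>x. cnj (cauchy_kernel z x) *\<^sub>M mat 1)"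
    by (rule ext) (simp add: apply_kern z)
  then show ?thesis by (simp add: bplus_def fourier_conj_kernel[OF z])
qed

text \<open>
  The minus function \<open>A / (x - z)\<close>, the error made when \<open>1 / (x - z)\<close> is applied to a plus function.
\<close>

definition kvec :: "complex \<Rightarrow> complex^'n^'m \<Rightarrow> (complex^'n^'m) L2" where
  "kvec z A = abs_L2 (\<lambda>x. cauchy_kernel z x *\<^sub>M A)"

lemma square_integrable_cauchy_kernel:
  assumes z: "Im z > 0" shows "square_integrable (\<lambda>x. cauchy_kernel z x *\<^sub>M A)"
  using square_integrable_multiplier[OF multiplier_ctranspose fourier_conj_kernel(1)[OF z, of "ctranspose A"]] by simp

lemma szego_kvec:
  assumes z: "Im z > 0" shows "szego_L2 (kvec z A) = 0"
proof -
  have "kvec z A = star (abs_L2 (\<lambda>x. cnj (cauchy_kernel z x) *\<^sub>M ctranspose A))"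
    by (simp add: kvec_def L2_map_abs[OF multiplier_ctranspose fourier_conj_kernel(1)[OF z]])
  then show ?thesis using szego_star_of_plus[OF fourier_conj_kernel(3)[OF z]] by simp
qed

lemma bounded_linear_kvec:
  assumes z: "Im z > 0" shows "bounded_linear (kvec z :: complex^'n^'m \<Rightarrow> _)"
proof -
  note s = square_integrable_cauchy_kernel[OF z]
  let ?B = "axis undefined (axis undefined 1) :: complex^'n^'m"
  show ?thesis
  proof (rule bounded_linear_intro[where K = "norm (abs_L2 (\<lambda>x. cauchy_kernel z x *\<^sub>M ?B))"])
    show "kvec z (A + B) = kvec z A + kvec z B" for A B :: "complex^'n^'m"
      unfolding kvec_def by (simp add: mscale_add_right abs_L2_add s)
    show "kvec z (r *\<^sub>R A) = r *\<^sub>R kvec z A" for r and A :: "complex^'n^'m"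
      unfolding kvec_def by (simp add: mscale_scaleR_right abs_L2_scaleR s)
    show "norm (kvec z A) \<le> norm A * norm (abs_L2 (\<lambda>x. cauchy_kernel z x *\<^sub>M ?B))" for A :: "complex^'n^'m"
      unfolding kvec_def by (rule norm_abs_L2_le[OF s s]) (auto simp: norm_mscale)
  qed
qed

lemma rep_lmul_kern:
  "Im z > 0 \<Longrightarrow> AE x in lborel. rep_L2 (lmul (kern z) F) x = cauchy_kernel z x *\<^sub>M rep_L2 F x"
  using rep_lmul[of "kern z" F] by (simp add: apply_kern)

lemma bounded_linear_poisson:
  assumes z: "Im z > 0"
  shows "bounded_linear (\<lambda>F :: (complex^'n^'m) L2. poisson F z)"
proof -
  let ?B = "axis undefined (axis undefined 1) :: complex^'n^'m"
  let ?P = "\<lambda>F :: (complex^'n^'m) L2. LINT x|lborel. cauchy_kernel z x *\<^sub>M rep_L2 F x"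
  have eq: "poisson F z = (1 / (2 * pi * \<i>)) *\<^sub>M ?P F" for F :: "(complex^'n^'m) L2"
    using cauchy_kernel_integral[OF z square_integrable_rep_L2, of F] by simp
  note int = integrable_cauchy_kernel_mult[OF z square_integrable_rep_L2]
  note [measurable] = measurable_cauchy_kernel[OF z]
  have "bounded_linear ?P"
  proof (rule bounded_linear_intro[where K = "norm (abs_L2 (\<lambda>x. cauchy_kernel z x *\<^sub>M ?B))"])
    show "?P (F + G) = ?P F + ?P G" for F G
    proof -
      have "?P (F + G) = (LINT x|lborel. cauchy_kernel z x *\<^sub>M rep_L2 F x + cauchy_kernel z x *\<^sub>M rep_L2 G x)"
        by (rule integral_cong_AE) (use rep_L2_add[of F G] in \<open>auto simp: mscale_add_right\<close>)
      then show ?thesis by (simp add: int)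
    qed
    show "?P (r *\<^sub>R F) = r *\<^sub>R ?P F" for r F
    proof -
      have "?P (r *\<^sub>R F) = (LINT x|lborel. r *\<^sub>R (cauchy_kernel z x *\<^sub>M rep_L2 F x))"
        by (rule integral_cong_AE) (use rep_L2_scaleR[of r F] in \<open>auto simp: mscale_scaleR_right\<close>)
      then show ?thesis by simp
    qed
    show "norm (?P F) \<le> norm F * norm (abs_L2 (\<lambda>x. cauchy_kernel z x *\<^sub>M ?B))" for F
    proof -
      have "norm (?P F) \<le> (LINT x|lborel. norm (rep_L2 F x) * norm (cauchy_kernel z x *\<^sub>M ?B))"
        by (rule order_trans[OF integral_norm_bound]) (simp add: norm_mscale mult.commute)
      also have "\<dots> \<le> norm (abs_L2 (rep_L2 F)) * norm (abs_L2 (\<lambda>x. cauchy_kernel z x *\<^sub>M ?B))"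
        by (rule integral_norm_mult_le) (simp_all add: square_integrable_cauchy_kernel z)
      finally show ?thesis by simp
    qed
  qed
  then show ?thesis unfolding eq by (rule bounded_linear_compose[OF bounded_linear_mscale])
qed

definition half_exp :: "complex \<Rightarrow> real \<Rightarrow> complex" where
  "half_exp z s = indicator {0..} s *\<^sub>R exp (\<i> * z * of_real s)"

lemma measurable_half_exp [measurable]: "half_exp z \<in> borel_measurable borel"
proof -
  have [measurable]: "(\<lambda>\<xi>. exp (\<i> * z * complex_of_real \<xi>)) \<in> borel_measurable borel"
    by (intro borel_measurable_continuous_onI continuous_intros)
  show ?thesis unfolding half_exp_def[abs_def] by measurable
qed

lemma cmod_half_exp: "cmod (half_exp z s) = indicator {0..} s * exp (- Im z * s)"
  unfolding half_exp_def norm_scaleR cmod_exp_iw by simp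

lemma square_integrable_half_exp_affine:
  assumes z: "Im z > 0" shows "square_integrable (\<lambda>\<eta>. half_exp z (\<eta> - \<xi>))"
proof -
  have n2: "(norm (half_exp z s))\<^sup>2 = indicator {0..} s * exp (- (2 * Im z) * s)" for s
    unfolding cmod_half_exp power_mult_distrib by (simp add: indicator_def power2_eq_square exp_add[symmetric])
  have "square_integrable (half_exp z)"
    unfolding square_integrable_def n2 using exp_half_line(1)[of "2 * Im z"] z by simp
  from square_integrable_affine[OF _ this, of 1 "- \<xi>"] show ?thesis by simp
qed

lemma integrable_half_exp_mult:
  fixes q :: "real \<Rightarrow> complex^'n^'m"
  assumes z: "Im z > 0" and q: "square_integrable q"
  shows "integrable lborel (\<lambda>\<eta>. half_exp z (\<eta> - \<xi>) *\<^sub>M q \<eta>)"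
proof (rule Bochner_Integration.integrable_bound)
  show "integrable lborel (\<lambda>\<eta>. norm (half_exp z (\<eta> - \<xi>)) * norm (q \<eta>))"
    by (intro integrable_norm_mult square_integrable_half_exp_affine z q)
qed (use square_integrable_measurable[OF q] in \<open>auto simp: norm_mscale\<close>)

text \<open>
  The Fourier side of the resolvent: the solution on the half line, decaying at infinity, of \<open>\<i> f' - z f = q\<close>.
\<close>

definition res_hat :: "complex \<Rightarrow> (real \<Rightarrow> complex^'n^'m) \<Rightarrow> real \<Rightarrow> complex^'n^'m" where
  "res_hat z q \<xi> = indicator {0..} \<xi> *\<^sub>R (\<i> *\<^sub>M (LINT \<eta>|lborel. half_exp z (\<eta> - \<xi>) *\<^sub>M q \<eta>))"

lemma square_integrable_of_bounded:
  assumes f: "integrable lborel f" and b: "\<And>x. norm (f x) \<le> B"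
  shows "square_integrable (f :: real \<Rightarrow> 'a::euclidean_space)"
proof -
  have "integrable lborel (\<lambda>x. (norm (f x))\<^sup>2)"
  proof (rule Bochner_Integration.integrable_bound)
    show "integrable lborel (\<lambda>x. B * norm (f x))" using f by simp
    have "(norm (f x))\<^sup>2 \<le> \<bar>B\<bar> * norm (f x)" for x
      unfolding power2_eq_square using b[of x] by (intro mult_right_mono) auto
    then show "AE x in lborel. norm ((norm (f x))\<^sup>2) \<le> norm (B * norm (f x))" by (simp add: abs_mult)
  qed (use f in auto)
  then show ?thesis using f by (auto simp: square_integrable_def)
qed

text \<open>
  For integrable data the transform of the double integral is computed by Fubini.
\<close>

lemma res_hat_L1:
  fixes q :: "real \<Rightarrow> complex^'n^'m"
  assumes z: "Im z > 0" and q: "integrable lborel q" "\<And>\<eta>. \<eta> < 0 \<Longrightarrow> q \<eta> = 0"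
  shows "integrable lborel (res_hat z q)" "square_integrable (res_hat z q)"
    and "fourier_L1 (res_hat z q) (- x)
       = cauchy_kernel z x *\<^sub>M (fourier_L1 q (- x) - (LINT \<eta>|lborel. exp (\<i> * z * of_real \<eta>) *\<^sub>M q \<eta>))"
proof -
  note [measurable] = borel_measurable_integrable[OF q(1)]
  define h where "h = (\<lambda>(\<eta>, \<xi>). (indicator {0..} \<xi> * (\<i> * half_exp z (\<eta> - \<xi>))) *\<^sub>M q \<eta>)"
  have [measurable]: "h \<in> borel_measurable (lborel \<Otimes>\<^sub>M lborel)" unfolding h_def by measurable
  have hi: "integrable (lborel \<Otimes>\<^sub>M lborel) h"
  proof (rule Bochner_Integration.integrable_bound)
    show "integrable (lborel \<Otimes>\<^sub>M lborel) (\<lambda>(\<eta>, \<xi>). cmod (half_exp z (\<eta> - \<xi>)) * norm (q \<eta>))"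
    proof (rule lborel_pair.Fubini_integrable)
      have e: "has_bochner_integral lborel (\<lambda>\<xi>. cmod (half_exp z (\<eta> - \<xi>))) (1 / Im z)" for \<eta>
        using lborel_has_bochner_integral_real_affine_iff[of "- 1" "\<lambda>s. cmod (half_exp z s)" "1 / Im z" \<eta>]
          exp_half_line[OF z] by (simp add: cmod_half_exp has_bochner_integral_iff)
      have "(LINT \<xi>|lborel. norm (case (\<eta>, \<xi>) of (\<eta>, \<xi>) \<Rightarrow> cmod (half_exp z (\<eta> - \<xi>)) * norm (q \<eta>))) = (1 / Im z) * norm (q \<eta>)" for \<eta>
        using e[of \<eta>] by (simp add: has_bochner_integral_iff)
      then show "integrable lborel (\<lambda>\<eta>. LINT \<xi>|lborel. norm (case (\<eta>, \<xi>) of (\<eta>, \<xi>) \<Rightarrow> cmod (half_exp z (\<eta> - \<xi>)) * norm (q \<eta>)))"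
        using q(1) by simp
      show "AE \<eta> in lborel. integrable lborel (\<lambda>\<xi>. case (\<eta>, \<xi>) of (\<eta>, \<xi>) \<Rightarrow> cmod (half_exp z (\<eta> - \<xi>)) * norm (q \<eta>))"
        using e by (simp add: has_bochner_integral_iff)
    qed measurable
    show "AE p in lborel \<Otimes>\<^sub>M lborel. norm (h p) \<le> norm (case p of (\<eta>, \<xi>) \<Rightarrow> cmod (half_exp z (\<eta> - \<xi>)) * norm (q \<eta>))"
      by (auto simp: h_def norm_mscale norm_mult indicator_def split: prod.split)
  qed measurable
  have hi': "integrable (lborel \<Otimes>\<^sub>M lborel) (\<lambda>(\<xi>, \<eta>). h (\<eta>, \<xi>))"
    by (rule lborel_pair.integrable_product_swap[OF hi])
  have qi: "integrable lborel (\<lambda>\<eta>. half_exp z (\<eta> - \<xi>) *\<^sub>M q \<eta>)" for \<xi>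
  proof (rule Bochner_Integration.integrable_bound[OF q(1)])
    have "cmod (half_exp z s) \<le> 1" for s using z by (auto simp: cmod_half_exp indicator_def)
    then show "AE \<eta> in lborel. norm (half_exp z (\<eta> - \<xi>) *\<^sub>M q \<eta>) \<le> norm (q \<eta>)"
      by (auto simp: norm_mscale intro!: mult_left_le_one_le)
  qed measurable
  have rh: "res_hat z q \<xi> = (LINT \<eta>|lborel. h (\<eta>, \<xi>))" for \<xi>
  proof -
    have "(LINT \<eta>|lborel. h (\<eta>, \<xi>)) = (LINT \<eta>|lborel. indicator {0..} \<xi> *\<^sub>R (\<i> *\<^sub>M (half_exp z (\<eta> - \<xi>) *\<^sub>M q \<eta>)))"
      by (intro Bochner_Integration.integral_cong refl) (auto simp: h_def indicator_def)
    also have "\<dots> = res_hat z q \<xi>"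
      unfolding res_hat_def
      by (subst integral_bounded_linear[OF bounded_linear_mscale qi, symmetric]) simp
    finally show ?thesis by simp
  qed
  show i: "integrable lborel (res_hat z q)"
    using lborel_pair.integrable_fst'[OF hi'] by (simp add: rh[abs_def])
  have bnd: "norm (res_hat z q \<xi>) \<le> (LINT \<eta>|lborel. norm (q \<eta>))" for \<xi>
  proof -
    have "norm (res_hat z q \<xi>) \<le> norm (LINT \<eta>|lborel. half_exp z (\<eta> - \<xi>) *\<^sub>M q \<eta>)"
      by (simp add: res_hat_def norm_mscale indicator_def)
    also have "\<dots> \<le> (LINT \<eta>|lborel. norm (half_exp z (\<eta> - \<xi>) *\<^sub>M q \<eta>))" by (rule integral_norm_bound)
    also have "\<dots> \<le> (LINT \<eta>|lborel. norm (q \<eta>))"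
    proof (rule integral_mono)
      show "norm (half_exp z (\<eta> - \<xi>) *\<^sub>M q \<eta>) \<le> norm (q \<eta>)" for \<eta>
        using z by (auto simp: norm_mscale cmod_half_exp indicator_def intro!: mult_left_le_one_le)
    qed (use qi q(1) in auto)
    finally show ?thesis .
  qed
  show "square_integrable (res_hat z q)" by (rule square_integrable_of_bounded[OF i bnd])
  have w0: "of_real x - z \<noteq> 0" using of_real_minus_nonzero[OF z] .
  have "fourier_L1 (res_hat z q) (- x) = (LINT \<xi>|lborel. LINT \<eta>|lborel. cis (x * \<xi>) *\<^sub>M h (\<eta>, \<xi>))"
    unfolding fourier_L1_cis
  proof (intro integral_cong_AE)
    have "AE \<xi> in lborel. integrable lborel (\<lambda>\<eta>. h (\<eta>, \<xi>))"
      using lborel_pair.AE_integrable_fst'[OF hi'] by simp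
    then show "AE \<xi> in lborel. cis (- (\<xi> * - x)) *\<^sub>M res_hat z q \<xi> = (LINT \<eta>|lborel. cis (x * \<xi>) *\<^sub>M h (\<eta>, \<xi>))"
    proof eventually_elim
      case (elim \<xi>)
      show ?case unfolding rh
        by (subst integral_bounded_linear[OF bounded_linear_mscale elim]) (simp add: mult.commute)
    qed
  qed (use borel_measurable_integrable[OF i] in measurable)
  also have "\<dots> = (LINT \<eta>|lborel. LINT \<xi>|lborel. cis (x * \<xi>) *\<^sub>M h (\<eta>, \<xi>))"
  proof (rule lborel_pair.Fubini_integral)
    show "integrable (lborel \<Otimes>\<^sub>M lborel) (\<lambda>(\<eta>, \<xi>). cis (x * \<xi>) *\<^sub>M h (\<eta>, \<xi>))"
      by (rule Bochner_Integration.integrable_bound[OF hi]) (measurable, auto simp: norm_mscale)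
  qed
  also have "\<dots> = (LINT \<eta>|lborel. cauchy_kernel z x *\<^sub>M (cis (x * \<eta>) *\<^sub>M q \<eta> - exp (\<i> * z * of_real \<eta>) *\<^sub>M q \<eta>))"
  proof (intro Bochner_Integration.integral_cong refl)
    fix \<eta>
    show "(LINT \<xi>|lborel. cis (x * \<xi>) *\<^sub>M h (\<eta>, \<xi>)) = cauchy_kernel z x *\<^sub>M (cis (x * \<eta>) *\<^sub>M q \<eta> - exp (\<i> * z * of_real \<eta>) *\<^sub>M q \<eta>)"
    proof (cases "\<eta> < 0")
      case True then show ?thesis by (simp add: h_def q(2))
    next
      case False
      let ?e = "\<lambda>\<xi>. indicator {0..\<eta>} \<xi> *\<^sub>R exp (\<i> * (of_real x - z) * of_real \<xi>)"
      have "cis (x * \<xi>) *\<^sub>M h (\<eta>, \<xi>) = (\<i> * exp (\<i> * z * of_real \<eta>) * ?e \<xi>) *\<^sub>M q \<eta>" for \<xi>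
      proof -
        have "exp (\<i> * (x * \<xi>)) * exp (\<i> * z * of_real (\<eta> - \<xi>)) = exp (\<i> * z * of_real \<eta>) * exp (\<i> * (of_real x - z) * of_real \<xi>)"
          unfolding exp_add[symmetric] by (simp add: algebra_simps)
        moreover have "indicator {0..} \<xi> * indicator {0..} (\<eta> - \<xi>) = (indicator {0..\<eta>} \<xi> :: real)"
          by (auto simp: indicator_def)
        ultimately show ?thesis
          by (auto simp: h_def half_exp_def cis_conv_exp indicator_def split: if_splits)
            (metis mult.assoc mult.left_commute)
      qed
      then have "(LINT \<xi>|lborel. cis (x * \<xi>) *\<^sub>M h (\<eta>, \<xi>)) = (LINT \<xi>|lborel. (\<i> * exp (\<i> * z * of_real \<eta>) * ?e \<xi>) *\<^sub>M q \<eta>)"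
        by simp
      also have "\<dots> = (LINT \<xi>|lborel. \<i> * exp (\<i> * z * of_real \<eta>) * ?e \<xi>) *\<^sub>M q \<eta>"
      proof (rule integral_bounded_linear[OF bounded_linear_mscale_left])
        have "integrable lborel ?e"
          by (rule borel_integrable_compact) (auto intro!: continuous_intros)
        then show "integrable lborel (\<lambda>\<xi>. \<i> * exp (\<i> * z * of_real \<eta>) * ?e \<xi>)" by (rule integrable_mult_right)
      qed
      also have "(LINT \<xi>|lborel. \<i> * exp (\<i> * z * of_real \<eta>) * ?e \<xi>)
          = \<i> * exp (\<i> * z * of_real \<eta>) * ((exp (\<i> * (of_real x - z) * of_real \<eta>) - 1) / (\<i> * (of_real x - z)))"
        using exp_interval_integral[OF w0, of \<eta>] False by (simp only: integral_mult_right_zero not_less)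
      also have "\<dots> = cauchy_kernel z x * (cis (x * \<eta>) - exp (\<i> * z * of_real \<eta>))"
      proof -
        have "exp (\<i> * z * of_real \<eta>) * exp (\<i> * (of_real x - z) * of_real \<eta>) = cis (x * \<eta>)"
          unfolding cis_conv_exp exp_add[symmetric] by (simp add: algebra_simps)
        then show ?thesis using w0 by (simp add: cauchy_kernel_def field_simps)
      qed
      finally show ?thesis by (simp add: mscale_diff_left right_diff_distrib mscale_diff_right)
    qed
  qed
  also have "\<dots> = cauchy_kernel z x *\<^sub>M (fourier_L1 q (- x) - (LINT \<eta>|lborel. exp (\<i> * z * of_real \<eta>) *\<^sub>M q \<eta>))"
  proof -
    have i1: "integrable lborel (\<lambda>\<eta>. cis (x * \<eta>) *\<^sub>M q \<eta>)" by (intro integrable_cis_mscale q(1)) measurable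
    have [measurable]: "(\<lambda>\<xi>. exp (\<i> * z * complex_of_real \<xi>)) \<in> borel_measurable borel"
      by (intro borel_measurable_continuous_onI continuous_intros)
    have i2: "integrable lborel (\<lambda>\<eta>. exp (\<i> * z * of_real \<eta>) *\<^sub>M q \<eta>)"
    proof (rule Bochner_Integration.integrable_bound[OF q(1)])
      have "norm (exp (\<i> * z * of_real \<eta>) *\<^sub>M q \<eta>) \<le> norm (q \<eta>)" for \<eta>
      proof (cases "\<eta> < 0")
        case True then show ?thesis by (simp add: q(2))
      next
        case False
        then show ?thesis using z unfolding norm_mscale cmod_exp_iw by (intro mult_left_le_one_le) auto
      qed
      then show "AE \<eta> in lborel. norm (exp (\<i> * z * of_real \<eta>) *\<^sub>M q \<eta>) \<le> norm (q \<eta>)" by simp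
    qed measurable
    have "(LINT \<eta>|lborel. cis (x * \<eta>) *\<^sub>M q \<eta>) = fourier_L1 q (- x)"
      by (simp add: fourier_L1_cis mult.commute)
    then show ?thesis
      by (subst integral_bounded_linear[OF bounded_linear_mscale]) (use i1 i2 in simp_all)
  qed
  finally show "fourier_L1 (res_hat z q) (- x)
       = cauchy_kernel z x *\<^sub>M (fourier_L1 q (- x) - (LINT \<eta>|lborel. exp (\<i> * z * of_real \<eta>) *\<^sub>M q \<eta>))" .
qed

text \<open>
  The inverse of \<open>G - z\<close> on plus functions, extended to all of \<open>L\<^sup>2\<close> by the projector.
\<close>

definition res :: "complex \<Rightarrow> (complex^'n^'m) L2 \<Rightarrow> (complex^'n^'m) L2" where
  "res z F = szego_L2 (lmul (kern z) (szego_L2 F))"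

lemma fourier_kern_decomposition:
  fixes F :: "(complex^'n^'m) L2"
  assumes z: "Im z > 0" and F: "szego_L2 F = F"
  shows "AE \<xi> in lborel. rep_L2 (fourier_L2 (lmul (kern z) F - kvec z (poisson F z))) \<xi>
    = res_hat z (\<lambda>\<eta>. indicator {0..} \<eta> *\<^sub>R rep_L2 (fourier_L2 F) \<eta>) \<xi>"
proof -
  obtain k where k: "\<And>n. integrable lborel (k n)" "\<And>n. square_integrable (k n)"
    "\<And>n \<xi>. \<xi> < 0 \<Longrightarrow> k n \<xi> = 0" "(\<lambda>n. ifourier_L2 (abs_L2 (k n))) \<longlonglongrightarrow> F"
    "\<And>\<xi>. (\<lambda>n. k n \<xi>) \<longlonglongrightarrow> indicator {0..} \<xi> *\<^sub>R rep_L2 (fourier_L2 F) \<xi>"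
    "\<And>n \<xi>. norm (k n \<xi>) \<le> norm (rep_L2 (fourier_L2 F) \<xi>)"
    using plus_approximation[OF F] by metis
  let ?q = "\<lambda>\<eta>. indicator {0..} \<eta> *\<^sub>R rep_L2 (fourier_L2 F) \<eta>"
  let ?F = "\<lambda>n. ifourier_L2 (abs_L2 (k n))"
  let ?D = "\<lambda>F :: (complex^'n^'m) L2. lmul (kern z) F - kvec z (poisson F z)"
  have eq: "?D (?F n) = ifourier_L2 (abs_L2 (res_hat z (k n)))" for n
  proof -
    note r = res_hat_L1[OF z k(1)[of n] k(3)]
    let ?e = "LINT \<eta>|lborel. exp (\<i> * z * of_real \<eta>) *\<^sub>M k n \<eta>"
    have p: "poisson (?F n) z = (1 / (2 * pi)) *\<^sub>R ?e"
      unfolding poisson_def set_lebesgue_integral_def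
    proof (intro arg_cong[where f = "\<lambda>A. (1 / (2 * pi)) *\<^sub>R A"] integral_cong_AE)
      have [measurable]: "(\<lambda>\<xi>. exp (\<i> * z * complex_of_real \<xi>)) \<in> borel_measurable borel"
        by (intro borel_measurable_continuous_onI continuous_intros)
      note [measurable] = borel_measurable_integrable[OF k(1)]
      show "(\<lambda>\<xi>. indicat_real {0..} \<xi> *\<^sub>R (exp (\<i> * z * complex_of_real \<xi>) *\<^sub>M rep_L2 (fourier_L2 (?F n)) \<xi>)) \<in> borel_measurable lborel"
        "(\<lambda>\<eta>. exp (\<i> * z * complex_of_real \<eta>) *\<^sub>M k n \<eta>) \<in> borel_measurable lborel" by measurable
      show "AE \<xi> in lborel. indicat_real {0..} \<xi> *\<^sub>R (exp (\<i> * z * complex_of_real \<xi>) *\<^sub>M rep_L2 (fourier_L2 (?F n)) \<xi>) = exp (\<i> * z * complex_of_real \<xi>) *\<^sub>M k n \<xi>"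
        using rep_L2_abs_L2[OF k(2)[of n]] k(3)[of _ n]
        by (auto elim!: eventually_mono simp: indicator_def not_le)
    qed
    have s1: "square_integrable (\<lambda>x. (1 / (2 * pi)) *\<^sub>R fourier_L1 (k n) (- x))"
      by (intro square_integrable_scaleR ifourier_abs k)
    have "?D (?F n) = lmul (kern z) (?F n) - kvec z ((1 / (2 * pi)) *\<^sub>R ?e)" by (simp only: p)
    also have "\<dots> = abs_L2 (\<lambda>x. cauchy_kernel z x *\<^sub>M ((1 / (2 * pi)) *\<^sub>R fourier_L1 (k n) (- x)) - cauchy_kernel z x *\<^sub>M ((1 / (2 * pi)) *\<^sub>R ?e))"
      using square_integrable_multiplier[OF multiplier_lmul s1, of "kern z"]
      by (simp add: abs_L2_diff square_integrable_cauchy_kernel z ifourier_abs(1)[OF k(1,2)] lmul_abs[OF s1] apply_kern kvec_def)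
    also have "\<dots> = abs_L2 (\<lambda>x. (1 / (2 * pi)) *\<^sub>R fourier_L1 (res_hat z (k n)) (- x))"
      by (simp only: r(3) mscale_diff_right mscale_scaleR_right scaleR_diff_right)
    also have "\<dots> = ifourier_L2 (abs_L2 (res_hat z (k n)))" by (rule ifourier_abs(1)[OF r(1,2), symmetric])
    finally show ?thesis .
  qed
  have bD: "bounded_linear ?D"
    by (intro bounded_linear_sub bounded_linear_lmul bounded_linear_compose[OF bounded_linear_kvec[OF z] bounded_linear_poisson[OF z]])
  have "(\<lambda>n. fourier_L2 (?D (?F n))) \<longlonglongrightarrow> fourier_L2 (?D F)"
    by (intro bounded_linear.tendsto[OF bounded_linear_fourier_L2] bounded_linear.tendsto[OF bD] k(4))
  then have lim: "(\<lambda>n. abs_L2 (res_hat z (k n))) \<longlonglongrightarrow> fourier_L2 (?D F)" by (simp add: eq)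
  show ?thesis
  proof (rule L2_AE_limit_unique[OF _ lim])
    show "square_integrable (res_hat z (k n))" for n by (rule res_hat_L1[OF z k(1) k(3)])
    show "AE \<xi> in lborel. (\<lambda>n. res_hat z (k n) \<xi>) \<longlonglongrightarrow> res_hat z ?q \<xi>"
    proof (rule AE_I2)
      fix \<xi>
      have i: "integrable lborel (\<lambda>\<eta>. norm (half_exp z (\<eta> - \<xi>)) * norm (rep_L2 (fourier_L2 F) \<eta>))"
        by (intro integrable_norm_mult square_integrable_half_exp_affine z square_integrable_rep_L2)
      have "(\<lambda>n. LINT \<eta>|lborel. half_exp z (\<eta> - \<xi>) *\<^sub>M k n \<eta>) \<longlonglongrightarrow> (LINT \<eta>|lborel. half_exp z (\<eta> - \<xi>) *\<^sub>M ?q \<eta>)"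
      proof (rule integral_dominated_convergence[OF _ _ i])
        note [measurable] = borel_measurable_integrable[OF k(1)]
        show "(\<lambda>\<eta>. half_exp z (\<eta> - \<xi>) *\<^sub>M ?q \<eta>) \<in> borel_measurable lborel"
          "(\<lambda>\<eta>. half_exp z (\<eta> - \<xi>) *\<^sub>M k n \<eta>) \<in> borel_measurable lborel" for n by measurable
        show "AE \<eta> in lborel. (\<lambda>n. half_exp z (\<eta> - \<xi>) *\<^sub>M k n \<eta>) \<longlonglongrightarrow> half_exp z (\<eta> - \<xi>) *\<^sub>M ?q \<eta>"
          by (intro AE_I2 bounded_linear.tendsto[OF bounded_linear_mscale] k(5))
        show "AE \<eta> in lborel. norm (half_exp z (\<eta> - \<xi>) *\<^sub>M k n \<eta>) \<le> norm (half_exp z (\<eta> - \<xi>)) * norm (rep_L2 (fourier_L2 F) \<eta>)" for n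
          by (auto simp: norm_mscale intro!: mult_left_mono k(6))
      qed
      then show "(\<lambda>n. res_hat z (k n) \<xi>) \<longlonglongrightarrow> res_hat z ?q \<xi>"
        unfolding res_hat_def by (intro tendsto_scaleR tendsto_const bounded_linear.tendsto[OF bounded_linear_mscale])
    qed
  qed
qed

text \<open>
  The splitting of \<open>F / (x - z)\<close> into its plus and minus parts, the basis of all computations with the resolvent. The explicit
  formula on the Fourier side shows that the difference from the minus function has no negative frequencies.
\<close>

theorem kern_decomposition:
  assumes z: "Im z > 0" and F: "szego_L2 F = F"
  shows "lmul (kern z) F = res z F + kvec z (poisson F z)"
proof -
  let ?D = "lmul (kern z) F - kvec z (poisson F z)"
  have "szego_L2 ?D = ?D"
    unfolding szego_plus_iff using fourier_kern_decomposition[OF z F]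
    by eventually_elim (simp add: res_hat_def)
  moreover have "szego_L2 ?D = res z F"
    by (simp add: bounded_linear.linear[OF bounded_linear_szego_L2] linear_diff szego_kvec z res_def F)
  ultimately show ?thesis by (simp add: algebra_simps)
qed

lemma fourier_res:
  assumes z: "Im z > 0" and F: "szego_L2 F = F"
  shows "AE \<xi> in lborel. rep_L2 (fourier_L2 (res z F)) \<xi>
    = res_hat z (\<lambda>\<eta>. indicator {0..} \<eta> *\<^sub>R rep_L2 (fourier_L2 F) \<eta>) \<xi>"
  using fourier_kern_decomposition[OF z F] by (simp add: kern_decomposition[OF z F])

lemma szego_res [simp]: "szego_L2 (res z F) = res z F"
  by (simp add: res_def)

lemma bounded_linear_res: "bounded_linear (res z)"
  unfolding res_def[abs_def]
  by (intro bounded_linear_compose[OF bounded_linear_szego_L2] bounded_linear_compose[OF bounded_linear_lmul] bounded_linear_szego_L2)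

section \<open>The functional \<open>I\<close> and the operator \<open>G\<close> on the range of the resolvent\<close>

lemma AE_ex_in_interval:
  assumes P: "AE x in lborel. P (x::real)" and ab: "a < b"
  shows "\<exists>x. a < x \<and> x < b \<and> P x"
proof (rule ccontr)
  assume "\<not> ?thesis"
  with P have "AE x in lborel. x \<notin> {a<..<b}" by (auto elim!: eventually_mono)
  then have "{a<..<b} \<in> null_sets lborel" by (subst AE_iff_null_sets) auto
  then show False using ab by (auto simp: null_sets_def)
qed

text \<open>
  Two representatives agree almost everywhere, hence at points arbitrarily close to 0, so their right limits coincide.
\<close>

lemma op_I_eq:
  assumes g: "AE \<xi> in lborel. 0 < \<xi> \<longrightarrow> g \<xi> = rep_L2 (fourier_L2 F) \<xi>" and l: "(g \<longlongrightarrow> c) (at_right 0)"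
  shows "op_I F = c"
  unfolding op_I_def
proof (rule the_equality)
  show "\<exists>g. (AE \<xi> in lborel. 0 < \<xi> \<longrightarrow> g \<xi> = rep_L2 (fourier_L2 F) \<xi>) \<and> (g \<longlongrightarrow> c) (at_right 0)"
    using g l by blast
  fix d assume "\<exists>g. (AE \<xi> in lborel. 0 < \<xi> \<longrightarrow> g \<xi> = rep_L2 (fourier_L2 F) \<xi>) \<and> (g \<longlongrightarrow> d) (at_right 0)"
  then obtain g' where g': "AE \<xi> in lborel. 0 < \<xi> \<longrightarrow> g' \<xi> = rep_L2 (fourier_L2 F) \<xi>" "(g' \<longlongrightarrow> d) (at_right 0)"
    by blast
  from g g'(1) have "AE \<xi> in lborel. 0 < \<xi> \<longrightarrow> g \<xi> = g' \<xi>" by eventually_elim simp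
  then have "\<exists>\<xi>. 0 < \<xi> \<and> \<xi> < 1 / real (Suc n) \<and> g \<xi> = g' \<xi>" for n
    using AE_ex_in_interval[of "\<lambda>\<xi>. 0 < \<xi> \<longrightarrow> g \<xi> = g' \<xi>" 0 "1 / real (Suc n)"] by auto
  then obtain X where X: "\<And>n. 0 < X n" "\<And>n. X n < 1 / real (Suc n)" "\<And>n. g (X n) = g' (X n)" by metis
  have X0: "X \<longlonglongrightarrow> 0"
  proof (rule tendsto_sandwich[of "\<lambda>_. 0"])
    show "(\<lambda>n. 1 / real (Suc n)) \<longlonglongrightarrow> 0" by (rule LIMSEQ_Suc[OF lim_const_over_n])
  qed (use X in \<open>auto intro!: always_eventually less_imp_le\<close>)
  have "filterlim X (at_right 0) sequentially"
    unfolding filterlim_at using X X0 by (auto simp: less_le)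
  then have "(\<lambda>n. g (X n)) \<longlonglongrightarrow> c" "(\<lambda>n. g' (X n)) \<longlonglongrightarrow> d"
    using filterlim_compose[OF l] filterlim_compose[OF g'(2)] by blast+
  then show "d = c" using LIMSEQ_unique by (simp add: X(3))
qed

text \<open>
  The explicit formula for the transform of \<open>res z Q\<close> has the right limit \<open>2 \<pi> \<i> Q(z)\<close> at 0, by dominated convergence in
  the integral over \<open>\<eta> \<ge> \<xi>\<close>.
\<close>

theorem op_I_res:
  fixes Q :: "(complex^'n^'m) L2"
  assumes z: "Im z > 0" and Q: "szego_L2 Q = Q"
  shows "op_I (res z Q) = (2 * pi * \<i>) *\<^sub>M poisson Q z"
proof (rule op_I_eq)
  let ?q = "\<lambda>\<eta>. indicator {0..} \<eta> *\<^sub>R rep_L2 (fourier_L2 Q) \<eta>"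
  let ?g = "\<lambda>\<xi>. \<i> *\<^sub>M (LINT \<eta>|lborel. half_exp z (\<eta> - \<xi>) *\<^sub>M ?q \<eta>)"
  show "AE \<xi> in lborel. 0 < \<xi> \<longrightarrow> ?g \<xi> = rep_L2 (fourier_L2 (res z Q)) \<xi>"
    using fourier_res[OF z Q] by eventually_elim (simp add: res_hat_def)
  have e: "(2 * pi * \<i>) *\<^sub>M poisson Q z = \<i> *\<^sub>M (LINT \<eta>|lborel. half_exp z (\<eta> - 0) *\<^sub>M ?q \<eta>)"
  proof -
    have "(LINT \<eta>|lborel. half_exp z (\<eta> - 0) *\<^sub>M ?q \<eta>) = (LINT \<xi>:{0..}|lborel. exp (\<i> * z * of_real \<xi>) *\<^sub>M rep_L2 (fourier_L2 Q) \<xi>)"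
      unfolding set_lebesgue_integral_def
      by (intro Bochner_Integration.integral_cong refl) (auto simp: half_exp_def indicator_def)
    then show ?thesis by (simp add: poisson_def mscale_of_real[symmetric])
  qed
  have sq: "square_integrable ?q"
    by (rule square_integrable_multiplier[OF multiplier_half_line]) simp
  note [measurable] = square_integrable_measurable[OF sq]
  have "((\<lambda>\<xi>. LINT \<eta>|lborel. half_exp z (\<eta> - \<xi>) *\<^sub>M ?q \<eta>) \<longlongrightarrow> (LINT \<eta>|lborel. half_exp z (\<eta> - 0) *\<^sub>M ?q \<eta>)) (at_right 0)"
    unfolding tendsto_at_iff_sequentially
  proof (intro allI impI)
    fix X :: "nat \<Rightarrow> real" assume X: "\<forall>i. X i \<in> {0<..} - {0}" "X \<longlonglongrightarrow> 0"
    have Xp: "0 < X i" for i using X(1) by auto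
    obtain B where B: "\<And>i. X i \<le> B" using convergent_imp_Bseq[OF convergentI[OF X(2)]] by (auto simp: Bseq_def abs_le_iff)
    have i: "integrable lborel (\<lambda>\<eta>. exp (Im z * B) * (norm (half_exp z (\<eta> - 0)) * norm (?q \<eta>)))"
      by (intro integrable_mult_right integrable_norm_mult square_integrable_half_exp_affine z sq)
    have "(\<lambda>n. LINT \<eta>|lborel. half_exp z (\<eta> - X n) *\<^sub>M ?q \<eta>) \<longlonglongrightarrow> (LINT \<eta>|lborel. half_exp z (\<eta> - 0) *\<^sub>M ?q \<eta>)"
    proof (rule integral_dominated_convergence[OF _ _ i])
      show "AE \<eta> in lborel. (\<lambda>n. half_exp z (\<eta> - X n) *\<^sub>M ?q \<eta>) \<longlonglongrightarrow> half_exp z (\<eta> - 0) *\<^sub>M ?q \<eta>"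
        using AE_lborel_singleton[of 0]
      proof eventually_elim
        case (elim \<eta>)
        have "(\<lambda>n. indicator {0..} (\<eta> - X n) :: real) \<longlonglongrightarrow> indicator {0..} (\<eta> - 0)"
        proof (rule tendsto_eventually)
          consider "\<eta> < 0" | "\<eta> > 0" using elim by linarith
          then show "\<forall>\<^sub>F n in sequentially. indicator {0..} (\<eta> - X n) = (indicator {0..} (\<eta> - 0) :: real)"
          proof cases
            case 1
            have "\<not> 0 \<le> \<eta> - X n" for n using 1 Xp[of n] by simp
            then show ?thesis using 1 by (auto simp: indicator_def)
          next
            case 2
            show ?thesis
              by (rule eventually_mono[OF order_tendstoD(2)[OF X(2) 2]]) (use 2 in \<open>auto simp: indicator_def\<close>)
          qed
        qed
        moreover have "(\<lambda>n. exp (\<i> * z * of_real (\<eta> - X n))) \<longlonglongrightarrow> exp (\<i> * z * of_real (\<eta> - 0))"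
          by (intro tendsto_intros X(2))
        ultimately show ?case
          unfolding half_exp_def by (intro bounded_bilinear.tendsto[OF bounded_bilinear_mscale] tendsto_scaleR tendsto_const)
      qed
      show "AE \<eta> in lborel. norm (half_exp z (\<eta> - X n) *\<^sub>M ?q \<eta>) \<le> exp (Im z * B) * (norm (half_exp z (\<eta> - 0)) * norm (?q \<eta>))" for n
      proof (rule AE_I2)
        fix \<eta>
        have "cmod (half_exp z (\<eta> - X n)) \<le> exp (Im z * B) * cmod (half_exp z (\<eta> - 0))"
        proof (cases "\<eta> - X n \<ge> 0")
          case True
          have "exp (- Im z * (\<eta> - X n)) \<le> exp (Im z * B + - Im z * \<eta>)"
            using B[of n] z by (simp add: algebra_simps)
          then have "exp (- Im z * (\<eta> - X n)) \<le> exp (Im z * B) * exp (- Im z * \<eta>)" by (simp only: exp_add)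
          then show ?thesis using True Xp[of n] by (simp add: cmod_half_exp)
        qed (simp add: cmod_half_exp)
        then show "norm (half_exp z (\<eta> - X n) *\<^sub>M ?q \<eta>) \<le> exp (Im z * B) * (norm (half_exp z (\<eta> - 0)) * norm (?q \<eta>))"
          unfolding norm_mscale mult.assoc[symmetric] by (rule mult_right_mono) simp
      qed
    qed measurable
    then show "((\<lambda>\<xi>. LINT \<eta>|lborel. half_exp z (\<eta> - \<xi>) *\<^sub>M ?q \<eta>) \<circ> X) \<longlonglongrightarrow> (LINT \<eta>|lborel. half_exp z (\<eta> - 0) *\<^sub>M ?q \<eta>)"
      by (simp add: o_def)
  qed
  then show "(?g \<longlongrightarrow> (2 * pi * \<i>) *\<^sub>M poisson Q z) (at_right 0)"
    unfolding e by (rule bounded_linear.tendsto[OF bounded_linear_mscale])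
qed

lemma shift_adj_eq: "shift_adj \<eta> F = szego_L2 (modulate (- \<eta>) F)"
proof -
  have "(\<lambda>x. exp (- \<i> * of_real (\<eta> * x)) *\<^sub>M rep_L2 F x) = (\<lambda>x. cis (- \<eta> * x) *\<^sub>M rep_L2 F x)"
    by (simp add: cis_conv_exp)
  then show ?thesis
    unfolding shift_adj_def modulate_def L2_map_def
    by (simp add: szego_eq square_integrable_multiplier[OF multiplier_cis square_integrable_rep_L2, of "- \<eta>" F, simplified])
qed

lemma cmod_cis_minus_1_le: "cmod (cis t - 1) \<le> \<bar>t\<bar>"
  using iexp_approx1[of t 0] by (simp add: cis_conv_exp)

lemma cis_difference_quotient:
  assumes y: "y \<longlonglongrightarrow> 0" "\<And>n. y n \<noteq> (0::real)"
  shows "(\<lambda>n. (cis (y n * x) - 1) / of_real (y n)) \<longlonglongrightarrow> \<i> * of_real x"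
proof -
  have "((\<lambda>t. exp (t * (\<i> * of_real x))) has_field_derivative \<i> * of_real x) (at 0)"
    by (auto intro!: derivative_eq_intros)
  then have d: "((\<lambda>h. (exp (h * (\<i> * of_real x)) - 1) / h) \<longlongrightarrow> \<i> * of_real x) (at 0)"
    by (simp add: DERIV_def)
  have "filterlim (\<lambda>n. complex_of_real (y n)) (at 0) sequentially"
    unfolding filterlim_at using y tendsto_of_real[OF y(1), where 'a = complex] by auto
  from filterlim_compose[OF d this] show ?thesis by (simp add: cis_conv_exp mult_ac)
qed

lemma of_real_mult_cauchy_kernel: "Im z > 0 \<Longrightarrow> of_real x * cauchy_kernel z x = 1 + z * cauchy_kernel z x"
  using of_real_minus_nonzero[of z x] by (simp add: cauchy_kernel_def field_simps)

lemma bounded_linear_simps: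
  assumes "bounded_linear f"
  shows "f (x + y) = f x + f y" "f (x - y) = f x - f y" "f (- x) = - f x" "f 0 = 0" "f (r *\<^sub>R x) = r *\<^sub>R f x"
  using bounded_linear.linear[OF assms] by (simp_all add: linear_add linear_diff linear_neg linear_0 linear_cmul)

lemma scaleC_eq_L2_map: "c *\<^sub>C F = L2_map (\<lambda>_. (*\<^sub>M) c) F"
proof (rule L2_eqI)
  have "AE x in lborel. rep_L2 (L2_map (\<lambda>_. (*\<^sub>M) c) F) x = c *\<^sub>M rep_L2 F x"
    by (rule multiplier_const[OF bounded_linear_mscale[of c]], rule rep_L2_map)
  then show "AE x in lborel. rep_L2 (c *\<^sub>C F) x = rep_L2 (L2_map (\<lambda>_. (*\<^sub>M) c) F) x"
    using rep_L2_scaleC[of c F] by eventually_elim simp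
qed

lemma bounded_linear_scaleC: "bounded_linear (\<lambda>F. c *\<^sub>C F)"
  unfolding scaleC_eq_L2_map by (rule multiplier_const[OF bounded_linear_mscale[of c]], rule bounded_linear_L2_map)

lemma scaleC_simps:
  "c *\<^sub>C (F + G) = c *\<^sub>C F + c *\<^sub>C G" "c *\<^sub>C (F - G) = c *\<^sub>C F - c *\<^sub>C G"
  "c *\<^sub>C (- F) = - (c *\<^sub>C F)" "c *\<^sub>C 0 = 0" "c *\<^sub>C (r *\<^sub>R F) = r *\<^sub>R (c *\<^sub>C F)"
  using bounded_linear_simps[OF bounded_linear_scaleC, of c] by metis+

lemma scaleC_scaleC [simp]: "c *\<^sub>C d *\<^sub>C F = (c * d) *\<^sub>C F"
proof (rule L2_eqI)
  show "AE x in lborel. rep_L2 (c *\<^sub>C d *\<^sub>C F) x = rep_L2 ((c * d) *\<^sub>C F) x"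
    using rep_L2_scaleC[of c "d *\<^sub>C F"] rep_L2_scaleC[of d F] rep_L2_scaleC[of "c * d" F] by eventually_elim simp
qed

lemma scaleC_of_real: "of_real r *\<^sub>C F = r *\<^sub>R F"
proof (rule L2_eqI)
  show "AE x in lborel. rep_L2 (of_real r *\<^sub>C F) x = rep_L2 (r *\<^sub>R F) x"
    using rep_L2_scaleC[of "of_real r" F] rep_L2_scaleR[of r F] by eventually_elim (simp add: mscale_of_real)
qed

lemma scaleC_minus_left: "(- c) *\<^sub>C F = - (c *\<^sub>C F)"
  using scaleC_scaleC[of "of_real (-1)" c F] unfolding scaleC_of_real by simp

lemma szego_scaleC: "szego_L2 (c *\<^sub>C F) = c *\<^sub>C szego_L2 F"
  unfolding scaleC_eq_L2_map by (rule szego_linear_map[OF bounded_linear_mscale]) (simp add: mult.commute)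

lemma fourier_scaleC: "fourier_L2 (c *\<^sub>C F) = c *\<^sub>C fourier_L2 F"
  unfolding scaleC_eq_L2_map by (rule fourier_L2_linear_map[OF bounded_linear_mscale]) (simp add: mult.commute)

text \<open>
  By the decomposition, the shifts of \<open>res z Q\<close> are the projections of \<open>e\<^bsup>-i\<eta>x\<^esup> Q / (x - z)\<close>, since modulating a minus function
  downwards leaves it minus. The function \<open>x Q / (x - z)\<close> is square integrable, so the derivative exists by dominated convergence.
\<close>

theorem shift_adj_derivative:
  fixes Q :: "(complex^'n^'m) L2"
  assumes z: "Im z > 0" and Q: "szego_L2 Q = Q"
  shows "((\<lambda>\<eta>. shift_adj \<eta> (res z Q)) has_vector_derivative (- \<i>) *\<^sub>C (Q + z *\<^sub>C res z Q)) (at 0 within {0..})"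
proof -
  let ?F = "res z Q" and ?K = "lmul (kern z) Q" and ?q = "rep_L2 Q"
  let ?d = "\<lambda>x. (- \<i> * (of_real x * cauchy_kernel z x)) *\<^sub>M ?q x"
  interpret S: bounded_linear "szego_L2 :: (complex^'n^'m) L2 \<Rightarrow> _" by (rule bounded_linear_szego_L2)
  note mk = measurable_cauchy_kernel[OF z]
  have dle: "norm (?d x) \<le> (1 + cmod z / Im z) * norm (?q x)" for x
  proof -
    have "cmod (of_real x * cauchy_kernel z x) \<le> 1 + cmod z * (1 / Im z)"
      unfolding of_real_mult_cauchy_kernel[OF z]
      by (rule order_trans[OF norm_triangle_ineq], rule add_mono, simp, unfold norm_mult,
          rule mult_left_mono[OF cmod_cauchy_kernel_le[OF z]]) simp
    then show ?thesis unfolding norm_mscale by (intro mult_right_mono) (simp_all add: norm_mult)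
  qed
  have sd: "square_integrable ?d"
  proof (rule square_integrable_bound[OF square_integrable_rep_L2])
    show "?d \<in> borel_measurable lborel" using mk by measurable
    show "norm (?d x) \<le> (1 + cmod z / Im z) * norm (?q x)" for x by (rule dle)
  qed
  have shift: "shift_adj \<eta> ?F = szego_L2 (modulate (- \<eta>) ?K)" if "0 \<le> \<eta>" for \<eta>
  proof -
    interpret M: bounded_linear "modulate (- \<eta>) :: (complex^'n^'m) L2 \<Rightarrow> _"
      unfolding modulate_def by (rule bounded_linear_L2_map[OF multiplier_cis])
    have "szego_L2 (modulate (- \<eta>) (kvec z (poisson Q z))) = 0"
      by (rule szego_modulate_minus[OF szego_kvec[OF z]]) (use that in simp)
    then show ?thesis unfolding shift_adj_eq kern_decomposition[OF z Q] by (simp add: M.add S.add)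
  qed
  have hd: "((\<lambda>\<eta>. shift_adj \<eta> ?F) has_vector_derivative szego_L2 (abs_L2 ?d)) (at 0 within {0..})"
    unfolding has_vector_derivative_def has_derivative_within
  proof (intro conjI bounded_linear_scaleR_left)
    show "((\<lambda>y. (1 / norm (y - 0)) *\<^sub>R (shift_adj y ?F - (shift_adj 0 ?F + (y - 0) *\<^sub>R szego_L2 (abs_L2 ?d)))) \<longlongrightarrow> 0) (at 0 within {0..})"
      unfolding tendsto_at_iff_sequentially
    proof (intro allI impI)
      fix y :: "nat \<Rightarrow> real" assume y: "\<forall>i. y i \<in> {0..} - {0}" "y \<longlonglongrightarrow> 0"
      have yp: "0 < y n" for n using y(1) by (auto simp: less_le)
      let ?g = "\<lambda>n x. (((cis (- y n * x) - 1) / of_real (y n)) * cauchy_kernel z x) *\<^sub>M ?q x"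
      have sK: "square_integrable (\<lambda>x. cauchy_kernel z x *\<^sub>M ?q x)"
        using square_integrable_multiplier[OF multiplier_lmul square_integrable_rep_L2, of "kern z" Q] by (simp add: apply_kern[OF z])
      have K: "?K = abs_L2 (\<lambda>x. cauchy_kernel z x *\<^sub>M ?q x)"
        unfolding lmul_def L2_map_def by (simp add: apply_kern[OF z])
      have mod: "modulate (- y n) ?K = abs_L2 (\<lambda>x. cis (- y n * x) *\<^sub>M (cauchy_kernel z x *\<^sub>M ?q x))" for n
        unfolding K modulate_def by (rule L2_map_abs[OF multiplier_cis sK])
      have smod: "square_integrable (\<lambda>x. cis (- y n * x) *\<^sub>M (cauchy_kernel z x *\<^sub>M ?q x))" for n
        by (rule square_integrable_multiplier[OF multiplier_cis sK])
      have g_eq: "abs_L2 (?g n) = (1 / y n) *\<^sub>R (modulate (- y n) ?K - ?K)" for n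
      proof -
        have "?g n = (\<lambda>x. (1 / y n) *\<^sub>R (cis (- y n * x) *\<^sub>M (cauchy_kernel z x *\<^sub>M ?q x) - cauchy_kernel z x *\<^sub>M ?q x))"
        proof
          fix x
          have "(1 / y n) *\<^sub>R (cis (- y n * x) *\<^sub>M (cauchy_kernel z x *\<^sub>M ?q x) - cauchy_kernel z x *\<^sub>M ?q x)
            = (of_real (1 / y n) * (cis (- y n * x) * cauchy_kernel z x - cauchy_kernel z x)) *\<^sub>M ?q x"
            by (simp only: mscale_of_real[symmetric] mscale_simps mscale_diff_left[symmetric])
          also have "of_real (1 / y n) * (cis (- y n * x) * cauchy_kernel z x - cauchy_kernel z x) = ((cis (- y n * x) - 1) / of_real (y n)) * cauchy_kernel z x"
            by (simp add: algebra_simps diff_divide_distrib)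
          finally show "?g n x = (1 / y n) *\<^sub>R (cis (- y n * x) *\<^sub>M (cauchy_kernel z x *\<^sub>M ?q x) - cauchy_kernel z x *\<^sub>M ?q x)" by simp
        qed
        then show ?thesis
          unfolding mod unfolding K
          by (simp only: abs_L2_scaleR[OF square_integrable_diff[OF smod sK]] abs_L2_diff[OF smod sK])
      qed
      have lim: "(\<lambda>n. abs_L2 (?g n)) \<longlonglongrightarrow> abs_L2 ?d"
      proof (rule L2_dominated_convergence)
        show "square_integrable (\<lambda>x. (1 + cmod z / Im z) *\<^sub>R ?q x)" by (intro square_integrable_scaleR square_integrable_rep_L2)
        show "?g n \<in> borel_measurable borel" for n using mk by measurable
        show "?d \<in> borel_measurable borel" using mk by measurable
        show "AE x in lborel. (\<lambda>n. ?g n x) \<longlonglongrightarrow> ?d x"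
        proof (rule AE_I2)
          fix x
          have "(\<lambda>n. (cis (y n * - x) - 1) / of_real (y n)) \<longlonglongrightarrow> \<i> * of_real (- x)"
            by (rule cis_difference_quotient) (use y(2) yp in \<open>auto simp: less_le\<close>)
          then have "(\<lambda>n. ?g n x) \<longlonglongrightarrow> ((\<i> * of_real (- x)) * cauchy_kernel z x) *\<^sub>M ?q x"
            by (intro bounded_linear.tendsto[OF bounded_linear_mscale_left] tendsto_mult tendsto_const) simp
          moreover have "(\<i> * of_real (- x)) * cauchy_kernel z x = - \<i> * (of_real x * cauchy_kernel z x)" by simp
          ultimately show "(\<lambda>n. ?g n x) \<longlonglongrightarrow> ?d x" by (simp only:)
        qed
        show "AE x in lborel. norm (?g n x) \<le> norm ((1 + cmod z / Im z) *\<^sub>R ?q x)" for n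
        proof (rule AE_I2)
          fix x
          have "cmod ((cis (- y n * x) - 1) / of_real (y n)) \<le> \<bar>x\<bar>"
            using cmod_cis_minus_1_le[of "- y n * x"] yp[of n] by (simp add: norm_divide divide_simps abs_mult mult.commute)
          then have "norm (?g n x) \<le> norm (?d x)"
            unfolding norm_mscale norm_mult by (simp add: mult_right_mono)
          also have "\<dots> \<le> (1 + cmod z / Im z) * norm (?q x)" by (rule dle)
          also have "\<dots> = norm ((1 + cmod z / Im z) *\<^sub>R ?q x)" using z by simp
          finally show "norm (?g n x) \<le> norm ((1 + cmod z / Im z) *\<^sub>R ?q x)" .
        qed
      qed
      have "(\<lambda>n. szego_L2 (abs_L2 (?g n)) - szego_L2 (abs_L2 ?d)) \<longlonglongrightarrow> 0"
        by (intro LIM_zero S.tendsto lim)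
      moreover have "szego_L2 (abs_L2 (?g n)) - szego_L2 (abs_L2 ?d)
          = (1 / norm (y n - 0)) *\<^sub>R (shift_adj (y n) ?F - (shift_adj 0 ?F + (y n - 0) *\<^sub>R szego_L2 (abs_L2 ?d)))" for n
      proof -
        have m0: "modulate (- 0) ?K = ?K" unfolding modulate_def L2_map_def by simp
        show ?thesis
          using yp[of n] unfolding g_eq shift[OF less_imp_le[OF yp]] shift[OF order_refl] m0
          by (simp add: S.scaleR S.diff scaleR_diff_right scaleR_add_right)
      qed
      ultimately show "((\<lambda>y. (1 / norm (y - 0)) *\<^sub>R (shift_adj y ?F - (shift_adj 0 ?F + (y - 0) *\<^sub>R szego_L2 (abs_L2 ?d)))) \<circ> y) \<longlonglongrightarrow> 0"
        by (simp add: o_def)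
    qed
  qed
  have d:  "\<i> *\<^sub>C abs_L2 ?d = Q + z *\<^sub>C ?K"
  proof -
    have "\<i> *\<^sub>C abs_L2 ?d = abs_L2 (\<lambda>x. \<i> *\<^sub>M ?d x)" by (rule abs_L2_scaleC[OF sd, symmetric])
    also have "\<dots> = Q + z *\<^sub>C ?K"
    proof (rule sym, rule L2_eq_absI)
      show "square_integrable (\<lambda>x. \<i> *\<^sub>M ?d x)" by (rule square_integrable_mscale[OF sd])
      show "AE x in lborel. rep_L2 (Q + z *\<^sub>C ?K) x = \<i> *\<^sub>M ?d x"
        using rep_L2_add[of Q "z *\<^sub>C ?K"] rep_L2_scaleC[of z ?K] rep_lmul_kern[OF z, of Q]
      proof eventually_elim
        case (elim x)
        have "\<i> * (- \<i> * w) = w" for w by (simp add: complex_eq_iff)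
        then have "\<i> *\<^sub>M ?d x = (1 + z * cauchy_kernel z x) *\<^sub>M ?q x"
          by (simp only: mscale_simps of_real_mult_cauchy_kernel[OF z])
        then show ?case using elim by (simp add: mscale_add_left)
      qed
    qed
    finally show ?thesis .
  qed
  have "abs_L2 ?d = (- \<i>) *\<^sub>C \<i> *\<^sub>C abs_L2 ?d" using scaleC_of_real[of 1 "abs_L2 ?d"] by simp
  then have "szego_L2 (abs_L2 ?d) = (- \<i>) *\<^sub>C (Q + z *\<^sub>C ?F)"
    unfolding d by (simp add: szego_scaleC S.add Q res_def)
  with hd show ?thesis by simp
qed

lemma at_0_within_half_line: "at 0 within {0::real..} \<noteq> bot"
  by (simp add: at_within_Ici_at_right)

theorem op_G_res:
  fixes Q :: "(complex^'n^'m) L2"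
  assumes z: "Im z > 0" and Q: "szego_L2 Q = Q"
  shows "op_G (res z Q) = Q + z *\<^sub>C res z Q"
proof -
  note hd = shift_adj_derivative[OF z Q]
  have "vector_derivative (\<lambda>\<eta>. shift_adj \<eta> (res z Q)) (at 0 within {0..}) = (- \<i>) *\<^sub>C (Q + z *\<^sub>C res z Q)"
    unfolding vector_derivative_def
    by (rule some_equality, rule hd, rule vector_derivative_unique_within[OF at_0_within_half_line _ hd])
  then show ?thesis using scaleC_of_real[of 1 "Q + z *\<^sub>C res z Q"] by (simp add: op_G_def)
qed

section \<open>Smooth bump functions\<close>

text \<open>
  For \<open>t > 0\<close> the functions \<open>t\<^bsup>-k\<^esup> e\<^bsup>-c/t\<^esup>\<close>; they span a space stable under differentiation.
\<close>

definition bump_half :: "real \<Rightarrow> nat \<Rightarrow> real \<Rightarrow> real" where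
  "bump_half c k t = (if 0 < t then (1 / t) ^ k * exp (- c / t) else 0)"

lemma power_times_exp_tendsto_0:
  assumes c: "(c::real) > 0"
  shows "((\<lambda>s. s ^ k * exp (- c * s)) \<longlongrightarrow> 0) at_top"
proof -
  have "filterlim (\<lambda>s. c * s) at_top at_top"
    by (rule filterlim_tendsto_pos_mult_at_top[OF tendsto_const c filterlim_ident])
  from filterlim_compose[OF tendsto_power_div_exp_0 this, of k]
  have "((\<lambda>s. (1 / c ^ k) * ((c * s) ^ k / exp (c * s))) \<longlongrightarrow> (1 / c ^ k) * 0) at_top"
    by (intro tendsto_mult tendsto_const)
  moreover have "(1 / c ^ k) * ((c * s) ^ k / exp (c * s)) = s ^ k * exp (- c * s)" for s
    using c by (simp add: power_mult_distrib exp_minus field_simps)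
  ultimately show ?thesis by simp
qed

lemma bump_half_tendsto_0:
  assumes c: "c > 0" shows "(bump_half c k \<longlongrightarrow> 0) (at 0)"
proof -
  have "((\<lambda>t. (1 / t) ^ k * exp (- c * (1 / t))) \<longlongrightarrow> 0) (at_right 0)"
    using filterlim_compose[OF power_times_exp_tendsto_0[OF c] filterlim_inverse_at_top_right, of k]
    by (simp add: inverse_eq_divide)
  then have r: "(bump_half c k \<longlongrightarrow> 0) (at_right 0)"
    by (rule Lim_transform_eventually)
      (auto simp: bump_half_def eventually_at_right_field intro!: exI[of _ 1])
  have l: "(bump_half c k \<longlongrightarrow> 0) (at_left 0)"
    by (rule Lim_transform_eventually[OF tendsto_const])
      (auto simp: bump_half_def eventually_at_left_field intro!: exI[of _ "- 1"])
  show ?thesis using l r by (simp add: filterlim_at_split)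
qed

lemma bump_half_has_derivative:
  assumes c: "c > 0"
  shows "(bump_half c k has_field_derivative (c * bump_half c (k + 2) t - real k * bump_half c (Suc k) t)) (at t)"
proof -
  consider "t > 0" | "t < 0" | "t = 0" by linarith
  then show ?thesis
  proof cases
    case 1
    define i where "i = 1 / t"
    have d1: "((\<lambda>t. 1 / t) has_field_derivative - (i * i)) (at t)"
      using 1 by (auto intro!: derivative_eq_intros simp: i_def)
    have d2: "((\<lambda>t. exp (- c / t)) has_field_derivative exp (- c / t) * (c * (i * i))) (at t)"
      using 1 by (auto intro!: derivative_eq_intros simp: i_def)
    have "((\<lambda>t. (1 / t) ^ k * exp (- c / t)) has_field_derivative
        c * bump_half c (k + 2) t - real k * bump_half c (Suc k) t) (at t)"
    proof (rule DERIV_cong[OF DERIV_mult[OF DERIV_power[OF d1, of k] d2]])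
      show "real k * (- (i * i) * (1 / t) ^ (k - Suc 0)) * exp (- c / t) + exp (- c / t) * (c * (i * i)) * (1 / t) ^ k
          = c * bump_half c (k + 2) t - real k * bump_half c (Suc k) t"
        using 1 unfolding i_def[symmetric] bump_half_def
        by (cases k) (simp_all add: algebra_simps)
    qed
    then show ?thesis
      by (rule has_field_derivative_transform_within_open[of _ _ _ "{0<..}"]) (use 1 in \<open>auto simp: bump_half_def\<close>)
  next
    case 2
    have "((\<lambda>_. 0) has_field_derivative 0) (at t)" by simp
    then have "(bump_half c k has_field_derivative 0) (at t)"
      by (rule has_field_derivative_transform_within_open[of _ _ _ "{..<0}"]) (use 2 in \<open>auto simp: bump_half_def\<close>)
    then show ?thesis using 2 by (simp add: bump_half_def)
  next
    case 3
    have "((\<lambda>h. bump_half c (Suc k) h) \<longlongrightarrow> 0) (at 0)" by (rule bump_half_tendsto_0[OF c])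
    moreover have "bump_half c (Suc k) h = (bump_half c k (0 + h) - bump_half c k 0) / h" for h
      by (simp add: bump_half_def)
    ultimately have "(bump_half c k has_field_derivative 0) (at 0)" by (simp add: DERIV_def)
    then show ?thesis using 3 by (simp add: bump_half_def)
  qed
qed

text \<open>
  Closed under derivatives, which proves smoothness of all members at once.
\<close>

inductive_set bump_algebra :: "real \<Rightarrow> real \<Rightarrow> real \<Rightarrow> (real \<Rightarrow> real) set" for a b c where
  const: "(\<lambda>_. r) \<in> bump_algebra a b c"
| left: "(\<lambda>x. bump_half c k (x - a)) \<in> bump_algebra a b c"
| right: "(\<lambda>x. bump_half c k (b - x)) \<in> bump_algebra a b c"
| add: "f \<in> bump_algebra a b c \<Longrightarrow> g \<in> bump_algebra a b c \<Longrightarrow> (\<lambda>x. f x + g x) \<in> bump_algebra a b c"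
| mult: "f \<in> bump_algebra a b c \<Longrightarrow> g \<in> bump_algebra a b c \<Longrightarrow> (\<lambda>x. f x * g x) \<in> bump_algebra a b c"

lemma bump_algebra_derivative:
  assumes c: "c > 0" and f: "f \<in> bump_algebra a b c"
  shows "\<exists>f'\<in>bump_algebra a b c. \<forall>x. (f has_field_derivative f' x) (at x)"
  using f
proof induction
  case (const r)
  show ?case by (rule bexI[OF _ bump_algebra.const[of 0]]) auto
next
  case (left k)
  let ?f = "\<lambda>x. c * bump_half c (k + 2) (x - a) + (- real k) * bump_half c (Suc k) (x - a)"
  have "?f \<in> bump_algebra a b c" by (intro bump_algebra.intros)
  moreover have "((\<lambda>x. bump_half c k (x - a)) has_field_derivative ?f x) (at x)" for x
  proof -
    have "((\<lambda>x. x - a) has_field_derivative 1) (at x)" by (auto intro!: derivative_eq_intros)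
    from DERIV_chain2[where f = "bump_half c k" and g = "\<lambda>x. x - a", OF bump_half_has_derivative[OF c] this] show ?thesis by simp
  qed
  ultimately show ?case by (intro bexI[where x = ?f] allI)
next
  case (right k)
  let ?f = "\<lambda>x. (- c) * bump_half c (k + 2) (b - x) + real k * bump_half c (Suc k) (b - x)"
  have "?f \<in> bump_algebra a b c" by (intro bump_algebra.intros)
  moreover have "((\<lambda>x. bump_half c k (b - x)) has_field_derivative ?f x) (at x)" for x
  proof -
    have "((\<lambda>x. b - x) has_field_derivative - 1) (at x)" by (auto intro!: derivative_eq_intros)
    from DERIV_chain2[where f = "bump_half c k" and g = "\<lambda>x. b - x", OF bump_half_has_derivative[OF c] this] show ?thesis by simp
  qed
  ultimately show ?case by (intro bexI[where x = ?f] allI)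
next
  case (add f g)
  then obtain f' g' where "f' \<in> bump_algebra a b c" "\<And>x. (f has_field_derivative f' x) (at x)"
      "g' \<in> bump_algebra a b c" "\<And>x. (g has_field_derivative g' x) (at x)" by blast
  then show ?case by (intro bexI[of _ "\<lambda>x. f' x + g' x"] allI DERIV_add bump_algebra.add)
next
  case (mult f g)
  then obtain f' g' where *: "f' \<in> bump_algebra a b c" "\<And>x. (f has_field_derivative f' x) (at x)"
      "g' \<in> bump_algebra a b c" "\<And>x. (g has_field_derivative g' x) (at x)" by blast
  have "(\<lambda>x. f' x * g x + g' x * f x) \<in> bump_algebra a b c" by (intro bump_algebra.intros * mult)
  moreover have "\<forall>x. ((\<lambda>x. f x * g x) has_field_derivative f' x * g x + g' x * f x) (at x)"
    by (intro allI DERIV_mult *)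
  ultimately show ?case by (intro bexI[where x = "\<lambda>x. f' x * g x + g' x * f x"])
qed

lemma bump_algebra_smooth:
  assumes c: "c > 0" and f: "f \<in> bump_algebra a b c"
  shows "(deriv ^^ k) f \<in> bump_algebra a b c"
proof (induction k)
  case (Suc k)
  from bump_algebra_derivative[OF c Suc] obtain f' where
    f': "f' \<in> bump_algebra a b c" "\<And>x. ((deriv ^^ k) f has_field_derivative f' x) (at x)" by blast
  have "(deriv ^^ Suc k) f = f'" by (rule ext) (simp add: DERIV_imp_deriv[OF f'(2)])
  then show ?case using f'(1) by simp
qed (use f in simp)

text \<open>
  As \<open>c\<close> tends to 0, this approximates the indicator of \<open>[a, b]\<close> from below.
\<close>

definition bump :: "real \<Rightarrow> real \<Rightarrow> real \<Rightarrow> real \<Rightarrow> real" where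
  "bump a b c x = bump_half c 0 (x - a) * bump_half c 0 (b - x)"

lemma bump_test_fun:
  assumes "0 < a" "c > 0" shows "bump a b c \<in> test_fun_pos"
proof -
  have "bump a b c \<in> bump_algebra a b c" unfolding bump_def[abs_def] by (intro bump_algebra.intros)
  then have "(deriv ^^ k) (bump a b c) differentiable at x" for k x
    using bump_algebra_derivative[OF assms(2) bump_algebra_smooth[OF assms(2)]]
    by (meson real_differentiable_def)
  moreover have "\<forall>x. x \<notin> {a..b} \<longrightarrow> bump a b c x = 0" by (auto simp: bump_def bump_half_def)
  ultimately show ?thesis using assms(1) unfolding test_fun_pos_def by blast
qed

lemma bump_bounds: "c > 0 \<Longrightarrow> 0 \<le> bump a b c x \<and> bump a b c x \<le> indicator {a..b} x"
proof -
  assume c: "c > 0"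
  have h: "0 \<le> bump_half c 0 t" "bump_half c 0 t \<le> 1" for t using c by (auto simp: bump_half_def)
  have "bump a b c x \<le> 1" unfolding bump_def by (intro mult_le_one h)
  moreover have "x \<notin> {a..b} \<Longrightarrow> bump a b c x = 0" by (auto simp: bump_def bump_half_def)
  moreover have "0 \<le> bump a b c x" unfolding bump_def by (intro mult_nonneg_nonneg h)
  ultimately show ?thesis by (auto simp: indicator_def)
qed

lemma bump_tendsto:
  assumes "x \<noteq> a" "x \<noteq> b"
  shows "(\<lambda>n. bump a b (1 / real (Suc n)) x) \<longlonglongrightarrow> indicator {a..b} x"
proof (cases "a < x \<and> x < b")
  case True
  have h: "(\<lambda>n. bump_half (1 / real (Suc n)) 0 t) \<longlonglongrightarrow> 1" if "t > 0" for t
  proof -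
    have "(\<lambda>n. exp (- (1 / real (Suc n)) / t)) \<longlonglongrightarrow> exp (- 0 / t)"
      by (intro tendsto_intros LIMSEQ_Suc[OF lim_const_over_n]) (use that in auto)
    then show ?thesis using that by (simp add: bump_half_def)
  qed
  have "(\<lambda>n. bump a b (1 / real (Suc n)) x) \<longlonglongrightarrow> 1 * 1"
    unfolding bump_def by (intro tendsto_mult h) (use True in auto)
  then show ?thesis using True by simp
next
  case False
  then have "x \<notin> {a..b}" using assms by auto
  moreover from this have "bump a b c x = 0" for c by (auto simp: bump_def bump_half_def)
  ultimately show ?thesis by simp
qed

lemma test_fun_pos_properties:
  assumes \<phi>: "\<phi> \<in> test_fun_pos"
  obtains a b B where "0 < a" "\<And>x. x \<notin> {a..b} \<Longrightarrow> \<phi> x = 0" "\<And>x. x \<notin> {a..b} \<Longrightarrow> deriv \<phi> x = 0"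
    "\<And>x. (\<phi> has_real_derivative deriv \<phi> x) (at x)" "continuous_on UNIV \<phi>" "continuous_on UNIV (deriv \<phi>)"
    "\<And>x. \<bar>\<phi> x\<bar> \<le> B" "\<And>x. \<bar>deriv \<phi> x\<bar> \<le> B"
proof -
  have sm: "(deriv ^^ k) \<phi> differentiable at x" for k x using \<phi> by (simp add: test_fun_pos_def)
  obtain a b where ab: "0 < a" "\<And>x. x \<notin> {a..b} \<Longrightarrow> \<phi> x = 0" using \<phi> by (auto simp: test_fun_pos_def)
  have d: "(\<phi> has_real_derivative deriv \<phi> x) (at x)" for x
    using sm[of 0 x] by (simp add: DERIV_deriv_iff_real_differentiable)
  have c0: "continuous_on UNIV \<phi>"
    by (intro continuous_at_imp_continuous_on ballI differentiable_imp_continuous_within) (use sm[of 0] in simp)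
  have c1: "continuous_on UNIV (deriv \<phi>)"
    by (intro continuous_at_imp_continuous_on ballI differentiable_imp_continuous_within) (use sm[of 1] in simp)
  have z: "deriv \<phi> x = 0" if "x \<notin> {a..b}" for x
  proof -
    have "((\<lambda>_. 0) has_real_derivative 0) (at x)" by simp
    then have "(\<phi> has_real_derivative 0) (at x)"
      by (rule has_field_derivative_transform_within_open[of _ _ _ "- {a..b}"]) (use that ab(2) in auto)
    then show ?thesis by (rule DERIV_imp_deriv)
  qed
  have "compact (\<phi> ` {a..b} \<union> deriv \<phi> ` {a..b})"
    by (intro compact_Un compact_continuous_image continuous_on_subset[OF c0] continuous_on_subset[OF c1]) auto
  then obtain B where B: "B > 0" "\<And>y. y \<in> \<phi> ` {a..b} \<union> deriv \<phi> ` {a..b} \<Longrightarrow> norm y \<le> B"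
    using compact_imp_bounded bounded_pos by metis
  have "\<bar>\<phi> x\<bar> \<le> B" for x using B ab(2)[of x] by (cases "x \<in> {a..b}") auto
  moreover have "\<bar>deriv \<phi> x\<bar> \<le> B" for x using B z[of x] by (cases "x \<in> {a..b}") auto
  ultimately show thesis using that ab z d c0 c1 by blast
qed

text \<open>
  Translation to the right keeps the support in the open half line; this is what makes translates usable as test functions.
\<close>

lemma test_fun_pos_translate:
  assumes \<phi>: "\<phi> \<in> test_fun_pos" and h: "0 \<le> h"
  shows "(\<lambda>x. \<phi> (x - h)) \<in> test_fun_pos" "deriv (\<lambda>x. \<phi> (x - h)) = (\<lambda>x. deriv \<phi> (x - h))"
proof -
  have sm: "(deriv ^^ k) \<phi> differentiable at x" for k x using \<phi> by (simp add: test_fun_pos_def)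
  have d: "((\<lambda>x. (deriv ^^ k) \<phi> (x - h)) has_real_derivative (deriv ^^ Suc k) \<phi> (x - h)) (at x)" for k x
  proof -
    have "((deriv ^^ k) \<phi> has_real_derivative (deriv ^^ Suc k) \<phi> (x - h)) (at (x - h))"
      using sm[of k "x - h"] by (simp add: DERIV_deriv_iff_real_differentiable)
    moreover have "((\<lambda>x. x - h) has_real_derivative 1) (at x)" by (auto intro!: derivative_eq_intros)
    ultimately show ?thesis using DERIV_chain2 by fastforce
  qed
  have e: "(deriv ^^ k) (\<lambda>x. \<phi> (x - h)) = (\<lambda>x. (deriv ^^ k) \<phi> (x - h))" for k
  proof (induction k)
    case (Suc k)
    have "(deriv ^^ Suc k) (\<lambda>x. \<phi> (x - h)) = deriv (\<lambda>x. (deriv ^^ k) \<phi> (x - h))"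
      by (simp only: funpow.simps o_apply Suc)
    then show ?case using DERIV_imp_deriv[OF d[of k]] by (simp add: fun_eq_iff)
  qed simp
  show "deriv (\<lambda>x. \<phi> (x - h)) = (\<lambda>x. deriv \<phi> (x - h))" using e[of 1] by simp
  obtain a b where ab: "0 < a" "\<And>x. x \<notin> {a..b} \<Longrightarrow> \<phi> x = 0" using \<phi> by (auto simp: test_fun_pos_def)
  have "(deriv ^^ k) (\<lambda>x. \<phi> (x - h)) differentiable at x" for k x
    unfolding e using d real_differentiable_def by blast
  moreover have "\<phi> (x - h) = 0" if "x \<notin> {a + h..b + h}" for x using ab(2)[of "x - h"] that by auto
  moreover have "0 < a + h" using ab(1) h by simp
  ultimately show "(\<lambda>x. \<phi> (x - h)) \<in> test_fun_pos" unfolding test_fun_pos_def by blast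
qed

section \<open>The domain of \<open>G\<close>\<close>

lemma compact_support_integrable:
  fixes \<psi> :: "real \<Rightarrow> 'a::euclidean_space"
  assumes "continuous_on UNIV \<psi>" "\<And>x. x \<notin> {a..b} \<Longrightarrow> \<psi> x = 0"
  shows "integrable lborel \<psi>"
proof -
  have "integrable lborel (\<lambda>x. indicator {a..b} x *\<^sub>R \<psi> x)"
    by (rule borel_integrable_compact) (auto intro: continuous_on_subset[OF assms(1)])
  moreover have "(\<lambda>x. indicator {a..b} x *\<^sub>R \<psi> x) = \<psi>" using assms(2) by (auto simp: indicator_def)
  ultimately show ?thesis by simp
qed

lemma bounded_mult_integrable:
  fixes f :: "real \<Rightarrow> 'a::euclidean_space"
  assumes f: "square_integrable f" and \<phi>: "\<phi> \<in> borel_measurable borel"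
    and s: "\<And>x. x \<notin> {a..b} \<Longrightarrow> \<phi> x = 0" and B: "\<And>x. \<bar>\<phi> x\<bar> \<le> B"
  shows "integrable lborel (\<lambda>x. \<phi> x *\<^sub>R f x)"
proof (rule Bochner_Integration.integrable_bound)
  show "integrable lborel (\<lambda>x. B *\<^sub>R (indicator {a..b} x *\<^sub>R f x))"
    by (intro integrable_scaleR_right square_integrable_set_integrable f) (auto simp: emeasure_Icc_finite)
  show "(\<lambda>x. \<phi> x *\<^sub>R f x) \<in> borel_measurable lborel"
    using \<phi> square_integrable_measurable[OF f] by measurable
  have B0: "0 \<le> B" using B[of 0] by linarith
  show "AE x in lborel. norm (\<phi> x *\<^sub>R f x) \<le> norm (B *\<^sub>R (indicator {a..b} x *\<^sub>R f x))"
  proof (rule AE_I2)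
    fix x show "norm (\<phi> x *\<^sub>R f x) \<le> norm (B *\<^sub>R (indicator {a..b} x *\<^sub>R f x))"
      using B[of x] B0 s[of x] by (cases "x \<in> {a..b}") (auto intro!: mult_right_mono)
  qed
qed

lemma has_vector_derivative_sequentially:
  fixes f :: "real \<Rightarrow> 'a::real_normed_vector"
  assumes "\<And>y. y \<longlonglongrightarrow> x \<Longrightarrow> (\<And>n::nat. y n \<noteq> x) \<Longrightarrow> (\<lambda>n. (1 / (y n - x)) *\<^sub>R (f (y n) - f x)) \<longlonglongrightarrow> D"
  shows "(f has_vector_derivative D) (at x)"
  unfolding has_vector_derivative_def has_derivative_within
proof (intro conjI bounded_linear_scaleR_left)
  show "((\<lambda>y. (1 / norm (y - x)) *\<^sub>R (f y - (f x + (y - x) *\<^sub>R D))) \<longlongrightarrow> 0) (at x)"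
    unfolding tendsto_at_iff_sequentially
  proof (intro allI impI)
    fix y :: "nat \<Rightarrow> real" assume "\<forall>i. y i \<in> UNIV - {x}" and y: "y \<longlonglongrightarrow> x"
    then have ne: "y n \<noteq> x" for n by auto
    have "norm ((1 / norm (y n - x)) *\<^sub>R (f (y n) - (f x + (y n - x) *\<^sub>R D))) = norm ((1 / (y n - x)) *\<^sub>R (f (y n) - f x) - D)" for n
    proof -
      have "(1 / (y n - x)) *\<^sub>R (f (y n) - f x) - D = (1 / (y n - x)) *\<^sub>R (f (y n) - (f x + (y n - x) *\<^sub>R D))"
        using ne[of n] by (simp add: scaleR_diff_right scaleR_add_right)
      then show ?thesis by simp
    qed
    moreover have "(\<lambda>n. norm ((1 / (y n - x)) *\<^sub>R (f (y n) - f x) - D)) \<longlonglongrightarrow> 0"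
      by (intro tendsto_norm_zero LIM_zero assms y ne)
    ultimately show "((\<lambda>y. (1 / norm (y - x)) *\<^sub>R (f y - (f x + (y - x) *\<^sub>R D))) \<circ> y) \<longlonglongrightarrow> 0"
      unfolding o_def by (subst tendsto_norm_zero_iff[symmetric]) (simp only:)
  qed
qed

lemma translate_integral_derivative:
  fixes D :: "real \<Rightarrow> complex^'n^'m"
  assumes D: "square_integrable D" and \<phi>: "\<phi> \<in> test_fun_pos"
  shows "((\<lambda>h. LINT \<xi>|lborel. \<phi> (\<xi> - h) *\<^sub>R D \<xi>) has_vector_derivative - (LINT \<xi>|lborel. deriv \<phi> (\<xi> - h) *\<^sub>R D \<xi>)) (at h)"
proof (rule has_vector_derivative_sequentially)
  fix y :: "nat \<Rightarrow> real" assume y: "y \<longlonglongrightarrow> h" "\<And>n. y n \<noteq> h"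
  from test_fun_pos_properties[OF \<phi>] obtain a b B where p: "0 < a" "\<And>x. x \<notin> {a..b} \<Longrightarrow> \<phi> x = 0"
    "\<And>x. (\<phi> has_real_derivative deriv \<phi> x) (at x)" "continuous_on UNIV \<phi>" "continuous_on UNIV (deriv \<phi>)"
    "\<And>x. \<bar>\<phi> x\<bar> \<le> B" "\<And>x. \<bar>deriv \<phi> x\<bar> \<le> B" by metis
  note [measurable] = square_integrable_measurable[OF D] borel_measurable_continuous_onI[OF p(4)] borel_measurable_continuous_onI[OF p(5)]
  obtain M where M: "\<And>n. \<bar>y n\<bar> \<le> M" using convergent_imp_Bseq[OF convergentI[OF y(1)]] by (auto simp: Bseq_def)
  define L where "L = max M \<bar>h\<bar>"
  have int: "integrable lborel (\<lambda>\<xi>. \<phi> (\<xi> - t) *\<^sub>R D \<xi>)" for t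
    by (rule bounded_mult_integrable[OF D, of _ "a + t" "b + t" B]) (measurable, use p(2,6) in auto)
  have w: "integrable lborel (\<lambda>\<xi>. B * norm (indicator {a - L..b + L} \<xi> *\<^sub>R D \<xi>))"
    by (intro integrable_mult_right integrable_norm square_integrable_set_integrable D) (auto simp: emeasure_Icc_finite)
  have "(\<lambda>n. LINT \<xi>|lborel. ((\<phi> (\<xi> - y n) - \<phi> (\<xi> - h)) / (y n - h)) *\<^sub>R D \<xi>) \<longlonglongrightarrow> (LINT \<xi>|lborel. (- deriv \<phi> (\<xi> - h)) *\<^sub>R D \<xi>)"
  proof (rule integral_dominated_convergence[OF _ _ w])
    show "AE \<xi> in lborel. (\<lambda>n. ((\<phi> (\<xi> - y n) - \<phi> (\<xi> - h)) / (y n - h)) *\<^sub>R D \<xi>) \<longlonglongrightarrow> (- deriv \<phi> (\<xi> - h)) *\<^sub>R D \<xi>"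
    proof (intro AE_I2 tendsto_scaleR tendsto_const)
      fix \<xi>
      have "((\<lambda>t. \<xi> - t) has_real_derivative - 1) (at h)" by (auto intro!: derivative_eq_intros)
      from DERIV_chain2[where f = \<phi> and g = "\<lambda>t. \<xi> - t", OF p(3) this]
      have "((\<lambda>t. (\<phi> (\<xi> - t) - \<phi> (\<xi> - h)) / (t - h)) \<longlongrightarrow> - deriv \<phi> (\<xi> - h)) (at h)"
        by (simp add: has_field_derivative_iff)
      moreover have "filterlim y (at h) sequentially" unfolding filterlim_at using y by auto
      ultimately show "(\<lambda>n. (\<phi> (\<xi> - y n) - \<phi> (\<xi> - h)) / (y n - h)) \<longlonglongrightarrow> - deriv \<phi> (\<xi> - h)"
        by (rule filterlim_compose)
    qed
    show "AE \<xi> in lborel. norm (((\<phi> (\<xi> - y n) - \<phi> (\<xi> - h)) / (y n - h)) *\<^sub>R D \<xi>) \<le> B * norm (indicator {a - L..b + L} \<xi> *\<^sub>R D \<xi>)" for n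
    proof (rule AE_I2)
      fix \<xi>
      have "norm (\<phi> (\<xi> - y n) - \<phi> (\<xi> - h)) \<le> B * norm ((\<xi> - y n) - (\<xi> - h))"
        by (rule field_differentiable_bound[of UNIV \<phi> "deriv \<phi>"]) (use p(3,7) in auto)
      then have q: "\<bar>(\<phi> (\<xi> - y n) - \<phi> (\<xi> - h)) / (y n - h)\<bar> \<le> B"
        using y(2)[of n] by (simp add: divide_simps abs_minus_commute)
      have B0: "0 \<le> B" using p(6)[of 0] by linarith
      show "norm (((\<phi> (\<xi> - y n) - \<phi> (\<xi> - h)) / (y n - h)) *\<^sub>R D \<xi>) \<le> B * norm (indicator {a - L..b + L} \<xi> *\<^sub>R D \<xi>)"
      proof (cases "\<xi> \<in> {a - L..b + L}")
        case True
        have "norm (((\<phi> (\<xi> - y n) - \<phi> (\<xi> - h)) / (y n - h)) *\<^sub>R D \<xi>) = \<bar>(\<phi> (\<xi> - y n) - \<phi> (\<xi> - h)) / (y n - h)\<bar> * norm (D \<xi>)"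
          by (rule norm_scaleR)
        also have "\<dots> \<le> B * norm (D \<xi>)" by (rule mult_right_mono[OF q norm_ge_zero])
        finally show ?thesis using True by simp
      next
        case False
        then have "\<xi> - y n \<notin> {a..b}" "\<xi> - h \<notin> {a..b}" using M[of n] by (auto simp: L_def abs_le_iff)
        then show ?thesis using B0 by (simp add: p(2))
      qed
    qed
  qed measurable
  moreover have "(LINT \<xi>|lborel. ((\<phi> (\<xi> - y n) - \<phi> (\<xi> - h)) / (y n - h)) *\<^sub>R D \<xi>)
      = (1 / (y n - h)) *\<^sub>R ((LINT \<xi>|lborel. \<phi> (\<xi> - y n) *\<^sub>R D \<xi>) - (LINT \<xi>|lborel. \<phi> (\<xi> - h) *\<^sub>R D \<xi>))" for n
  proof -
    have "((\<phi> (\<xi> - y n) - \<phi> (\<xi> - h)) / (y n - h)) *\<^sub>R D \<xi> = (1 / (y n - h)) *\<^sub>R (\<phi> (\<xi> - y n) *\<^sub>R D \<xi> - \<phi> (\<xi> - h) *\<^sub>R D \<xi>)" for \<xi>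
      by (simp add: scaleR_diff_left[symmetric])
    then show ?thesis by (simp only: integral_scaleR_right Bochner_Integration.integral_diff[OF int int])
  qed
  ultimately show "(\<lambda>n. (1 / (y n - h)) *\<^sub>R ((LINT \<xi>|lborel. \<phi> (\<xi> - y n) *\<^sub>R D \<xi>) - (LINT \<xi>|lborel. \<phi> (\<xi> - h) *\<^sub>R D \<xi>)))
      \<longlonglongrightarrow> - (LINT \<xi>|lborel. deriv \<phi> (\<xi> - h) *\<^sub>R D \<xi>)"
    by simp
qed

text \<open>
  Translating the test function by \<open>h \<ge> 0\<close> multiplies the pairing by \<open>e\<^bsup>-izh\<^esup>\<close>, which grows exponentially in \<open>h\<close>; but the pairing is
  bounded by the Cauchy-Schwarz inequality.
\<close>

lemma weak_ode_test_zero: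
  fixes D :: "real \<Rightarrow> complex^'n^'m"
  assumes z: "Im z > 0" and D: "square_integrable D"
    and ode: "\<And>\<phi>. \<phi> \<in> test_fun_pos \<Longrightarrow> (LINT \<xi>|lborel. deriv \<phi> \<xi> *\<^sub>R D \<xi>) = (\<i> * z) *\<^sub>M (LINT \<xi>|lborel. \<phi> \<xi> *\<^sub>R D \<xi>)"
    and \<phi>: "\<phi> \<in> test_fun_pos"
  shows "(LINT \<xi>|lborel. \<phi> \<xi> *\<^sub>R D \<xi>) = 0"
proof -
  define N where "N h = (LINT \<xi>|lborel. \<phi> (\<xi> - h) *\<^sub>R D \<xi>)" for h
  from test_fun_pos_properties[OF \<phi>] obtain a b B where p: "0 < a" "\<And>x. x \<notin> {a..b} \<Longrightarrow> \<phi> x = 0"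
    "continuous_on UNIV \<phi>" "\<And>x. \<bar>\<phi> x\<bar> \<le> B" by metis
  have s\<phi>: "square_integrable \<phi>"
  proof (rule square_integrable_of_bounded)
    show "integrable lborel \<phi>" by (rule compact_support_integrable[OF p(3) p(2)])
    show "norm (\<phi> x) \<le> B" for x using p(4) by simp
  qed
  let ?C = "norm (abs_L2 \<phi>) * norm (abs_L2 D)"
  have Nle: "norm (N h) \<le> ?C" for h
  proof -
    have s: "square_integrable (\<lambda>x. \<phi> (x - h))" using square_integrable_affine[OF one_neq_zero s\<phi>, of "- h"] by simp
    have "norm (N h) \<le> (LINT \<xi>|lborel. norm (\<phi> (\<xi> - h)) * norm (D \<xi>))"
      unfolding N_def by (rule order_trans[OF integral_norm_bound]) simp
    also have "\<dots> \<le> norm (abs_L2 (\<lambda>x. \<phi> (x - h))) * norm (abs_L2 D)"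
      by (rule integral_norm_mult_le[OF s D])
    also have "norm (abs_L2 (\<lambda>x. \<phi> (x - h))) = norm (abs_L2 \<phi>)"
      using L2_affine_abs[OF one_neq_zero s\<phi>, of "- h"] inner_L2_affine[OF one_neq_zero, of "- h" "abs_L2 \<phi>" "abs_L2 \<phi>"]
      by (simp add: norm_eq_sqrt_inner)
    finally show ?thesis .
  qed
  have dN: "(N has_vector_derivative - ((\<i> * z) *\<^sub>M N h)) (at h)" if "0 \<le> h" for h
    using translate_integral_derivative[OF D \<phi>, of h] ode[OF test_fun_pos_translate(1)[OF \<phi> that]]
    by (simp add: test_fun_pos_translate(2)[OF \<phi> that] N_def[abs_def])
  define K where "K h = exp (\<i> * z * of_real h) *\<^sub>M N h" for h
  have dK: "(K has_vector_derivative 0) (at h within {0..})" if "0 \<le> h" for h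
  proof -
    have "((\<lambda>s. exp (\<i> * z * s)) has_field_derivative (\<i> * z) * exp (\<i> * z * of_real h)) (at (of_real h))"
      by (auto intro!: derivative_eq_intros)
    then have d2: "((\<lambda>h. exp (\<i> * z * of_real h)) has_vector_derivative (\<i> * z) * exp (\<i> * z * of_real h)) (at h)"
      by (rule has_vector_derivative_real_field)
    from bounded_bilinear.has_vector_derivative[OF bounded_bilinear_mscale this dN[OF that]]
    have "(K has_vector_derivative 0) (at h)" unfolding K_def by (simp add: mult.commute)
    then show ?thesis by (rule has_vector_derivative_at_within)
  qed
  obtain c where c: "\<And>h. 0 \<le> h \<Longrightarrow> K h = c"
    using has_vector_derivative_zero_constant[of "{0..}" K] dK by auto
  have "norm c \<le> exp (- Im z) ^ n * ?C" for n
  proof -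
    have "norm c = exp (- Im z * real n) * norm (N (real n))"
      using c[of "real n"] by (simp only: K_def norm_mscale cmod_exp_iw[symmetric] of_nat_0_le_iff flip: norm_mscale)
    also have "\<dots> \<le> exp (- Im z * real n) * ?C" by (intro mult_left_mono Nle) simp
    also have "exp (- Im z * real n) = exp (- Im z) ^ n" by (simp add: exp_of_nat_mult[symmetric] mult.commute)
    finally show ?thesis .
  qed
  moreover have "(\<lambda>n. exp (- Im z) ^ n * ?C) \<longlonglongrightarrow> 0 * ?C"
    using z by (intro tendsto_mult tendsto_const LIMSEQ_power_zero) simp
  ultimately have "norm c \<le> 0 * ?C" by (intro LIMSEQ_le_const[of _ "0 * ?C"]) auto
  then have "N 0 = 0" using c[of 0] by (simp add: K_def)
  then show ?thesis by (simp add: N_def)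
qed

text \<open>
  Approximating indicators of intervals by bump functions shows that all integrals of \<open>D\<close> over intervals in the open half line vanish.
\<close>

lemma weak_ode_zero:
  fixes D :: "real \<Rightarrow> complex^'n^'m"
  assumes z: "Im z > 0" and D: "square_integrable D"
    and ode: "\<And>\<phi>. \<phi> \<in> test_fun_pos \<Longrightarrow> (LINT \<xi>|lborel. deriv \<phi> \<xi> *\<^sub>R D \<xi>) = (\<i> * z) *\<^sub>M (LINT \<xi>|lborel. \<phi> \<xi> *\<^sub>R D \<xi>)"
  shows "AE \<xi> in lborel. 0 < \<xi> \<longrightarrow> D \<xi> = 0"
proof -
  note [measurable] = square_integrable_measurable[OF D]
  have int: "integrable lborel (\<lambda>\<xi>. indicator {a..b} \<xi> *\<^sub>R D \<xi>)" for a b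
    by (rule square_integrable_set_integrable[OF D]) (auto simp: emeasure_Icc_finite)
  have zero: "(LINT \<xi>|lborel. indicator {a..b} \<xi> *\<^sub>R D \<xi>) = 0" if a: "0 < a" for a b
  proof (rule LIMSEQ_unique)
    have m [measurable]: "bump a b (1 / real (Suc n)) \<in> borel_measurable borel" for n
    proof -
      have "bump a b (1 / real (Suc n)) \<in> test_fun_pos" by (rule bump_test_fun[OF a]) simp
      from test_fun_pos_properties[OF this] show ?thesis by (metis borel_measurable_continuous_onI)
    qed
    show "(\<lambda>n. LINT \<xi>|lborel. bump a b (1 / real (Suc n)) \<xi> *\<^sub>R D \<xi>) \<longlonglongrightarrow> (LINT \<xi>|lborel. indicator {a..b} \<xi> *\<^sub>R D \<xi>)"
    proof (rule integral_dominated_convergence[OF _ _ integrable_norm[OF int[of a b]]])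
      show "AE \<xi> in lborel. (\<lambda>n. bump a b (1 / real (Suc n)) \<xi> *\<^sub>R D \<xi>) \<longlonglongrightarrow> indicator {a..b} \<xi> *\<^sub>R D \<xi>"
        using AE_lborel_singleton[of a] AE_lborel_singleton[of b]
        by eventually_elim (intro tendsto_scaleR tendsto_const bump_tendsto)
      show "AE \<xi> in lborel. norm (bump a b (1 / real (Suc n)) \<xi> *\<^sub>R D \<xi>) \<le> norm (indicator {a..b} \<xi> *\<^sub>R D \<xi>)" for n
        using bump_bounds[of "1 / real (Suc n)" a b] by (auto intro!: mult_right_mono simp: abs_of_nonneg)
    qed measurable
    have "(LINT \<xi>|lborel. bump a b (1 / real (Suc n)) \<xi> *\<^sub>R D \<xi>) = 0" for n
      by (rule weak_ode_test_zero[OF z D ode bump_test_fun[OF a]]) simp_all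
    then show "(\<lambda>n. LINT \<xi>|lborel. bump a b (1 / real (Suc n)) \<xi> *\<^sub>R D \<xi>) \<longlonglongrightarrow> 0" by simp
  qed
  have "AE \<xi> in lborel. indicator {1 / real (Suc m)..} \<xi> *\<^sub>R D \<xi> = 0" for m
  proof (rule AE_zero_of_interval_integrals)
    let ?e = "1 / real (Suc m)"
    have eq: "(\<lambda>\<xi>. indicator {a..b} \<xi> *\<^sub>R indicator {?e..} \<xi> *\<^sub>R D \<xi>) = (\<lambda>\<xi>. indicator {max a ?e..b} \<xi> *\<^sub>R D \<xi>)" for a b
      by (auto simp: indicator_def)
    show "integrable lborel (\<lambda>\<xi>. indicator {a..b} \<xi> *\<^sub>R indicator {?e..} \<xi> *\<^sub>R D \<xi>)" for a b
      unfolding eq by (rule int)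
    show "(LINT \<xi>|lborel. indicator {a..b} \<xi> *\<^sub>R indicator {?e..} \<xi> *\<^sub>R D \<xi>) = 0" for a b
      unfolding eq by (rule zero, rule less_le_trans[OF _ max.cobounded2]) simp
  qed
  then have "AE \<xi> in lborel. \<forall>m. indicator {1 / real (Suc m)..} \<xi> *\<^sub>R D \<xi> = 0"
    unfolding AE_all_countable by (rule allI)
  then show ?thesis
  proof eventually_elim
    case (elim \<xi>)
    show ?case
    proof
      assume "0 < \<xi>"
      then obtain m where "1 / real (Suc m) < \<xi>" using reals_Archimedean[of \<xi>] by (auto simp: inverse_eq_divide)
      then show "D \<xi> = 0" using elim[rule_format, of m] by simp
    qed
  qed
qed

text \<open>
  Pairing the one-sided derivative of the shifts with a test function and moving the shift onto the test function
  gives the weak derivative of the Fourier transform.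
\<close>

theorem res_weak_derivative:
  fixes Q :: "(complex^'n^'m) L2"
  assumes z: "Im z > 0" and Q: "szego_L2 Q = Q" and \<phi>: "\<phi> \<in> test_fun_pos"
  shows "(LINT \<xi>|lborel. deriv \<phi> \<xi> *\<^sub>R rep_L2 (fourier_L2 (res z Q)) \<xi>)
    = (LINT \<xi>|lborel. \<phi> \<xi> *\<^sub>R rep_L2 (fourier_L2 (\<i> *\<^sub>C (Q + z *\<^sub>C res z Q))) \<xi>)"
proof -
  let ?F = "res z Q" and ?f = "rep_L2 (fourier_L2 (res z Q))"
  from test_fun_pos_properties[OF \<phi>] obtain a b B where p: "0 < a" "\<And>x. x \<notin> {a..b} \<Longrightarrow> \<phi> x = 0"
    "continuous_on UNIV \<phi>" "\<And>x. \<bar>\<phi> x\<bar> \<le> B" by metis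
  note [measurable] = borel_measurable_continuous_onI[OF p(3)] rep_L2_measurable
  define \<Phi> where "\<Phi> G = (LINT \<xi>|lborel. \<phi> \<xi> *\<^sub>R rep_L2 (fourier_L2 G) \<xi>)" for G :: "(complex^'n^'m) L2"
  have int: "integrable lborel (\<lambda>x. \<phi> x *\<^sub>R rep_L2 G x)" for G :: "(complex^'n^'m) L2"
    by (rule bounded_mult_integrable[OF square_integrable_rep_L2 _ p(2) p(4)]) measurable
  have s\<phi>: "square_integrable \<phi>"
  proof (rule square_integrable_of_bounded)
    show "integrable lborel \<phi>" by (rule compact_support_integrable[OF p(3) p(2)])
    show "norm (\<phi> x) \<le> B" for x using p(4) by simp
  qed
  interpret f: bounded_linear "fourier_L2 :: (complex^'n^'m) L2 \<Rightarrow> _" by (rule bounded_linear_fourier_L2)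
  have "bounded_linear (\<lambda>G :: (complex^'n^'m) L2. LINT \<xi>|lborel. \<phi> \<xi> *\<^sub>R rep_L2 G \<xi>)"
  proof (rule bounded_linear_intro)
    fix G H :: "(complex^'n^'m) L2" and r :: real
    have "(LINT \<xi>|lborel. \<phi> \<xi> *\<^sub>R rep_L2 (G + H) \<xi>) = (LINT \<xi>|lborel. \<phi> \<xi> *\<^sub>R rep_L2 G \<xi> + \<phi> \<xi> *\<^sub>R rep_L2 H \<xi>)"
      by (rule integral_cong_AE) (measurable, use rep_L2_add[of G H] in \<open>auto elim!: eventually_mono simp: scaleR_add_right\<close>)
    then show "(LINT \<xi>|lborel. \<phi> \<xi> *\<^sub>R rep_L2 (G + H) \<xi>) = (LINT \<xi>|lborel. \<phi> \<xi> *\<^sub>R rep_L2 G \<xi>) + (LINT \<xi>|lborel. \<phi> \<xi> *\<^sub>R rep_L2 H \<xi>)"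
      by (simp only: Bochner_Integration.integral_add[OF int int])
    have "(LINT \<xi>|lborel. \<phi> \<xi> *\<^sub>R rep_L2 (r *\<^sub>R G) \<xi>) = (LINT \<xi>|lborel. r *\<^sub>R (\<phi> \<xi> *\<^sub>R rep_L2 G \<xi>))"
      by (rule integral_cong_AE) (measurable, use rep_L2_scaleR[of r G] in \<open>auto elim!: eventually_mono simp: mult.commute\<close>)
    then show "(LINT \<xi>|lborel. \<phi> \<xi> *\<^sub>R rep_L2 (r *\<^sub>R G) \<xi>) = r *\<^sub>R (LINT \<xi>|lborel. \<phi> \<xi> *\<^sub>R rep_L2 G \<xi>)"
      by (simp only: integral_scaleR_right)
    have "norm (LINT \<xi>|lborel. \<phi> \<xi> *\<^sub>R rep_L2 G \<xi>) \<le> (LINT \<xi>|lborel. norm (\<phi> \<xi>) * norm (rep_L2 G \<xi>))"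
      by (rule order_trans[OF integral_norm_bound]) simp
    also have "\<dots> \<le> norm G * norm (abs_L2 \<phi>)"
      using integral_norm_mult_le[OF s\<phi> square_integrable_rep_L2[of G]] by (simp add: mult.commute)
    finally show "norm (LINT \<xi>|lborel. \<phi> \<xi> *\<^sub>R rep_L2 G \<xi>) \<le> norm G * norm (abs_L2 \<phi>)" .
  qed
  then have bl: "bounded_linear \<Phi>"
    unfolding \<Phi>_def by (rule bounded_linear_compose[OF _ bounded_linear_fourier_L2])
  have shift: "\<Phi> (shift_adj h ?F) = (LINT \<xi>|lborel. \<phi> (\<xi> - h) *\<^sub>R ?f \<xi>)" if h: "h \<in> {0..}" for h
  proof -
    have "\<Phi> (shift_adj h ?F) = (LINT \<xi>|lborel. \<phi> \<xi> *\<^sub>R ?f (h + 1 * \<xi>))"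
      unfolding \<Phi>_def
    proof (rule integral_cong_AE)
      show "AE \<xi> in lborel. \<phi> \<xi> *\<^sub>R rep_L2 (fourier_L2 (shift_adj h ?F)) \<xi> = \<phi> \<xi> *\<^sub>R ?f (h + 1 * \<xi>)"
        unfolding shift_adj_eq fourier_szego_L2 fourier_L2_modulate
        using rep_cutoff[of "L2_affine 1 (- (- h)) (fourier_L2 ?F)"] rep_L2_affine[OF one_neq_zero, of "- (- h)" "fourier_L2 ?F"]
      proof eventually_elim
        case (elim \<xi>)
        then show ?case using p(1) p(2)[of \<xi>] by (cases "0 \<le> \<xi>") auto
      qed
    qed measurable
    also have "\<dots> = (LINT \<xi>|lborel. \<phi> (\<xi> - h) *\<^sub>R ?f \<xi>)"
      using lborel_integral_real_affine[of 1 "\<lambda>\<xi>. \<phi> (\<xi> - h) *\<^sub>R ?f \<xi>" h] by simp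
    finally show ?thesis .
  qed
  have "((\<lambda>h. \<Phi> (shift_adj h ?F)) has_vector_derivative \<Phi> ((- \<i>) *\<^sub>C (Q + z *\<^sub>C ?F))) (at 0 within {0..})"
    by (rule bounded_linear.has_vector_derivative[OF bl shift_adj_derivative[OF z Q]])
  then have "((\<lambda>h. LINT \<xi>|lborel. \<phi> (\<xi> - h) *\<^sub>R ?f \<xi>) has_vector_derivative \<Phi> ((- \<i>) *\<^sub>C (Q + z *\<^sub>C ?F))) (at 0 within {0..})"
    by (rule has_vector_derivative_transform[rotated 2]) (simp_all add: shift)
  from vector_derivative_unique_within[OF at_0_within_half_line this
      has_vector_derivative_at_within[OF translate_integral_derivative[OF square_integrable_rep_L2 \<phi>]]]
  have "\<Phi> ((- \<i>) *\<^sub>C (Q + z *\<^sub>C ?F)) = - (LINT \<xi>|lborel. deriv \<phi> \<xi> *\<^sub>R ?f \<xi>)" by simp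
  then show ?thesis unfolding scaleC_minus_left bounded_linear_simps[OF bl] by (simp add: \<Phi>_def)
qed

text \<open>
  Test functions vanish off the open half line, so that the restriction of the integrals can be dropped.
\<close>

lemma test_fun_pos_half_line:
  assumes \<phi>: "\<phi> \<in> test_fun_pos"
  shows "(LINT \<xi>:{0<..}|lborel. \<phi> \<xi> *\<^sub>R f \<xi>) = (LINT \<xi>|lborel. \<phi> \<xi> *\<^sub>R f \<xi>)"
    "(LINT \<xi>:{0<..}|lborel. deriv \<phi> \<xi> *\<^sub>R f \<xi>) = (LINT \<xi>|lborel. deriv \<phi> \<xi> *\<^sub>R f \<xi>)"
    "(LINT \<xi>|lborel. \<phi> \<xi> *\<^sub>R (indicator {0<..} \<xi> *\<^sub>R f \<xi>)) = (LINT \<xi>|lborel. \<phi> \<xi> *\<^sub>R f \<xi>)"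
proof -
  from test_fun_pos_properties[OF \<phi>] obtain a b where p: "0 < a" "\<And>x. x \<notin> {a..b} \<Longrightarrow> \<phi> x = 0" "\<And>x. x \<notin> {a..b} \<Longrightarrow> deriv \<phi> x = 0" by metis
  have z0: "\<phi> x = 0" "deriv \<phi> x = 0" if "\<not> 0 < x" for x using p(1) that by (auto intro!: p(2,3))
  show "(LINT \<xi>:{0<..}|lborel. \<phi> \<xi> *\<^sub>R f \<xi>) = (LINT \<xi>|lborel. \<phi> \<xi> *\<^sub>R f \<xi>)"
    "(LINT \<xi>:{0<..}|lborel. deriv \<phi> \<xi> *\<^sub>R f \<xi>) = (LINT \<xi>|lborel. deriv \<phi> \<xi> *\<^sub>R f \<xi>)"
    "(LINT \<xi>|lborel. \<phi> \<xi> *\<^sub>R (indicator {0<..} \<xi> *\<^sub>R f \<xi>)) = (LINT \<xi>|lborel. \<phi> \<xi> *\<^sub>R f \<xi>)"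
    unfolding set_lebesgue_integral_def
    by (intro Bochner_Integration.integral_cong refl, use z0 in \<open>auto simp: indicator_def\<close>)+
qed

theorem res_in_Dom_G:
  fixes Q :: "(complex^'n^'m) L2"
  assumes z: "Im z > 0" and Q: "szego_L2 Q = Q"
  shows "res z Q \<in> Dom_G"
proof -
  let ?f = "rep_L2 (fourier_L2 (res z Q))" and ?g = "\<lambda>\<xi>. - rep_L2 (fourier_L2 (\<i> *\<^sub>C (Q + z *\<^sub>C res z Q))) \<xi>"
  have mi: "multiplier 1 (\<lambda>\<xi> A. indicator {0<..} \<xi> *\<^sub>R (A :: complex^'n^'m))" by (rule multiplier_indicator) simp
  have "(LINT \<xi>:{0<..}|lborel. deriv \<phi> \<xi> *\<^sub>R ?f \<xi>) = - (LINT \<xi>:{0<..}|lborel. \<phi> \<xi> *\<^sub>R ?g \<xi>)"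
    if \<phi>: "\<phi> \<in> test_fun_pos" for \<phi>
    unfolding test_fun_pos_half_line(1,2)[OF \<phi>] res_weak_derivative[OF z Q \<phi>] by simp
  then have "H1_pos ?f"
    unfolding H1_pos_def
    using square_integrable_multiplier[OF mi square_integrable_rep_L2] square_integrable_multiplier[OF mi square_integrable_minus[OF square_integrable_rep_L2]]
    by (intro conjI exI[of _ ?g]) auto
  then show ?thesis by (simp add: Dom_G_def L2_plus_iff)
qed

text \<open>
  The weak derivative determines the candidate \<open>Q\<close>; then \<open>F - res z Q\<close> solves the homogeneous equation weakly.
\<close>

theorem Dom_G_imp_res:
  fixes F :: "(complex^'n^'m) L2"
  assumes z: "Im z > 0" and F: "F \<in> Dom_G"
  obtains Q where "szego_L2 Q = Q" "F = res z Q"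
proof -
  have Fp: "szego_L2 F = F" and H1: "H1_pos (rep_L2 (fourier_L2 F))"
    using F by (auto simp: Dom_G_def L2_plus_iff)
  let ?f = "rep_L2 (fourier_L2 F)"
  obtain g where g: "square_integrable (\<lambda>\<xi>. indicator {0<..} \<xi> *\<^sub>R g \<xi>)"
    and wd: "\<And>\<phi>. \<phi> \<in> test_fun_pos \<Longrightarrow> (LINT \<xi>:{0<..}|lborel. deriv \<phi> \<xi> *\<^sub>R ?f \<xi>) = - (LINT \<xi>:{0<..}|lborel. \<phi> \<xi> *\<^sub>R g \<xi>)"
    using H1 by (auto simp: H1_pos_def)
  define g0 where "g0 \<xi> = indicator {0<..} \<xi> *\<^sub>R g \<xi>" for \<xi> :: real
  have g0: "square_integrable g0" using g by (simp add: g0_def[abs_def])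
  define q where "q \<xi> = \<i> *\<^sub>M g0 \<xi> - indicator {0<..} \<xi> *\<^sub>R (z *\<^sub>M ?f \<xi>)" for \<xi> :: real
  have sq: "square_integrable q"
    unfolding q_def by (intro square_integrable_diff square_integrable_mscale g0
        square_integrable_multiplier[OF multiplier_indicator]) auto
  define Q where "Q = ifourier_L2 (abs_L2 q)"
  have FQ: "AE \<xi> in lborel. rep_L2 (fourier_L2 Q) \<xi> = q \<xi>"
    unfolding Q_def by (simp add: rep_L2_abs_L2[OF sq])
  have Qp: "szego_L2 Q = Q"
    unfolding szego_plus_iff using FQ by eventually_elim (simp add: q_def g0_def)
  let ?f1 = "rep_L2 (fourier_L2 (res z Q))" and ?D = "\<lambda>\<xi>. ?f \<xi> - rep_L2 (fourier_L2 (res z Q)) \<xi>"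
  have sD: "square_integrable ?D" by (intro square_integrable_diff square_integrable_rep_L2)
  have "AE \<xi> in lborel. 0 < \<xi> \<longrightarrow> ?D \<xi> = 0"
  proof (rule weak_ode_zero[OF z sD])
    fix \<phi> assume \<phi>: "\<phi> \<in> test_fun_pos"
    from test_fun_pos_properties[OF \<phi>] obtain a b B where p: "0 < a" "\<And>x. x \<notin> {a..b} \<Longrightarrow> \<phi> x = 0" "\<And>x. x \<notin> {a..b} \<Longrightarrow> deriv \<phi> x = 0"
      "continuous_on UNIV \<phi>" "continuous_on UNIV (deriv \<phi>)" "\<And>x. \<bar>\<phi> x\<bar> \<le> B" "\<And>x. \<bar>deriv \<phi> x\<bar> \<le> B" by metis
    note [measurable] = borel_measurable_continuous_onI[OF p(4)] borel_measurable_continuous_onI[OF p(5)]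
      square_integrable_measurable[OF g0] square_integrable_measurable[OF sD] rep_L2_measurable
    have z0: "\<phi> x = 0" if "\<not> 0 < x" for x using p(1) that by (auto intro!: p(2))
    have int: "integrable lborel (\<lambda>x. \<phi> x *\<^sub>R k x)" "integrable lborel (\<lambda>x. deriv \<phi> x *\<^sub>R k x)"
      if "square_integrable k" for k :: "real \<Rightarrow> complex^'n^'m"
      by (rule bounded_mult_integrable[OF that _ p(2) p(6)], measurable)
        (rule bounded_mult_integrable[OF that _ p(3) p(7)], measurable)
    have 1: "(LINT \<xi>|lborel. deriv \<phi> \<xi> *\<^sub>R ?f \<xi>) = - (LINT \<xi>|lborel. \<phi> \<xi> *\<^sub>R g0 \<xi>)"
      using wd[OF \<phi>] unfolding test_fun_pos_half_line(1,2)[OF \<phi>] g0_def test_fun_pos_half_line(3)[OF \<phi>] .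
    have "(LINT \<xi>|lborel. deriv \<phi> \<xi> *\<^sub>R ?f1 \<xi>) = (LINT \<xi>|lborel. - (\<phi> \<xi> *\<^sub>R g0 \<xi>) - (\<i> * z) *\<^sub>M (\<phi> \<xi> *\<^sub>R ?D \<xi>))"
      unfolding res_weak_derivative[OF z Qp \<phi>]
    proof (rule integral_cong_AE)
      have hat: "fourier_L2 (\<i> *\<^sub>C (Q + z *\<^sub>C res z Q)) = \<i> *\<^sub>C (fourier_L2 Q + z *\<^sub>C fourier_L2 (res z Q))"
        by (simp add: fourier_scaleC bounded_linear_simps[OF bounded_linear_fourier_L2])
      show "AE \<xi> in lborel. \<phi> \<xi> *\<^sub>R rep_L2 (fourier_L2 (\<i> *\<^sub>C (Q + z *\<^sub>C res z Q))) \<xi> = - (\<phi> \<xi> *\<^sub>R g0 \<xi>) - (\<i> * z) *\<^sub>M (\<phi> \<xi> *\<^sub>R ?D \<xi>)"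
        unfolding hat
        using FQ rep_L2_scaleC[of \<i> "fourier_L2 Q + z *\<^sub>C fourier_L2 (res z Q)"] rep_L2_add[of "fourier_L2 Q" "z *\<^sub>C fourier_L2 (res z Q)"]
          rep_L2_scaleC[of z "fourier_L2 (res z Q)"]
      proof eventually_elim
        case (elim \<xi>)
        show ?case
        proof (cases "0 < \<xi>")
          case True
          have "\<i> *\<^sub>M rep_L2 (fourier_L2 Q) \<xi> = - g0 \<xi> - (\<i> * z) *\<^sub>M ?f \<xi>"
            using elim(1) True by (simp add: q_def mscale_diff_right)
          then show ?thesis
            using elim(2-4) by (simp add: mscale_scaleR_right[symmetric] mscale_add_right mscale_diff_right scaleR_diff_right scaleR_add_right)
        qed (simp add: z0)
      qed
    qed measurable
    also have "\<dots> = - (LINT \<xi>|lborel. \<phi> \<xi> *\<^sub>R g0 \<xi>) - (\<i> * z) *\<^sub>M (LINT \<xi>|lborel. \<phi> \<xi> *\<^sub>R ?D \<xi>)"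
      by (simp only: Bochner_Integration.integral_diff[OF integrable_minus[OF int(1)[OF g0]] integrable_bounded_linear[OF bounded_linear_mscale int(1)[OF sD]]]
          integral_minus integral_bounded_linear[OF bounded_linear_mscale int(1)[OF sD]])
    finally have 3: "(LINT \<xi>|lborel. deriv \<phi> \<xi> *\<^sub>R ?f1 \<xi>) = - (LINT \<xi>|lborel. \<phi> \<xi> *\<^sub>R g0 \<xi>) - (\<i> * z) *\<^sub>M (LINT \<xi>|lborel. \<phi> \<xi> *\<^sub>R ?D \<xi>)" .
    have "(LINT \<xi>|lborel. deriv \<phi> \<xi> *\<^sub>R ?D \<xi>) = (LINT \<xi>|lborel. deriv \<phi> \<xi> *\<^sub>R ?f \<xi>) - (LINT \<xi>|lborel. deriv \<phi> \<xi> *\<^sub>R ?f1 \<xi>)"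
      by (simp only: scaleR_diff_right Bochner_Integration.integral_diff[OF int(2)[OF square_integrable_rep_L2] int(2)[OF square_integrable_rep_L2]])
    then show "(LINT \<xi>|lborel. deriv \<phi> \<xi> *\<^sub>R ?D \<xi>) = (\<i> * z) *\<^sub>M (LINT \<xi>|lborel. \<phi> \<xi> *\<^sub>R ?D \<xi>)"
      by (simp add: 1 3)
  qed
  moreover have "AE \<xi> in lborel. \<xi> < 0 \<longrightarrow> ?f \<xi> = 0" using Fp by (simp add: szego_plus_iff)
  moreover have "AE \<xi> in lborel. \<xi> < 0 \<longrightarrow> ?f1 \<xi> = 0" using szego_res[of z Q] by (simp only: szego_plus_iff)
  ultimately have "AE \<xi> in lborel. ?f \<xi> = ?f1 \<xi>"
    using AE_lborel_singleton[of 0]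
  proof eventually_elim
    case (elim \<xi>)
    then show ?case by (cases "\<xi> < 0") auto
  qed
  then have "fourier_L2 F = fourier_L2 (res z Q)" by (rule L2_eqI)
  then have "F = res z Q" by (simp add: fourier_L2_inject)
  with Qp show thesis by (rule that)
qed

section \<open>Isospectral flows\<close>

text \<open>
  Composition with an operator precedence above that of addition.
\<close>

abbreviation bcomp :: "('b::real_normed_vector \<Rightarrow>\<^sub>L 'c::real_normed_vector) \<Rightarrow> ('a::real_normed_vector \<Rightarrow>\<^sub>L 'b) \<Rightarrow> 'a \<Rightarrow>\<^sub>L 'c"
  (infixl "\<odot>" 70) where "A \<odot> B \<equiv> A o\<^sub>L B"

text \<open>
  Linear equations in which the coefficient acts through a bounded bilinear product, such as composition from either side or
  a commutator.
\<close>

lemma bilinear_ode: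
  fixes prod :: "'a::real_normed_vector \<Rightarrow> 'b::banach \<Rightarrow> 'b"
  assumes prod: "bounded_bilinear prod" and A: "continuous_on UNIV A"
  shows bilinear_ode_exists: "\<exists>y. y 0 = a \<and> (\<forall>t. (y has_vector_derivative prod (A t) (y t)) (at t))"
    and bilinear_ode_unique: "\<And>y z t. y 0 = z 0 \<Longrightarrow> (\<And>t. (y has_vector_derivative prod (A t) (y t)) (at t)) \<Longrightarrow>
        (\<And>t. (z has_vector_derivative prod (A t) (z t)) (at t)) \<Longrightarrow> y t = z t"
proof -
  interpret p: bounded_bilinear prod by (rule prod)
  define op where "op a = Blinfun (prod a)" for a
  have op: "blinfun_apply (op a) b = prod a b" for a b
    by (simp add: op_def bounded_linear_Blinfun_apply p.bounded_linear_right)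
  obtain K where K: "0 \<le> K" "\<And>a b. norm (prod a b) \<le> norm a * norm b * K" using p.nonneg_bounded by blast
  have "bounded_linear op"
  proof (rule bounded_linear_intro[where K = K])
    show "op (a + b) = op a + op b" for a b by (rule blinfun_eqI) (simp add: op blinfun.add_left p.add_left)
    show "op (r *\<^sub>R a) = r *\<^sub>R op a" for r a by (rule blinfun_eqI) (simp add: op blinfun.scaleR_left p.scaleR_left)
    show "norm (op a) \<le> norm a * K" for a
      by (rule norm_blinfun_bound) (use K in \<open>simp_all add: op mult_ac\<close>)
  qed
  from bounded_linear.continuous_on[OF this A] have c: "continuous_on UNIV (\<lambda>t. op (A t))" .
  obtain y where "y 0 = a" "\<And>t. (y has_vector_derivative op (A t) (y t)) (at t)"
    using linear_ode_solution_exists[OF c] by blast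
  then have "y 0 = a \<and> (\<forall>t. (y has_vector_derivative prod (A t) (y t)) (at t))"
    unfolding op by simp
  then show "\<exists>y. y 0 = a \<and> (\<forall>t. (y has_vector_derivative prod (A t) (y t)) (at t))" by (rule exI[of _ y])
  fix y z t
  assume *: "y 0 = z 0" "\<And>t. (y has_vector_derivative prod (A t) (y t)) (at t)"
    "\<And>t. (z has_vector_derivative prod (A t) (z t)) (at t)"
  show "y t = z t"
    by (rule linear_ode_unique[OF c]) (simp_all only: op *)
qed

lemma bounded_bilinear_commutator:
  "bounded_bilinear (\<lambda>A X :: 'b::real_normed_vector \<Rightarrow>\<^sub>L 'b. A \<odot> X - X \<odot> A)"
proof -
  interpret c: bounded_bilinear "blinfun_compose :: ('b \<Rightarrow>\<^sub>L 'b) \<Rightarrow> ('b \<Rightarrow>\<^sub>L 'b) \<Rightarrow> 'b \<Rightarrow>\<^sub>L 'b"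
    by (rule bounded_bilinear_blinfun_compose)
  show ?thesis
  proof (rule bounded_bilinear.intro)
    show "\<exists>K. \<forall>A X :: 'b \<Rightarrow>\<^sub>L 'b. norm (A \<odot> X - X \<odot> A) \<le> norm A * norm X * K"
    proof (intro exI allI)
      fix A X :: "'b \<Rightarrow>\<^sub>L 'b"
      have "norm (A \<odot> X - X \<odot> A) \<le> norm (A \<odot> X) + norm (X \<odot> A)" by (rule norm_triangle_ineq4)
      then show "norm (A \<odot> X - X \<odot> A) \<le> norm A * norm X * 2"
        using norm_blinfun_compose[of A X] norm_blinfun_compose[of X A] by (simp add: mult.commute)
    qed
  qed (simp_all add: c.add_left c.add_right c.scaleR_left c.scaleR_right scaleR_diff_right)
qed

lemma blinfun_compose_assoc: "(A \<odot> B) \<odot> C = A \<odot> (B \<odot> C)"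
  by (rule blinfun_eqI) simp

lemma id_blinfun_compose [simp]: "id_blinfun \<odot> A = A" "A \<odot> id_blinfun = A"
  by (rule blinfun_eqI, simp)+

lemmas compose_derivative = bounded_bilinear.has_vector_derivative[OF bounded_bilinear_blinfun_compose]
lemmas apply_derivative = bounded_bilinear.has_vector_derivative[OF bounded_bilinear_blinfun_apply]

lemmas blinfun_compose_simps =
  bounded_bilinear.add_left[OF bounded_bilinear_blinfun_compose] bounded_bilinear.add_right[OF bounded_bilinear_blinfun_compose]
  bounded_bilinear.diff_left[OF bounded_bilinear_blinfun_compose] bounded_bilinear.diff_right[OF bounded_bilinear_blinfun_compose]
  bounded_bilinear.minus_left[OF bounded_bilinear_blinfun_compose] bounded_bilinear.minus_right[OF bounded_bilinear_blinfun_compose]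
  bounded_bilinear.scaleR_left[OF bounded_bilinear_blinfun_compose] bounded_bilinear.scaleR_right[OF bounded_bilinear_blinfun_compose]

lemma continuous_of_derivative:
  assumes "\<And>t. (f has_vector_derivative f' t) (at t)" shows "continuous_on UNIV f"
  by (rule continuous_at_imp_continuous_on) (use assms has_vector_derivative_continuous in blast)

text \<open>
  The relations between the operators of the equation that enter the proof of the explicit formula, for a fixed \<open>z\<close>.
\<close>

locale lax_flow =
  fixes A B m :: "real \<Rightarrow> 'b::banach \<Rightarrow>\<^sub>L 'b" and R :: "'b \<Rightarrow>\<^sub>L 'b" and ev :: "'b \<Rightarrow>\<^sub>L 'c::banach"
    and u :: "real \<Rightarrow> 'b"
  assumes contB: "continuous_on UNIV B"
    and dA: "\<And>t. (A has_vector_derivative A t \<odot> B t - B t \<odot> A t) (at t)"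
    and dm: "\<And>t. (m has_vector_derivative m t \<odot> B t - B t \<odot> m t) (at t)"
    and du: "\<And>t. (u has_vector_derivative - B t (u t)) (at t)"
    and RC: "\<And>t. R \<odot> (A t - B t) - (A t - B t) \<odot> R = - (1 / (2 * pi)) *\<^sub>R (R \<odot> (m t \<odot> R))"
    and evC: "\<And>t. ev \<odot> (A t - B t) = - (1 / (2 * pi)) *\<^sub>R (ev \<odot> (m t \<odot> R))"
begin

lemma flow_exists:
  "\<exists>E. E 0 = id_blinfun \<and> (\<forall>t. (E has_vector_derivative A 0 \<odot> E t) (at t))"
proof -
  have "continuous_on UNIV (\<lambda>t::real. A 0)" by simp
  from bilinear_ode_exists[OF bounded_bilinear_blinfun_compose this, of id_blinfun] show ?thesis by blast
qed

context
  fixes E assumes E0: "E 0 = id_blinfun" and dE: "\<And>t. (E has_vector_derivative A 0 \<odot> E t) (at t)"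
begin

lemma flow_commutes: "A 0 \<odot> E t = E t \<odot> A 0"
proof (rule bilinear_ode_unique[OF bounded_bilinear_blinfun_compose continuous_on_const[of UNIV "A 0"],
      where y = "\<lambda>t. A 0 \<odot> E t" and z = "\<lambda>t. E t \<odot> A 0" and t = t])
  fix t
  show "((\<lambda>t. A 0 \<odot> E t) has_vector_derivative A 0 \<odot> (A 0 \<odot> E t)) (at t)"
    using compose_derivative[OF has_vector_derivative_const dE, of "A 0"] by simp
  show "((\<lambda>t. E t \<odot> A 0) has_vector_derivative A 0 \<odot> (E t \<odot> A 0)) (at t)"
    using compose_derivative[OF dE[of t] has_vector_derivative_const[of "A 0"]] by (simp add: blinfun_compose_assoc)
qed (simp add: E0)

lemma flow_commutes': "A 0 \<odot> (E t \<odot> X) = E t \<odot> (A 0 \<odot> X)"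
  by (simp add: blinfun_compose_assoc[symmetric] flow_commutes)

lemma dE_minus: "((\<lambda>t. E (- t)) has_vector_derivative - (A 0 \<odot> E (- t))) (at t)"
  using vector_diff_chain_at[of uminus "- 1" t E "A 0 \<odot> E (- t)"] dE[of "- t"]
  by (simp add: o_def has_vector_derivative_minus[OF has_vector_derivative_id, simplified])

text \<open>
  In the applications, the integrand of the operator \<open>L(t)\<close>.
\<close>

definition conj_m :: "real \<Rightarrow> 'b \<Rightarrow>\<^sub>L 'b" where "conj_m t = E (- t) \<odot> (m 0 \<odot> E t)"

lemma conj_m_derivative: "(conj_m has_vector_derivative conj_m t \<odot> A 0 - A 0 \<odot> conj_m t) (at t)"
proof -
  have "((\<lambda>t. m 0 \<odot> E t) has_vector_derivative m 0 \<odot> (A 0 \<odot> E t)) (at t)"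
    using compose_derivative[OF has_vector_derivative_const dE, of "m 0" t] by simp
  from compose_derivative[OF dE_minus this]
  show ?thesis unfolding conj_m_def[abs_def]
    by (simp add: flow_commutes flow_commutes' blinfun_compose_assoc blinfun_compose_simps)
qed

definition Lop :: "real \<Rightarrow> 'b \<Rightarrow>\<^sub>L 'b" where "Lop t = (1 / (2 * pi)) *\<^sub>R antideriv conj_m t"

lemma Lop_0: "Lop 0 = 0" by (simp add: Lop_def)

lemma Lop_derivative: "(Lop has_vector_derivative (1 / (2 * pi)) *\<^sub>R conj_m t) (at t)"
  unfolding Lop_def[abs_def]
  by (intro bounded_linear.has_vector_derivative[OF bounded_linear_scaleR_right] has_vector_derivative_antideriv
      continuous_of_derivative[OF conj_m_derivative])

text \<open>
  The vector \<open>F\<close> is \<open>(1 + R L)\<^sup>-\<^sup>1 R w\<close>, stated without inverses: \<open>F = R (w - L F)\<close> says that \<open>F\<close> solves \<open>(G + L - z) F = w\<close>.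
  Every identity in the proof holds at time 0, and both sides solve the same linear equation.
\<close>

theorem explicit_solution:
  defines "w \<equiv> \<lambda>t. E (- t) (u 0)"
  obtains F where "F = R (w t - Lop t F)" "ev (w t - Lop t F) = ev (u t)"
    "\<And>F'. F' = R (w t - Lop t F') \<Longrightarrow> F' = F"
proof -
  note cs = blinfun_compose_assoc blinfun_compose_simps
  let ?c = "1 / (2 * pi)"
  define C where "C t = A t - B t" for t
  have contA: "continuous_on UNIV A" by (rule continuous_of_derivative[OF dA])
  have contC: "continuous_on UNIV C" unfolding C_def[abs_def] by (intro continuous_intros contA contB)
  obtain V where V0: "V 0 = id_blinfun" and dV: "\<And>t. (V has_vector_derivative C t \<odot> V t) (at t)"
    using bilinear_ode_exists[OF bounded_bilinear_blinfun_compose contC, of id_blinfun] by blast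
  have "continuous_on UNIV (\<lambda>t. - C t)" by (intro continuous_intros contC)
  from bilinear_ode_exists[OF bounded_bilinear.flip[OF bounded_bilinear_blinfun_compose] this, of id_blinfun]
  obtain P where P0: "P 0 = id_blinfun" and dP: "\<And>t. (P has_vector_derivative - (P t \<odot> C t)) (at t)"
    by (auto simp: blinfun_compose_simps)
  \<comment> \<open>\<open>P\<close> is the inverse of \<open>V\<close>, constructed from its own equation.\<close>
  have PV: "P t \<odot> V t = id_blinfun" for t
  proof -
    have "((\<lambda>t. P t \<odot> V t) has_vector_derivative 0) (at t)" for t
      using compose_derivative[OF dP dV, of t] by (simp add: cs)
    from constant_of_zero_derivative[OF this, of t] show ?thesis by (simp add: P0 V0)
  qed
  have VP: "V t \<odot> P t = id_blinfun" for t
  proof (rule bilinear_ode_unique[OF bounded_bilinear_commutator contC,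
      where y = "\<lambda>t. V t \<odot> P t" and z = "\<lambda>t. id_blinfun" and t = t])
    show "((\<lambda>t. V t \<odot> P t) has_vector_derivative C t \<odot> (V t \<odot> P t) - (V t \<odot> P t) \<odot> C t) (at t)" for t
      using compose_derivative[OF dV dP, of t] by (simp add: cs)
    show "((\<lambda>t. id_blinfun) has_vector_derivative C t \<odot> id_blinfun - id_blinfun \<odot> C t) (at t)" for t
      by simp
  qed (simp add: P0 V0)
  have VP': "V t \<odot> (P t \<odot> X) = X" for t and X :: "'b \<Rightarrow>\<^sub>L 'b"
    by (simp add: blinfun_compose_assoc[symmetric] VP)
  have conj_derivative: "((\<lambda>t. P t \<odot> (T t \<odot> V t)) has_vector_derivative P t \<odot> ((T' t + T t \<odot> C t - C t \<odot> T t) \<odot> V t)) (at t)"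
    if "\<And>t. (T has_vector_derivative T' t) (at t)" for T T' t
    using compose_derivative[OF dP compose_derivative[OF that dV], of t] by (simp add: cs algebra_simps)
  have PAV: "P t \<odot> (A t \<odot> V t) = A 0" for t
  proof -
    have "((\<lambda>t. P t \<odot> (A t \<odot> V t)) has_vector_derivative 0) (at t)" for t
      using conj_derivative[OF dA, of t] by (simp add: cs C_def)
    from constant_of_zero_derivative[OF this, of t] show ?thesis by (simp add: P0 V0)
  qed
  define M where "M t = P t \<odot> (m t \<odot> V t)" for t
  have dM: "(M has_vector_derivative - (A 0 \<odot> M t - M t \<odot> A 0)) (at t)" for t
  proof -
    have "P t \<odot> ((m t \<odot> A t - A t \<odot> m t) \<odot> V t) = M t \<odot> A 0 - A 0 \<odot> M t"
      unfolding M_def PAV[of t, symmetric] by (simp add: cs VP')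
    then show ?thesis using conj_derivative[OF dm, of t] by (simp add: M_def[abs_def] cs C_def)
  qed
  have M_eq: "M t = conj_m t" for t
  proof (rule bilinear_ode_unique[OF bounded_bilinear_commutator continuous_on_const[of UNIV "- A 0"],
      where y = "M" and z = "conj_m" and t = t])
    show "(M has_vector_derivative - A 0 \<odot> M t - M t \<odot> - A 0) (at t)" for t
      using dM[of t] by (simp add: cs)
    show "(conj_m has_vector_derivative - A 0 \<odot> conj_m t - conj_m t \<odot> - A 0) (at t)" for t
      using conj_m_derivative[of t] by (simp add: cs)
  qed (simp add: M_def conj_m_def P0 V0 E0)
  have Pu: "P t (u t) = w t" for t
  proof (rule bilinear_ode_unique[OF bounded_bilinear_blinfun_apply continuous_on_const[of UNIV "- A 0"],
      where y = "\<lambda>t. P t (u t)" and z = "w" and t = t])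
    fix t
    have "((\<lambda>t. P t (u t)) has_vector_derivative - (P t (A t (u t)))) (at t)"
      using apply_derivative[OF dP du, of t]
      by (simp add: C_def blinfun.diff_left blinfun.diff_right blinfun.minus_left blinfun.minus_right)
    moreover have "P t (A t (u t)) = A 0 (P t (u t))"
    proof -
      have "V t (P t (u t)) = u t" using VP[of t] by (metis blinfun_apply_blinfun_compose blinfun_apply_id_blinfun id_apply)
      then show ?thesis unfolding PAV[of t, symmetric] by simp
    qed
    ultimately show "((\<lambda>t. P t (u t)) has_vector_derivative (- A 0) (P t (u t))) (at t)" by (simp add: blinfun.minus_left)
    show "(w has_vector_derivative (- A 0) (w t)) (at t)"
      unfolding w_def using apply_derivative[OF dE_minus[of t] has_vector_derivative_const[of "u 0"]] by (simp add: blinfun.minus_left)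
  qed (simp add: w_def P0 E0)
  \<comment> \<open>The conjugate of the resolvent; it solves a Riccati equation driven by \<open>L'\<close>.\<close>
  define X where "X t = P t \<odot> (R \<odot> V t)" for t
  have dX: "(X has_vector_derivative - ?c *\<^sub>R (X t \<odot> (M t \<odot> X t))) (at t)" for t
  proof -
    have "P t \<odot> ((R \<odot> C t - C t \<odot> R) \<odot> V t) = - ?c *\<^sub>R (X t \<odot> (M t \<odot> X t))"
      unfolding C_def RC by (simp add: cs VP' X_def M_def)
    then show ?thesis using conj_derivative[OF has_vector_derivative_const, of R t] by (simp add: X_def[abs_def])
  qed
  have dL: "(Lop has_vector_derivative ?c *\<^sub>R M t) (at t)" for t
    using Lop_derivative[of t] by (simp add: M_eq)
  have contM: "continuous_on UNIV M" by (rule continuous_of_derivative[OF dM])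
  have contX: "continuous_on UNIV X" by (rule continuous_of_derivative[OF dX])
  have contXM: "continuous_on UNIV (\<lambda>t. - ?c *\<^sub>R (X t \<odot> M t))"
    by (intro continuous_intros bounded_bilinear.continuous_on[OF bounded_bilinear_blinfun_compose] contX contM)
  have contMX: "continuous_on UNIV (\<lambda>t. - ?c *\<^sub>R (M t \<odot> X t))"
    by (intro continuous_intros bounded_bilinear.continuous_on[OF bounded_bilinear_blinfun_compose] contX contM)
  have XLR: "X t + X t \<odot> (Lop t \<odot> R) - R = 0" for t
  proof (rule bilinear_ode_unique[OF bounded_bilinear_blinfun_compose contXM,
      where y = "\<lambda>t. X t + X t \<odot> (Lop t \<odot> R) - R" and z = "\<lambda>t. 0" and t = t])
    fix t
    have "((\<lambda>t. Lop t \<odot> R) has_vector_derivative (?c *\<^sub>R M t) \<odot> R) (at t)"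
      using compose_derivative[OF dL[of t] has_vector_derivative_const[of R]] by simp
    from has_vector_derivative_diff[OF has_vector_derivative_add[OF dX compose_derivative[OF dX this]] has_vector_derivative_const]
    show "((\<lambda>t. X t + X t \<odot> (Lop t \<odot> R) - R) has_vector_derivative
        - ?c *\<^sub>R (X t \<odot> M t) \<odot> (X t + X t \<odot> (Lop t \<odot> R) - R)) (at t)"
      by (rule has_vector_derivative_eq_rhs) (simp add: cs algebra_simps)
  qed (simp_all add: X_def P0 V0 Lop_0)
  have RLX: "X t + R \<odot> (Lop t \<odot> X t) - R = 0" for t
  proof (rule bilinear_ode_unique[OF bounded_bilinear.flip[OF bounded_bilinear_blinfun_compose] contMX,
      where y = "\<lambda>t. X t + R \<odot> (Lop t \<odot> X t) - R" and z = "\<lambda>t. 0" and t = t])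
    fix t
    have "((\<lambda>t. R \<odot> (Lop t \<odot> X t)) has_vector_derivative R \<odot> (Lop t \<odot> (- ?c *\<^sub>R (X t \<odot> (M t \<odot> X t))) + (?c *\<^sub>R M t) \<odot> X t)) (at t)"
      using compose_derivative[OF has_vector_derivative_const compose_derivative[OF dL dX], of R t] by simp
    from has_vector_derivative_diff[OF has_vector_derivative_add[OF dX this] has_vector_derivative_const]
    show "((\<lambda>t. X t + R \<odot> (Lop t \<odot> X t) - R) has_vector_derivative
        (X t + R \<odot> (Lop t \<odot> X t) - R) \<odot> (- ?c *\<^sub>R (M t \<odot> X t))) (at t)"
      by (rule has_vector_derivative_eq_rhs) (simp add: cs algebra_simps)
  qed (simp_all add: X_def P0 V0 Lop_0)
  have evX: "ev \<odot> V t - ev + ev \<odot> (Lop t \<odot> X t) = 0" for t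
  proof (rule bilinear_ode_unique[OF bounded_bilinear.flip[OF bounded_bilinear_blinfun_compose] contMX,
      where y = "\<lambda>t. ev \<odot> V t - ev + ev \<odot> (Lop t \<odot> X t)" and z = "\<lambda>t. 0" and t = t])
    fix t
    have "(ev \<odot> C t) \<odot> V t = - ?c *\<^sub>R (ev \<odot> (V t \<odot> (M t \<odot> X t)))"
      unfolding C_def evC by (simp add: cs M_def X_def VP')
    then have "((\<lambda>t. ev \<odot> V t) has_vector_derivative - ?c *\<^sub>R (ev \<odot> (V t \<odot> (M t \<odot> X t)))) (at t)"
      using compose_derivative[OF has_vector_derivative_const dV, of ev t] by (simp add: blinfun_compose_assoc)
    moreover have "((\<lambda>t. ev \<odot> (Lop t \<odot> X t)) has_vector_derivative ev \<odot> (Lop t \<odot> (- ?c *\<^sub>R (X t \<odot> (M t \<odot> X t))) + (?c *\<^sub>R M t) \<odot> X t)) (at t)"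
      using compose_derivative[OF has_vector_derivative_const compose_derivative[OF dL dX], of ev t] by simp
    ultimately have "((\<lambda>t. ev \<odot> V t - ev + ev \<odot> (Lop t \<odot> X t)) has_vector_derivative
        - ?c *\<^sub>R (ev \<odot> (V t \<odot> (M t \<odot> X t))) - 0 + ev \<odot> (Lop t \<odot> (- ?c *\<^sub>R (X t \<odot> (M t \<odot> X t))) + (?c *\<^sub>R M t) \<odot> X t)) (at t)"
      by (intro has_vector_derivative_add has_vector_derivative_diff has_vector_derivative_const)
    then show "((\<lambda>t. ev \<odot> V t - ev + ev \<odot> (Lop t \<odot> X t)) has_vector_derivative
        (ev \<odot> V t - ev + ev \<odot> (Lop t \<odot> X t)) \<odot> (- ?c *\<^sub>R (M t \<odot> X t))) (at t)"
      by (rule has_vector_derivative_eq_rhs) (simp add: cs algebra_simps)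
  qed (simp_all add: X_def P0 V0 Lop_0)
  let ?F = "X t (w t)"
  have app: "(S \<odot> T) x = S (T x)" for S :: "'y::real_normed_vector \<Rightarrow>\<^sub>L 'z::real_normed_vector" and T :: "'x::real_normed_vector \<Rightarrow>\<^sub>L 'y" and x by simp
  show thesis
  proof (rule that)
    have "(X t + R \<odot> (Lop t \<odot> X t) - R) (w t) = 0" by (simp add: RLX)
    then show "?F = R (w t - Lop t ?F)"
      by (simp add: blinfun.add_left blinfun.diff_left blinfun.diff_right algebra_simps)
    have "(ev \<odot> V t - ev + ev \<odot> (Lop t \<odot> X t)) (w t) = 0" by (simp add: evX)
    then have "ev (V t (w t)) = ev (w t - Lop t ?F)"
      by (simp add: blinfun.add_left blinfun.diff_left blinfun.diff_right algebra_simps)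
    moreover have "V t (w t) = u t"
      using VP[of t] unfolding Pu[symmetric] by (metis blinfun_apply_blinfun_compose blinfun_apply_id_blinfun id_apply)
    ultimately show "ev (w t - Lop t ?F) = ev (u t)" by simp
    fix F' assume F': "F' = R (w t - Lop t F')"
    \<comment> \<open>\<open>X\<close> and \<open>R\<close> are linked by the second resolvent identity, so \<open>X = R (1 + L R)\<^sup>-\<^sup>1\<close>.\<close>
    define q where "q = w t - Lop t F'"
    have "(X t + X t \<odot> (Lop t \<odot> R) - R) q = 0" by (simp add: XLR)
    then have "R q = X t (q + Lop t (R q))"
      by (simp add: blinfun.add_left blinfun.diff_left blinfun.add_right)
    moreover have "R q = F'" using F' by (simp add: q_def)
    ultimately show "F' = ?F" by (simp add: q_def)
  qed
qed

end

end

section \<open>Hankel and Toeplitz operators\<close>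

lemmas szego_simps = bounded_linear_simps[OF bounded_linear_szego_L2]
lemmas star_simps = bounded_linear_simps[OF bounded_linear_star]
lemmas lmul_simps = bounded_linear_simps[OF bounded_linear_lmul]

text \<open>
  Right multiplication commutes with all left multiplications and with the projector.
\<close>

definition rmul :: "complex^'n^'k \<Rightarrow> (complex^'k^'m) L2 \<Rightarrow> (complex^'n^'m) L2" where
  "rmul C = L2_map (\<lambda>_ A. A ** C)"

lemma mult_minus_left: "(- (A :: complex^'b^'a)) ** B = - (A ** B)"
  using mult_mscale_left[of "- 1" A B] by simp

lemma rep_rmul: "AE x in lborel. rep_L2 (rmul C F) x = rep_L2 F x ** C"
  unfolding rmul_def by (rule multiplier_const[OF bounded_linear_mult_const_right[of C]], rule rep_L2_map)

lemma bounded_linear_rmul: "bounded_linear (rmul C)"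
  unfolding rmul_def by (rule multiplier_const[OF bounded_linear_mult_const_right[of C]], rule bounded_linear_L2_map)

lemma szego_rmul: "szego_L2 (rmul C F) = rmul C (szego_L2 F)"
  unfolding rmul_def by (rule szego_linear_map[OF bounded_linear_mult_const_right mult_mscale_left])

lemma lmul_rmul: "lmul u (rmul C F) = rmul C (lmul u F)"
proof (rule L2_eqI)
  show "AE x in lborel. rep_L2 (lmul u (rmul C F)) x = rep_L2 (rmul C (lmul u F)) x"
    using rep_lmul[of u "rmul C F"] rep_lmul[of u F] rep_rmul[of C F] rep_rmul[of C "lmul u F"]
    by eventually_elim (simp add: matrix_mul_assoc)
qed

lemma star_star [simp]: "star (star F) = F"
proof (rule L2_eqI)
  show "AE x in lborel. rep_L2 (star (star F)) x = rep_L2 F x"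
    using rep_star[of F] rep_star[of "star F"] by eventually_elim simp
qed

lemma lmul_kern_commute:
  assumes z: "Im z > 0" shows "lmul u (lmul (kern z) F) = lmul (kern z) (lmul u F)"
proof (rule L2_eqI)
  show "AE x in lborel. rep_L2 (lmul u (lmul (kern z) F)) x = rep_L2 (lmul (kern z) (lmul u F)) x"
    using rep_lmul[of u F] rep_lmul[of u "lmul (kern z) F"] rep_lmul_kern[OF z, of F] rep_lmul_kern[OF z, of "lmul u F"]
    by eventually_elim simp
qed

lemma rep_lmul_bstar_kern:
  "Im z > 0 \<Longrightarrow> AE x in lborel. rep_L2 (lmul (bstar (kern z)) F) x = cnj (cauchy_kernel z x) *\<^sub>M rep_L2 F x"
  using rep_lmul[of "bstar (kern z)" F] by eventually_elim (simp add: apply_kern)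

lemma star_lmul_kern:
  assumes z: "Im z > 0" shows "star (lmul (kern z) F) = lmul (bstar (kern z)) (star F)"
proof (rule L2_eqI)
  show "AE x in lborel. rep_L2 (star (lmul (kern z) F)) x = rep_L2 (lmul (bstar (kern z)) (star F)) x"
    using rep_star[of "lmul (kern z) F"] rep_lmul_kern[OF z, of F] rep_lmul_bstar_kern[OF z, of "star F"] rep_star[of F]
    by eventually_elim simp
qed

lemma star_lmul_bstar_kern:
  assumes z: "Im z > 0" shows "star (lmul (bstar (kern z)) F) = lmul (kern z) (star F)"
  using star_lmul_kern[OF z, of "star F"] by (metis star_star)

abbreviation L2_of :: "(real \<Rightarrow>\<^sub>C (complex^'n^'m)) \<Rightarrow> (complex^'n^'m) L2" where
  "L2_of u \<equiv> abs_L2 (apply_bcontfun u)"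

lemma lmul_kvec:
  assumes z: "Im z > 0" and u: "square_integrable (apply_bcontfun u)"
  shows "lmul u (kvec z C) = lmul (kern z) (rmul C (L2_of u))"
proof (rule L2_eqI)
  show "AE x in lborel. rep_L2 (lmul u (kvec z C)) x = rep_L2 (lmul (kern z) (rmul C (L2_of u))) x"
    using rep_lmul[of u "kvec z C"] rep_L2_abs_L2[OF square_integrable_cauchy_kernel[OF z, of C], folded kvec_def]
      rep_lmul_kern[OF z, of "rmul C (L2_of u)"] rep_rmul[of C "L2_of u"] rep_L2_abs_L2[OF u]
    by eventually_elim simp
qed

lemma star_scaleC: "star (c *\<^sub>C F) = cnj c *\<^sub>C star F"
proof (rule L2_eqI)
  show "AE x in lborel. rep_L2 (star (c *\<^sub>C F)) x = rep_L2 (cnj c *\<^sub>C star F) x"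
    using rep_L2_scaleC[of c F] rep_L2_scaleC[of "cnj c" "star F"] rep_star[of F] rep_star[of "c *\<^sub>C F"] by eventually_elim simp
qed

lemma lmul_scaleC: "lmul u (c *\<^sub>C F) = c *\<^sub>C lmul u F"
proof (rule L2_eqI)
  show "AE x in lborel. rep_L2 (lmul u (c *\<^sub>C F)) x = rep_L2 (c *\<^sub>C lmul u F) x"
    using rep_L2_scaleC[of c F] rep_L2_scaleC[of c "lmul u F"] rep_lmul[of u F] rep_lmul[of u "c *\<^sub>C F"] by eventually_elim simp
qed

lemma rmul_scaleC: "rmul C (c *\<^sub>C F) = c *\<^sub>C rmul C F" "rmul (c *\<^sub>M C) F = c *\<^sub>C rmul C F"
proof (rule L2_eqI)
  show "AE x in lborel. rep_L2 (rmul C (c *\<^sub>C F)) x = rep_L2 (c *\<^sub>C rmul C F) x"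
    using rep_L2_scaleC[of c F] rep_L2_scaleC[of c "rmul C F"] rep_rmul[of C F] rep_rmul[of C "c *\<^sub>C F"] by eventually_elim simp
next
  show "rmul (c *\<^sub>M C) F = c *\<^sub>C rmul C F"
  proof (rule L2_eqI)
    show "AE x in lborel. rep_L2 (rmul (c *\<^sub>M C) F) x = rep_L2 (c *\<^sub>C rmul C F) x"
      using rep_L2_scaleC[of c "rmul C F"] rep_rmul[of C F] rep_rmul[of "c *\<^sub>M C" F] by eventually_elim simp
  qed
qed

lemma kvec_inj:
  assumes z: "Im z > 0" and eq: "kvec z C = kvec z D" shows "C = D"
proof -
  have "AE x in lborel. cauchy_kernel z x *\<^sub>M C = cauchy_kernel z x *\<^sub>M D"
    using eq unfolding kvec_def abs_L2_eq_iff[OF square_integrable_cauchy_kernel[OF z] square_integrable_cauchy_kernel[OF z]] .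
  then have "AE x in lborel :: real measure. C = D"
  proof eventually_elim
    case (elim x)
    have c: "cauchy_kernel z x \<noteq> 0" using of_real_minus_nonzero[OF z, of x] by (simp add: cauchy_kernel_def)
    have "inverse (cauchy_kernel z x) *\<^sub>M (cauchy_kernel z x *\<^sub>M C) = inverse (cauchy_kernel z x) *\<^sub>M (cauchy_kernel z x *\<^sub>M D)"
      using elim by simp
    then show ?case using c by simp
  qed
  then show ?thesis by (simp add: eventually_const ae_filter_eq_bot_iff)
qed

lemma poisson_minus:
  assumes "szego_L2 F = 0" shows "poisson F z = 0"
proof -
  have "AE \<xi> in lborel. indicator {0..} \<xi> *\<^sub>R (exp (\<i> * z * of_real \<xi>) *\<^sub>M rep_L2 (fourier_L2 F) \<xi>) = 0"
    using assms[unfolded szego_minus_iff] by eventually_elim (auto simp: indicator_def)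
  from integral_eq_zero_AE[OF this]
  have "(LINT \<xi>:{0..}|lborel. exp (\<i> * z * of_real \<xi>) *\<^sub>M rep_L2 (fourier_L2 F) \<xi>) = 0"
    by (simp add: set_lebesgue_integral_def)
  then show ?thesis by (simp add: poisson_def)
qed

lemma szego_kern_minus:
  assumes z: "Im z > 0" and F: "szego_L2 F = 0" shows "szego_L2 (lmul (kern z) F) = 0"
  using lmul_bstar_minus[OF bplus_bstar_kern[OF z] F] by simp

lemma res_plus_eq:
  assumes z: "Im z > 0" and F: "szego_L2 F = F"
  shows "res z F = lmul (kern z) F - kvec z (poisson F z)"
  using kern_decomposition[OF z F] by simp

lemma minus_part: "szego_L2 (F - szego_L2 F) = 0"
  by (simp add: szego_simps)

lemma res_szego:
  assumes z: "Im z > 0" shows "res z (szego_L2 F) = szego_L2 (lmul (kern z) F)"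
proof -
  have "szego_L2 (lmul (kern z) (F - szego_L2 F)) = 0"
    by (rule szego_kern_minus[OF z minus_part])
  then show ?thesis by (simp add: res_def lmul_simps szego_simps)
qed

lemma poisson_simps:
  assumes "Im z > 0"
  shows "poisson (F + G) z = poisson F z + poisson G z" "poisson (F - G) z = poisson F z - poisson G z"
    "poisson (- F) z = - poisson F z"
  using bounded_linear_simps[OF bounded_linear_poisson[OF assms]] by auto

lemma poisson_szego:
  assumes z: "Im z > 0" shows "poisson (szego_L2 F) z = poisson F z"
  using poisson_minus[OF minus_part[of F], of z] by (simp add: poisson_simps z)

text \<open>Evaluation at \<open>z\<close> is multiplicative, because the remainders in the decomposition of both sides agree.\<close>

lemma poisson_lmul:
  assumes z: "Im z > 0" and u: "bplus u" and G: "szego_L2 G = G"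
  shows "poisson (lmul u G) z = poisson (rmul (poisson G z) (L2_of u)) z"
    and "lmul u (res z G) + res z (rmul (poisson G z) (L2_of u)) = res z (lmul u G)"
proof -
  let ?b = "poisson G z" let ?U = "rmul ?b (L2_of u)"
  have su: "square_integrable (apply_bcontfun u)" and Pu: "szego_L2 (L2_of u) = L2_of u" using u by (auto simp: bplus_def)
  have U: "szego_L2 ?U = ?U" by (simp add: szego_rmul Pu)
  have uG: "szego_L2 (lmul u G) = lmul u G" by (rule lmul_plus[OF u G])
  have uR: "szego_L2 (lmul u (res z G)) = lmul u (res z G)" by (rule lmul_plus[OF u szego_res])
  have "lmul (kern z) (lmul u G) = lmul u (res z G + kvec z ?b)"
    by (simp add: lmul_kern_commute[OF z, symmetric] kern_decomposition[OF z G])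
  then have e: "res z (lmul u G) + kvec z (poisson (lmul u G) z) = lmul u (res z G) + res z ?U + kvec z (poisson ?U z)"
    by (simp add: lmul_simps lmul_kvec[OF z su] kern_decomposition[OF z U] kern_decomposition[OF z uG])
  from arg_cong[OF this, of szego_L2]
  show r: "lmul u (res z G) + res z ?U = res z (lmul u G)"
    by (simp add: szego_simps uR szego_kvec[OF z])
  from e have "kvec z (poisson (lmul u G) z) = kvec z (poisson ?U z)" unfolding r by simp
  then show "poisson (lmul u G) z = poisson ?U z" by (rule kvec_inj[OF z])
qed

text \<open>
  Through \<open>star\<close> the antilinear Hankel operators become real linear compositions of multiplications, adjoints and projections.
\<close>

definition hankel_sq :: "(real \<Rightarrow>\<^sub>C (complex^'n^'m)) \<Rightarrow> (complex^'d^'m) L2 \<Rightarrow> (complex^'d^'m) L2" where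
  "hankel_sq u G = szego_L2 (lmul u (star (szego_L2 (star (lmul (bstar u) G)))))"

definition toeplitz_sq :: "(real \<Rightarrow>\<^sub>C (complex^'n^'m)) \<Rightarrow> (complex^'d^'m) L2 \<Rightarrow> (complex^'d^'m) L2" where
  "toeplitz_sq u G = szego_L2 (lmul u (lmul (bstar u) G))"

text \<open>
  The matrix \<open>\<integral> U\<^sup>* F\<close>, treated through its inner products with constant matrices, where the \<open>L\<^sup>2\<close> adjoint relations apply.
\<close>

definition pairing :: "(complex^'n^'m) L2 \<Rightarrow> (complex^'d^'m) L2 \<Rightarrow> complex^'d^'n" where
  "pairing U F = (LINT x|lborel. ctranspose (rep_L2 U x) ** rep_L2 F x)"

lemma integrable_pairing: "integrable lborel (\<lambda>x. ctranspose (rep_L2 (U :: (complex^'n^'m) L2) x) ** rep_L2 (F :: (complex^'d^'m) L2) x)"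
proof (rule Bochner_Integration.integrable_bound)
  show "integrable lborel (\<lambda>x. norm (rep_L2 U x) * norm (rep_L2 F x))"
    by (rule integrable_norm_mult[OF square_integrable_rep_L2 square_integrable_rep_L2])
  show "(\<lambda>x. ctranspose (rep_L2 U x) ** rep_L2 F x) \<in> borel_measurable lborel"
    by (rule borel_measurable_continuous_Pair[OF measurable_compose[OF _ borel_measurable_continuous_onI[OF linear_continuous_on[OF bounded_linear_ctranspose]]]])
      (auto intro!: bounded_bilinear.continuous_on[OF bounded_bilinear_mult] continuous_intros)
  show "AE x in lborel. norm (ctranspose (rep_L2 U x) ** rep_L2 F x) \<le> norm (norm (rep_L2 U x) * norm (rep_L2 F x))"
    using norm_mult_le[of "ctranspose (rep_L2 U _)" "rep_L2 F _"] by (auto intro!: AE_I2)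
qed

lemma inner_pairing: "pairing U F \<bullet> C = F \<bullet> rmul C U"
proof -
  have "pairing U F \<bullet> C = (LINT x|lborel. (ctranspose (rep_L2 U x) ** rep_L2 F x) \<bullet> C)"
    unfolding pairing_def by (rule Bochner_Integration.integral_inner_left[symmetric]) (rule integrable_pairing)
  also have "\<dots> = F \<bullet> rmul C U"
    unfolding inner_L2 by (rule integral_cong_AE) (use rep_rmul[of C U] in \<open>auto simp: inner_mult_left\<close>)
  finally show ?thesis .
qed

lemma pairing_eqI: "(\<And>C. F \<bullet> rmul C U = G \<bullet> rmul C W) \<Longrightarrow> pairing U F = pairing W G"
  by (rule vector_eq_rdot[THEN iffD1]) (simp add: inner_pairing)

lemma pairing_szego_left: "szego_L2 F = F \<Longrightarrow> pairing (szego_L2 U) F = pairing U F"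
  by (rule pairing_eqI) (simp add: szego_rmul[symmetric] szego_L2_adjoint[symmetric])

lemma pairing_szego_right: "szego_L2 U = U \<Longrightarrow> pairing U (szego_L2 F) = pairing U F"
  by (rule pairing_eqI) (metis szego_rmul szego_L2_adjoint)

lemma pairing_lmul: "pairing (lmul u U) F = pairing U (lmul (bstar u) F)"
  by (rule pairing_eqI) (simp add: lmul_rmul[symmetric] lmul_adjoint)

lemma pairing_lmul_bstar: "pairing (lmul (bstar u) U) F = pairing U (lmul u F)"
  using pairing_lmul[of "bstar u"] by simp

text \<open>Applied to \<open>S = u\<^sup>* F\<close>, this gives the value \<open>P\<close> of the Hankel operator together with the remainder \<open>Q\<close>.\<close>

lemma star_parts:
  fixes S :: "(complex^'d^'n) L2"
  obtains P Q where "star S = P + Q" "szego_L2 P = P" "szego_L2 Q = 0" "P = szego_L2 (star S)"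
    "S = star P + star Q" "szego_L2 (star P) = 0" "szego_L2 (star Q) = star Q"
proof
  let ?P = "szego_L2 (star S)" and ?Q = "star S - szego_L2 (star S)"
  show "star S = ?P + ?Q" "szego_L2 ?P = ?P" "?P = ?P" by simp_all
  show q: "szego_L2 ?Q = 0" by (rule minus_part)
  show "S = star ?P + star ?Q" by (simp add: star_simps)
  show "szego_L2 (star ?P) = 0" by (rule szego_star_of_plus) simp
  show "szego_L2 (star ?Q) = star ?Q" by (rule szego_star_of_minus[OF q])
qed

text \<open>
  By the decomposition of \<open>F / (x - z)\<close>, the left side is the Cauchy integral of \<open>u\<^sup>* F\<close> minus that of the minus function \<open>u\<^sup>* F(z)\<close>;
  Cauchy integrals of minus functions vanish.
\<close>

lemma pairing_res:
  assumes z: "Im z > 0" and u: "bplus u" and F: "szego_L2 F = F"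
  shows "pairing (L2_of u) (res z F) = (2 * pi * \<i>) *\<^sub>M poisson (lmul (bstar u) F) z"
proof -
  note su = u[unfolded bplus_def]
  let ?S = "lmul (bstar u) F" and ?a = "poisson F z"
  \<comment> \<open>\<open>\<integral> u\<^sup>* / (x - z)\<close> vanishes since \<open>u\<^sup>*\<close> has negative frequencies only.\<close>
  let ?N = "rmul ?a (star (L2_of u))"
  have N: "szego_L2 ?N = 0" using su by (simp add: szego_rmul szego_star_of_plus bounded_linear_simps[OF bounded_linear_rmul])
  have "pairing (L2_of u) (res z F) = (LINT x|lborel. cauchy_kernel z x *\<^sub>M rep_L2 (?S - ?N) x)"
    unfolding pairing_def
  proof (rule integral_cong_AE)
    show "(\<lambda>x. cauchy_kernel z x *\<^sub>M rep_L2 (?S - ?N) x) \<in> borel_measurable lborel"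
      using integrable_cauchy_kernel_mult[OF z square_integrable_rep_L2[of "?S - ?N"]] by (rule borel_measurable_integrable)
    show "(\<lambda>x. ctranspose (rep_L2 (L2_of u) x) ** rep_L2 (res z F) x) \<in> borel_measurable lborel"
      using integrable_pairing by (rule borel_measurable_integrable)
    show "AE x in lborel. ctranspose (rep_L2 (L2_of u) x) ** rep_L2 (res z F) x = cauchy_kernel z x *\<^sub>M rep_L2 (?S - ?N) x"
      unfolding res_plus_eq[OF z F]
      using rep_L2_diff[of "lmul (kern z) F" "kvec z ?a"] rep_lmul_kern[OF z, of F]
        rep_L2_abs_L2[OF square_integrable_cauchy_kernel[OF z, of ?a], folded kvec_def] rep_L2_diff[of ?S ?N]
        rep_lmul[of "bstar u" F] rep_rmul[of ?a "star (L2_of u)"] rep_star[of "L2_of u"] rep_L2_abs_L2[OF conjunct1[OF su]]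
      by eventually_elim (simp add: mult_diff_right mscale_diff_right)
  qed
  also have "\<dots> = (2 * pi * \<i>) *\<^sub>M poisson (?S - ?N) z"
    using cauchy_kernel_integral[OF z square_integrable_rep_L2[of "?S - ?N"]] by (simp add: abs_L2_rep_L2)
  also have "poisson (?S - ?N) z = poisson ?S z" by (simp add: poisson_simps[OF z] poisson_minus[OF N])
  finally show ?thesis .
qed

text \<open>
  Both commutators with the resolvent produce the term \<open>u u\<^sup>* kvec (F z)\<close>, which therefore cancels.
\<close>

lemma res_commutators:
  assumes z: "Im z > 0" and u: "bplus u" and F: "szego_L2 F = F"
  defines "b \<equiv> poisson (lmul (bstar u) F) z"
  shows "res z (hankel_sq u F - toeplitz_sq u F) - (hankel_sq u (res z F) - toeplitz_sq u (res z F)) = - res z (rmul b (L2_of u))"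
    and "poisson (hankel_sq u F - toeplitz_sq u F) z = - poisson (rmul b (L2_of u)) z"
proof -
  note su = u[unfolded bplus_def]
  have U: "szego_L2 (rmul C (L2_of u)) = rmul C (L2_of u)" for C using su by (simp add: szego_rmul)
  let ?r = "lmul (kern z)" and ?a = "poisson F z" and ?S = "lmul (bstar u) F"
  note rl = bounded_linear_simps[OF bounded_linear_res[of z]]
  obtain P Q where S: "star ?S = P + Q" and P: "szego_L2 P = P" and Q: "szego_L2 Q = 0" and PS: "P = szego_L2 (star ?S)"
    and SPQ: "?S = star P + star Q" and sP: "szego_L2 (star P) = 0" and sQ: "szego_L2 (star Q) = star Q"
    by (rule star_parts)
  have b: "b = poisson (star Q) z" unfolding b_def SPQ by (simp add: poisson_simps[OF z] poisson_minus[OF sP])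
  have T: "res z (toeplitz_sq u F) - toeplitz_sq u (res z F) = szego_L2 (lmul u (lmul (bstar u) (kvec z ?a)))"
    unfolding toeplitz_sq_def res_szego[OF z] res_plus_eq[OF z F]
    by (simp add: lmul_simps szego_simps lmul_kern_commute[OF z])
  have k: "szego_L2 (lmul (bstar u) (kvec z ?a)) = 0" by (rule lmul_bstar_minus[OF u szego_kvec[OF z]])
  have rP: "szego_L2 (lmul (bstar (kern z)) P) = lmul (bstar (kern z)) P" by (rule lmul_plus[OF bplus_bstar_kern[OF z] P])
  have rQ: "lmul (bstar (kern z)) Q = star (res z (star Q)) + star (kvec z b)"
    using kern_decomposition[OF z sQ] star_lmul_kern[OF z, of "star Q"] by (simp add: star_simps b)
  have "szego_L2 (star (lmul (bstar u) (res z F)))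
      = szego_L2 (star (?r ?S)) - szego_L2 (star (lmul (bstar u) (kvec z ?a)))"
    by (simp add: res_plus_eq[OF z F] lmul_simps szego_simps star_simps lmul_kern_commute[OF z])
  also have "szego_L2 (star (lmul (bstar u) (kvec z ?a))) = star (lmul (bstar u) (kvec z ?a))"
    by (rule szego_star_of_minus[OF k])
  also have "szego_L2 (star (?r ?S)) = lmul (bstar (kern z)) P + star (kvec z b)"
    unfolding star_lmul_kern[OF z] S
    by (simp add: lmul_simps szego_simps rP rQ szego_star_of_plus szego_star_of_minus szego_kvec[OF z])
  finally have "star (szego_L2 (star (lmul (bstar u) (res z F)))) = ?r (star P) + kvec z b - lmul (bstar u) (kvec z ?a)"
    by (simp add: star_simps star_lmul_bstar_kern[OF z])
  then have H1: "hankel_sq u (res z F) = szego_L2 (?r (lmul u (star P))) + res z (rmul b (L2_of u)) - szego_L2 (lmul u (lmul (bstar u) (kvec z ?a)))"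
    using conjunct1[OF su]
    by (simp add: hankel_sq_def lmul_simps szego_simps lmul_kern_commute[OF z] lmul_kvec[OF z] res_szego[OF z, of "rmul b (L2_of u)", symmetric] U)
  have H2: "hankel_sq u F = szego_L2 (lmul u (star P))" by (simp add: hankel_sq_def PS)
  have "res z (hankel_sq u F) - hankel_sq u (res z F) = szego_L2 (lmul u (lmul (bstar u) (kvec z ?a))) - res z (rmul b (L2_of u))"
    unfolding H1 unfolding H2 res_szego[OF z] by simp
  with T show "res z (hankel_sq u F - toeplitz_sq u F) - (hankel_sq u (res z F) - toeplitz_sq u (res z F)) = - res z (rmul b (L2_of u))"
    by (simp add: rl algebra_simps)
  have "toeplitz_sq u F = hankel_sq u F + szego_L2 (lmul u (star Q))"
    unfolding H2 toeplitz_sq_def by (subst SPQ) (simp add: lmul_simps szego_simps)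
  then show "poisson (hankel_sq u F - toeplitz_sq u F) z = - poisson (rmul b (L2_of u)) z"
    by (simp add: poisson_simps[OF z] poisson_szego[OF z] poisson_lmul(1)[OF z u sQ] b)
qed

text \<open>
  The Lax pair for the Hankel operator; in the application \<open>v\<close> is the time derivative of \<open>u\<close>, and \<open>N\<close> the minus part of
  \<open>u u\<^sup>* u\<close>. The products of \<open>N\<close> and of its adjoint with the relevant factors are projected to 0, which leaves a commutator.
\<close>

lemma hankel_sq_derivative:
  assumes u: "bplus u" and N: "bplus (bstar N)" and F: "szego_L2 F = F"
    and v: "\<And>x. apply_bcontfun v x = (- \<i>) *\<^sub>M (apply_bcontfun u x ** ctranspose (apply_bcontfun u x) ** apply_bcontfun u x - apply_bcontfun N x)"
  shows "szego_L2 (lmul v (star (szego_L2 (star (lmul (bstar u) F))))) + szego_L2 (lmul u (star (szego_L2 (star (lmul (bstar v) F)))))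
    = \<i> *\<^sub>C (hankel_sq u (toeplitz_sq u F) - toeplitz_sq u (hankel_sq u F))"
proof -
  let ?bF = "lmul u (lmul (bstar u) F)"
  obtain P Q where P: "P = szego_L2 (star (lmul (bstar u) F))"
    and SPQ: "lmul (bstar u) F = star P + star Q" and sP: "szego_L2 (star P) = 0" and sQ: "szego_L2 (star Q) = star Q"
    by (rule star_parts)
  have lv: "lmul v G = (- \<i>) *\<^sub>C (lmul u (lmul (bstar u) (lmul u G)) - lmul N G)" for G
  proof (rule L2_eqI)
    show "AE x in lborel. rep_L2 (lmul v G) x = rep_L2 ((- \<i>) *\<^sub>C (lmul u (lmul (bstar u) (lmul u G)) - lmul N G)) x"
      using rep_lmul[of v G] rep_lmul[of N G] rep_lmul[of u G] rep_lmul[of "bstar u" "lmul u G"] rep_lmul[of u "lmul (bstar u) (lmul u G)"]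
        rep_L2_scaleC[of "- \<i>" "lmul u (lmul (bstar u) (lmul u G)) - lmul N G"] rep_L2_diff[of "lmul u (lmul (bstar u) (lmul u G))" "lmul N G"]
      by eventually_elim (simp add: v mult_diff_left mult_minus_left matrix_mul_assoc)
  qed
  have lbv: "lmul (bstar v) G = \<i> *\<^sub>C (lmul (bstar u) (lmul u (lmul (bstar u) G)) - lmul (bstar N) G)" for G
  proof (rule L2_eqI)
    show "AE x in lborel. rep_L2 (lmul (bstar v) G) x = rep_L2 (\<i> *\<^sub>C (lmul (bstar u) (lmul u (lmul (bstar u) G)) - lmul (bstar N) G)) x"
      using rep_lmul[of "bstar v" G] rep_lmul[of "bstar N" G] rep_lmul[of "bstar u" G] rep_lmul[of u "lmul (bstar u) G"] rep_lmul[of "bstar u" "lmul u (lmul (bstar u) G)"]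
        rep_L2_scaleC[of "\<i>" "lmul (bstar u) (lmul u (lmul (bstar u) G)) - lmul (bstar N) G"] rep_L2_diff[of "lmul (bstar u) (lmul u (lmul (bstar u) G))" "lmul (bstar N) G"]
      by eventually_elim (simp add: v mult_diff_left matrix_mul_assoc ctranspose_mult ctranspose_diff)
  qed
  define X where "X = ?bF - szego_L2 ?bF"
  have X: "szego_L2 X = 0" unfolding X_def by (rule minus_part)
  have bF: "?bF = szego_L2 ?bF + X" by (simp add: X_def)
  \<comment> \<open>The negative parts of \<open>u (star P)\<close> and of \<open>u u\<^sup>* F\<close> agree because \<open>u (star Q)\<close> has none.\<close>
  have uP: "lmul u (star P) = szego_L2 (lmul u (star P)) + X"
    unfolding X_def SPQ using lmul_plus[OF u sQ] by (simp add: lmul_simps szego_simps)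
  have 1: "szego_L2 (lmul v (star P)) = (- \<i>) *\<^sub>C (toeplitz_sq u (hankel_sq u F) + szego_L2 (lmul u (lmul (bstar u) X)))"
  proof -
    have "szego_L2 (lmul N (star P)) = 0" using lmul_bstar_minus[OF N sP] by simp
    then have "szego_L2 (lmul v (star P)) = (- \<i>) *\<^sub>C szego_L2 (lmul u (lmul (bstar u) (lmul u (star P))))"
      by (simp add: lv szego_scaleC szego_simps)
    also have "szego_L2 (lmul u (lmul (bstar u) (lmul u (star P)))) = toeplitz_sq u (hankel_sq u F) + szego_L2 (lmul u (lmul (bstar u) X))"
      by (subst uP) (simp add: lmul_simps szego_simps toeplitz_sq_def hankel_sq_def P)
    finally show ?thesis .
  qed
  have uX: "szego_L2 (lmul (bstar u) X) = 0" by (rule lmul_bstar_minus[OF u X])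
  have "szego_L2 (star (lmul (bstar v) F)) = (- \<i>) *\<^sub>C szego_L2 (star (lmul (bstar u) ?bF))"
    using szego_star_of_plus[OF lmul_plus[OF N F]]
    by (simp add: lbv szego_scaleC star_scaleC szego_simps star_simps)
  also have "szego_L2 (star (lmul (bstar u) ?bF)) = szego_L2 (star (lmul (bstar u) (toeplitz_sq u F))) + star (lmul (bstar u) X)"
    by (subst bF) (simp add: lmul_simps szego_simps star_simps toeplitz_sq_def szego_star_of_minus[OF uX])
  finally have 2: "szego_L2 (lmul u (star (szego_L2 (star (lmul (bstar v) F)))))
      = \<i> *\<^sub>C (hankel_sq u (toeplitz_sq u F) + szego_L2 (lmul u (lmul (bstar u) X)))"
    by (simp add: szego_scaleC star_scaleC lmul_scaleC szego_simps star_simps lmul_simps hankel_sq_def)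
  show ?thesis unfolding P[symmetric] 1 2 by (simp add: scaleC_simps scaleC_minus_left)
qed

lemma toeplitz_sq_rmul: "toeplitz_sq u (rmul C F) = rmul C (toeplitz_sq u F)"
  by (simp add: toeplitz_sq_def lmul_rmul szego_rmul)

lemma pairing_scaleC: "pairing (c *\<^sub>C U) F = pairing U (cnj c *\<^sub>C F)"
proof -
  have "AE x in lborel. ctranspose (rep_L2 (c *\<^sub>C U) x) ** rep_L2 F x = ctranspose (rep_L2 U x) ** rep_L2 (cnj c *\<^sub>C F) x"
    using rep_L2_scaleC[of c U] rep_L2_scaleC[of "cnj c" F] by eventually_elim simp
  from integral_cong_AE[OF borel_measurable_integrable[OF integrable_pairing] borel_measurable_integrable[OF integrable_pairing] this]
  show ?thesis by (simp add: pairing_def)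
qed

text \<open>
  By the adjoint relations, the derivative of \<open>u\<close> inside the pairing can be moved onto \<open>F\<close>.
\<close>

lemma rank_derivative:
  assumes u: "bplus u" and F: "szego_L2 F = F" and V: "V = (- \<i>) *\<^sub>C toeplitz_sq u (L2_of u)"
  shows "rmul (pairing V F) (L2_of u) + rmul (pairing (L2_of u) F) V
    = rmul (pairing (L2_of u) (\<i> *\<^sub>C toeplitz_sq u F)) (L2_of u) - \<i> *\<^sub>C toeplitz_sq u (rmul (pairing (L2_of u) F) (L2_of u))"
proof -
  note su = u[unfolded bplus_def]
  have iF: "szego_L2 (\<i> *\<^sub>C F) = \<i> *\<^sub>C F" by (simp add: szego_scaleC F)
  have "pairing V F = pairing (L2_of u) (lmul u (lmul (bstar u) (\<i> *\<^sub>C F)))"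
    unfolding V pairing_scaleC toeplitz_sq_def by (simp add: pairing_szego_left iF pairing_lmul pairing_lmul_bstar)
  also have "\<dots> = pairing (L2_of u) (\<i> *\<^sub>C toeplitz_sq u F)"
    unfolding toeplitz_sq_def szego_scaleC[symmetric] lmul_scaleC[symmetric] using su by (simp add: pairing_szego_right)
  finally have "pairing V F = pairing (L2_of u) (\<i> *\<^sub>C toeplitz_sq u F)" .
  moreover have "rmul C V = (- \<i>) *\<^sub>C toeplitz_sq u (rmul C (L2_of u))" for C
    by (simp only: V rmul_scaleC toeplitz_sq_rmul)
  ultimately show ?thesis by (simp add: scaleC_minus_left)
qed

section \<open>The Lax pair of the matrix Szego equation\<close>

lemma res_scaleC: "res z (c *\<^sub>C F) = c *\<^sub>C res z F"
  by (simp add: res_def szego_scaleC lmul_scaleC)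

lemma mscale_cancel: "c \<noteq> 0 \<Longrightarrow> c *\<^sub>M A = c *\<^sub>M B \<longleftrightarrow> A = B"
  by (auto simp: vec_eq_iff)

lemma poisson_scaleC:
  assumes z: "Im z > 0" shows "poisson (c *\<^sub>C F) z = c *\<^sub>M poisson F z"
proof -
  have "(2 * pi * \<i>) *\<^sub>M poisson (c *\<^sub>C F) z = (LINT x|lborel. cauchy_kernel z x *\<^sub>M rep_L2 (c *\<^sub>C F) x)"
    using cauchy_kernel_integral[OF z square_integrable_rep_L2[of "c *\<^sub>C F"]] by (simp add: abs_L2_rep_L2)
  also have "\<dots> = (LINT x|lborel. c *\<^sub>M (cauchy_kernel z x *\<^sub>M rep_L2 F x))"
  proof (rule integral_cong_AE)
    have i: "integrable lborel (\<lambda>x. cauchy_kernel z x *\<^sub>M rep_L2 G x)" for G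
      by (rule integrable_cauchy_kernel_mult[OF z square_integrable_rep_L2])
    show "(\<lambda>x. cauchy_kernel z x *\<^sub>M rep_L2 (c *\<^sub>C F) x) \<in> borel_measurable lborel" by (rule borel_measurable_integrable[OF i])
    show "(\<lambda>x. c *\<^sub>M (cauchy_kernel z x *\<^sub>M rep_L2 F x)) \<in> borel_measurable lborel"
      by (rule borel_measurable_integrable[OF integrable_bounded_linear[OF bounded_linear_mscale i]])
    show "AE x in lborel. cauchy_kernel z x *\<^sub>M rep_L2 (c *\<^sub>C F) x = c *\<^sub>M (cauchy_kernel z x *\<^sub>M rep_L2 F x)"
      using rep_L2_scaleC[of c F] by eventually_elim (simp add: mult.commute)
  qed
  also have "\<dots> = c *\<^sub>M (LINT x|lborel. cauchy_kernel z x *\<^sub>M rep_L2 F x)"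
    by (rule integral_bounded_linear[OF bounded_linear_mscale integrable_cauchy_kernel_mult[OF z square_integrable_rep_L2]])
  also have "(LINT x|lborel. cauchy_kernel z x *\<^sub>M rep_L2 F x) = (2 * pi * \<i>) *\<^sub>M poisson F z"
    using cauchy_kernel_integral[OF z square_integrable_rep_L2[of F]] by (simp add: abs_L2_rep_L2)
  finally have "(2 * pi * \<i>) *\<^sub>M poisson (c *\<^sub>C F) z = (2 * pi * \<i>) *\<^sub>M (c *\<^sub>M poisson F z)"
    by (simp add: mult.commute)
  then show ?thesis by (subst (asm) mscale_cancel) simp_all
qed

lemma hankel_sq_scaleC: "hankel_sq u (c *\<^sub>C F) = c *\<^sub>C hankel_sq u F"
  by (simp add: hankel_sq_def lmul_scaleC star_scaleC szego_scaleC)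

lemma toeplitz_sq_scaleC: "toeplitz_sq u (c *\<^sub>C F) = c *\<^sub>C toeplitz_sq u F"
  by (simp add: toeplitz_sq_def lmul_scaleC szego_scaleC)

lemma szego_hankel_sq [simp]: "szego_L2 (hankel_sq u F) = hankel_sq u F"
  by (simp add: hankel_sq_def)

lemma szego_toeplitz_sq [simp]: "szego_L2 (toeplitz_sq u F) = toeplitz_sq u F"
  by (simp add: toeplitz_sq_def)

lemma bounded_bilinear_lmul: "bounded_bilinear (lmul :: (real \<Rightarrow>\<^sub>C (complex^'k^'m)) \<Rightarrow> (complex^'n^'k) L2 \<Rightarrow> (complex^'n^'m) L2)"
proof (rule bounded_bilinear.intro)
  fix u v :: "real \<Rightarrow>\<^sub>C (complex^'k^'m)" and F G :: "(complex^'n^'k) L2" and r :: real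
  show "lmul (u + v) F = lmul u F + lmul v F"
  proof (rule L2_eqI)
    show "AE x in lborel. rep_L2 (lmul (u + v) F) x = rep_L2 (lmul u F + lmul v F) x"
      using rep_lmul[of u F] rep_lmul[of v F] rep_lmul[of "u + v" F] rep_L2_add[of "lmul u F" "lmul v F"]
      by eventually_elim (simp add: mult_add_left)
  qed
  show "lmul (r *\<^sub>R u) F = r *\<^sub>R lmul u F"
  proof (rule L2_eqI)
    show "AE x in lborel. rep_L2 (lmul (r *\<^sub>R u) F) x = rep_L2 (r *\<^sub>R lmul u F) x"
      using rep_lmul[of u F] rep_lmul[of "r *\<^sub>R u" F] rep_L2_scaleR[of r "lmul u F"]
      by eventually_elim (simp add: bounded_bilinear.scaleR_left[OF bounded_bilinear_mult])
  qed
next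
  show "\<exists>K. \<forall>(u :: real \<Rightarrow>\<^sub>C (complex^'k^'m)) (F :: (complex^'n^'k) L2). norm (lmul u F) \<le> norm u * norm F * K"
    by (rule exI[of _ 1]) (simp add: norm_lmul_le)
qed (simp_all add: lmul_simps)

lemma bounded_linear_bstar: "bounded_linear (bstar :: (real \<Rightarrow>\<^sub>C (complex^'n^'m)) \<Rightarrow> _)"
proof (rule bounded_linear_intro[where K = 1])
  fix u v :: "real \<Rightarrow>\<^sub>C (complex^'n^'m)" and r :: real
  show "bstar (u + v) = bstar u + bstar v" by (rule bcontfun_eqI) (simp add: ctranspose_add)
  show "bstar (r *\<^sub>R u) = r *\<^sub>R bstar u" by (rule bcontfun_eqI) (simp add: bounded_linear_simps[OF bounded_linear_ctranspose])
  show "norm (bstar u) \<le> norm u * 1" by (rule norm_bound) (simp add: norm_bounded)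
qed

lemma bounded_bilinear_rmul: "bounded_bilinear (\<lambda>(U :: (complex^'k^'m) L2) (C :: complex^'n^'k). rmul C U)"
proof (rule bounded_bilinear.intro)
  fix U :: "(complex^'k^'m) L2" and C D :: "complex^'n^'k" and r :: real
  show "rmul (C + D) U = rmul C U + rmul D U"
  proof (rule L2_eqI)
    show "AE x in lborel. rep_L2 (rmul (C + D) U) x = rep_L2 (rmul C U + rmul D U) x"
      using rep_rmul[of C U] rep_rmul[of D U] rep_rmul[of "C + D" U] rep_L2_add[of "rmul C U" "rmul D U"]
      by eventually_elim (simp add: mult_add_right)
  qed
  show "rmul (r *\<^sub>R C) U = r *\<^sub>R rmul C U"
  proof (rule L2_eqI)
    show "AE x in lborel. rep_L2 (rmul (r *\<^sub>R C) U) x = rep_L2 (r *\<^sub>R rmul C U) x"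
      using rep_rmul[of C U] rep_rmul[of "r *\<^sub>R C" U] rep_L2_scaleR[of r "rmul C U"]
      by eventually_elim (simp add: bounded_bilinear.scaleR_right[OF bounded_bilinear_mult])
  qed
next
  show "\<exists>K. \<forall>(U :: (complex^'k^'m) L2) (C :: complex^'n^'k). norm (rmul C U) \<le> norm U * norm C * K"
  proof (intro exI allI)
    fix U :: "(complex^'k^'m) L2" and C :: "complex^'n^'k"
    have "norm (abs_L2 (rep_L2 (rmul C U))) \<le> norm C * norm (abs_L2 (rep_L2 U))"
    proof (rule norm_abs_L2_le[OF square_integrable_rep_L2 square_integrable_rep_L2 norm_ge_zero])
      show "AE x in lborel. norm (rep_L2 (rmul C U) x) \<le> norm C * norm (rep_L2 U x)"
        using rep_rmul[of C U]
      proof eventually_elim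
        case (elim x)
        then show ?case using norm_mult_le[of "rep_L2 U x" C] by (simp add: mult.commute)
      qed
    qed
    then show "norm (rmul C U) \<le> norm U * norm C * 1" by (simp add: abs_L2_rep_L2 mult.commute)
  qed
qed (simp_all add: bounded_linear_simps[OF bounded_linear_rmul])

text \<open>
  The bound is obtained by pairing the value with itself.
\<close>

lemma bounded_bilinear_pairing: "bounded_bilinear (pairing :: (complex^'n^'m) L2 \<Rightarrow> (complex^'d^'m) L2 \<Rightarrow> complex^'d^'n)"
proof (rule bounded_bilinear.intro)
  fix U V :: "(complex^'n^'m) L2" and F G :: "(complex^'d^'m) L2" and r :: real
  note rl = bounded_linear_simps[OF bounded_linear_rmul]
  have eq: "A = B" if "\<And>C. A \<bullet> C = B \<bullet> C" for A B :: "complex^'d^'n"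
    by (rule vector_eq_rdot[THEN iffD1]) (use that in blast)
  show "pairing (U + V) F = pairing U F + pairing V F"
    by (rule eq) (simp add: inner_pairing rl inner_add_left inner_add_right)
  show "pairing U (F + G) = pairing U F + pairing U G"
    by (rule eq) (simp add: inner_pairing rl inner_add_left inner_add_right)
  show "pairing (r *\<^sub>R U) F = r *\<^sub>R pairing U F" by (rule eq) (simp add: inner_pairing rl)
  show "pairing U (r *\<^sub>R F) = r *\<^sub>R pairing U F" by (rule eq) (simp add: inner_pairing rl)
next
  obtain K where K: "\<And>(U :: (complex^'n^'m) L2) (C :: complex^'d^'n). norm (rmul C U) \<le> norm U * norm C * K" "0 \<le> K"
    using bounded_bilinear.nonneg_bounded[OF bounded_bilinear_rmul] by blast
  show "\<exists>K. \<forall>(U :: (complex^'n^'m) L2) (F :: (complex^'d^'m) L2). norm (pairing U F) \<le> norm U * norm F * K"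
  proof (intro exI allI)
    fix U :: "(complex^'n^'m) L2" and F :: "(complex^'d^'m) L2"
    let ?p = "pairing U F"
    have "norm ?p * norm ?p = ?p \<bullet> ?p" by (simp add: norm_eq_sqrt_inner)
    also have "\<dots> = F \<bullet> rmul ?p U" by (rule inner_pairing)
    also have "\<dots> \<le> norm F * norm (rmul ?p U)" by (rule norm_cauchy_schwarz)
    also have "\<dots> \<le> norm F * (norm U * norm ?p * K)" by (rule mult_left_mono[OF K(1)]) simp
    finally have le: "norm ?p * norm ?p \<le> (norm U * norm F * K) * norm ?p" by (simp add: mult_ac)
    show "norm ?p \<le> norm U * norm F * K"
    proof (cases "norm ?p = 0")
      case True then show ?thesis using K(2) by simp
    next
      case False then show ?thesis by (intro mult_right_le_imp_le[OF le]) simp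
    qed
  qed
qed

definition PiL :: "(complex^'n^'m) L2 \<Rightarrow>\<^sub>L (complex^'n^'m) L2" where "PiL = Blinfun szego_L2"
definition StarL :: "(complex^'n^'m) L2 \<Rightarrow>\<^sub>L (complex^'m^'n) L2" where "StarL = Blinfun star"
definition ImL :: "(complex^'n^'m) L2 \<Rightarrow>\<^sub>L (complex^'n^'m) L2" where "ImL = Blinfun ((*\<^sub>C) \<i>)"
definition MulL :: "(real \<Rightarrow>\<^sub>C (complex^'k^'m)) \<Rightarrow> (complex^'n^'k) L2 \<Rightarrow>\<^sub>L (complex^'n^'m) L2" where "MulL = bounded_bilinear.prod_right lmul"
definition RmulL :: "(complex^'k^'m) L2 \<Rightarrow> (complex^'n^'k) \<Rightarrow>\<^sub>L (complex^'n^'m) L2" where "RmulL = bounded_bilinear.prod_right (\<lambda>U C. rmul C U)"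
definition PairL :: "(complex^'n^'m) L2 \<Rightarrow> (complex^'d^'m) L2 \<Rightarrow>\<^sub>L (complex^'d^'n)" where "PairL = bounded_bilinear.prod_right pairing"

lemma blinfun_apply_simps [simp]:
  "blinfun_apply PiL F = szego_L2 F" "blinfun_apply StarL G = star G" "blinfun_apply ImL F = \<i> *\<^sub>C F"
  "blinfun_apply (MulL u) H = lmul u H" "blinfun_apply (RmulL U) C = rmul C U" "blinfun_apply (PairL V) K = pairing V K"
  by (simp_all add: PiL_def StarL_def ImL_def MulL_def RmulL_def PairL_def bounded_linear_Blinfun_apply bounded_linear_szego_L2
      bounded_linear_star bounded_linear_scaleC bounded_bilinear.prod_right.rep_eq bounded_bilinear_lmul bounded_bilinear_rmul
      bounded_bilinear_pairing)

lemmas bounded_linear_MulL = bounded_bilinear.bounded_linear_prod_right[OF bounded_bilinear_lmul, folded MulL_def]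
lemmas bounded_linear_RmulL = bounded_bilinear.bounded_linear_prod_right[OF bounded_bilinear_rmul, folded RmulL_def]
lemmas bounded_linear_PairL = bounded_bilinear.bounded_linear_prod_right[OF bounded_bilinear_pairing, folded PairL_def]

text \<open>
  The factor \<open>\<i>\<close> is included, and the projector is applied on both sides, so that the operators act on all of \<open>L\<^sup>2\<close> and vanish on
  minus functions; the relations below then hold on \<open>L\<^sup>2\<close> without restriction.
\<close>

definition hankel_op :: "(real \<Rightarrow>\<^sub>C (complex^'n^'m)) \<Rightarrow> (complex^'d^'m) L2 \<Rightarrow>\<^sub>L (complex^'d^'m) L2" where
  "hankel_op u = (ImL \<odot> PiL) \<odot> (MulL u \<odot> ((StarL \<odot> (PiL \<odot> StarL)) \<odot> (MulL (bstar u) \<odot> PiL)))"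

definition toeplitz_op :: "(real \<Rightarrow>\<^sub>C (complex^'n^'m)) \<Rightarrow> (complex^'d^'m) L2 \<Rightarrow>\<^sub>L (complex^'d^'m) L2" where
  "toeplitz_op u = (ImL \<odot> PiL) \<odot> (MulL u \<odot> (MulL (bstar u) \<odot> PiL))"

definition rank_op :: "(complex^'n^'m) L2 \<Rightarrow> (complex^'d^'m) L2 \<Rightarrow>\<^sub>L (complex^'d^'m) L2" where
  "rank_op U = RmulL U \<odot> (PairL U \<odot> PiL)"

lemma hankel_op_apply [simp]: "hankel_op u F = \<i> *\<^sub>C hankel_sq u (szego_L2 F)"
  by (simp add: hankel_op_def hankel_sq_def)

lemma toeplitz_op_apply [simp]: "toeplitz_op u F = \<i> *\<^sub>C toeplitz_sq u (szego_L2 F)"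
  by (simp add: toeplitz_op_def toeplitz_sq_def)

lemma rank_op_apply [simp]: "rank_op U F = rmul (pairing U (szego_L2 F)) U"
  by (simp add: rank_op_def)

text \<open>
  A curve of bounded continuous functions solving the equation \<open>\<i> u' = u u\<^sup>* u - N\<close>, where \<open>N\<close> is the negative
  part of \<open>u u\<^sup>* u\<close>.
\<close>

locale szego_curve =
  fixes u v N :: "real \<Rightarrow> real \<Rightarrow>\<^sub>C (complex^'n^'m)"
  assumes bplus: "\<And>t. bplus (u t)" and N: "\<And>t. bplus (bstar (N t))"
    and v: "\<And>t x. apply_bcontfun (v t) x = (- \<i>) *\<^sub>M (apply_bcontfun (u t) x ** ctranspose (apply_bcontfun (u t) x) ** apply_bcontfun (u t) x - apply_bcontfun (N t) x)"
    and du: "\<And>t. (u has_vector_derivative v t) (at t)"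
    and dU: "\<And>t. ((\<lambda>t. L2_of (u t)) has_vector_derivative (- \<i>) *\<^sub>C toeplitz_sq (u t) (L2_of (u t))) (at t)"
begin

lemma hankel_op_derivative:
  "((\<lambda>t. hankel_op (u t) :: (complex^'d^'m) L2 \<Rightarrow>\<^sub>L _) has_vector_derivative
    hankel_op (u t) \<odot> toeplitz_op (u t) - toeplitz_op (u t) \<odot> hankel_op (u t)) (at t)"
proof -
  note d1 = bounded_linear.has_vector_derivative[OF bounded_linear_MulL du[of t]]
  note d2 = bounded_linear.has_vector_derivative[OF bounded_linear_MulL bounded_linear.has_vector_derivative[OF bounded_linear_bstar du[of t]]]
  let ?Z = "StarL \<odot> (PiL \<odot> StarL)"
  have "((\<lambda>t. hankel_op (u t) :: (complex^'d^'m) L2 \<Rightarrow>\<^sub>L _) has_vector_derivative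
      (ImL \<odot> PiL) \<odot> (MulL (u t) \<odot> (?Z \<odot> (MulL (bstar (v t)) \<odot> PiL)) + MulL (v t) \<odot> (?Z \<odot> (MulL (bstar (u t)) \<odot> PiL)))) (at t)"
    unfolding hankel_op_def
    using compose_derivative[OF has_vector_derivative_const[of "ImL \<odot> PiL"] compose_derivative[OF d1
        compose_derivative[OF has_vector_derivative_const[of ?Z] compose_derivative[OF d2 has_vector_derivative_const]]]]
    by simp
  moreover have "(ImL \<odot> PiL) \<odot> (MulL (u t) \<odot> (?Z \<odot> (MulL (bstar (v t)) \<odot> PiL)) + MulL (v t) \<odot> (?Z \<odot> (MulL (bstar (u t)) \<odot> PiL)))
      = (hankel_op (u t) \<odot> toeplitz_op (u t) - toeplitz_op (u t) \<odot> hankel_op (u t) :: (complex^'d^'m) L2 \<Rightarrow>\<^sub>L _)" (is "?L = ?R")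
  proof (rule blinfun_eqI)
    fix F :: "(complex^'d^'m) L2"
    let ?F = "szego_L2 F"
    have "?L F = \<i> *\<^sub>C (szego_L2 (lmul (v t) (star (szego_L2 (star (lmul (bstar (u t)) ?F)))))
        + szego_L2 (lmul (u t) (star (szego_L2 (star (lmul (bstar (v t)) ?F))))))"
      by (simp add: blinfun.add_left szego_simps scaleC_simps add.commute)
    also have "\<dots> = \<i> *\<^sub>C \<i> *\<^sub>C (hankel_sq (u t) (toeplitz_sq (u t) ?F) - toeplitz_sq (u t) (hankel_sq (u t) ?F))"
      by (subst hankel_sq_derivative[OF bplus N szego_szego v]) (rule refl)
    also have "\<dots> = ?R F"
      by (simp add: blinfun.diff_left szego_scaleC hankel_sq_scaleC toeplitz_sq_scaleC scaleC_simps)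
    finally show "?L F = ?R F" .
  qed
  ultimately show ?thesis by simp
qed

lemma rank_op_derivative:
  "((\<lambda>t. rank_op (L2_of (u t)) :: (complex^'d^'m) L2 \<Rightarrow>\<^sub>L _) has_vector_derivative
    rank_op (L2_of (u t)) \<odot> toeplitz_op (u t) - toeplitz_op (u t) \<odot> rank_op (L2_of (u t))) (at t)"
proof -
  define V where "V = (- \<i>) *\<^sub>C toeplitz_sq (u t) (L2_of (u t))"
  let ?U = "L2_of (u t)"
  note d1 = bounded_linear.has_vector_derivative[OF bounded_linear_RmulL dU[of t, folded V_def]]
  note d2 = bounded_linear.has_vector_derivative[OF bounded_linear_PairL dU[of t, folded V_def]]
  have "((\<lambda>t. rank_op (L2_of (u t)) :: (complex^'d^'m) L2 \<Rightarrow>\<^sub>L _) has_vector_derivative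
      RmulL ?U \<odot> (PairL V \<odot> PiL) + RmulL V \<odot> (PairL ?U \<odot> PiL)) (at t)"
    unfolding rank_op_def using compose_derivative[OF d1 compose_derivative[OF d2 has_vector_derivative_const]] by simp
  moreover have "RmulL ?U \<odot> (PairL V \<odot> PiL) + RmulL V \<odot> (PairL ?U \<odot> PiL)
      = (rank_op ?U \<odot> toeplitz_op (u t) - toeplitz_op (u t) \<odot> rank_op ?U :: (complex^'d^'m) L2 \<Rightarrow>\<^sub>L _)" (is "?L = ?R")
  proof (rule blinfun_eqI)
    fix F :: "(complex^'d^'m) L2"
    let ?F = "szego_L2 F"
    have U: "szego_L2 (rmul C ?U) = rmul C ?U" for C :: "complex^'d^'n" using bplus[of t] by (simp add: szego_rmul bplus_def)
    have "?L F = rmul (pairing V ?F) ?U + rmul (pairing ?U ?F) V"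
      by (simp add: blinfun.add_left)
    also have "\<dots> = ?R F"
      by (subst rank_derivative[OF bplus szego_szego V_def]) (simp add: blinfun.diff_left szego_scaleC U)
    finally show "?L F = ?R F" .
  qed
  ultimately show ?thesis by simp
qed

lemma continuous_toeplitz_op: "continuous_on UNIV (\<lambda>t. toeplitz_op (u t) :: (complex^'d^'m) L2 \<Rightarrow>\<^sub>L _)"
proof (rule continuous_of_derivative)
  fix t
  note d1 = bounded_linear.has_vector_derivative[OF bounded_linear_MulL du[of t]]
  note d2 = bounded_linear.has_vector_derivative[OF bounded_linear_MulL bounded_linear.has_vector_derivative[OF bounded_linear_bstar du[of t]]]
  show "((\<lambda>t. toeplitz_op (u t) :: (complex^'d^'m) L2 \<Rightarrow>\<^sub>L _) has_vector_derivative
      (ImL \<odot> PiL) \<odot> (MulL (u t) \<odot> (MulL (bstar (v t)) \<odot> PiL) + MulL (v t) \<odot> (MulL (bstar (u t)) \<odot> PiL))) (at t)"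
    unfolding toeplitz_op_def
    using compose_derivative[OF has_vector_derivative_const[of "ImL \<odot> PiL"] compose_derivative[OF d1 compose_derivative[OF d2 has_vector_derivative_const]]]
    by simp
qed

text \<open>
  All five relations, for the operators of a solution.
\<close>

theorem lax:
  fixes z :: complex
  assumes z: "Im z > 0"
  defines "R \<equiv> Blinfun (res z) :: (complex^'n^'m) L2 \<Rightarrow>\<^sub>L _" and "evz \<equiv> Blinfun (\<lambda>F :: (complex^'n^'m) L2. poisson F z)"
  shows "lax_flow (\<lambda>t. hankel_op (u t)) (\<lambda>t. toeplitz_op (u t)) (\<lambda>t. rank_op (L2_of (u t))) R evz (\<lambda>t. L2_of (u t))"
proof
  have R [simp]: "R F = res z F" for F
    unfolding R_def by (simp add: bounded_linear_Blinfun_apply bounded_linear_res)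
  have evz [simp]: "evz F = poisson F z" for F :: "(complex^'n^'m) L2"
    unfolding evz_def by (simp add: bounded_linear_Blinfun_apply bounded_linear_poisson[OF z])
  fix t
  let ?U = "L2_of (u t)"
  have U: "szego_L2 ?U = ?U" using bplus[of t] by (simp add: bplus_def)
  show "((\<lambda>t. L2_of (u t)) has_vector_derivative - toeplitz_op (u t) (L2_of (u t))) (at t)"
    using dU[of t] by (simp add: U scaleC_minus_left)
  have P: "pairing ?U (res z (szego_L2 F)) = (2 * pi * \<i>) *\<^sub>M poisson (lmul (bstar (u t)) (szego_L2 F)) z" for F :: "(complex^'n^'m) L2"
    by (rule pairing_res[OF z bplus szego_szego])
  have R_szego: "res z F = res z (szego_L2 F)" for F :: "(complex^'n^'m) L2" by (simp add: res_def)
  have c: "(1 / (2 * pi)) *\<^sub>R (2 * pi * \<i>) *\<^sub>C G = \<i> *\<^sub>C G" for G :: "(complex^'n^'m) L2"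
    by (simp add: scaleC_of_real[symmetric])
  have c': "(1 / (2 * pi)) *\<^sub>R (2 * pi * \<i>) *\<^sub>M G = \<i> *\<^sub>M G" for G :: "complex^'n^'m"
    by (simp add: mscale_of_real[symmetric])
  show "R \<odot> (hankel_op (u t) - toeplitz_op (u t)) - (hankel_op (u t) - toeplitz_op (u t)) \<odot> R
      = - (1 / (2 * pi)) *\<^sub>R (R \<odot> (rank_op ?U \<odot> R))" (is "?L = ?R")
  proof (rule blinfun_eqI)
    fix F :: "(complex^'n^'m) L2"
    let ?F = "szego_L2 F" and ?b = "poisson (lmul (bstar (u t)) (szego_L2 F)) z"
    have "?L F = \<i> *\<^sub>C (res z (hankel_sq (u t) ?F - toeplitz_sq (u t) ?F) - (hankel_sq (u t) (res z ?F) - toeplitz_sq (u t) (res z ?F)))"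
      by (simp add: blinfun.diff_left blinfun.diff_right scaleC_simps res_scaleC bounded_linear_simps[OF bounded_linear_res] R_szego[of F, symmetric])
    also have "\<dots> = \<i> *\<^sub>C (- res z (rmul ?b ?U))"
      unfolding res_commutators(1)[OF z bplus szego_szego] ..
    also have "\<dots> = - ((1 / (2 * pi)) *\<^sub>R (2 * pi * \<i>) *\<^sub>C res z (rmul ?b ?U))"
      unfolding c by (simp add: scaleC_simps)
    also have "\<dots> = ?R F"
      by (simp add: blinfun.scaleR_left blinfun.minus_left R_szego[of F] P rmul_scaleC res_scaleC)
    finally show "?L F = ?R F" .
  qed
  show "evz \<odot> (hankel_op (u t) - toeplitz_op (u t)) = - (1 / (2 * pi)) *\<^sub>R (evz \<odot> (rank_op ?U \<odot> R))" (is "?L = ?R")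
  proof (rule blinfun_eqI)
    fix F :: "(complex^'n^'m) L2"
    let ?F = "szego_L2 F" and ?b = "poisson (lmul (bstar (u t)) (szego_L2 F)) z"
    have "?L F = \<i> *\<^sub>M poisson (hankel_sq (u t) ?F - toeplitz_sq (u t) ?F) z"
      by (simp add: blinfun.diff_left blinfun.diff_right poisson_scaleC[OF z] poisson_simps[OF z] mscale_diff_right)
    also have "\<dots> = \<i> *\<^sub>M (- poisson (rmul ?b ?U) z)"
      unfolding res_commutators(2)[OF z bplus szego_szego] ..
    also have "\<dots> = - ((1 / (2 * pi)) *\<^sub>R (2 * pi * \<i>) *\<^sub>M poisson (rmul ?b ?U) z)"
      unfolding c' by simp
    also have "\<dots> = ?R F"
      by (simp add: blinfun.scaleR_left blinfun.minus_left R_szego[of F] P rmul_scaleC poisson_scaleC[OF z])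
    finally show "?L F = ?R F" .
  qed
qed (rule continuous_toeplitz_op hankel_op_derivative rank_op_derivative)+

end

section \<open>The explicit formula from an isospectral flow\<close>

lemma oriented_integral_eq: "oriented_integral t f = antideriv f t"
  by (simp add: oriented_integral_def antideriv_def)

lemma antideriv_bounded_linear:
  assumes f: "continuous_on UNIV f" and h: "bounded_linear h"
  shows "antideriv (\<lambda>t. h (f t)) t = h (antideriv f t)"
proof -
  have "f integrable_on {a..b}" for a b
    by (rule integrable_continuous_interval) (rule continuous_on_subset[OF f], simp)
  then have "integral {a..b} (\<lambda>t. h (f t)) = h (integral {a..b} f)" for a b
    using integral_linear[OF _ h, of f "{a..b}"] by (simp add: o_def)
  then show ?thesis by (simp add: antideriv_def bounded_linear_simps[OF h])
qed

text \<open>A curve that starts among the nonnegative frequencies and whose velocity stays there never leaves.\<close>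

lemma szego_invariant_curve:
  assumes d: "\<And>t. (y has_vector_derivative y' t) (at t)" and y': "\<And>t. szego_L2 (y' t) = y' t"
    and y0: "szego_L2 (y 0) = y 0"
  shows "szego_L2 (y t) = y t"
proof -
  have "((\<lambda>t. y t - szego_L2 (y t)) has_vector_derivative 0) (at t)" for t
    using has_vector_derivative_diff[OF d bounded_linear.has_vector_derivative[OF bounded_linear_szego_L2 d], of t] y'[of t] by simp
  from constant_of_zero_derivative[OF this, of t] y0 show ?thesis by simp
qed

text \<open>
  The passage from the bounded operators of the flow to the operators of the formula. The exponential series are Picard series,
  hence equal to the flow; the operator \<open>G\<close> enters only through its resolvent \<open>res z\<close>. Stated for arbitrary \<open>H\<close> and \<open>mm\<close> that agree with
  the operators of the flow on plus functions, to serve both kinds of Hankel operators.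
\<close>

theorem lax_flow_explicit_formula:
  fixes u :: "real \<Rightarrow> (complex^'n^'m) L2" and t :: real
  assumes lf: "lax_flow A B m R evz u" and z: "Im z > 0"
    and R: "\<And>F. R F = res z F" and evz: "\<And>F. evz F = poisson F z"
    and A0: "\<And>F. szego_L2 F = F \<Longrightarrow> A 0 F = \<i> *\<^sub>C H F" and m0: "\<And>F. szego_L2 F = F \<Longrightarrow> m 0 F = mm F"
    and A_plus: "\<And>F. szego_L2 (A 0 F) = A 0 F" and m_plus: "\<And>F. szego_L2 (m 0 F) = m 0 F"
    and A_scaleC: "\<And>c F. A 0 (c *\<^sub>C F) = c *\<^sub>C A 0 F"
    and u0: "szego_L2 (u 0) = u 0"
  defines "L \<equiv> \<lambda>F. (1 / (2 * pi)) *\<^sub>R oriented_integral t (\<lambda>\<tau>. exp_op H (- \<i> * of_real \<tau>) (mm (exp_op H (\<i> * of_real \<tau>) F)))"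
  shows "poisson (u t) z = (1 / (2 * of_real pi * \<i>)) *\<^sub>M op_I (resolvent_G L z (exp_op H (- \<i> * of_real t) (u 0)))"
proof -
  interpret lax_flow A B m R evz u by (rule lf)
  obtain E where E0: "E 0 = id_blinfun" and dE: "\<And>t. (E has_vector_derivative A 0 \<odot> E t) (at t)"
    using flow_exists by blast
  have dE': "((\<lambda>t. E t F) has_vector_derivative A 0 (E t F)) (at t)" for t F
    using bounded_linear.has_vector_derivative[OF bounded_bilinear.bounded_linear_left[OF bounded_bilinear_blinfun_apply] dE] by simp
  have E_plus: "szego_L2 (E t F) = E t F" if "szego_L2 F = F" for t F
    by (rule szego_invariant_curve[OF dE']) (simp_all add: A_plus E0 that)
  have exp_E: "exp_op H (\<i> * of_real \<tau>) F = E \<tau> F" if F: "szego_L2 F = F" for \<tau> F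
  proof -
    define y where "y k \<tau> = (\<tau> ^ k / fact k) *\<^sub>R ((blinfun_apply (A 0)) ^^ k) F" for k and \<tau> :: real
    have pl: "szego_L2 ((blinfun_apply (A 0) ^^ k) F) = (blinfun_apply (A 0) ^^ k) F" for k
      by (cases k) (simp_all add: F A_plus)
    have Hk: "szego_L2 ((H ^^ k) F) = (H ^^ k) F \<and> (blinfun_apply (A 0) ^^ k) F = (\<i> ^ k) *\<^sub>C (H ^^ k) F" for k
    proof (induction k)
      case 0 show ?case using scaleC_of_real[of 1 F] F by simp
    next
      case (Suc k)
      let ?G = "(H ^^ k) F"
      have G: "A 0 ?G = \<i> *\<^sub>C H ?G" using Suc A0 by blast
      have "H ?G = (- \<i>) *\<^sub>C A 0 ?G" using scaleC_of_real[of 1 "H ?G"] by (simp add: G)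
      then have "szego_L2 (H ?G) = H ?G" by (simp add: szego_scaleC A_plus)
      moreover have "A 0 ((blinfun_apply (A 0) ^^ k) F) = (\<i> ^ Suc k) *\<^sub>C H ?G"
        using Suc by (simp add: A_scaleC G mult.commute)
      ultimately show ?case by simp
    qed
    have summand: "((\<i> * of_real \<tau>) ^ k / fact k) *\<^sub>C (H ^^ k) F = y k \<tau>" for k \<tau>
    proof -
      have "y k \<tau> = of_real (\<tau> ^ k / fact k) *\<^sub>C (\<i> ^ k) *\<^sub>C (H ^^ k) F"
        unfolding y_def scaleC_of_real using Hk[of k] by simp
      then show ?thesis by (simp add: power_mult_distrib mult.commute)
    qed
    have c: "continuous_on UNIV (\<lambda>t::real. A 0)" by simp
    have y0: "y 0 t = F" for t by (simp add: y_def)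
    have yS0: "y (Suc n) 0 = 0" for n by (simp add: y_def)
    have yd: "(y (Suc n) has_vector_derivative A 0 (y n t)) (at t)" for n t
    proof -
      have "((\<lambda>\<tau>. \<tau> ^ Suc n / fact (Suc n)) has_real_derivative (t ^ n / fact n)) (at t)"
        by (rule derivative_eq_intros refl | simp)+
      from bounded_linear.has_vector_derivative[OF bounded_linear_scaleR_left this[unfolded has_real_derivative_iff_has_vector_derivative]]
      show ?thesis unfolding y_def by (simp add: blinfun.scaleR_right)
    qed
    note ps = picard_series[OF c y0 yS0 yd]
    have "(\<Sum>n. y n \<tau>) = E \<tau> F"
      by (rule linear_ode_unique[OF c, where y = "\<lambda>\<tau>. \<Sum>n. y n \<tau>"]) (simp_all add: ps(2,3) dE' E0)
    then show ?thesis by (simp add: exp_op_def summand)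
  qed
  have exp_E': "exp_op H (- \<i> * of_real \<tau>) F = E (- \<tau>) F" if F: "szego_L2 F = F" for \<tau> F
    using exp_E[OF F, of "- \<tau>"] by simp
  let ?c = "conj_m E" and ?L = "Lop E t" and ?w = "E (- t) (u 0)"
  have cm: "continuous_on UNIV ?c" by (rule continuous_of_derivative[OF conj_m_derivative[OF E0 dE]])
  have cF: "exp_op H (- \<i> * of_real \<tau>) (mm (exp_op H (\<i> * of_real \<tau>) F)) = ?c \<tau> F" and c_plus: "szego_L2 (?c \<tau> F) = ?c \<tau> F"
    if F: "szego_L2 F = F" for \<tau> F
  proof -
    have mp: "szego_L2 (mm (E \<tau> F)) = mm (E \<tau> F)" using m_plus[of "E \<tau> F"] by (simp add: m0[OF E_plus[OF F]])
    show "exp_op H (- \<i> * of_real \<tau>) (mm (exp_op H (\<i> * of_real \<tau>) F)) = ?c \<tau> F"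
      unfolding exp_E[OF F] exp_E'[OF mp] by (simp add: conj_m_def[OF E0 dE] m0[OF E_plus[OF F]])
    show "szego_L2 (?c \<tau> F) = ?c \<tau> F"
      by (simp add: conj_m_def[OF E0 dE] E_plus m_plus)
  qed
  have L: "L F = ?L F" if F: "szego_L2 F = F" for F
  proof -
    have "antideriv (\<lambda>\<tau>. ?c \<tau> F) t = antideriv ?c t F"
      by (rule antideriv_bounded_linear[OF cm bounded_bilinear.bounded_linear_left[OF bounded_bilinear_blinfun_apply]])
    then show ?thesis by (simp add: L_def oriented_integral_eq cF[OF F, simplified] Lop_def[OF E0 dE] blinfun.scaleR_left)
  qed
  have L_plus: "szego_L2 (?L F) = ?L F" if F: "szego_L2 F = F" for F
  proof (rule szego_invariant_curve)
    show "((\<lambda>t. Lop E t F) has_vector_derivative (1 / (2 * pi)) *\<^sub>R ?c t F) (at t)" for t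
      using bounded_linear.has_vector_derivative[OF bounded_bilinear.bounded_linear_left[OF bounded_bilinear_blinfun_apply] Lop_derivative[OF E0 dE], of F t]
      by (simp add: blinfun.scaleR_left)
  qed (simp_all add: szego_simps c_plus[OF F] Lop_0[OF E0 dE])
  obtain F where F: "F = R (?w - ?L F)" "evz (?w - ?L F) = evz (u t)" and uniq: "\<And>F'. F' = R (?w - ?L F') \<Longrightarrow> F' = F"
    by (rule explicit_solution[OF E0 dE, of t]) blast
  define Q where "Q = ?w - ?L F"
  have FQ: "F = res z Q" using F(1) by (simp add: Q_def R)
  have F_plus: "szego_L2 F = F" unfolding FQ by simp
  have Q: "szego_L2 Q = Q" by (simp add: Q_def szego_simps E_plus[OF u0] L_plus[OF F_plus])
  let ?op = "\<lambda>F. op_G F + L F - z *\<^sub>C F"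
  have "resolvent_G L z ?w = F"
    unfolding resolvent_G_def the_inv_into_def
  proof (rule the_equality)
    show "F \<in> Dom_G \<and> ?op F = ?w"
      unfolding L[OF F_plus] using res_in_Dom_G[OF z Q] op_G_res[OF z Q] by (simp add: FQ[symmetric]) (simp add: Q_def)
    fix F' assume F': "F' \<in> Dom_G \<and> ?op F' = ?w"
    then obtain Q' where Q': "szego_L2 Q' = Q'" "F' = res z Q'" using Dom_G_imp_res[OF z] by metis
    have "szego_L2 F' = F'" unfolding Q'(2) by simp
    from L[OF this] F' op_G_res[OF z Q'(1)] have "Q' = ?w - ?L F'" by (simp add: Q'(2)[symmetric] algebra_simps)
    then have "F' = R (?w - ?L F')" using Q'(2) by (simp add: R)
    then show "F' = F" by (rule uniq)
  qed
  moreover have "op_I F = (2 * pi * \<i>) *\<^sub>M poisson (u t) z"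
    unfolding FQ op_I_res[OF z Q] using F(2) by (simp add: evz Q_def)
  moreover have "exp_op H (- \<i> * of_real t) (u 0) = ?w" by (rule exp_E'[OF u0])
  ultimately show ?thesis by simp
qed

section \<open>Sobolev curves\<close>

text \<open>
  Comparison with \<open>(1 + |x|)\<^bsup>-2s\<^esup>\<close>, which has an explicit primitive.
\<close>

lemma weight_integrable:
  assumes s: "s > 1 / 2" shows "integrable lborel (\<lambda>\<xi>::real. (1 + \<xi>\<^sup>2) powr (- s))"
proof -
  let ?g = "\<lambda>x::real. (1 + x) powr (- 2 * s)"
  have lim: "((\<lambda>x::real. (1 + x) powr (1 - 2 * s) / (1 - 2 * s)) \<longlongrightarrow> 0 / (1 - 2 * s)) at_top"
    by (intro tendsto_divide tendsto_neg_powr filterlim_tendsto_add_at_top[OF tendsto_const filterlim_ident] tendsto_const)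
      (use s in simp_all)
  have "(\<integral>\<^sup>+x\<in>{0..}. ennreal (?g x) \<partial>lborel) = ennreal (0 / (1 - 2 * s) - (1 + 0) powr (1 - 2 * s) / (1 - 2 * s))"
  proof (rule nn_integral_FTC_atLeast[OF _ _ _ lim])
    fix x :: real assume "0 \<le> x"
    then show "((\<lambda>x. (1 + x) powr (1 - 2 * s) / (1 - 2 * s)) has_real_derivative ?g x) (at x)"
      using s by (auto intro!: derivative_eq_intros simp: divide_simps)
  qed simp_all
  also have "\<dots> < \<infinity>" by simp
  finally have fin: "(\<integral>\<^sup>+x\<in>{0..}. ennreal (?g x) \<partial>lborel) < \<infinity>" .
  have "(\<integral>\<^sup>+x. ennreal (indicator {0..} x *\<^sub>R ?g x) \<partial>lborel) = (\<integral>\<^sup>+x\<in>{0..}. ennreal (?g x) \<partial>lborel)"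
    by (rule nn_integral_cong) (auto simp: indicator_def)
  with fin have "integrable lborel (\<lambda>x. indicator {0..} x *\<^sub>R ?g x)"
    by (intro integrableI_nonneg) (auto simp del: real_scaleR_def intro!: AE_I2 scaleR_nonneg_nonneg)
  then have i: "integrable lborel (\<lambda>x. indicator {0..} x *\<^sub>R ?g x + indicator {0..} (0 + (- 1) * x) *\<^sub>R ?g (0 + (- 1) * x))"
    by (intro Bochner_Integration.integrable_add lborel_integrable_real_affine[where f = "\<lambda>x. indicator {0..} x *\<^sub>R ?g x"]) simp_all
  from integrable_mult_right[OF this, of "2 powr s"] show ?thesis
  proof (rule Bochner_Integration.integrable_bound)
    show "AE x in lborel. norm ((1 + x\<^sup>2) powr (- s)) \<le> norm (2 powr s * (indicator {0..} x *\<^sub>R ?g x + indicator {0..} (0 + (- 1) * x) *\<^sub>R ?g (0 + (- 1) * x)))"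
    proof (rule AE_I2)
      fix x :: real
      have "(1 + \<bar>x\<bar>)\<^sup>2 \<le> 2 * (1 + x\<^sup>2)"
        using zero_le_power2[of "1 - \<bar>x\<bar>"] by (simp add: power2_eq_square algebra_simps)
      then have "(2 * (1 + x\<^sup>2)) powr (- s) \<le> ((1 + \<bar>x\<bar>)\<^sup>2) powr (- s)"
        by (intro powr_mono2') (use s in auto)
      also have "((1 + \<bar>x\<bar>)\<^sup>2) powr (- s) = ?g \<bar>x\<bar>"
        by (simp add: powr_powr powr_numeral[symmetric] del: powr_numeral)
      also have "(2 * (1 + x\<^sup>2)) powr (- s) = 2 powr (- s) * (1 + x\<^sup>2) powr (- s)"
        by (rule powr_mult)
      finally have "2 powr s * (2 powr (- s) * (1 + x\<^sup>2) powr (- s)) \<le> 2 powr s * ?g \<bar>x\<bar>"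
        by (rule mult_left_mono) simp
      moreover have "2 powr s * (2 powr (- s) * (1 + x\<^sup>2) powr (- s)) = (1 + x\<^sup>2) powr (- s)"
        unfolding mult.assoc[symmetric] powr_add[symmetric] by simp
      ultimately have *: "(1 + x\<^sup>2) powr (- s) \<le> 2 powr s * ?g \<bar>x\<bar>" by simp
      have "?g \<bar>x\<bar> \<le> indicator {0..} x *\<^sub>R ?g x + indicator {0..} (0 + (- 1) * x) *\<^sub>R ?g (0 + (- 1) * x)"
        by (cases "0 \<le> x") (auto simp: indicator_def)
      from order_trans[OF * mult_left_mono[OF this, of "2 powr s"]]
      show "norm ((1 + x\<^sup>2) powr (- s)) \<le> norm (2 powr s * (indicator {0..} x *\<^sub>R ?g x + indicator {0..} (0 + (- 1) * x) *\<^sub>R ?g (0 + (- 1) * x)))"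
        unfolding real_norm_def by (simp del: real_scaleR_def)
    qed
  qed simp
qed

definition weighted_hat :: "real \<Rightarrow> (complex^'n^'m) L2 \<Rightarrow> real \<Rightarrow> complex^'n^'m" where
  "weighted_hat s U \<xi> = (1 + \<xi>\<^sup>2) powr (s / 2) *\<^sub>R rep_L2 (fourier_L2 U) \<xi>"

lemma norm_weighted_hat: "(norm (weighted_hat s U \<xi>))\<^sup>2 = (1 + \<xi>\<^sup>2) powr s * (norm (rep_L2 (fourier_L2 U) \<xi>))\<^sup>2"
proof -
  have "((1 + \<xi>\<^sup>2) powr (s / 2))\<^sup>2 = (1 + \<xi>\<^sup>2) powr s"
    by (simp add: power2_eq_square powr_add[symmetric])
  then show ?thesis by (simp add: weighted_hat_def power_mult_distrib)
qed

lemma measurable_weighted_hat: "weighted_hat s U \<in> borel_measurable borel"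
  using rep_L2_measurable[of "fourier_L2 U"] unfolding weighted_hat_def by measurable

lemma Hs_iff: "U \<in> Hs s \<longleftrightarrow> square_integrable (weighted_hat s U)"
  using measurable_weighted_hat[of s U] by (simp add: Hs_def square_integrable_def norm_weighted_hat)

lemma Hs_norm_eq: "U \<in> Hs s \<Longrightarrow> Hs_norm s U = norm (abs_L2 (weighted_hat s U)) / sqrt (2 * pi)"
proof -
  assume "U \<in> Hs s"
  then have "(norm (abs_L2 (weighted_hat s U)))\<^sup>2 = (LINT \<xi>|lborel. (1 + \<xi>\<^sup>2) powr s * (norm (rep_L2 (fourier_L2 U) \<xi>))\<^sup>2)"
    by (simp add: Hs_iff norm_abs_L2 norm_weighted_hat)
  then show ?thesis by (simp add: Hs_norm_def real_sqrt_divide flip: \<open>_ = (LINT \<xi>|lborel. _ \<xi>)\<close>)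
qed

lemma weighted_hat_linear:
  "AE \<xi> in lborel. weighted_hat s (a *\<^sub>R U + b *\<^sub>R V) \<xi> = a *\<^sub>R weighted_hat s U \<xi> + b *\<^sub>R weighted_hat s V \<xi>"
proof -
  have F: "fourier_L2 (a *\<^sub>R U + b *\<^sub>R V) = a *\<^sub>R fourier_L2 U + b *\<^sub>R fourier_L2 V"
    by (simp add: bounded_linear_simps[OF bounded_linear_fourier_L2])
  show ?thesis
    unfolding weighted_hat_def F
    using rep_L2_add[of "a *\<^sub>R fourier_L2 U" "b *\<^sub>R fourier_L2 V"] rep_L2_scaleR[of a "fourier_L2 U"] rep_L2_scaleR[of b "fourier_L2 V"]
    by eventually_elim (simp add: scaleR_add_right mult.commute)
qed

lemma Hs_linear: "U \<in> Hs s \<Longrightarrow> V \<in> Hs s \<Longrightarrow> a *\<^sub>R U + b *\<^sub>R V \<in> Hs s"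
  unfolding Hs_iff
  by (rule square_integrable_cong_AE[OF _ measurable_weighted_hat weighted_hat_linear])
    (intro square_integrable_add square_integrable_scaleR)

lemma norm_le_Hs_norm:
  assumes s: "s \<ge> 0" and U: "U \<in> Hs s" shows "norm U \<le> Hs_norm s U"
proof -
  have "(norm (fourier_L2 U))\<^sup>2 = 2 * pi * (norm U)\<^sup>2"
    using plancherel[of U U] by (simp add: dot_square_norm)
  then have f: "norm (fourier_L2 U) = sqrt (2 * pi) * norm U"
    by (metis norm_ge_zero real_sqrt_mult real_sqrt_unique)
  have "norm (abs_L2 (rep_L2 (fourier_L2 U))) \<le> 1 * norm (abs_L2 (weighted_hat s U))"
  proof (rule norm_abs_L2_le[OF square_integrable_rep_L2 U[unfolded Hs_iff]])
    show "AE \<xi> in lborel. norm (rep_L2 (fourier_L2 U) \<xi>) \<le> 1 * norm (weighted_hat s U \<xi>)"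
    proof (rule AE_I2)
      fix \<xi> :: real
      have "1 \<le> (1 + \<xi>\<^sup>2) powr (s / 2)" using s by (intro ge_one_powr_ge_zero) auto
      then show "norm (rep_L2 (fourier_L2 U) \<xi>) \<le> 1 * norm (weighted_hat s U \<xi>)"
        by (simp add: weighted_hat_def mult_le_cancel_right1)
    qed
  qed simp
  then show ?thesis unfolding Hs_norm_eq[OF U] by (simp add: abs_L2_rep_L2 f field_simps)
qed

text \<open>
  Sobolev embedding: the Cauchy-Schwarz inequality with the weight \<open>(1 + \<xi>\<^sup>2)\<^bsup>-s/2\<^esup>\<close>, square integrable for \<open>s > 1/2\<close>.
\<close>

lemma Hs_hat_integrable:
  assumes s: "s > 1 / 2"
  obtains K where "0 \<le> K"
    "\<And>U :: (complex^'n^'m) L2. U \<in> Hs s \<Longrightarrow> integrable lborel (rep_L2 (fourier_L2 U)) \<and> (LINT \<xi>|lborel. norm (rep_L2 (fourier_L2 U) \<xi>)) \<le> K * Hs_norm s U"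
proof
  let ?g = "\<lambda>\<xi>::real. (1 + \<xi>\<^sup>2) powr (- s / 2)"
  let ?K = "norm (abs_L2 ?g) * sqrt (2 * pi)"
  have g: "square_integrable ?g"
  proof -
    have "(?g \<xi>)\<^sup>2 = (1 + \<xi>\<^sup>2) powr (- s)" for \<xi>
      by (simp add: power2_eq_square powr_add[symmetric])
    then show ?thesis using weight_integrable[OF s] by (simp add: square_integrable_def)
  qed
  show "0 \<le> ?K" by simp
  fix U :: "(complex^'n^'m) L2" assume U: "U \<in> Hs s"
  note w = U[unfolded Hs_iff]
  have eq: "norm (?g \<xi>) * norm (weighted_hat s U \<xi>) = norm (rep_L2 (fourier_L2 U) \<xi>)" for \<xi>
  proof -
    have "?g \<xi> * (1 + \<xi>\<^sup>2) powr (s / 2) = 1" by (simp add: powr_add[symmetric] add_pos_nonneg order_less_imp_not_eq2)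
    then show ?thesis by (simp add: weighted_hat_def mult.assoc[symmetric])
  qed
  have "integrable lborel (rep_L2 (fourier_L2 U))"
    using integrable_norm_mult[OF g w] rep_L2_measurable[of "fourier_L2 U"] unfolding eq by (simp add: integrable_norm_iff)
  moreover have "(LINT \<xi>|lborel. norm (rep_L2 (fourier_L2 U) \<xi>)) \<le> ?K * Hs_norm s U"
    using integral_norm_mult_le[OF g w] unfolding eq by (simp add: Hs_norm_eq[OF U])
  ultimately show "integrable lborel (rep_L2 (fourier_L2 U)) \<and> (LINT \<xi>|lborel. norm (rep_L2 (fourier_L2 U) \<xi>)) \<le> ?K * Hs_norm s U" ..
qed

text \<open>
  The continuous representative, defined by Fourier inversion.
\<close>

definition crep :: "(complex^'n^'m) L2 \<Rightarrow> real \<Rightarrow>\<^sub>C (complex^'n^'m)" where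
  "crep U = Bcontfun (\<lambda>x. (1 / (2 * pi)) *\<^sub>R fourier_L1 (rep_L2 (fourier_L2 U)) (- x))"

lemma crep:
  assumes i: "integrable lborel (rep_L2 (fourier_L2 U))"
  shows apply_crep: "apply_bcontfun (crep U) x = (1 / (2 * pi)) *\<^sub>R fourier_L1 (rep_L2 (fourier_L2 U)) (- x)"
    and norm_crep: "norm (crep U) \<le> (LINT \<xi>|lborel. norm (rep_L2 (fourier_L2 U) \<xi>))"
    and square_integrable_crep: "square_integrable (apply_bcontfun (crep U))"
    and L2_of_crep: "L2_of (crep U) = U"
proof -
  let ?f = "\<lambda>x. (1 / (2 * pi)) *\<^sub>R fourier_L1 (rep_L2 (fourier_L2 U)) (- x)"
  have c: "continuous_on UNIV ?f"
    by (intro continuous_intros continuous_on_compose2[OF continuous_fourier_L1[OF i]]) auto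
  have pi1: "1 / (2 * pi) \<le> 1" using pi_gt3 by simp
  have b: "norm (?f x) \<le> (LINT \<xi>|lborel. norm (rep_L2 (fourier_L2 U) \<xi>))" for x
  proof -
    have "norm (?f x) \<le> 1 * norm (fourier_L1 (rep_L2 (fourier_L2 U)) (- x))"
      using pi1 by (simp only: norm_scaleR) (intro mult_right_mono, auto)
    then show ?thesis using norm_fourier_L1_le[of "rep_L2 (fourier_L2 U)" "- x"] by simp
  qed
  have a: "apply_bcontfun (crep U) = ?f"
    unfolding crep_def by (rule Bcontfun_inverse) (rule bcontfun_normI[OF c b])
  then show "apply_bcontfun (crep U) x = ?f x" by simp
  show "norm (crep U) \<le> (LINT \<xi>|lborel. norm (rep_L2 (fourier_L2 U) \<xi>))" by (rule norm_bound) (simp only: a b)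
  have "square_integrable ?f" by (rule square_integrable_scaleR) (rule ifourier_abs(2)[OF i square_integrable_rep_L2])
  then show "square_integrable (apply_bcontfun (crep U))" by (simp only: a)
  show "L2_of (crep U) = U"
    unfolding a ifourier_abs(1)[OF i square_integrable_rep_L2, symmetric] by (simp add: abs_L2_rep_L2)
qed

lemma crep_linear:
  assumes "integrable lborel (rep_L2 (fourier_L2 U))" "integrable lborel (rep_L2 (fourier_L2 V))"
    "integrable lborel (rep_L2 (fourier_L2 (a *\<^sub>R U + b *\<^sub>R V)))"
  shows "crep (a *\<^sub>R U + b *\<^sub>R V) = a *\<^sub>R crep U + b *\<^sub>R crep V"
proof (rule bcontfun_eqI)
  fix x
  have "AE \<xi> in lborel. rep_L2 (fourier_L2 (a *\<^sub>R U + b *\<^sub>R V)) \<xi> = a *\<^sub>R rep_L2 (fourier_L2 U) \<xi> + b *\<^sub>R rep_L2 (fourier_L2 V) \<xi>"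
    using weighted_hat_linear[of 0 a U b V]
    by (simp add: weighted_hat_def sum_power2_eq_zero_iff add_nonneg_eq_0_iff)
  then have "fourier_L1 (rep_L2 (fourier_L2 (a *\<^sub>R U + b *\<^sub>R V))) (- x) = fourier_L1 (\<lambda>\<xi>. a *\<^sub>R rep_L2 (fourier_L2 U) \<xi> + b *\<^sub>R rep_L2 (fourier_L2 V) \<xi>) (- x)"
    using fourier_L1_cong_AE[of "rep_L2 (fourier_L2 (a *\<^sub>R U + b *\<^sub>R V))" "\<lambda>\<xi>. a *\<^sub>R rep_L2 (fourier_L2 U) \<xi> + b *\<^sub>R rep_L2 (fourier_L2 V) \<xi>"]
    by (simp add: rep_L2_measurable borel_measurable_add borel_measurable_scaleR)
  also have "\<dots> = a *\<^sub>R fourier_L1 (rep_L2 (fourier_L2 U)) (- x) + b *\<^sub>R fourier_L1 (rep_L2 (fourier_L2 V)) (- x)"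
    using assms by (simp add: fourier_L1_add fourier_L1_scaleR)
  finally show "apply_bcontfun (crep (a *\<^sub>R U + b *\<^sub>R V)) x = apply_bcontfun (a *\<^sub>R crep U + b *\<^sub>R crep V) x"
    using assms by (simp add: apply_crep scaleR_add_right)
qed

lemma has_vector_derivative_iff_quotient:
  "(f has_vector_derivative f') (at t) \<longleftrightarrow> ((\<lambda>h. (1 / h) *\<^sub>R (f (t + h) - f t) - f') \<longlongrightarrow> 0) (at 0)"
proof -
  have "(f has_vector_derivative f') (at t) \<longleftrightarrow> ((\<lambda>h. norm ((f (t + h) - f t - h *\<^sub>R f') /\<^sub>R \<bar>h\<bar>)) \<longlongrightarrow> 0) (at 0)"
    unfolding has_vector_derivative_def has_derivative_at
    by (simp add: bounded_linear_scaleR_left divide_inverse mult.commute)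
  also have "\<dots> \<longleftrightarrow> ((\<lambda>h. norm ((1 / h) *\<^sub>R (f (t + h) - f t) - f')) \<longlongrightarrow> 0) (at 0)"
  proof (rule filterlim_cong[OF refl refl])
    show "\<forall>\<^sub>F h in at 0. norm ((f (t + h) - f t - h *\<^sub>R f') /\<^sub>R \<bar>h\<bar>) = norm ((1 / h) *\<^sub>R (f (t + h) - f t) - f')"
      unfolding eventually_at_filter
    proof (rule always_eventually, intro allI impI)
      fix h :: real assume "h \<noteq> 0"
      then have "(1 / h) *\<^sub>R (f (t + h) - f t) - f' = (1 / h) *\<^sub>R (f (t + h) - f t - h *\<^sub>R f')"
        by (simp add: scaleR_diff_right)
      then show "norm ((f (t + h) - f t - h *\<^sub>R f') /\<^sub>R \<bar>h\<bar>) = norm ((1 / h) *\<^sub>R (f (t + h) - f t) - f')"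
        by (simp add: divide_inverse)
    qed
  qed
  also have "\<dots> \<longleftrightarrow> ((\<lambda>h. (1 / h) *\<^sub>R (f (t + h) - f t) - f') \<longlongrightarrow> 0) (at 0)"
    by (rule tendsto_norm_zero_iff)
  finally show ?thesis .
qed

text \<open>
  Both the \<open>L\<^sup>2\<close> norm and the supremum norm are dominated by the norm of \<open>H\<^sup>s\<close>.
\<close>

lemma Hs_derivative:
  fixes U :: "real \<Rightarrow> (complex^'n^'m) L2"
  assumes s: "s > 1 / 2" and d: "has_Hs_derivative s U V t"
  shows Hs_derivative_L2: "(U has_vector_derivative V) (at t)"
    and Hs_derivative_crep: "((\<lambda>t. crep (U t)) has_vector_derivative crep V) (at t)"
proof -
  let ?q = "\<lambda>h. (1 / h) *\<^sub>R (U (t + h) - U t) - V"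
  have U: "U \<tau> \<in> Hs s" and V: "V \<in> Hs s" for \<tau> using d by (auto simp: has_Hs_derivative_def)
  have lim: "((\<lambda>h. Hs_norm s (?q h)) \<longlongrightarrow> 0) (at 0)" using d by (simp add: has_Hs_derivative_def)
  have D: "1 *\<^sub>R U (t + h) + (- 1) *\<^sub>R U t \<in> Hs s" for h by (rule Hs_linear[OF U U])
  have q_eq: "?q h = (1 / h) *\<^sub>R (1 *\<^sub>R U (t + h) + (- 1) *\<^sub>R U t) + (- 1) *\<^sub>R V" for h by simp
  have q: "?q h \<in> Hs s" for h unfolding q_eq by (rule Hs_linear[OF D V])
  obtain K where K: "0 \<le> K" "\<And>U :: (complex^'n^'m) L2. U \<in> Hs s \<Longrightarrow> integrable lborel (rep_L2 (fourier_L2 U)) \<and> (LINT \<xi>|lborel. norm (rep_L2 (fourier_L2 U) \<xi>)) \<le> K * Hs_norm s U"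
    using Hs_hat_integrable[OF s] by blast
  have i: "integrable lborel (rep_L2 (fourier_L2 W))" if "W \<in> Hs s" for W :: "(complex^'n^'m) L2" using K(2)[OF that] by simp
  show "(U has_vector_derivative V) (at t)"
    unfolding has_vector_derivative_iff_quotient
  proof (rule Lim_null_comparison[OF _ lim])
    show "\<forall>\<^sub>F h in at 0. norm (?q h) \<le> Hs_norm s (?q h)"
      by (rule always_eventually, rule allI, rule norm_le_Hs_norm[OF _ q]) (use s in simp)
  qed
  have cq: "crep (?q h) = (1 / h) *\<^sub>R (crep (U (t + h)) - crep (U t)) - crep V" for h
    unfolding q_eq
    by (subst crep_linear[OF i[OF D] i[OF V] i[OF Hs_linear[OF D V]]], subst crep_linear[OF i[OF U] i[OF U] i[OF D]]) simp
  show "((\<lambda>t. crep (U t)) has_vector_derivative crep V) (at t)"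
    unfolding has_vector_derivative_iff_quotient
  proof (rule Lim_null_comparison)
    show "((\<lambda>h. K * Hs_norm s (?q h)) \<longlongrightarrow> 0) (at 0)" using tendsto_mult_right_zero[OF lim] by simp
    show "\<forall>\<^sub>F h in at 0. norm ((1 / h) *\<^sub>R (crep (U (t + h)) - crep (U t)) - crep V) \<le> K * Hs_norm s (?q h)"
      unfolding cq[symmetric]
      by (rule always_eventually, rule allI) (rule order_trans[OF norm_crep[OF i[OF q]]], use K(2)[OF q] in blast)
  qed
qed

lemma Hs_plusD:
  assumes "U \<in> Hs_plus s" shows "U \<in> Hs s" "szego_L2 U = U"
proof -
  obtain V where V: "V \<in> Hs s" "U = szego_L2 V" using assms by (auto simp: Hs_plus_def szego_rep)
  show "szego_L2 U = U" by (simp add: V)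
  show "U \<in> Hs s"
    unfolding Hs_iff
  proof (rule square_integrable_AE_bound[where c = 1, OF V(1)[unfolded Hs_iff] measurable_weighted_hat])
    show "AE \<xi> in lborel. norm (weighted_hat s U \<xi>) \<le> 1 * norm (weighted_hat s V \<xi>)"
      using rep_cutoff[of "fourier_L2 V"] unfolding V(2) weighted_hat_def by (auto simp: indicator_def)
  qed
qed

lemma Hs_plus_bplus:
  assumes s: "s > 1 / 2" and U: "U \<in> Hs_plus s"
  shows "bplus (crep U)" "L2_of (crep U) = U"
proof -
  have i: "integrable lborel (rep_L2 (fourier_L2 U))" using Hs_hat_integrable[OF s] Hs_plusD(1)[OF U] by metis
  show "L2_of (crep U) = U" by (rule L2_of_crep[OF i])
  then show "bplus (crep U)" using square_integrable_crep[OF i] Hs_plusD(2)[OF U] by (simp add: bplus_def)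
qed

text \<open>
  Products of square integrable representatives need not be known to be square integrable beforehand; agreement with an element
  of \<open>L\<^sup>2\<close> almost everywhere suffices.
\<close>

lemma szego_AE:
  assumes "f \<in> borel_measurable borel" "AE x in lborel. f x = rep_L2 F x" shows "szego f = szego_L2 F"
proof -
  have f: "square_integrable f" by (rule square_integrable_cong_AE[OF square_integrable_rep_L2 assms])
  have "abs_L2 f = F" by (rule L2_eqI) (use rep_L2_abs_L2[OF f] assms(2) in \<open>auto elim: eventually_elim2\<close>)
  then show ?thesis using szego_eq[OF f] by simp
qed

text \<open>
  The derivative supplied by the equation equals the one supplied by smoothness, because derivatives in \<open>L\<^sup>2\<close> are unique. The
  remainder \<open>N = u u\<^sup>* u - \<i> u'\<close> is bounded and continuous because both terms are; it is the minus part of \<open>u u\<^sup>* u\<close>.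
\<close>

theorem szego_curve_of_solution:
  fixes U :: "real \<Rightarrow> (complex^'n^'m) L2"
  assumes s: "s > 1 / 2" and smooth: "smooth_Hs_plus s U" and eq: "solves_matrix_szego s U"
  obtains u v N where "szego_curve u v N" "\<And>t. L2_of (u t) = U t" "\<And>t. bplus (u t)"
proof -
  obtain D :: "nat \<Rightarrow> real \<Rightarrow> (complex^'n^'m) L2" where D: "D 0 = U" "\<And>k t. D k t \<in> Hs_plus s"
    "\<And>k t. has_Hs_derivative s (D k) (D (Suc k) t) t"
    using smooth unfolding smooth_Hs_plus_def by blast
  define u where "u t = crep (U t)" for t
  define v where "v t = crep (D 1 t)" for t
  have u: "bplus (u t)" "L2_of (u t) = U t" for t using Hs_plus_bplus[OF s D(2)[of 0 t]] by (auto simp: D(1) u_def)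
  have v: "bplus (v t)" "L2_of (v t) = D 1 t" for t using Hs_plus_bplus[OF s D(2)[of 1 t]] by (auto simp: v_def)
  have dU: "has_Hs_derivative s U (D 1 t) t" for t using D(3)[of 0 t] by (simp add: D(1))
  have su: "square_integrable (apply_bcontfun (u t))" and sv: "square_integrable (apply_bcontfun (v t))" for t
    using u(1)[of t] v(1)[of t] by (auto simp: bplus_def)
  let ?b = "\<lambda>t. lmul (u t) (lmul (bstar (u t)) (U t))"
  have sz: "\<i> *\<^sub>C D 1 t = szego_L2 (?b t)" for t
  proof -
    obtain V where V: "has_Hs_derivative s U V t" "\<i> *\<^sub>C V = szego (\<lambda>x. rep_L2 (U t) x ** ctranspose (rep_L2 (U t) x) ** rep_L2 (U t) x)"
      using eq unfolding solves_matrix_szego_def by blast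
    have "V = D 1 t" by (rule vector_derivative_unique_at[OF Hs_derivative_L2[OF s V(1)] Hs_derivative_L2[OF s dU]])
    moreover have "szego (\<lambda>x. rep_L2 (U t) x ** ctranspose (rep_L2 (U t) x) ** rep_L2 (U t) x) = szego_L2 (?b t)"
    proof (rule szego_AE)
      show "(\<lambda>x. rep_L2 (U t) x ** ctranspose (rep_L2 (U t) x) ** rep_L2 (U t) x) \<in> borel_measurable borel"
        by (intro measurable_matrix_mult measurable_ctranspose rep_L2_measurable)
      show "AE x in lborel. rep_L2 (U t) x ** ctranspose (rep_L2 (U t) x) ** rep_L2 (U t) x = rep_L2 (?b t) x"
        using rep_L2_abs_L2[OF su[of t]] rep_lmul[of "u t" "lmul (bstar (u t)) (U t)"] rep_lmul[of "bstar (u t)" "U t"]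
        unfolding u(2) by eventually_elim (simp add: matrix_mul_assoc)
    qed
    ultimately show ?thesis using V(2) by simp
  qed
  have D1: "D 1 t = (- \<i>) *\<^sub>C toeplitz_sq (u t) (U t)" for t
    using scaleC_of_real[of 1 "D 1 t"] by (simp add: toeplitz_sq_def sz[symmetric])
  define n where "n t x = apply_bcontfun (u t) x ** ctranspose (apply_bcontfun (u t) x) ** apply_bcontfun (u t) x - \<i> *\<^sub>M apply_bcontfun (v t) x" for t x
  define N where "N t = Bcontfun (n t)" for t
  have N: "apply_bcontfun (N t) = n t" for t
    unfolding N_def
  proof (rule Bcontfun_inverse, rule bcontfun_normI)
    show "continuous_on UNIV (n t)"
      unfolding n_def
      by (intro continuous_intros bounded_bilinear.continuous_on[OF bounded_bilinear_mult] continuous_apply_bcontfun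
          continuous_on_compose2[OF linear_continuous_on[OF bounded_linear_ctranspose]]) auto
    fix x
    have "norm (n t x) \<le> norm (apply_bcontfun (u t) x ** ctranspose (apply_bcontfun (u t) x) ** apply_bcontfun (u t) x) + norm (\<i> *\<^sub>M apply_bcontfun (v t) x)"
      unfolding n_def by (rule norm_triangle_ineq4)
    also have "\<dots> \<le> norm (u t) * norm (u t) * norm (u t) + norm (v t)"
    proof (intro add_mono)
      have b: "norm (apply_bcontfun (u t) x) \<le> norm (u t)" by (rule norm_bounded)
      have "norm (apply_bcontfun (u t) x ** ctranspose (apply_bcontfun (u t) x) ** apply_bcontfun (u t) x)
        \<le> norm (apply_bcontfun (u t) x) * norm (apply_bcontfun (u t) x) * norm (apply_bcontfun (u t) x)"
        by (rule order_trans[OF norm_mult_le], rule mult_right_mono[OF order_trans[OF norm_mult_le]]) simp_all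
      also have "\<dots> \<le> norm (u t) * norm (u t) * norm (u t)" by (intro mult_mono b) simp_all
      finally show "norm (apply_bcontfun (u t) x ** ctranspose (apply_bcontfun (u t) x) ** apply_bcontfun (u t) x) \<le> norm (u t) * norm (u t) * norm (u t)" .
    qed (simp add: norm_mscale norm_bounded)
    finally show "norm (n t x) \<le> norm (u t) * norm (u t) * norm (u t) + norm (v t)" .
  qed
  have nrep: "AE x in lborel. n t x = rep_L2 (?b t - \<i> *\<^sub>C D 1 t) x" for t
    using rep_L2_abs_L2[OF su[of t]] rep_L2_abs_L2[OF sv[of t]] rep_lmul[of "u t" "lmul (bstar (u t)) (U t)"] rep_lmul[of "bstar (u t)" "U t"]
      rep_L2_diff[of "?b t" "\<i> *\<^sub>C D 1 t"] rep_L2_scaleC[of \<i> "D 1 t"]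
    unfolding u(2) v(2) by eventually_elim (simp add: n_def matrix_mul_assoc)
  have bN: "bplus (bstar (N t))" for t
  proof -
    let ?W = "?b t - \<i> *\<^sub>C D 1 t"
    have W: "szego_L2 ?W = 0" unfolding sz by (rule minus_part)
    have ae: "AE x in lborel. apply_bcontfun (bstar (N t)) x = rep_L2 (star ?W) x"
      using nrep[of t] rep_star[of ?W] by eventually_elim (simp add: N)
    have sq: "square_integrable (apply_bcontfun (bstar (N t)))"
      by (rule square_integrable_cong_AE[OF square_integrable_rep_L2 measurable_apply_bcontfun ae])
    have "L2_of (bstar (N t)) = star ?W"
      by (rule L2_eqI) (use rep_L2_abs_L2[OF sq] ae in \<open>auto elim: eventually_elim2\<close>)
    then show ?thesis using sq szego_star_of_minus[OF W] by (simp add: bplus_def)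
  qed
  have "szego_curve u v N"
  proof
    fix t x
    show "bplus (u t)" "bplus (bstar (N t))" by (rule u, rule bN)
    show "apply_bcontfun (v t) x = (- \<i>) *\<^sub>M (apply_bcontfun (u t) x ** ctranspose (apply_bcontfun (u t) x) ** apply_bcontfun (u t) x - apply_bcontfun (N t) x)"
      by (simp add: N n_def)
    show "(u has_vector_derivative v t) (at t)"
      unfolding u_def v_def by (rule Hs_derivative_crep[OF s dU])
    show "((\<lambda>t. L2_of (u t)) has_vector_derivative (- \<i>) *\<^sub>C toeplitz_sq (u t) (L2_of (u t))) (at t)"
      unfolding u(2) D1[symmetric] by (rule Hs_derivative_L2[OF s dU])
  qed
  then show thesis by (rule that[OF _ u(2) u(1)])
qed

section \<open>Both explicit formulas\<close>

lemma hankel_l_eq: "hankel_l (L2_of u) G = szego_L2 (star (lmul (bstar u) G))" if u: "square_integrable (apply_bcontfun u)"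
  unfolding hankel_l_def
proof (rule szego_AE)
  show "(\<lambda>x. ctranspose (rep_L2 G x) ** rep_L2 (L2_of u) x) \<in> borel_measurable borel"
    by (intro measurable_matrix_mult measurable_ctranspose rep_L2_measurable)
  show "AE x in lborel. ctranspose (rep_L2 G x) ** rep_L2 (L2_of u) x = rep_L2 (star (lmul (bstar u) G)) x"
    using rep_L2_abs_L2[OF u] rep_star[of "lmul (bstar u) G"] rep_lmul[of "bstar u" G] by eventually_elim (simp add: ctranspose_mult)
qed

lemma hankel_r_eq: "hankel_r (L2_of u) F = szego_L2 (lmul u (star F))" if u: "square_integrable (apply_bcontfun u)"
  unfolding hankel_r_def
proof (rule szego_AE)
  show "(\<lambda>x. rep_L2 (L2_of u) x ** ctranspose (rep_L2 F x)) \<in> borel_measurable borel"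
    by (intro measurable_matrix_mult measurable_ctranspose rep_L2_measurable)
  show "AE x in lborel. rep_L2 (L2_of u) x ** ctranspose (rep_L2 F x) = rep_L2 (lmul u (star F)) x"
    using rep_L2_abs_L2[OF u] rep_star[of F] rep_lmul[of u "star F"] by eventually_elim simp
qed

lemma hankel_rl_eq: "square_integrable (apply_bcontfun u) \<Longrightarrow> hankel_rl (L2_of u) F = hankel_sq u F"
  by (simp add: hankel_rl_def hankel_l_eq hankel_r_eq hankel_sq_def)

lemma m_rl_eq: "m_rl U F = rmul (pairing U F) U"
  by (simp add: m_rl_def pairing_def rmul_def L2_map_def)

theorem (in szego_curve) explicit_formula_rl:
  assumes z: "Im z > 0"
  shows "poisson (L2_of (u t)) z = (1 / (2 * of_real pi * \<i>)) *\<^sub>M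
    op_I (resolvent_G (L_rl (L2_of (u 0)) t) z (exp_op (hankel_rl (L2_of (u 0))) (- \<i> * of_real t) (L2_of (u 0))))"
proof -
  have u: "square_integrable (apply_bcontfun (u 0))" and U: "szego_L2 (L2_of (u 0)) = L2_of (u 0)" using bplus[of 0] by (auto simp: bplus_def)
  show ?thesis
    unfolding L_rl_def[abs_def]
  proof (rule lax_flow_explicit_formula[OF lax[OF z] z])
    show "szego_L2 (rank_op (L2_of (u 0)) F) = rank_op (L2_of (u 0)) F" for F :: "(complex^'n^'m) L2" by (simp add: szego_rmul U)
  qed (simp_all add: bounded_linear_Blinfun_apply bounded_linear_res bounded_linear_poisson[OF z] hankel_rl_eq[OF u] m_rl_eq U
      szego_scaleC hankel_sq_scaleC mult.commute)
qed

text \<open>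
  The relations are invariant under conjugation by an isomorphism.
\<close>

lemma (in lax_flow) conjugate:
  assumes ST: "S \<odot> T = id_blinfun"
  shows "lax_flow (\<lambda>t. T \<odot> (A t \<odot> S)) (\<lambda>t. T \<odot> (B t \<odot> S)) (\<lambda>t. T \<odot> (m t \<odot> S)) (T \<odot> (R \<odot> S)) (K \<odot> (ev \<odot> S)) (\<lambda>t. T (u t))"
proof
  have ST': "S \<odot> (T \<odot> X) = X" for X :: "'z::real_normed_vector \<Rightarrow>\<^sub>L 'b"
    by (simp add: blinfun_compose_assoc[symmetric] ST)
  note cs = blinfun_compose_assoc blinfun_compose_simps ST'
  have d: "((\<lambda>t. T \<odot> (X t \<odot> S)) has_vector_derivative T \<odot> (X' \<odot> S)) (at t)" if "(X has_vector_derivative X') (at t)" for X X' t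
    using compose_derivative[OF has_vector_derivative_const[of T] compose_derivative[OF that has_vector_derivative_const[of S]]] by simp
  show "continuous_on UNIV (\<lambda>t. T \<odot> (B t \<odot> S))"
    by (intro bounded_bilinear.continuous_on[OF bounded_bilinear_blinfun_compose] continuous_on_const contB)
  fix t
  show "((\<lambda>t. T \<odot> (A t \<odot> S)) has_vector_derivative (T \<odot> (A t \<odot> S)) \<odot> (T \<odot> (B t \<odot> S)) - (T \<odot> (B t \<odot> S)) \<odot> (T \<odot> (A t \<odot> S))) (at t)"
    using d[OF dA, of t] by (simp add: cs)
  show "((\<lambda>t. T \<odot> (m t \<odot> S)) has_vector_derivative (T \<odot> (m t \<odot> S)) \<odot> (T \<odot> (B t \<odot> S)) - (T \<odot> (B t \<odot> S)) \<odot> (T \<odot> (m t \<odot> S))) (at t)"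
    using d[OF dm, of t] by (simp add: cs)
  have "S (T x) = x" for x using ST by (metis blinfun_apply_blinfun_compose blinfun_apply_id_blinfun id_apply)
  then show "((\<lambda>t. T (u t)) has_vector_derivative - (T \<odot> (B t \<odot> S)) (T (u t))) (at t)"
    using bounded_linear.has_vector_derivative[OF blinfun.bounded_linear_right du, of T t] by (simp add: blinfun.minus_right)
  show "T \<odot> (R \<odot> S) \<odot> (T \<odot> (A t \<odot> S) - T \<odot> (B t \<odot> S)) - (T \<odot> (A t \<odot> S) - T \<odot> (B t \<odot> S)) \<odot> (T \<odot> (R \<odot> S))
      = - (1 / (2 * pi)) *\<^sub>R (T \<odot> (R \<odot> S) \<odot> (T \<odot> (m t \<odot> S) \<odot> (T \<odot> (R \<odot> S))))" (is "?L = ?R")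
  proof -
    have "?L = T \<odot> ((R \<odot> (A t - B t) - (A t - B t) \<odot> R) \<odot> S)" by (simp add: cs)
    also have "\<dots> = ?R" unfolding RC by (simp add: cs)
    finally show ?thesis .
  qed
  show "K \<odot> (ev \<odot> S) \<odot> (T \<odot> (A t \<odot> S) - T \<odot> (B t \<odot> S)) = - (1 / (2 * pi)) *\<^sub>R (K \<odot> (ev \<odot> S) \<odot> (T \<odot> (m t \<odot> S) \<odot> (T \<odot> (R \<odot> S))))" (is "?L = ?R")
  proof -
    have "?L = K \<odot> ((ev \<odot> (A t - B t)) \<odot> S)" by (simp add: cs)
    also have "\<dots> = ?R" unfolding evC by (simp add: cs)
    finally show ?thesis .
  qed
qed

lemma transpose_nth: "transpose A $ i $ j = A $ j $ i"
  by (simp add: transpose_def)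

lemma transpose_simps:
  "transpose (c *\<^sub>M X) = c *\<^sub>M transpose X" "transpose (transpose X) = X" "transpose (X - Y) = transpose X - transpose Y"
  "transpose (X ** W) = transpose W ** transpose X" "ctranspose (transpose X) = transpose (ctranspose X)"
  for X Y :: "complex^'n^'m" and W :: "complex^'k^'n"
  by (simp_all add: vec_eq_iff transpose_nth matrix_mult_nth mult.commute)

lemma norm_transpose: "norm (transpose (X :: complex^'n^'m)) = norm X"
proof -
  have "transpose X \<bullet> transpose X = X \<bullet> X"
    unfolding inner_vec_def by (subst sum.swap) (simp add: transpose_nth)
  then show ?thesis by (simp add: norm_eq_sqrt_inner)
qed

lemma bounded_linear_transpose: "bounded_linear (transpose :: complex^'n^'m \<Rightarrow> _)"
  by (rule bounded_linear_intro[where K = 1]) (simp_all add: norm_transpose, simp_all add: vec_eq_iff transpose_nth)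

text \<open>
  Transposition reverses products but, unlike the adjoint, is complex linear; so it commutes with the projector and with the
  resolvent, while it exchanges left and right multiplication.
\<close>

definition tr :: "(complex^'n^'m) L2 \<Rightarrow> (complex^'m^'n) L2" where "tr = L2_map (\<lambda>_. transpose)"

lemma rep_tr: "AE x in lborel. rep_L2 (tr F) x = transpose (rep_L2 F x)"
  unfolding tr_def by (rule multiplier_const[OF bounded_linear_transpose], rule rep_L2_map)

lemma bounded_linear_tr: "bounded_linear tr"
  unfolding tr_def by (rule multiplier_const[OF bounded_linear_transpose], rule bounded_linear_L2_map)

lemma szego_tr: "szego_L2 (tr F) = tr (szego_L2 F)"
  unfolding tr_def by (rule szego_linear_map[OF bounded_linear_transpose transpose_simps(1)])

lemma tr_tr [simp]: "tr (tr F) = F"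
proof (rule L2_eqI)
  show "AE x in lborel. rep_L2 (tr (tr F)) x = rep_L2 F x"
    using rep_tr[of F] rep_tr[of "tr F"] by eventually_elim (simp add: transpose_simps)
qed

lemma tr_scaleC: "tr (c *\<^sub>C F) = c *\<^sub>C tr F"
proof (rule L2_eqI)
  show "AE x in lborel. rep_L2 (tr (c *\<^sub>C F)) x = rep_L2 (c *\<^sub>C tr F) x"
    using rep_tr[of F] rep_tr[of "c *\<^sub>C F"] rep_L2_scaleC[of c F] rep_L2_scaleC[of c "tr F"] by eventually_elim (simp add: transpose_simps)
qed

lemma lmul_kern_tr:
  assumes z: "Im z > 0" shows "lmul (kern z) (tr F) = tr (lmul (kern z) F)"
proof (rule L2_eqI)
  show "AE x in lborel. rep_L2 (lmul (kern z) (tr F)) x = rep_L2 (tr (lmul (kern z) F)) x"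
    using rep_tr[of F] rep_tr[of "lmul (kern z) F"] rep_lmul_kern[OF z, of F] rep_lmul_kern[OF z, of "tr F"]
    by eventually_elim (simp add: transpose_simps)
qed

lemma res_tr: "Im z > 0 \<Longrightarrow> res z (tr F) = tr (res z F)"
  by (simp add: res_def szego_tr lmul_kern_tr)

text \<open>
  Transpose the decomposition of \<open>F / (x - z)\<close> and compare the minus parts.
\<close>

lemma poisson_tr:
  assumes z: "Im z > 0" shows "poisson (tr F) z = transpose (poisson F z)"
proof -
  let ?F = "szego_L2 F"
  have k: "tr (kvec z C) = kvec z (transpose C)" for C :: "complex^'b^'a"
  proof (rule L2_eqI)
    show "AE x in lborel. rep_L2 (tr (kvec z C)) x = rep_L2 (kvec z (transpose C)) x"
      using rep_tr[of "kvec z C"] rep_L2_abs_L2[OF square_integrable_cauchy_kernel[OF z, of C], folded kvec_def]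
        rep_L2_abs_L2[OF square_integrable_cauchy_kernel[OF z, of "transpose C"], folded kvec_def]
      by eventually_elim (simp add: transpose_simps)
  qed
  have p: "szego_L2 (tr ?F) = tr ?F" by (simp add: szego_tr)
  have "res z (tr ?F) + kvec z (poisson (tr ?F) z) = tr (res z ?F + kvec z (poisson ?F z))"
    unfolding kern_decomposition[OF z p, symmetric] kern_decomposition[OF z szego_szego, symmetric] by (rule lmul_kern_tr[OF z])
  then have "kvec z (poisson (tr ?F) z) = kvec z (transpose (poisson ?F z))"
    by (simp add: bounded_linear_simps[OF bounded_linear_tr] res_tr[OF z] k)
  from kvec_inj[OF z this] show ?thesis by (simp add: szego_tr[symmetric] poisson_szego[OF z])
qed

definition btr :: "(real \<Rightarrow>\<^sub>C (complex^'n^'m)) \<Rightarrow> (real \<Rightarrow>\<^sub>C (complex^'m^'n))" where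
  "btr u = Bcontfun (\<lambda>x. transpose (apply_bcontfun u x))"

lemma apply_btr [simp]: "apply_bcontfun (btr u) x = transpose (apply_bcontfun u x)"
proof -
  have "(\<lambda>x. transpose (apply_bcontfun u x)) \<in> bcontfun"
    by (rule bcontfun_normI[of _ "norm u"])
      (auto intro: continuous_on_compose2[OF linear_continuous_on[OF bounded_linear_transpose] continuous_apply_bcontfun] simp: norm_transpose norm_bounded)
  then show ?thesis by (simp add: btr_def Bcontfun_inverse)
qed

lemma bounded_linear_btr: "bounded_linear (btr :: (real \<Rightarrow>\<^sub>C (complex^'n^'m)) \<Rightarrow> _)"
proof (rule bounded_linear_intro[where K = 1])
  fix u v :: "real \<Rightarrow>\<^sub>C (complex^'n^'m)" and r :: real
  show "btr (u + v) = btr u + btr v" by (rule bcontfun_eqI) (simp add: bounded_linear_simps[OF bounded_linear_transpose])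
  show "btr (r *\<^sub>R u) = r *\<^sub>R btr u" by (rule bcontfun_eqI) (simp add: bounded_linear_simps[OF bounded_linear_transpose])
  show "norm (btr u) \<le> norm u * 1" by (rule norm_bound) (simp add: norm_bounded norm_transpose)
qed

lemma L2_of_btr:
  assumes u: "square_integrable (apply_bcontfun u)"
  shows "square_integrable (apply_bcontfun (btr u))" "L2_of (btr u) = tr (L2_of u)"
proof -
  show sq: "square_integrable (apply_bcontfun (btr u))"
    by (rule square_integrable_AE_bound[OF u measurable_apply_bcontfun, where c = 1]) (simp add: norm_transpose)
  show "L2_of (btr u) = tr (L2_of u)"
  proof (rule L2_eqI)
    show "AE x in lborel. rep_L2 (L2_of (btr u)) x = rep_L2 (tr (L2_of u)) x"
      using rep_L2_abs_L2[OF sq] rep_L2_abs_L2[OF u] rep_tr[of "L2_of u"] by eventually_elim simp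
  qed
qed

lemma bplus_btr: "bplus u \<Longrightarrow> bplus (btr u)"
  by (simp add: bplus_def L2_of_btr szego_tr)

lemma bstar_btr: "bstar (btr u) = btr (bstar u)"
  by (rule bcontfun_eqI) (simp add: transpose_simps)

context szego_curve
begin

text \<open>
  The nonlinearity \<open>u u\<^sup>* u\<close> is a palindrome, hence compatible with transposition.
\<close>

lemma transposed: "szego_curve (\<lambda>t. btr (u t)) (\<lambda>t. btr (v t)) (\<lambda>t. btr (N t))"
proof
  fix t x
  have u: "square_integrable (apply_bcontfun (u t))" for t using bplus[of t] by (simp add: bplus_def)
  show "bplus (btr (u t))" by (rule bplus_btr[OF bplus])
  show "bplus (bstar (btr (N t)))" unfolding bstar_btr by (rule bplus_btr[OF N])
  show "((\<lambda>t. btr (u t)) has_vector_derivative btr (v t)) (at t)"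
    by (rule bounded_linear.has_vector_derivative[OF bounded_linear_btr du])
  show "apply_bcontfun (btr (v t)) x = (- \<i>) *\<^sub>M (apply_bcontfun (btr (u t)) x ** ctranspose (apply_bcontfun (btr (u t)) x) ** apply_bcontfun (btr (u t)) x - apply_bcontfun (btr (N t)) x)"
    unfolding apply_btr v transpose_simps matrix_mul_assoc ..
  have "tr (lmul (u t) (lmul (bstar (u t)) (L2_of (u t)))) = lmul (btr (u t)) (lmul (bstar (btr (u t))) (L2_of (btr (u t))))"
  proof (rule L2_eqI)
    show "AE x in lborel. rep_L2 (tr (lmul (u t) (lmul (bstar (u t)) (L2_of (u t))))) x = rep_L2 (lmul (btr (u t)) (lmul (bstar (btr (u t))) (L2_of (btr (u t))))) x"
      using rep_tr[of "lmul (u t) (lmul (bstar (u t)) (L2_of (u t)))"] rep_lmul[of "u t" "lmul (bstar (u t)) (L2_of (u t))"]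
        rep_lmul[of "bstar (u t)" "L2_of (u t)"] rep_L2_abs_L2[OF u[of t]] rep_L2_abs_L2[OF L2_of_btr(1)[OF u[of t]]]
        rep_lmul[of "btr (u t)" "lmul (bstar (btr (u t))) (L2_of (btr (u t)))"] rep_lmul[of "bstar (btr (u t))" "L2_of (btr (u t))"]
      by eventually_elim (simp add: transpose_simps matrix_mul_assoc)
  qed
  then have "tr ((- \<i>) *\<^sub>C toeplitz_sq (u t) (L2_of (u t))) = (- \<i>) *\<^sub>C toeplitz_sq (btr (u t)) (L2_of (btr (u t)))"
    by (simp add: toeplitz_sq_def tr_scaleC szego_tr[symmetric])
  then show "((\<lambda>t. L2_of (btr (u t))) has_vector_derivative (- \<i>) *\<^sub>C toeplitz_sq (btr (u t)) (L2_of (btr (u t)))) (at t)"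
    using bounded_linear.has_vector_derivative[OF bounded_linear_tr dU, of t] by (simp add: L2_of_btr(2)[OF u])
qed

end

lemma hankel_lr_eq:
  assumes u: "square_integrable (apply_bcontfun u)"
  shows "hankel_lr (L2_of u) F = tr (hankel_sq (btr u) (tr F))"
proof -
  have 1: "star (lmul (bstar (btr u)) (tr F)) = tr (lmul u (star F))"
  proof (rule L2_eqI)
    show "AE x in lborel. rep_L2 (star (lmul (bstar (btr u)) (tr F))) x = rep_L2 (tr (lmul u (star F))) x"
      using rep_star[of "lmul (bstar (btr u)) (tr F)"] rep_lmul[of "bstar (btr u)" "tr F"] rep_tr[of F] rep_tr[of "lmul u (star F)"]
        rep_lmul[of u "star F"] rep_star[of F]
      by eventually_elim (simp add: transpose_simps ctranspose_mult)
  qed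
  have 2: "lmul (btr u) (star (tr X)) = tr (star (lmul (bstar u) X))" for X
  proof (rule L2_eqI)
    show "AE x in lborel. rep_L2 (lmul (btr u) (star (tr X))) x = rep_L2 (tr (star (lmul (bstar u) X))) x"
      using rep_lmul[of "btr u" "star (tr X)"] rep_star[of "tr X"] rep_tr[of X] rep_tr[of "star (lmul (bstar u) X)"]
        rep_star[of "lmul (bstar u) X"] rep_lmul[of "bstar u" X]
      by eventually_elim (simp add: transpose_simps ctranspose_mult)
  qed
  show ?thesis
    by (simp add: hankel_lr_def hankel_l_eq[OF u] hankel_r_eq[OF u] hankel_sq_def 1 2 szego_tr)
qed

lemma m_lr_eq: "m_lr U F = tr (rmul (pairing (tr U) (tr F)) (tr U))"
proof -
  have "AE x in lborel. ctranspose (rep_L2 (tr U) x) ** rep_L2 (tr F) x = transpose (rep_L2 F x ** ctranspose (rep_L2 U x))"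
    using rep_tr[of U] rep_tr[of F] by eventually_elim (simp add: transpose_simps)
  then have ae: "AE x in lborel. rep_L2 F x ** ctranspose (rep_L2 U x) = transpose (ctranspose (rep_L2 (tr U) x) ** rep_L2 (tr F) x)"
    by eventually_elim (simp add: transpose_simps)
  have m: "(\<lambda>x. rep_L2 F x ** ctranspose (rep_L2 U x)) \<in> borel_measurable lborel"
    using measurable_matrix_mult[OF rep_L2_measurable measurable_ctranspose[OF rep_L2_measurable], of F U] by simp
  have i: "integrable lborel (\<lambda>x. transpose (ctranspose (rep_L2 (tr U) x) ** rep_L2 (tr F) x))"
    by (rule integrable_bounded_linear[OF bounded_linear_transpose integrable_pairing])
  have p: "(LINT x|lborel. rep_L2 F x ** ctranspose (rep_L2 U x)) = transpose (pairing (tr U) (tr F))"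
    unfolding pairing_def integral_bounded_linear[OF bounded_linear_transpose integrable_pairing, symmetric]
    by (rule integral_cong_AE[OF m borel_measurable_integrable[OF i] ae])
  define C where "C = pairing (tr U) (tr F)"
  have a: "AE x in lborel. rep_L2 (tr (rmul C (tr U))) x = transpose C ** rep_L2 U x"
    using rep_tr[of "rmul C (tr U)"] rep_rmul[of C "tr U"] rep_tr[of U] by eventually_elim (simp add: transpose_simps)
  have m: "(\<lambda>x. transpose C ** rep_L2 U x) \<in> borel_measurable borel"
    by (rule measurable_matrix_mult[OF _ rep_L2_measurable]) simp
  have "AE x in lborel. transpose C ** rep_L2 U x = rep_L2 (tr (rmul C (tr U))) x" using a by eventually_elim simp
  note s = square_integrable_cong_AE[OF square_integrable_rep_L2 m this]
  show ?thesis
    unfolding m_lr_def p C_def[symmetric] by (rule L2_eq_absI[OF s a, symmetric])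
qed

text \<open>
  The flow of the transposed curve, conjugated by transposition, is the flow of the second kind of Hankel operators.
\<close>

theorem (in szego_curve) explicit_formula_lr:
  assumes z: "Im z > 0"
  shows "poisson (L2_of (u t)) z = (1 / (2 * of_real pi * \<i>)) *\<^sub>M
    op_I (resolvent_G (L_lr (L2_of (u 0)) t) z (exp_op (hankel_lr (L2_of (u 0))) (- \<i> * of_real t) (L2_of (u 0))))"
proof -
  have u: "square_integrable (apply_bcontfun (u t))" and U: "szego_L2 (L2_of (u t)) = L2_of (u t)" for t using bplus[of t] by (auto simp: bplus_def)
  interpret t: szego_curve "\<lambda>t. btr (u t)" "\<lambda>t. btr (v t)" "\<lambda>t. btr (N t)" by (rule transposed)
  interpret lt: lax_flow "\<lambda>t. hankel_op (btr (u t))" "\<lambda>t. toeplitz_op (btr (u t))" "\<lambda>t. rank_op (L2_of (btr (u t)))"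
    "Blinfun (res z) :: (complex^'m^'n) L2 \<Rightarrow>\<^sub>L _" "Blinfun (\<lambda>F. poisson F z)" "\<lambda>t. L2_of (btr (u t))"
    by (rule t.lax[OF z])
  define T where "T = (Blinfun tr :: (complex^'m^'n) L2 \<Rightarrow>\<^sub>L (complex^'n^'m) L2)"
  define S where "S = (Blinfun tr :: (complex^'n^'m) L2 \<Rightarrow>\<^sub>L (complex^'m^'n) L2)"
  define K where "K = (Blinfun transpose :: (complex^'m^'n) \<Rightarrow>\<^sub>L (complex^'n^'m))"
  have app [simp]: "T F = tr F" "S G = tr G" "K C = transpose C" for F G C
    by (simp_all add: T_def S_def K_def bounded_linear_Blinfun_apply bounded_linear_tr bounded_linear_transpose)
  have "S \<odot> T = id_blinfun" by (rule blinfun_eqI) simp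
  note flow = lt.conjugate[OF this, of K]
  have Tu: "T (L2_of (btr (u t))) = L2_of (u t)" for t by (simp add: L2_of_btr[OF u])
  show ?thesis
    unfolding L_lr_def[abs_def]
  proof (rule lax_flow_explicit_formula[OF flow[unfolded Tu] z])
    fix F :: "(complex^'n^'m) L2" and c
    have Fp: "szego_L2 (tr F) = tr F" if "szego_L2 F = F" using that by (simp add: szego_tr)
    show "(T \<odot> (Blinfun (res z) \<odot> S)) F = res z F"
      by (simp add: bounded_linear_Blinfun_apply bounded_linear_res res_tr[OF z])
    show "(K \<odot> (Blinfun (\<lambda>F. poisson F z) \<odot> S)) F = poisson F z"
      by (simp add: bounded_linear_Blinfun_apply bounded_linear_poisson[OF z] poisson_tr[OF z] transpose_simps)
    show "(T \<odot> (hankel_op (btr (u 0)) \<odot> S)) F = \<i> *\<^sub>C hankel_lr (L2_of (u 0)) F" if "szego_L2 F = F"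
      by (simp add: hankel_lr_eq[OF u] Fp[OF that] tr_scaleC)
    show "(T \<odot> (rank_op (L2_of (btr (u 0))) \<odot> S)) F = m_lr (L2_of (u 0)) F" if "szego_L2 F = F"
      by (simp add: m_lr_eq L2_of_btr[OF u] Fp[OF that])
    show "szego_L2 ((T \<odot> (hankel_op (btr (u 0)) \<odot> S)) F) = (T \<odot> (hankel_op (btr (u 0)) \<odot> S)) F"
      by (simp add: szego_tr szego_scaleC)
    show "szego_L2 ((T \<odot> (rank_op (L2_of (btr (u 0))) \<odot> S)) F) = (T \<odot> (rank_op (L2_of (btr (u 0))) \<odot> S)) F"
      by (simp add: szego_tr szego_rmul L2_of_btr[OF u] U)
    show "(T \<odot> (hankel_op (btr (u 0)) \<odot> S)) (c *\<^sub>C F) = c *\<^sub>C (T \<odot> (hankel_op (btr (u 0)) \<odot> S)) F"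
      by (simp add: szego_tr tr_scaleC szego_scaleC hankel_sq_scaleC mult.commute)
    show "szego_L2 (L2_of (u 0)) = L2_of (u 0)" by (rule U)
  qed
qed

theorem theorem1p5:
  fixes U :: "real \<Rightarrow> (complex^'n^'m) L2" and U0 :: "(complex^'n^'m) L2"
    and s t :: real and z :: complex
  assumes "s > 1 / 2"
    and "U0 \<in> Hs_plus s"
    and "smooth_Hs_plus s U"
    and "solves_matrix_szego s U"
    and "U 0 = U0"
    and "Im z > 0"
  shows "poisson (U t) z = (1 / (2 * of_real pi * \<i>)) *\<^sub>M
           op_I (resolvent_G (L_rl U0 t) z (exp_op (hankel_rl U0) (- \<i> * of_real t) U0))
       \<and> poisson (U t) z = (1 / (2 * of_real pi * \<i>)) *\<^sub>M
           op_I (resolvent_G (L_lr U0 t) z (exp_op (hankel_lr U0) (- \<i> * of_real t) U0))"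
proof -
  obtain u v N where c: "szego_curve u v N" and U: "\<And>t. L2_of (u t) = U t"
    by (rule szego_curve_of_solution[OF assms(1,3,4)]) blast
  show ?thesis
    using szego_curve.explicit_formula_rl[OF c assms(6), of t] szego_curve.explicit_formula_lr[OF c assms(6), of t]
    unfolding U assms(5) ..
qed

end
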